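(* Let $\mathcal{S}$ be a small category admitting binary products which, with its subcategories $\mathcal{S}^{sm}$ and $\mathcal{S}^{cl}$, satisfies the standing assumptions listed in the context. Let $\mathbb{H}$ be a localic triangulated $\mathcal{S}$-fibered category. Then every localic external tensor structure on $\mathbb{H}$ determines, by restriction to $\mathcal{S}^{sm}$ and by restriction to $\mathcal{S}^{cl}$ and adjunction, an external tensor core on $\mathbb{H}$; conversely, every external tensor core on $\mathbb{H}$ extends uniquely to a localic external tensor structure on $\mathbb{H}$ (i.e. it is the external tensor core determined by a unique localic external tensor structure).
   Context: Standing assumptions on $\mathcal{S}$: a small category with binary products and two (possibly non-full) subcategories $\mathcal{S}^{sm},\mathcal{S}^{cl}$ such that: (i) both have the same objects as $\mathcal{S}$ and contain all isomorphisms; (ii) for every $p:P\to S$ in $\mathcal{S}^{sm}$ and every $f:T\to S$ in $\mathcal{S}$ the fibered product $P\times_S T$ exists, and every base change of a morphism of $\mathcal{S}^{sm}$ lies in $\mathcal{S}^{sm}$; (iii) in every Cartesian square with sides $z':P_Z\to P$, $p':P_Z\to Z$, $p:P\to S$ in $\mathcal{S}^{sm}$, $z:Z\to S$ in $\mathcal{S}^{cl}$, the morphism $z'$ is in $\mathcal{S}^{cl}$; and if $gz$ is in $\mathcal{S}^{cl}$ then $z$ is in $\mathcal{S}^{cl}$; (iv) every morphism $f$ of $\mathcal{S}$ factors as $f=p\circ t$ with $t$ in $\mathcal{S}^{cl}$, $p$ in $\mathcal{S}^{sm}$; (v) $\mathcal{S}$ has an initial object $\emptyset$; (vi) for every $z:Z\to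 S$ in $\mathcal{S}^{cl}$ there is a distinguished $u:U\to S$ in $\mathcal{S}^{sm}$ (the open immersion complementary to $z$) such that for every $T$ the map $u\circ-:\operatorname{Hom}_{\mathcal{S}}(T,U)\to\operatorname{Hom}_{\mathcal{S}}(T,S)$ identifies $\operatorname{Hom}_{\mathcal{S}}(T,U)$ with the set of those $f:T\to S$ for which the square with sides $\emptyset\to T$, $\emptyset\to Z$, $f$, $z$ is Cartesian. Morphisms of $\mathcal{S}^{sm}$ are called smooth, morphisms of $\mathcal{S}^{cl}$ closed immersions. An $\mathcal{S}$-fibered category $\mathbb{H}$: categories $\mathbb{H}(S)$, functors $f^*:\mathbb{H}(S)\to\mathbb{H}(T)$ for $f:T\to S$, and natural isomorphisms $\mathrm{conn}_{f,g}:(gf)^*A\xrightarrow{\sim}f^*g^*A$ with $\mathrm{id}_S^*=\mathrm{id}$ and $f^*\mathrm{conn}_{g,h}\circ\mathrm{conn}_{f,hg}=\mathrm{conn}_{f,g}\circ\mathrm{conn}_{gf,h}$. Composites of connection isomorphisms are written as equalities. It is triangulated if all $\mathbb{H}(S)$ are triangulated, all $f^*$ triangulated functors, all connection isomorphisms compatible with shifts. A triangulated $\mathbb{H}$ is localic if: (a) $\mathbb{H}(\emptyset)=0$; (b) for every smooth $p$, $p^*$ has a left adjoint $p_\#$, and for every Cartesian square $pf'=fp'$ with $p$ smooth, the transformation $p'_\#f'^*A\xrightarrow{\eta}p'_\#f'^*p^*p_\#A=p'_\#p'^*f^*p_\#A\xrightarrow{\epsilon}f^*p_\#A$ is invertible;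 (c) for every closed immersion $z$, $z^*$ has a right adjoint $z_*$, which is fully faithful; (d) for every closed immersion $z$ with complementary open immersion $u$, the pair $(z^*,u^* )$ is jointly conservative. Adjoints of $\mathrm{id}_S^*$ are chosen to be identities; the functors $z_*$, with the isomorphisms $(z_1z_2)_*=z_{1,*}z_{2,*}$ induced by adjunction from connection isomorphisms, make $\mathbb{H}$ an $\mathcal{S}^{cl,op}$-fibered category. For a Cartesian square $pz'=zp'$ with $p$ smooth, $z$ a closed immersion, the base-change transformation $p^*z_*A\xrightarrow{\eta}z'_*z'^*p^*z_*A=z'_*p'^*z^*z_*A\xrightarrow{\epsilon}z'_*p'^*A$ is invertible when $\mathbb{H}$ is localic. For $\mathcal{S}'=\mathcal{S},\mathcal{S}^{sm},\mathcal{S}^{cl}$, an external tensor structure $(\boxtimes,m)$ over $\mathcal{S}'$ on $\mathbb{H}$ consists of functors $\boxtimes:\mathbb{H}(S_1)\times\mathbb{H}(S_2)\to\mathbb{H}(S_1\times S_2)$ and natural isomorphisms $m_{f_1,f_2}:f_1^*A_1\boxtimes f_2^*A_2\xrightarrow{\sim}(f_1\times f_2)^*(A_1\boxtimes A_2)$ for $f_1,f_2$ in $\mathcal{S}'$, such that $m_{g_1f_1,g_2f_2}=(f_1\times f_2)^*m_{g_1,g_2}\circ m_{f_1,f_2}$ modulo connection isomorphisms. Over $\mathcal{S}^{cl,op}$ it consists of functors $\boxtimes$ and natural isomorphisms $\bar m_{z_1,z_2}:z_{1,*}A_1\boxtimes z_{2,*}A_2\xrightarrow{\sim}(z_1\times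 z_2)_*(A_1\boxtimes A_2)$ for closed immersions $z_1,z_2$, compatible with composition in the same way, where $(z_1\times z_2)_*$ denotes the right adjoint of $(z_1\times z_2)^*$. Triangulated means that $\boxtimes$ is triangulated in each variable (bitriangulated) and the isomorphisms are compatible with shifts in each variable. An external tensor structure over $\mathcal{S}$ is smooth-adjointable if for all smooth $p_i:P_i\to S_i$ the composite $(p_1\times p_2)_\#(A_1\boxtimes A_2)\xrightarrow{\eta}(p_1\times p_2)_\#(p_1^*p_{1,\#}A_1\boxtimes p_2^*p_{2,\#}A_2)\xrightarrow{m}(p_1\times p_2)_\#(p_1\times p_2)^*(p_{1,\#}A_1\boxtimes p_{2,\#}A_2)\xrightarrow{\epsilon}p_{1,\#}A_1\boxtimes p_{2,\#}A_2$ is invertible. A triangulated external tensor structure on $\mathbb{H}$ (over $\mathcal{S}$) is localic if it is smooth-adjointable. Adjunction. From $m^{cl}$ one obtains $\bar m^{cl}_{z_1,z_2}$: $z_{1,*}A_1\boxtimes z_{2,*}A_2\xrightarrow{\eta}(z_1\times z_2)_*(z_1\times z_2)^*(z_{1,*}A_1\boxtimes z_{2,*}A_2)\xrightarrow{m^{-1}}(z_1\times z_2)_*(z_1^*z_{1,*}A_1\boxtimes z_2^*z_{2,*}A_2)\xrightarrow{\epsilon}(z_1\times z_2)_*(A_1\boxtimes A_2)$. From $\bar m^{cl}$ one obtains $m^{cl}_{z_1,z_2}$ as the inverse of $(z_1\times z_2)^*(A_1\boxtimes A_2)\xrightarrow{\eta}(z_1\times z_2)^*(z_{1,*}z_1^*A_1\boxtimes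 z_{2,*}z_2^*A_2)\xrightarrow{\bar m}(z_1\times z_2)^*(z_1\times z_2)_*(z_1^*A_1\boxtimes z_2^*A_2)\xrightarrow{\epsilon}z_1^*A_1\boxtimes z_2^*A_2$. An external tensor core $(\boxtimes,m^{sm},\bar m^{cl})$ on $\mathbb{H}$ consists of a triangulated external tensor structure $(\boxtimes,m^{sm})$ over $\mathcal{S}^{sm}$ and a triangulated external tensor structure $(\boxtimes,\bar m^{cl})$ over $\mathcal{S}^{cl,op}$, with the same functors $\boxtimes$, such that: (C') for every pair of Cartesian squares with sides $z'_i:P_{i,Z_i}\to P_i$, $p'_i:P_{i,Z_i}\to Z_i$, $p_i:P_i\to S_i$ smooth, $z_i:Z_i\to S_i$ a closed immersion ($i=1,2$), the composites $$p_1^*z_{1,*}A_1\boxtimes p_2^*z_{2,*}A_2\xrightarrow{m^{sm}}(p_1\times p_2)^*(z_{1,*}A_1\boxtimes z_{2,*}A_2)\xrightarrow{\bar m^{cl}}(p_1\times p_2)^*(z_1\times z_2)_*(A_1\boxtimes A_2),$$ $$z'_{1,*}{p'_1}^*A_1\boxtimes z'_{2,*}{p'_2}^*A_2\xrightarrow{\bar m^{cl}}(z'_1\times z'_2)_*({p'_1}^*A_1\boxtimes{p'_2}^*A_2)\xrightarrow{m^{sm}}(z'_1\times z'_2)_*(p'_1\times p'_2)^*(A_1\boxtimes A_2)$$ correspond to each other under the base-change isomorphisms; (T) for every pair of commutative triangles $q_i=p_ih_i$ with $p_i:P_i\to S_i$, $q_i:Q_i\to S_i$ smooth and $h_i:Q_i\to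 P_i$ a closed immersion, $m^{sm}_{q_1,q_2}$ coincides, modulo connection isomorphisms, with $h_1^*p_1^*A_1\boxtimes h_2^*p_2^*A_2\xrightarrow{m^{cl}}(h_1\times h_2)^*(p_1^*A_1\boxtimes p_2^*A_2)\xrightarrow{m^{sm}}(h_1\times h_2)^*(p_1\times p_2)^*(A_1\boxtimes A_2)$, where $m^{cl}$ is obtained from $\bar m^{cl}$ by adjunction.
   Formalization: Closed immersions are assumed stable under products, so that (z1×z2)_* makes sense, and an external tensor core is required to have smooth-adjointable m^sm; without these the claim is undefined or false, and every core coming from a localic structure is smooth-adjointable. *)

theory Defs
  imports "HOL-Algebra.Group"
begin

section \<open>Categories, functors, adjunctions\<close>

record ('o, 'm) cat =
  Ob :: "'o set"
  Ar :: "'m set"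
  Dom :: "'m \<Rightarrow> 'o"
  Cod :: "'m \<Rightarrow> 'o"
  Idn :: "'o \<Rightarrow> 'm"
  Cmp :: "'m \<Rightarrow> 'm \<Rightarrow> 'm"  (infixr "\<cdot>\<index>" 70)

definition Hom :: "('o, 'm, 'x) cat_scheme \<Rightarrow> 'o \<Rightarrow> 'o \<Rightarrow> 'm set" where
  "Hom C a b = {f \<in> Ar C. Dom C f = a \<and> Cod C f = b}"

locale category =
  fixes C :: "('o, 'm, 'x) cat_scheme"
  assumes Dom_Ob: "f \<in> Ar C \<Longrightarrow> Dom C f \<in> Ob C"
    and Cod_Ob: "f \<in> Ar C \<Longrightarrow> Cod C f \<in> Ob C"
    and Idn_Hom: "a \<in> Ob C \<Longrightarrow> Idn C a \<in> Hom C a a"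
    and Cmp_Hom: "f \<in> Hom C a b \<Longrightarrow> g \<in> Hom C b c \<Longrightarrow> g \<cdot>\<^bsub>C\<^esub> f \<in> Hom C a c"
    and Idn_right: "f \<in> Hom C a b \<Longrightarrow> f \<cdot>\<^bsub>C\<^esub> Idn C a = f"
    and Idn_left: "f \<in> Hom C a b \<Longrightarrow> Idn C b \<cdot>\<^bsub>C\<^esub> f = f"
    and Cmp_assoc: "f \<in> Hom C a b \<Longrightarrow> g \<in> Hom C b c \<Longrightarrow> h \<in> Hom C c d
      \<Longrightarrow> (h \<cdot>\<^bsub>C\<^esub> g) \<cdot>\<^bsub>C\<^esub> f = h \<cdot>\<^bsub>C\<^esub> (g \<cdot>\<^bsub>C\<^esub> f)"

definition inverse_arrows :: "('o, 'm, 'x) cat_scheme \<Rightarrow> 'm \<Rightarrow> 'm \<Rightarrow> bool" where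
  "inverse_arrows C f g \<longleftrightarrow> f \<in> Ar C \<and> g \<in> Hom C (Cod C f) (Dom C f)
     \<and> g \<cdot>\<^bsub>C\<^esub> f = Idn C (Dom C f) \<and> f \<cdot>\<^bsub>C\<^esub> g = Idn C (Cod C f)"

definition Iso :: "('o, 'm, 'x) cat_scheme \<Rightarrow> 'm set" where
  "Iso C = {f. \<exists>g. inverse_arrows C f g}"

definition inv_ar :: "('o, 'm, 'x) cat_scheme \<Rightarrow> 'm \<Rightarrow> 'm" where
  "inv_ar C f = (THE g. inverse_arrows C f g)"

definition prod_cat :: "('o, 'm, 'x) cat_scheme \<Rightarrow> ('p, 'n, 'y) cat_scheme \<Rightarrow> ('o \<times> 'p, 'm \<times> 'n) cat" where
  "prod_cat C D = \<lparr> Ob = Ob C \<times> Ob D, Ar = Ar C \<times> Ar D,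
     Dom = map_prod (Dom C) (Dom D), Cod = map_prod (Cod C) (Cod D),
     Idn = map_prod (Idn C) (Idn D),
     Cmp = (\<lambda>g f. (fst g \<cdot>\<^bsub>C\<^esub> fst f, snd g \<cdot>\<^bsub>D\<^esub> snd f)) \<rparr>"

definition is_functor ::
  "('o, 'm, 'x) cat_scheme \<Rightarrow> ('p, 'n, 'y) cat_scheme \<Rightarrow> ('o \<Rightarrow> 'p) \<Rightarrow> ('m \<Rightarrow> 'n) \<Rightarrow> bool" where
  "is_functor C D Fo Fa \<longleftrightarrow>
     (\<forall>a\<in>Ob C. Fo a \<in> Ob D \<and> Fa (Idn C a) = Idn D (Fo a)) \<and>
     (\<forall>f\<in>Ar C. Fa f \<in> Hom D (Fo (Dom C f)) (Fo (Cod C f))) \<and>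
     (\<forall>f\<in>Ar C. \<forall>g\<in>Ar C. Cod C f = Dom C g \<longrightarrow> Fa (g \<cdot>\<^bsub>C\<^esub> f) = Fa g \<cdot>\<^bsub>D\<^esub> Fa f)"

definition is_nat ::
  "('o, 'm, 'x) cat_scheme \<Rightarrow> ('p, 'n, 'y) cat_scheme \<Rightarrow> ('o \<Rightarrow> 'p) \<Rightarrow> ('m \<Rightarrow> 'n)
     \<Rightarrow> ('o \<Rightarrow> 'p) \<Rightarrow> ('m \<Rightarrow> 'n) \<Rightarrow> ('o \<Rightarrow> 'n) \<Rightarrow> bool" where
  "is_nat C D Fo Fa Go Ga \<tau> \<longleftrightarrow>
     (\<forall>a\<in>Ob C. \<tau> a \<in> Hom D (Fo a) (Go a)) \<and>
     (\<forall>f\<in>Ar C. Ga f \<cdot>\<^bsub>D\<^esub> \<tau> (Dom C f) = \<tau> (Cod C f) \<cdot>\<^bsub>D\<^esub> Fa f)"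

definition is_nat_iso ::
  "('o, 'm, 'x) cat_scheme \<Rightarrow> ('p, 'n, 'y) cat_scheme \<Rightarrow> ('o \<Rightarrow> 'p) \<Rightarrow> ('m \<Rightarrow> 'n)
     \<Rightarrow> ('o \<Rightarrow> 'p) \<Rightarrow> ('m \<Rightarrow> 'n) \<Rightarrow> ('o \<Rightarrow> 'n) \<Rightarrow> bool" where
  "is_nat_iso C D Fo Fa Go Ga \<tau> \<longleftrightarrow> is_nat C D Fo Fa Go Ga \<tau> \<and> (\<forall>a\<in>Ob C. \<tau> a \<in> Iso D)"

definition fully_faithful ::
  "('o, 'm, 'x) cat_scheme \<Rightarrow> ('p, 'n, 'y) cat_scheme \<Rightarrow> ('o \<Rightarrow> 'p) \<Rightarrow> ('m \<Rightarrow> 'n) \<Rightarrow> bool" where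
  "fully_faithful C D Fo Fa \<longleftrightarrow>
     (\<forall>a\<in>Ob C. \<forall>b\<in>Ob C. bij_betw Fa (Hom C a b) (Hom D (Fo a) (Fo b)))"

definition equivalence_functor ::
  "('o, 'm, 'x) cat_scheme \<Rightarrow> ('p, 'n, 'y) cat_scheme \<Rightarrow> ('o \<Rightarrow> 'p) \<Rightarrow> ('m \<Rightarrow> 'n) \<Rightarrow> bool" where
  "equivalence_functor C D Fo Fa \<longleftrightarrow> is_functor C D Fo Fa \<and> fully_faithful C D Fo Fa \<and>
     (\<forall>b\<in>Ob D. \<exists>a\<in>Ob C. \<exists>\<phi>\<in>Iso D. \<phi> \<in> Hom D (Fo a) b)"

text \<open>\<open>L : C \<rightarrow> D\<close> is left adjoint to \<open>R : D \<rightarrow> C\<close> with unit \<open>\<eta>\<close> and counit \<open>\<epsilon>\<close>.\<close>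

definition adjunction ::
  "('o, 'm, 'x) cat_scheme \<Rightarrow> ('p, 'n, 'y) cat_scheme \<Rightarrow> ('o \<Rightarrow> 'p) \<Rightarrow> ('m \<Rightarrow> 'n)
     \<Rightarrow> ('p \<Rightarrow> 'o) \<Rightarrow> ('n \<Rightarrow> 'm) \<Rightarrow> ('o \<Rightarrow> 'm) \<Rightarrow> ('p \<Rightarrow> 'n) \<Rightarrow> bool" where
  "adjunction C D Lo La Ro Ra \<eta> \<epsilon> \<longleftrightarrow>
     is_functor C D Lo La \<and> is_functor D C Ro Ra \<and>
     is_nat C C id id (Ro \<circ> Lo) (Ra \<circ> La) \<eta> \<and>
     is_nat D D (Lo \<circ> Ro) (La \<circ> Ra) id id \<epsilon> \<and>
     (\<forall>a\<in>Ob C. \<epsilon> (Lo a) \<cdot>\<^bsub>D\<^esub> La (\<eta> a) = Idn D (Lo a)) \<and>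
     (\<forall>b\<in>Ob D. Ra (\<epsilon> b) \<cdot>\<^bsub>C\<^esub> \<eta> (Ro b) = Idn C (Ro b))"


section \<open>Triangulated categories\<close>

record ('o, 'm) add_cat = "('o, 'm) cat" +
  Add :: "'m \<Rightarrow> 'm \<Rightarrow> 'm"
  Zero :: "'o \<Rightarrow> 'o \<Rightarrow> 'm"

definition hom_group :: "('o, 'm, 'x) add_cat_scheme \<Rightarrow> 'o \<Rightarrow> 'o \<Rightarrow> 'm monoid" where
  "hom_group C a b = \<lparr> carrier = Hom C a b, monoid.mult = Add C, one = Zero C a b \<rparr>"

definition neg_ar :: "('o, 'm, 'x) add_cat_scheme \<Rightarrow> 'm \<Rightarrow> 'm" where
  "neg_ar C f = inv\<^bsub>hom_group C (Dom C f) (Cod C f)\<^esub> f"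

definition zero_object :: "('o, 'm, 'x) add_cat_scheme \<Rightarrow> 'o \<Rightarrow> bool" where
  "zero_object C a \<longleftrightarrow> a \<in> Ob C \<and> Idn C a = Zero C a a"

locale additive_category = category C for C :: "('o, 'm, 'x) add_cat_scheme" +
  assumes hom_comm_group: "a \<in> Ob C \<Longrightarrow> b \<in> Ob C \<Longrightarrow> comm_group (hom_group C a b)"
    and Cmp_Add_right: "f \<in> Hom C a b \<Longrightarrow> f' \<in> Hom C a b \<Longrightarrow> g \<in> Hom C b c
      \<Longrightarrow> g \<cdot>\<^bsub>C\<^esub> Add C f f' = Add C (g \<cdot>\<^bsub>C\<^esub> f) (g \<cdot>\<^bsub>C\<^esub> f')"
    and Cmp_Add_left: "f \<in> Hom C a b \<Longrightarrow> g \<in> Hom C b c \<Longrightarrow> g' \<in> Hom C b c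
      \<Longrightarrow> Add C g g' \<cdot>\<^bsub>C\<^esub> f = Add C (g \<cdot>\<^bsub>C\<^esub> f) (g' \<cdot>\<^bsub>C\<^esub> f)"
    and zero_object_exists: "\<exists>a. zero_object C a"
    and biproduct_exists: "a \<in> Ob C \<Longrightarrow> b \<in> Ob C \<Longrightarrow>
      \<exists>s\<in>Ob C. \<exists>i\<in>Hom C a s. \<exists>j\<in>Hom C b s. \<exists>p\<in>Hom C s a. \<exists>q\<in>Hom C s b.
        p \<cdot>\<^bsub>C\<^esub> i = Idn C a \<and> q \<cdot>\<^bsub>C\<^esub> j = Idn C b \<and>
        p \<cdot>\<^bsub>C\<^esub> j = Zero C b a \<and> q \<cdot>\<^bsub>C\<^esub> i = Zero C a b \<and>
        Add C (i \<cdot>\<^bsub>C\<^esub> p) (j \<cdot>\<^bsub>C\<^esub> q) = Idn C s"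

definition additive_functor ::
  "('o, 'm, 'x) add_cat_scheme \<Rightarrow> ('p, 'n, 'y) add_cat_scheme \<Rightarrow> ('o \<Rightarrow> 'p) \<Rightarrow> ('m \<Rightarrow> 'n) \<Rightarrow> bool" where
  "additive_functor C D Fo Fa \<longleftrightarrow> is_functor C D Fo Fa \<and>
     (\<forall>a\<in>Ob C. \<forall>b\<in>Ob C. \<forall>f\<in>Hom C a b. \<forall>g\<in>Hom C a b. Fa (Add C f g) = Add D (Fa f) (Fa g))"

text \<open>\<open>Sh\<close>, \<open>Sha\<close> are the action of the shift functor on objects and arrows; an element
  \<open>(f, g, h)\<close> of \<open>Tri\<close> is a distinguished triangle \<open>X \<rightarrow> Y \<rightarrow> Z \<rightarrow> X[1]\<close>.\<close>

record ('o, 'm) tri_cat = "('o, 'm) add_cat" +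
  Sh :: "'o \<Rightarrow> 'o"
  Sha :: "'m \<Rightarrow> 'm"
  Tri :: "('m \<times> 'm \<times> 'm) set"

definition candidate_triangle :: "('o, 'm, 'x) tri_cat_scheme \<Rightarrow> 'm \<Rightarrow> 'm \<Rightarrow> 'm \<Rightarrow> bool" where
  "candidate_triangle C f g h \<longleftrightarrow> f \<in> Ar C \<and> g \<in> Ar C \<and> h \<in> Ar C \<and>
     Cod C f = Dom C g \<and> Cod C g = Dom C h \<and> Cod C h = Sh C (Dom C f)"

definition triangle_morphism ::
  "('o, 'm, 'x) tri_cat_scheme \<Rightarrow> 'm \<times> 'm \<times> 'm \<Rightarrow> 'm \<times> 'm \<times> 'm \<Rightarrow> 'm \<Rightarrow> 'm \<Rightarrow> 'm \<Rightarrow> bool" where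
  "triangle_morphism C t t' \<alpha> \<beta> \<gamma> \<longleftrightarrow> (case (t, t') of ((f, g, h), (f', g', h')) \<Rightarrow>
     \<alpha> \<in> Hom C (Dom C f) (Dom C f') \<and> \<beta> \<in> Hom C (Dom C g) (Dom C g') \<and>
     \<gamma> \<in> Hom C (Dom C h) (Dom C h') \<and>
     \<beta> \<cdot>\<^bsub>C\<^esub> f = f' \<cdot>\<^bsub>C\<^esub> \<alpha> \<and> \<gamma> \<cdot>\<^bsub>C\<^esub> g = g' \<cdot>\<^bsub>C\<^esub> \<beta> \<and> Sha C \<alpha> \<cdot>\<^bsub>C\<^esub> h = h' \<cdot>\<^bsub>C\<^esub> \<gamma>)"

locale triangulated_category = additive_category C for C :: "('o, 'm, 'x) tri_cat_scheme" +
  assumes shift_additive: "additive_functor C C (Sh C) (Sha C)"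
    and shift_equivalence: "equivalence_functor C C (Sh C) (Sha C)"
    and Tri_candidate: "(f, g, h) \<in> Tri C \<Longrightarrow> candidate_triangle C f g h"
    and TR1_iso: "(f, g, h) \<in> Tri C \<Longrightarrow> candidate_triangle C f' g' h' \<Longrightarrow>
      \<alpha> \<in> Iso C \<Longrightarrow> \<beta> \<in> Iso C \<Longrightarrow> \<gamma> \<in> Iso C \<Longrightarrow>
      triangle_morphism C (f, g, h) (f', g', h') \<alpha> \<beta> \<gamma> \<Longrightarrow> (f', g', h') \<in> Tri C"
    and TR1_id: "a \<in> Ob C \<Longrightarrow> zero_object C z \<Longrightarrow> (Idn C a, Zero C a z, Zero C z (Sh C a)) \<in> Tri C"
    and TR1_cone: "f \<in> Ar C \<Longrightarrow> \<exists>g h. (f, g, h) \<in> Tri C"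
    and TR2: "candidate_triangle C f g h \<Longrightarrow>
      (f, g, h) \<in> Tri C \<longleftrightarrow> (g, h, neg_ar C (Sha C f)) \<in> Tri C"
    and TR3: "(f, g, h) \<in> Tri C \<Longrightarrow> (f', g', h') \<in> Tri C \<Longrightarrow>
      \<alpha> \<in> Hom C (Dom C f) (Dom C f') \<Longrightarrow> \<beta> \<in> Hom C (Dom C g) (Dom C g') \<Longrightarrow>
      \<beta> \<cdot>\<^bsub>C\<^esub> f = f' \<cdot>\<^bsub>C\<^esub> \<alpha> \<Longrightarrow> \<exists>\<gamma>. triangle_morphism C (f, g, h) (f', g', h') \<alpha> \<beta> \<gamma>"
    and TR4: "f \<in> Ar C \<Longrightarrow> g \<in> Ar C \<Longrightarrow> Cod C f = Dom C g \<Longrightarrow>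
      (f, f', f'') \<in> Tri C \<Longrightarrow> (g, g', g'') \<in> Tri C \<Longrightarrow> (g \<cdot>\<^bsub>C\<^esub> f, k', k'') \<in> Tri C \<Longrightarrow>
      \<exists>u\<in>Hom C (Cod C f') (Cod C k'). \<exists>v\<in>Hom C (Cod C k') (Cod C g').
        (u, v, Sha C f' \<cdot>\<^bsub>C\<^esub> g'') \<in> Tri C \<and>
        u \<cdot>\<^bsub>C\<^esub> f' = k' \<cdot>\<^bsub>C\<^esub> g \<and> v \<cdot>\<^bsub>C\<^esub> k' = g' \<and>
        k'' \<cdot>\<^bsub>C\<^esub> u = f'' \<and> g'' \<cdot>\<^bsub>C\<^esub> v = Sha C f \<cdot>\<^bsub>C\<^esub> k''"

text \<open>\<open>\<phi> A : F (A[1]) \<rightarrow> (F A)[1]\<close> is the commutation with the shifts.\<close>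

definition triangulated_functor ::
  "('o, 'm, 'x) tri_cat_scheme \<Rightarrow> ('p, 'n, 'y) tri_cat_scheme
     \<Rightarrow> ('o \<Rightarrow> 'p) \<Rightarrow> ('m \<Rightarrow> 'n) \<Rightarrow> ('o \<Rightarrow> 'n) \<Rightarrow> bool" where
  "triangulated_functor C D Fo Fa \<phi> \<longleftrightarrow> additive_functor C D Fo Fa \<and>
     is_nat_iso C D (Fo \<circ> Sh C) (Fa \<circ> Sha C) (Sh D \<circ> Fo) (Sha D \<circ> Fa) \<phi> \<and>
     (\<forall>f g h. (f, g, h) \<in> Tri C \<longrightarrow> (Fa f, Fa g, \<phi> (Dom C f) \<cdot>\<^bsub>D\<^esub> Fa h) \<in> Tri D)"


section \<open>The base category\<close>

text \<open>A choice of binary products, of an initial object \<open>Empt\<close> and of complementary open immersions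
  \<open>Compl z\<close> (for \<open>z\<close> a closed immersion) is part of the data; \<open>Sm\<close> and \<open>Cl\<close> are the sets of smooth
  morphisms and of closed immersions.\<close>

record ('s, 'm) base_cat = "('s, 'm) cat" +
  Sm :: "'m set"
  Cl :: "'m set"
  Pr :: "'s \<Rightarrow> 's \<Rightarrow> 's"
  pr1 :: "'s \<Rightarrow> 's \<Rightarrow> 'm"
  pr2 :: "'s \<Rightarrow> 's \<Rightarrow> 'm"
  Empt :: "'s"
  Compl :: "'m \<Rightarrow> 'm"

text \<open>The square with sides \<open>a : W \<rightarrow> X\<close>, \<open>b : W \<rightarrow> Y\<close>, \<open>f : X \<rightarrow> B\<close>, \<open>g : Y \<rightarrow> B\<close>,
  where \<open>f a = g b\<close>.\<close>

definition cartesian :: "('s, 'm, 'x) cat_scheme \<Rightarrow> 'm \<Rightarrow> 'm \<Rightarrow> 'm \<Rightarrow> 'm \<Rightarrow> bool" where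
  "cartesian S a b f g \<longleftrightarrow>
     a \<in> Ar S \<and> b \<in> Ar S \<and> f \<in> Ar S \<and> g \<in> Ar S \<and> Dom S a = Dom S b \<and>
     Cod S a = Dom S f \<and> Cod S b = Dom S g \<and> Cod S f = Cod S g \<and> f \<cdot>\<^bsub>S\<^esub> a = g \<cdot>\<^bsub>S\<^esub> b \<and>
     (\<forall>T\<in>Ob S. \<forall>x\<in>Hom S T (Dom S f). \<forall>y\<in>Hom S T (Dom S g). f \<cdot>\<^bsub>S\<^esub> x = g \<cdot>\<^bsub>S\<^esub> y \<longrightarrow>
        (\<exists>!h. h \<in> Hom S T (Dom S a) \<and> a \<cdot>\<^bsub>S\<^esub> h = x \<and> b \<cdot>\<^bsub>S\<^esub> h = y))"

definition from_empty :: "('s, 'm, 'x) base_cat_scheme \<Rightarrow> 's \<Rightarrow> 'm" where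
  "from_empty S T = (THE h. h \<in> Hom S (Empt S) T)"

text \<open>The morphism \<open>f \<times> g\<close>.\<close>

definition prod_ar :: "('s, 'm, 'x) base_cat_scheme \<Rightarrow> 'm \<Rightarrow> 'm \<Rightarrow> 'm" where
  "prod_ar S f g = (THE h. h \<in> Hom S (Pr S (Dom S f) (Dom S g)) (Pr S (Cod S f) (Cod S g)) \<and>
     pr1 S (Cod S f) (Cod S g) \<cdot>\<^bsub>S\<^esub> h = f \<cdot>\<^bsub>S\<^esub> pr1 S (Dom S f) (Dom S g) \<and>
     pr2 S (Cod S f) (Cod S g) \<cdot>\<^bsub>S\<^esub> h = g \<cdot>\<^bsub>S\<^esub> pr2 S (Dom S f) (Dom S g))"

definition wide_subcategory :: "('s, 'm, 'x) cat_scheme \<Rightarrow> 'm set \<Rightarrow> bool" where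
  "wide_subcategory S M \<longleftrightarrow> M \<subseteq> Ar S \<and> (\<forall>a\<in>Ob S. Idn S a \<in> M) \<and>
     (\<forall>f\<in>M. \<forall>g\<in>M. Cod S f = Dom S g \<longrightarrow> g \<cdot>\<^bsub>S\<^esub> f \<in> M)"

locale base_category = category S for S :: "('s, 'm, 'x) base_cat_scheme" +
  assumes Pr_Ob: "a \<in> Ob S \<Longrightarrow> b \<in> Ob S \<Longrightarrow> Pr S a b \<in> Ob S"
    and pr1_Hom: "a \<in> Ob S \<Longrightarrow> b \<in> Ob S \<Longrightarrow> pr1 S a b \<in> Hom S (Pr S a b) a"
    and pr2_Hom: "a \<in> Ob S \<Longrightarrow> b \<in> Ob S \<Longrightarrow> pr2 S a b \<in> Hom S (Pr S a b) b"
    and Pr_universal: "a \<in> Ob S \<Longrightarrow> b \<in> Ob S \<Longrightarrow> x \<in> Hom S t a \<Longrightarrow> y \<in> Hom S t b \<Longrightarrow>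
      \<exists>!h. h \<in> Hom S t (Pr S a b) \<and> pr1 S a b \<cdot>\<^bsub>S\<^esub> h = x \<and> pr2 S a b \<cdot>\<^bsub>S\<^esub> h = y"
    and Sm_subcategory: "wide_subcategory S (Sm S)"
    and Cl_subcategory: "wide_subcategory S (Cl S)"
    and Iso_Sm: "Iso S \<subseteq> Sm S"
    and Iso_Cl: "Iso S \<subseteq> Cl S"
    and smooth_fibre_product: "p \<in> Sm S \<Longrightarrow> f \<in> Ar S \<Longrightarrow> Cod S f = Cod S p \<Longrightarrow>
      \<exists>f' p'. cartesian S f' p' p f"
    and smooth_base_change: "p \<in> Sm S \<Longrightarrow> cartesian S f' p' p f \<Longrightarrow> p' \<in> Sm S"
    and closed_base_change: "p \<in> Sm S \<Longrightarrow> z \<in> Cl S \<Longrightarrow> cartesian S z' p' p z \<Longrightarrow> z' \<in> Cl S"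
    and closed_cancel: "z \<in> Ar S \<Longrightarrow> g \<in> Ar S \<Longrightarrow> Cod S z = Dom S g \<Longrightarrow> g \<cdot>\<^bsub>S\<^esub> z \<in> Cl S \<Longrightarrow> z \<in> Cl S"
    \<comment> \<open>Implicit in the notion of an external tensor structure over the closed immersions, which needs
      \<open>(z1 \<times> z2)\<^sub>*\<close> to be one of the functors \<open>z\<^sub>*\<close>; the other axioms do not imply it.\<close>
    and closed_product: "z1 \<in> Cl S \<Longrightarrow> z2 \<in> Cl S \<Longrightarrow> prod_ar S z1 z2 \<in> Cl S"
    and factorization: "f \<in> Ar S \<Longrightarrow>
      \<exists>t\<in>Cl S. \<exists>p\<in>Sm S. Cod S t = Dom S p \<and> f = p \<cdot>\<^bsub>S\<^esub> t"
    and Empt_Ob: "Empt S \<in> Ob S"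
    and Empt_initial: "T \<in> Ob S \<Longrightarrow> \<exists>!h. h \<in> Hom S (Empt S) T"
    and Compl_Sm: "z \<in> Cl S \<Longrightarrow> Compl S z \<in> Sm S"
    and Compl_Cod: "z \<in> Cl S \<Longrightarrow> Cod S (Compl S z) = Cod S z"
    and Compl_universal: "z \<in> Cl S \<Longrightarrow> T \<in> Ob S \<Longrightarrow>
      bij_betw (\<lambda>h. Compl S z \<cdot>\<^bsub>S\<^esub> h) (Hom S T (Dom S (Compl S z)))
        {f \<in> Hom S T (Cod S z). cartesian S (from_empty S T) (from_empty S (Dom S z)) f z}"


section \<open>Localic triangulated fibered categories\<close>

text \<open>For \<open>f : T \<rightarrow> S\<close>, the functor \<open>f\<^sup>* : H(S) \<rightarrow> H(T)\<close> is \<open>(pbo H f, pba H f)\<close>;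
  \<open>pbsh H f A : f\<^sup>*(A[1]) \<rightarrow> (f\<^sup>*A)[1]\<close> is its commutation with the shifts, and
  \<open>conn H f g A : (g f)\<^sup>*A \<rightarrow> f\<^sup>*g\<^sup>*A\<close>.\<close>

record ('s, 'm, 'a, 'b) fib_cat =
  Fib :: "'s \<Rightarrow> ('a, 'b) tri_cat"
  pbo :: "'m \<Rightarrow> 'a \<Rightarrow> 'a"
  pba :: "'m \<Rightarrow> 'b \<Rightarrow> 'b"
  pbsh :: "'m \<Rightarrow> 'a \<Rightarrow> 'b"
  conn :: "'m \<Rightarrow> 'm \<Rightarrow> 'a \<Rightarrow> 'b"

locale fibered_category = category S
  for S :: "('s, 'm, 'x) cat_scheme" and H :: "('s, 'm, 'a, 'b, 'y) fib_cat_scheme" +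
  assumes fibre_category: "s \<in> Ob S \<Longrightarrow> category (Fib H s)"
    and pb_functor: "f \<in> Ar S \<Longrightarrow>
      is_functor (Fib H (Cod S f)) (Fib H (Dom S f)) (pbo H f) (pba H f)"
    and pbo_Idn: "s \<in> Ob S \<Longrightarrow> A \<in> Ob (Fib H s) \<Longrightarrow> pbo H (Idn S s) A = A"
    and pba_Idn: "s \<in> Ob S \<Longrightarrow> \<phi> \<in> Ar (Fib H s) \<Longrightarrow> pba H (Idn S s) \<phi> = \<phi>"
    and conn_nat_iso: "f \<in> Ar S \<Longrightarrow> g \<in> Ar S \<Longrightarrow> Cod S f = Dom S g \<Longrightarrow>
      is_nat_iso (Fib H (Cod S g)) (Fib H (Dom S f))
        (pbo H (g \<cdot>\<^bsub>S\<^esub> f)) (pba H (g \<cdot>\<^bsub>S\<^esub> f)) (pbo H f \<circ> pbo H g) (pba H f \<circ> pba H g) (conn H f g)"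
    and conn_cocycle: "f \<in> Ar S \<Longrightarrow> g \<in> Ar S \<Longrightarrow> h \<in> Ar S \<Longrightarrow>
      Cod S f = Dom S g \<Longrightarrow> Cod S g = Dom S h \<Longrightarrow> A \<in> Ob (Fib H (Cod S h)) \<Longrightarrow>
      pba H f (conn H g h A) \<cdot>\<^bsub>Fib H (Dom S f)\<^esub> conn H f (h \<cdot>\<^bsub>S\<^esub> g) A =
      conn H f g (pbo H h A) \<cdot>\<^bsub>Fib H (Dom S f)\<^esub> conn H (g \<cdot>\<^bsub>S\<^esub> f) h A"

locale triangulated_fibered_category = fibered_category S H
  for S :: "('s, 'm, 'x) cat_scheme" and H :: "('s, 'm, 'a, 'b, 'y) fib_cat_scheme" +
  assumes fibre_triangulated: "s \<in> Ob S \<Longrightarrow> triangulated_category (Fib H s)"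
    and pb_triangulated: "f \<in> Ar S \<Longrightarrow>
      triangulated_functor (Fib H (Cod S f)) (Fib H (Dom S f)) (pbo H f) (pba H f) (pbsh H f)"
    and conn_shift: "f \<in> Ar S \<Longrightarrow> g \<in> Ar S \<Longrightarrow> Cod S f = Dom S g \<Longrightarrow>
      A \<in> Ob (Fib H (Cod S g)) \<Longrightarrow>
      pbsh H f (pbo H g A) \<cdot>\<^bsub>Fib H (Dom S f)\<^esub> pba H f (pbsh H g A)
        \<cdot>\<^bsub>Fib H (Dom S f)\<^esub> conn H f g (Sh (Fib H (Cod S g)) A) =
      Sha (Fib H (Dom S f)) (conn H f g A) \<cdot>\<^bsub>Fib H (Dom S f)\<^esub> pbsh H (g \<cdot>\<^bsub>S\<^esub> f) A"

text \<open>For \<open>f a = g b\<close>, the composite connection isomorphism \<open>a\<^sup>*f\<^sup>*B = b\<^sup>*g\<^sup>*B\<close>.\<close>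

definition exch :: "('s, 'm, 'x) cat_scheme \<Rightarrow> ('s, 'm, 'a, 'b, 'y) fib_cat_scheme
    \<Rightarrow> 'm \<Rightarrow> 'm \<Rightarrow> 'm \<Rightarrow> 'm \<Rightarrow> 'a \<Rightarrow> 'b" where
  "exch S H a b f g B =
     conn H b g B \<cdot>\<^bsub>Fib H (Dom S a)\<^esub> inv_ar (Fib H (Dom S a)) (conn H a f B)"

text \<open>A choice of adjunctions \<open>p\<^sub># \<stileturn> p\<^sup>*\<close> (\<open>sho\<close>, \<open>sha\<close>) for \<open>p\<close> smooth and \<open>z\<^sup>* \<stileturn> z\<^sub>*\<close>
  (\<open>lowo\<close>, \<open>lowa\<close>) for \<open>z\<close> a closed immersion is part of the data.\<close>

record ('s, 'm, 'a, 'b) adj_fib_cat = "('s, 'm, 'a, 'b) fib_cat" +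
  sho :: "'m \<Rightarrow> 'a \<Rightarrow> 'a"
  sha :: "'m \<Rightarrow> 'b \<Rightarrow> 'b"
  sh_unit :: "'m \<Rightarrow> 'a \<Rightarrow> 'b"
  sh_counit :: "'m \<Rightarrow> 'a \<Rightarrow> 'b"
  lowo :: "'m \<Rightarrow> 'a \<Rightarrow> 'a"
  lowa :: "'m \<Rightarrow> 'b \<Rightarrow> 'b"
  low_unit :: "'m \<Rightarrow> 'a \<Rightarrow> 'b"
  low_counit :: "'m \<Rightarrow> 'a \<Rightarrow> 'b"

text \<open>For \<open>p f' = f p'\<close> with \<open>p\<close>, \<open>p'\<close> smooth: \<open>p'\<^sub># f'\<^sup>* A \<rightarrow> f\<^sup>* p\<^sub># A\<close>.\<close>

definition smooth_bc :: "('s, 'm, 'x) cat_scheme \<Rightarrow> ('s, 'm, 'a, 'b, 'y) adj_fib_cat_scheme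
    \<Rightarrow> 'm \<Rightarrow> 'm \<Rightarrow> 'm \<Rightarrow> 'm \<Rightarrow> 'a \<Rightarrow> 'b" where
  "smooth_bc S H f' p' p f A = (let D = Fib H (Dom S f) in
     sh_counit H p' (pbo H f (sho H p A))
     \<cdot>\<^bsub>D\<^esub> sha H p' (exch S H f' p' p f (sho H p A))
     \<cdot>\<^bsub>D\<^esub> sha H p' (pba H f' (sh_unit H p A)))"

text \<open>For \<open>p z' = z p'\<close> with \<open>z\<close>, \<open>z'\<close> closed immersions: \<open>p\<^sup>* z\<^sub>* A \<rightarrow> z'\<^sub>* p'\<^sup>* A\<close>.\<close>

definition closed_bc :: "('s, 'm, 'x) cat_scheme \<Rightarrow> ('s, 'm, 'a, 'b, 'y) adj_fib_cat_scheme
    \<Rightarrow> 'm \<Rightarrow> 'm \<Rightarrow> 'm \<Rightarrow> 'm \<Rightarrow> 'a \<Rightarrow> 'b" where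
  "closed_bc S H z' p' p z A = (let D = Fib H (Dom S p) in
     lowa H z' (pba H p' (low_counit H z A))
     \<cdot>\<^bsub>D\<^esub> lowa H z' (exch S H z' p' p z (lowo H z A))
     \<cdot>\<^bsub>D\<^esub> low_unit H z' (pbo H p (lowo H z A)))"

text \<open>The isomorphism \<open>(w z)\<^sub>* A \<rightarrow> w\<^sub>* z\<^sub>* A\<close> induced by adjunction from \<open>conn\<close>.\<close>

definition low_conn :: "('s, 'm, 'x) cat_scheme \<Rightarrow> ('s, 'm, 'a, 'b, 'y) adj_fib_cat_scheme
    \<Rightarrow> 'm \<Rightarrow> 'm \<Rightarrow> 'a \<Rightarrow> 'b" where
  "low_conn S H w z A = (let D = Fib H (Cod S w); B = lowo H (w \<cdot>\<^bsub>S\<^esub> z) A in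
     lowa H w (lowa H z (low_counit H (w \<cdot>\<^bsub>S\<^esub> z) A))
     \<cdot>\<^bsub>D\<^esub> lowa H w (lowa H z (inv_ar (Fib H (Dom S z)) (conn H z w B)))
     \<cdot>\<^bsub>D\<^esub> lowa H w (low_unit H z (pbo H w B))
     \<cdot>\<^bsub>D\<^esub> low_unit H w B)"

text \<open>The commutation \<open>(z\<^sub>* A)[1] \<rightarrow> z\<^sub>* (A[1])\<close> induced by adjunction from \<open>pbsh\<close>.\<close>

definition low_shift :: "('s, 'm, 'x) cat_scheme \<Rightarrow> ('s, 'm, 'a, 'b, 'y) adj_fib_cat_scheme
    \<Rightarrow> 'm \<Rightarrow> 'a \<Rightarrow> 'b" where
  "low_shift S H z A = (let D = Fib H (Cod S z) in
     lowa H z (Sha (Fib H (Dom S z)) (low_counit H z A))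
     \<cdot>\<^bsub>D\<^esub> lowa H z (pbsh H z (lowo H z A))
     \<cdot>\<^bsub>D\<^esub> low_unit H z (Sh D (lowo H z A)))"

locale localic_fibered_category = triangulated_fibered_category S H
  for S :: "('s, 'm, 'x) base_cat_scheme" and H :: "('s, 'm, 'a, 'b, 'y) adj_fib_cat_scheme" +
  assumes fibre_Empt: "A \<in> Ob (Fib H (Empt S)) \<Longrightarrow> zero_object (Fib H (Empt S)) A"
    and sharp_adjunction: "p \<in> Sm S \<Longrightarrow>
      adjunction (Fib H (Dom S p)) (Fib H (Cod S p))
        (sho H p) (sha H p) (pbo H p) (pba H p) (sh_unit H p) (sh_counit H p)"
    and smooth_bc_iso: "p \<in> Sm S \<Longrightarrow> cartesian S f' p' p f \<Longrightarrow> A \<in> Ob (Fib H (Dom S p)) \<Longrightarrow>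
      smooth_bc S H f' p' p f A \<in> Iso (Fib H (Dom S f))"
    and low_adjunction: "z \<in> Cl S \<Longrightarrow>
      adjunction (Fib H (Cod S z)) (Fib H (Dom S z))
        (pbo H z) (pba H z) (lowo H z) (lowa H z) (low_unit H z) (low_counit H z)"
    and low_fully_faithful: "z \<in> Cl S \<Longrightarrow>
      fully_faithful (Fib H (Dom S z)) (Fib H (Cod S z)) (lowo H z) (lowa H z)"
    and jointly_conservative: "z \<in> Cl S \<Longrightarrow> \<phi> \<in> Ar (Fib H (Cod S z)) \<Longrightarrow>
      pba H z \<phi> \<in> Iso (Fib H (Dom S z)) \<Longrightarrow>
      pba H (Compl S z) \<phi> \<in> Iso (Fib H (Dom S (Compl S z))) \<Longrightarrow> \<phi> \<in> Iso (Fib H (Cod S z))"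
    and sharp_Idn: "s \<in> Ob S \<Longrightarrow> A \<in> Ob (Fib H s) \<Longrightarrow>
      sho H (Idn S s) A = A \<and> sh_unit H (Idn S s) A = Idn (Fib H s) A \<and>
      sh_counit H (Idn S s) A = Idn (Fib H s) A"
    and sharp_Idn_ar: "s \<in> Ob S \<Longrightarrow> \<phi> \<in> Ar (Fib H s) \<Longrightarrow> sha H (Idn S s) \<phi> = \<phi>"
    and low_Idn: "s \<in> Ob S \<Longrightarrow> A \<in> Ob (Fib H s) \<Longrightarrow>
      lowo H (Idn S s) A = A \<and> low_unit H (Idn S s) A = Idn (Fib H s) A \<and>
      low_counit H (Idn S s) A = Idn (Fib H s) A"
    and low_Idn_ar: "s \<in> Ob S \<Longrightarrow> \<phi> \<in> Ar (Fib H s) \<Longrightarrow> lowa H (Idn S s) \<phi> = \<phi>"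


section \<open>External tensor structures\<close>

text \<open>\<open>bxo B S1 S2\<close>, \<open>bxa B S1 S2\<close> are the action of \<open>\<boxtimes> : H(S1) \<times> H(S2) \<rightarrow> H(S1 \<times> S2)\<close> on objects
  and arrows, and \<open>bxl B S1 S2 A1 A2 : A1[1] \<boxtimes> A2 \<rightarrow> (A1 \<boxtimes> A2)[1]\<close>,
  \<open>bxr B S1 S2 A1 A2 : A1 \<boxtimes> A2[1] \<rightarrow> (A1 \<boxtimes> A2)[1]\<close> its commutations with the shifts.\<close>

record ('s, 'a, 'b) box =
  bxo :: "'s \<Rightarrow> 's \<Rightarrow> 'a \<Rightarrow> 'a \<Rightarrow> 'a"
  bxa :: "'s \<Rightarrow> 's \<Rightarrow> 'b \<Rightarrow> 'b \<Rightarrow> 'b"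
  bxl :: "'s \<Rightarrow> 's \<Rightarrow> 'a \<Rightarrow> 'a \<Rightarrow> 'b"
  bxr :: "'s \<Rightarrow> 's \<Rightarrow> 'a \<Rightarrow> 'a \<Rightarrow> 'b"

definition box_functors :: "('s, 'm, 'x) base_cat_scheme \<Rightarrow> ('s, 'm, 'a, 'b, 'y) fib_cat_scheme
    \<Rightarrow> ('s, 'a, 'b, 'z) box_scheme \<Rightarrow> bool" where
  "box_functors S H B \<longleftrightarrow> (\<forall>S1\<in>Ob S. \<forall>S2\<in>Ob S.
     is_functor (prod_cat (Fib H S1) (Fib H S2)) (Fib H (Pr S S1 S2))
       (\<lambda>(A1, A2). bxo B S1 S2 A1 A2) (\<lambda>(\<phi>1, \<phi>2). bxa B S1 S2 \<phi>1 \<phi>2))"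

definition box_triangulated :: "('s, 'm, 'x) base_cat_scheme \<Rightarrow> ('s, 'm, 'a, 'b, 'y) fib_cat_scheme
    \<Rightarrow> ('s, 'a, 'b, 'z) box_scheme \<Rightarrow> bool" where
  "box_triangulated S H B \<longleftrightarrow> (\<forall>S1\<in>Ob S. \<forall>S2\<in>Ob S.
     let C1 = Fib H S1; C2 = Fib H S2; D = Fib H (Pr S S1 S2) in
     is_nat_iso (prod_cat C1 C2) D
       (\<lambda>(A1, A2). bxo B S1 S2 (Sh C1 A1) A2) (\<lambda>(\<phi>1, \<phi>2). bxa B S1 S2 (Sha C1 \<phi>1) \<phi>2)
       (\<lambda>(A1, A2). Sh D (bxo B S1 S2 A1 A2)) (\<lambda>(\<phi>1, \<phi>2). Sha D (bxa B S1 S2 \<phi>1 \<phi>2))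
       (\<lambda>(A1, A2). bxl B S1 S2 A1 A2) \<and>
     is_nat_iso (prod_cat C1 C2) D
       (\<lambda>(A1, A2). bxo B S1 S2 A1 (Sh C2 A2)) (\<lambda>(\<phi>1, \<phi>2). bxa B S1 S2 \<phi>1 (Sha C2 \<phi>2))
       (\<lambda>(A1, A2). Sh D (bxo B S1 S2 A1 A2)) (\<lambda>(\<phi>1, \<phi>2). Sha D (bxa B S1 S2 \<phi>1 \<phi>2))
       (\<lambda>(A1, A2). bxr B S1 S2 A1 A2) \<and>
     (\<forall>A2\<in>Ob C2. triangulated_functor C1 D
       (\<lambda>A1. bxo B S1 S2 A1 A2) (\<lambda>\<phi>1. bxa B S1 S2 \<phi>1 (Idn C2 A2)) (\<lambda>A1. bxl B S1 S2 A1 A2)) \<and>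
     (\<forall>A1\<in>Ob C1. triangulated_functor C2 D
       (\<lambda>A2. bxo B S1 S2 A1 A2) (\<lambda>\<phi>2. bxa B S1 S2 (Idn C1 A1) \<phi>2) (\<lambda>A2. bxr B S1 S2 A1 A2)))"

text \<open>\<open>m f1 f2 A1 A2 : f1\<^sup>*A1 \<boxtimes> f2\<^sup>*A2 \<rightarrow> (f1 \<times> f2)\<^sup>*(A1 \<boxtimes> A2)\<close> for \<open>f1\<close>, \<open>f2\<close> in the
  subcategory with set of arrows \<open>M\<close>.\<close>

definition ext_tensor :: "('s, 'm, 'x) base_cat_scheme \<Rightarrow> ('s, 'm, 'a, 'b, 'y) fib_cat_scheme
    \<Rightarrow> 'm set \<Rightarrow> ('s, 'a, 'b, 'z) box_scheme \<Rightarrow> ('m \<Rightarrow> 'm \<Rightarrow> 'a \<Rightarrow> 'a \<Rightarrow> 'b) \<Rightarrow> bool" where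
  "ext_tensor S H M B m \<longleftrightarrow> box_functors S H B \<and>
     (\<forall>f1\<in>M. \<forall>f2\<in>M.
        let T1 = Dom S f1; T2 = Dom S f2; S1 = Cod S f1; S2 = Cod S f2; f = prod_ar S f1 f2 in
        is_nat_iso (prod_cat (Fib H S1) (Fib H S2)) (Fib H (Pr S T1 T2))
          (\<lambda>(A1, A2). bxo B T1 T2 (pbo H f1 A1) (pbo H f2 A2))
          (\<lambda>(\<phi>1, \<phi>2). bxa B T1 T2 (pba H f1 \<phi>1) (pba H f2 \<phi>2))
          (\<lambda>(A1, A2). pbo H f (bxo B S1 S2 A1 A2))
          (\<lambda>(\<phi>1, \<phi>2). pba H f (bxa B S1 S2 \<phi>1 \<phi>2))
          (\<lambda>(A1, A2). m f1 f2 A1 A2)) \<and>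
     (\<forall>f1\<in>M. \<forall>f2\<in>M. \<forall>g1\<in>M. \<forall>g2\<in>M. Cod S f1 = Dom S g1 \<longrightarrow> Cod S f2 = Dom S g2 \<longrightarrow>
        (\<forall>A1\<in>Ob (Fib H (Cod S g1)). \<forall>A2\<in>Ob (Fib H (Cod S g2)).
          let T1 = Dom S f1; T2 = Dom S f2; D = Fib H (Pr S T1 T2) in
          conn H (prod_ar S f1 f2) (prod_ar S g1 g2) (bxo B (Cod S g1) (Cod S g2) A1 A2)
            \<cdot>\<^bsub>D\<^esub> m (g1 \<cdot>\<^bsub>S\<^esub> f1) (g2 \<cdot>\<^bsub>S\<^esub> f2) A1 A2 =
          pba H (prod_ar S f1 f2) (m g1 g2 A1 A2)
            \<cdot>\<^bsub>D\<^esub> m f1 f2 (pbo H g1 A1) (pbo H g2 A2)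
            \<cdot>\<^bsub>D\<^esub> bxa B T1 T2 (conn H f1 g1 A1) (conn H f2 g2 A2)))"

definition tensor_shift_compatible ::
  "('s, 'm, 'x) base_cat_scheme \<Rightarrow> ('s, 'm, 'a, 'b, 'y) fib_cat_scheme
    \<Rightarrow> 'm set \<Rightarrow> ('s, 'a, 'b, 'z) box_scheme \<Rightarrow> ('m \<Rightarrow> 'm \<Rightarrow> 'a \<Rightarrow> 'a \<Rightarrow> 'b) \<Rightarrow> bool" where
  "tensor_shift_compatible S H M B m \<longleftrightarrow>
     (\<forall>f1\<in>M. \<forall>f2\<in>M. \<forall>A1\<in>Ob (Fib H (Cod S f1)). \<forall>A2\<in>Ob (Fib H (Cod S f2)).
        let T1 = Dom S f1; T2 = Dom S f2; S1 = Cod S f1; S2 = Cod S f2; f = prod_ar S f1 f2;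
            D = Fib H (Pr S T1 T2) in
        pbsh H f (bxo B S1 S2 A1 A2) \<cdot>\<^bsub>D\<^esub> pba H f (bxl B S1 S2 A1 A2)
          \<cdot>\<^bsub>D\<^esub> m f1 f2 (Sh (Fib H S1) A1) A2 =
        Sha D (m f1 f2 A1 A2) \<cdot>\<^bsub>D\<^esub> bxl B T1 T2 (pbo H f1 A1) (pbo H f2 A2)
          \<cdot>\<^bsub>D\<^esub> bxa B T1 T2 (pbsh H f1 A1) (Idn (Fib H T2) (pbo H f2 A2)) \<and>
        pbsh H f (bxo B S1 S2 A1 A2) \<cdot>\<^bsub>D\<^esub> pba H f (bxr B S1 S2 A1 A2)
          \<cdot>\<^bsub>D\<^esub> m f1 f2 A1 (Sh (Fib H S2) A2) =
        Sha D (m f1 f2 A1 A2) \<cdot>\<^bsub>D\<^esub> bxr B T1 T2 (pbo H f1 A1) (pbo H f2 A2)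
          \<cdot>\<^bsub>D\<^esub> bxa B T1 T2 (Idn (Fib H T1) (pbo H f1 A1)) (pbsh H f2 A2))"

definition tri_ext_tensor :: "('s, 'm, 'x) base_cat_scheme \<Rightarrow> ('s, 'm, 'a, 'b, 'y) fib_cat_scheme
    \<Rightarrow> 'm set \<Rightarrow> ('s, 'a, 'b, 'z) box_scheme \<Rightarrow> ('m \<Rightarrow> 'm \<Rightarrow> 'a \<Rightarrow> 'a \<Rightarrow> 'b) \<Rightarrow> bool" where
  "tri_ext_tensor S H M B m \<longleftrightarrow>
     ext_tensor S H M B m \<and> box_triangulated S H B \<and> tensor_shift_compatible S H M B m"

text \<open>\<open>mb z1 z2 A1 A2 : z1\<^sub>*A1 \<boxtimes> z2\<^sub>*A2 \<rightarrow> (z1 \<times> z2)\<^sub>*(A1 \<boxtimes> A2)\<close> for closed immersions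
  \<open>z1\<close>, \<open>z2\<close>.\<close>

definition ext_tensor_cl_op ::
  "('s, 'm, 'x) base_cat_scheme \<Rightarrow> ('s, 'm, 'a, 'b, 'y) adj_fib_cat_scheme
    \<Rightarrow> ('s, 'a, 'b, 'z) box_scheme \<Rightarrow> ('m \<Rightarrow> 'm \<Rightarrow> 'a \<Rightarrow> 'a \<Rightarrow> 'b) \<Rightarrow> bool" where
  "ext_tensor_cl_op S H B mb \<longleftrightarrow> box_functors S H B \<and>
     (\<forall>z1\<in>Cl S. \<forall>z2\<in>Cl S.
        let Z1 = Dom S z1; Z2 = Dom S z2; S1 = Cod S z1; S2 = Cod S z2; z = prod_ar S z1 z2 in
        is_nat_iso (prod_cat (Fib H Z1) (Fib H Z2)) (Fib H (Pr S S1 S2))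
          (\<lambda>(A1, A2). bxo B S1 S2 (lowo H z1 A1) (lowo H z2 A2))
          (\<lambda>(\<phi>1, \<phi>2). bxa B S1 S2 (lowa H z1 \<phi>1) (lowa H z2 \<phi>2))
          (\<lambda>(A1, A2). lowo H z (bxo B Z1 Z2 A1 A2))
          (\<lambda>(\<phi>1, \<phi>2). lowa H z (bxa B Z1 Z2 \<phi>1 \<phi>2))
          (\<lambda>(A1, A2). mb z1 z2 A1 A2)) \<and>
     (\<forall>z1\<in>Cl S. \<forall>z2\<in>Cl S. \<forall>w1\<in>Cl S. \<forall>w2\<in>Cl S.
        Cod S z1 = Dom S w1 \<longrightarrow> Cod S z2 = Dom S w2 \<longrightarrow>
        (\<forall>A1\<in>Ob (Fib H (Dom S z1)). \<forall>A2\<in>Ob (Fib H (Dom S z2)).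
          let S1 = Cod S w1; S2 = Cod S w2; D = Fib H (Pr S S1 S2) in
          low_conn S H (prod_ar S w1 w2) (prod_ar S z1 z2) (bxo B (Dom S z1) (Dom S z2) A1 A2)
            \<cdot>\<^bsub>D\<^esub> mb (w1 \<cdot>\<^bsub>S\<^esub> z1) (w2 \<cdot>\<^bsub>S\<^esub> z2) A1 A2 =
          lowa H (prod_ar S w1 w2) (mb z1 z2 A1 A2)
            \<cdot>\<^bsub>D\<^esub> mb w1 w2 (lowo H z1 A1) (lowo H z2 A2)
            \<cdot>\<^bsub>D\<^esub> bxa B S1 S2 (low_conn S H w1 z1 A1) (low_conn S H w2 z2 A2)))"

definition tensor_cl_op_shift_compatible ::
  "('s, 'm, 'x) base_cat_scheme \<Rightarrow> ('s, 'm, 'a, 'b, 'y) adj_fib_cat_scheme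
    \<Rightarrow> ('s, 'a, 'b, 'z) box_scheme \<Rightarrow> ('m \<Rightarrow> 'm \<Rightarrow> 'a \<Rightarrow> 'a \<Rightarrow> 'b) \<Rightarrow> bool" where
  "tensor_cl_op_shift_compatible S H B mb \<longleftrightarrow>
     (\<forall>z1\<in>Cl S. \<forall>z2\<in>Cl S. \<forall>A1\<in>Ob (Fib H (Dom S z1)). \<forall>A2\<in>Ob (Fib H (Dom S z2)).
        let Z1 = Dom S z1; Z2 = Dom S z2; S1 = Cod S z1; S2 = Cod S z2; z = prod_ar S z1 z2;
            D = Fib H (Pr S S1 S2) in
        lowa H z (bxl B Z1 Z2 A1 A2) \<cdot>\<^bsub>D\<^esub> mb z1 z2 (Sh (Fib H Z1) A1) A2
          \<cdot>\<^bsub>D\<^esub> bxa B S1 S2 (low_shift S H z1 A1) (Idn (Fib H S2) (lowo H z2 A2)) =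
        low_shift S H z (bxo B Z1 Z2 A1 A2) \<cdot>\<^bsub>D\<^esub> Sha D (mb z1 z2 A1 A2)
          \<cdot>\<^bsub>D\<^esub> bxl B S1 S2 (lowo H z1 A1) (lowo H z2 A2) \<and>
        lowa H z (bxr B Z1 Z2 A1 A2) \<cdot>\<^bsub>D\<^esub> mb z1 z2 A1 (Sh (Fib H Z2) A2)
          \<cdot>\<^bsub>D\<^esub> bxa B S1 S2 (Idn (Fib H S1) (lowo H z1 A1)) (low_shift S H z2 A2) =
        low_shift S H z (bxo B Z1 Z2 A1 A2) \<cdot>\<^bsub>D\<^esub> Sha D (mb z1 z2 A1 A2)
          \<cdot>\<^bsub>D\<^esub> bxr B S1 S2 (lowo H z1 A1) (lowo H z2 A2))"

definition tri_ext_tensor_cl_op ::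
  "('s, 'm, 'x) base_cat_scheme \<Rightarrow> ('s, 'm, 'a, 'b, 'y) adj_fib_cat_scheme
    \<Rightarrow> ('s, 'a, 'b, 'z) box_scheme \<Rightarrow> ('m \<Rightarrow> 'm \<Rightarrow> 'a \<Rightarrow> 'a \<Rightarrow> 'b) \<Rightarrow> bool" where
  "tri_ext_tensor_cl_op S H B mb \<longleftrightarrow>
     ext_tensor_cl_op S H B mb \<and> box_triangulated S H B \<and> tensor_cl_op_shift_compatible S H B mb"

text \<open>The composite \<open>(p1 \<times> p2)\<^sub>#(A1 \<boxtimes> A2) \<rightarrow> p1\<^sub>#A1 \<boxtimes> p2\<^sub>#A2\<close>.\<close>

definition sharp_box :: "('s, 'm, 'x) base_cat_scheme \<Rightarrow> ('s, 'm, 'a, 'b, 'y) adj_fib_cat_scheme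
    \<Rightarrow> ('s, 'a, 'b, 'z) box_scheme \<Rightarrow> ('m \<Rightarrow> 'm \<Rightarrow> 'a \<Rightarrow> 'a \<Rightarrow> 'b)
    \<Rightarrow> 'm \<Rightarrow> 'm \<Rightarrow> 'a \<Rightarrow> 'a \<Rightarrow> 'b" where
  "sharp_box S H B m p1 p2 A1 A2 =
     (let P1 = Dom S p1; P2 = Dom S p2; S1 = Cod S p1; S2 = Cod S p2; p = prod_ar S p1 p2;
          D = Fib H (Pr S S1 S2) in
      sh_counit H p (bxo B S1 S2 (sho H p1 A1) (sho H p2 A2))
      \<cdot>\<^bsub>D\<^esub> sha H p (m p1 p2 (sho H p1 A1) (sho H p2 A2))
      \<cdot>\<^bsub>D\<^esub> sha H p (bxa B P1 P2 (sh_unit H p1 A1) (sh_unit H p2 A2)))"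

definition smooth_adjointable ::
  "('s, 'm, 'x) base_cat_scheme \<Rightarrow> ('s, 'm, 'a, 'b, 'y) adj_fib_cat_scheme
    \<Rightarrow> ('s, 'a, 'b, 'z) box_scheme \<Rightarrow> ('m \<Rightarrow> 'm \<Rightarrow> 'a \<Rightarrow> 'a \<Rightarrow> 'b) \<Rightarrow> bool" where
  "smooth_adjointable S H B m \<longleftrightarrow>
     (\<forall>p1\<in>Sm S. \<forall>p2\<in>Sm S. \<forall>A1\<in>Ob (Fib H (Dom S p1)). \<forall>A2\<in>Ob (Fib H (Dom S p2)).
        sharp_box S H B m p1 p2 A1 A2 \<in> Iso (Fib H (Pr S (Cod S p1) (Cod S p2))))"

record ('s, 'm, 'a, 'b) tensor = "('s, 'a, 'b) box" +
  mten :: "'m \<Rightarrow> 'm \<Rightarrow> 'a \<Rightarrow> 'a \<Rightarrow> 'b"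

definition localic_ext_tensor ::
  "('s, 'm, 'x) base_cat_scheme \<Rightarrow> ('s, 'm, 'a, 'b, 'y) adj_fib_cat_scheme
    \<Rightarrow> ('s, 'm, 'a, 'b) tensor \<Rightarrow> bool" where
  "localic_ext_tensor S H T \<longleftrightarrow>
     tri_ext_tensor S H (Ar S) T (mten T) \<and> smooth_adjointable S H T (mten T)"


section \<open>External tensor cores\<close>

text \<open>Passing from \<open>m\<close> to \<open>mb\<close> by adjunction.\<close>

definition mbar_of :: "('s, 'm, 'x) base_cat_scheme \<Rightarrow> ('s, 'm, 'a, 'b, 'y) adj_fib_cat_scheme
    \<Rightarrow> ('s, 'a, 'b, 'z) box_scheme \<Rightarrow> ('m \<Rightarrow> 'm \<Rightarrow> 'a \<Rightarrow> 'a \<Rightarrow> 'b)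
    \<Rightarrow> 'm \<Rightarrow> 'm \<Rightarrow> 'a \<Rightarrow> 'a \<Rightarrow> 'b" where
  "mbar_of S H B m z1 z2 A1 A2 =
     (let Z1 = Dom S z1; Z2 = Dom S z2; S1 = Cod S z1; S2 = Cod S z2; z = prod_ar S z1 z2;
          D = Fib H (Pr S S1 S2) in
      lowa H z (bxa B Z1 Z2 (low_counit H z1 A1) (low_counit H z2 A2))
      \<cdot>\<^bsub>D\<^esub> lowa H z (inv_ar (Fib H (Pr S Z1 Z2)) (m z1 z2 (lowo H z1 A1) (lowo H z2 A2)))
      \<cdot>\<^bsub>D\<^esub> low_unit H z (bxo B S1 S2 (lowo H z1 A1) (lowo H z2 A2)))"

text \<open>Passing from \<open>mb\<close> to \<open>m\<close> by adjunction.\<close>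

definition mcl_of :: "('s, 'm, 'x) base_cat_scheme \<Rightarrow> ('s, 'm, 'a, 'b, 'y) adj_fib_cat_scheme
    \<Rightarrow> ('s, 'a, 'b, 'z) box_scheme \<Rightarrow> ('m \<Rightarrow> 'm \<Rightarrow> 'a \<Rightarrow> 'a \<Rightarrow> 'b)
    \<Rightarrow> 'm \<Rightarrow> 'm \<Rightarrow> 'a \<Rightarrow> 'a \<Rightarrow> 'b" where
  "mcl_of S H B mb z1 z2 A1 A2 =
     (let Z1 = Dom S z1; Z2 = Dom S z2; S1 = Cod S z1; S2 = Cod S z2; z = prod_ar S z1 z2;
          D = Fib H (Pr S Z1 Z2) in
      inv_ar D
       (low_counit H z (bxo B Z1 Z2 (pbo H z1 A1) (pbo H z2 A2))
        \<cdot>\<^bsub>D\<^esub> pba H z (mb z1 z2 (pbo H z1 A1) (pbo H z2 A2))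
        \<cdot>\<^bsub>D\<^esub> pba H z (bxa B S1 S2 (low_unit H z1 A1) (low_unit H z2 A2))))"

text \<open>Compatibility of \<open>ms\<close> and \<open>mb\<close> under the base-change isomorphisms.\<close>

definition core_base_change ::
  "('s, 'm, 'x) base_cat_scheme \<Rightarrow> ('s, 'm, 'a, 'b, 'y) adj_fib_cat_scheme
    \<Rightarrow> ('s, 'a, 'b, 'z) box_scheme \<Rightarrow> ('m \<Rightarrow> 'm \<Rightarrow> 'a \<Rightarrow> 'a \<Rightarrow> 'b)
    \<Rightarrow> ('m \<Rightarrow> 'm \<Rightarrow> 'a \<Rightarrow> 'a \<Rightarrow> 'b) \<Rightarrow> bool" where
  "core_base_change S H B ms mb \<longleftrightarrow>
     (\<forall>z1' p1' p1 z1 z2' p2' p2 z2.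
        cartesian S z1' p1' p1 z1 \<longrightarrow> cartesian S z2' p2' p2 z2 \<longrightarrow>
        p1 \<in> Sm S \<longrightarrow> p2 \<in> Sm S \<longrightarrow> z1 \<in> Cl S \<longrightarrow> z2 \<in> Cl S \<longrightarrow>
        (\<forall>A1\<in>Ob (Fib H (Dom S z1)). \<forall>A2\<in>Ob (Fib H (Dom S z2)).
          let P1 = Dom S p1; P2 = Dom S p2; D = Fib H (Pr S P1 P2);
              z = prod_ar S z1 z2; p = prod_ar S p1 p2;
              z' = prod_ar S z1' z2'; p' = prod_ar S p1' p2' in
          closed_bc S H z' p' p z (bxo B (Dom S z1) (Dom S z2) A1 A2)
            \<cdot>\<^bsub>D\<^esub> (pba H p (mb z1 z2 A1 A2) \<cdot>\<^bsub>D\<^esub> ms p1 p2 (lowo H z1 A1) (lowo H z2 A2)) =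
          (lowa H z' (ms p1' p2' A1 A2) \<cdot>\<^bsub>D\<^esub> mb z1' z2' (pbo H p1' A1) (pbo H p2' A2))
            \<cdot>\<^bsub>D\<^esub> bxa B P1 P2 (closed_bc S H z1' p1' p1 z1 A1) (closed_bc S H z2' p2' p2 z2 A2)))"

text \<open>Compatibility of \<open>ms\<close> and \<open>mb\<close> for the triangles \<open>q = p h\<close>.\<close>

definition core_triangles ::
  "('s, 'm, 'x) base_cat_scheme \<Rightarrow> ('s, 'm, 'a, 'b, 'y) adj_fib_cat_scheme
    \<Rightarrow> ('s, 'a, 'b, 'z) box_scheme \<Rightarrow> ('m \<Rightarrow> 'm \<Rightarrow> 'a \<Rightarrow> 'a \<Rightarrow> 'b)
    \<Rightarrow> ('m \<Rightarrow> 'm \<Rightarrow> 'a \<Rightarrow> 'a \<Rightarrow> 'b) \<Rightarrow> bool" where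
  "core_triangles S H B ms mb \<longleftrightarrow>
     (\<forall>p1\<in>Sm S. \<forall>p2\<in>Sm S. \<forall>q1\<in>Sm S. \<forall>q2\<in>Sm S. \<forall>h1\<in>Cl S. \<forall>h2\<in>Cl S.
        Cod S h1 = Dom S p1 \<longrightarrow> Cod S h2 = Dom S p2 \<longrightarrow>
        q1 = p1 \<cdot>\<^bsub>S\<^esub> h1 \<longrightarrow> q2 = p2 \<cdot>\<^bsub>S\<^esub> h2 \<longrightarrow>
        (\<forall>A1\<in>Ob (Fib H (Cod S p1)). \<forall>A2\<in>Ob (Fib H (Cod S p2)).
          let Q1 = Dom S h1; Q2 = Dom S h2; D = Fib H (Pr S Q1 Q2);
              h = prod_ar S h1 h2; p = prod_ar S p1 p2 in
          conn H h p (bxo B (Cod S p1) (Cod S p2) A1 A2) \<cdot>\<^bsub>D\<^esub> ms q1 q2 A1 A2 =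
          pba H h (ms p1 p2 A1 A2)
            \<cdot>\<^bsub>D\<^esub> mcl_of S H B mb h1 h2 (pbo H p1 A1) (pbo H p2 A2)
            \<cdot>\<^bsub>D\<^esub> bxa B Q1 Q2 (conn H h1 p1 A1) (conn H h2 p2 A2)))"

record ('s, 'm, 'a, 'b) tensor_core = "('s, 'a, 'b) box" +
  msm :: "'m \<Rightarrow> 'm \<Rightarrow> 'a \<Rightarrow> 'a \<Rightarrow> 'b"
  mbcl :: "'m \<Rightarrow> 'm \<Rightarrow> 'a \<Rightarrow> 'a \<Rightarrow> 'b"

text \<open>Smooth-adjointability of \<open>msm\<close> is made explicit. It involves the
  smooth morphisms only, and without it the composite inverted in \<open>mcl_of\<close> need not be an isomorphism.
  A core which lacks it cannot come from a localic external tensor structure, since \<open>core_of\<close>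
  leaves the smooth part unchanged.\<close>

definition ext_tensor_core ::
  "('s, 'm, 'x) base_cat_scheme \<Rightarrow> ('s, 'm, 'a, 'b, 'y) adj_fib_cat_scheme
    \<Rightarrow> ('s, 'm, 'a, 'b) tensor_core \<Rightarrow> bool" where
  "ext_tensor_core S H K \<longleftrightarrow>
     tri_ext_tensor S H (Sm S) K (msm K) \<and> smooth_adjointable S H K (msm K) \<and>
     tri_ext_tensor_cl_op S H K (mbcl K) \<and>
     core_base_change S H K (msm K) (mbcl K) \<and> core_triangles S H K (msm K) (mbcl K)"

text \<open>Only the values on smooth morphisms, respectively closed immersions, matter for a core:
  see \<open>same_core\<close>.\<close>

definition core_of :: "('s, 'm, 'x) base_cat_scheme \<Rightarrow> ('s, 'm, 'a, 'b, 'y) adj_fib_cat_scheme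
    \<Rightarrow> ('s, 'm, 'a, 'b) tensor \<Rightarrow> ('s, 'm, 'a, 'b) tensor_core" where
  "core_of S H T = \<lparr> bxo = bxo T, bxa = bxa T, bxl = bxl T, bxr = bxr T,
     msm = mten T, mbcl = mbar_of S H T (mten T) \<rparr>"

text \<open>Equality of structures: the functions of the records are compared where they are meaningful (HOL functions are total).\<close>

definition same_box :: "('s, 'm, 'x) base_cat_scheme \<Rightarrow> ('s, 'm, 'a, 'b, 'y) fib_cat_scheme
    \<Rightarrow> ('s, 'a, 'b, 'z) box_scheme \<Rightarrow> ('s, 'a, 'b, 'w) box_scheme \<Rightarrow> bool" where
  "same_box S H B B' \<longleftrightarrow> (\<forall>S1\<in>Ob S. \<forall>S2\<in>Ob S.
     (\<forall>A1\<in>Ob (Fib H S1). \<forall>A2\<in>Ob (Fib H S2).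
        bxo B S1 S2 A1 A2 = bxo B' S1 S2 A1 A2 \<and> bxl B S1 S2 A1 A2 = bxl B' S1 S2 A1 A2 \<and>
        bxr B S1 S2 A1 A2 = bxr B' S1 S2 A1 A2) \<and>
     (\<forall>\<phi>1\<in>Ar (Fib H S1). \<forall>\<phi>2\<in>Ar (Fib H S2). bxa B S1 S2 \<phi>1 \<phi>2 = bxa B' S1 S2 \<phi>1 \<phi>2))"

definition same_tensor :: "('s, 'm, 'x) base_cat_scheme \<Rightarrow> ('s, 'm, 'a, 'b, 'y) fib_cat_scheme
    \<Rightarrow> ('s, 'm, 'a, 'b) tensor \<Rightarrow> ('s, 'm, 'a, 'b) tensor \<Rightarrow> bool" where
  "same_tensor S H T T' \<longleftrightarrow> same_box S H T T' \<and>
     (\<forall>f1\<in>Ar S. \<forall>f2\<in>Ar S. \<forall>A1\<in>Ob (Fib H (Cod S f1)). \<forall>A2\<in>Ob (Fib H (Cod S f2)).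
        mten T f1 f2 A1 A2 = mten T' f1 f2 A1 A2)"

definition same_core :: "('s, 'm, 'x) base_cat_scheme \<Rightarrow> ('s, 'm, 'a, 'b, 'y) fib_cat_scheme
    \<Rightarrow> ('s, 'm, 'a, 'b) tensor_core \<Rightarrow> ('s, 'm, 'a, 'b) tensor_core \<Rightarrow> bool" where
  "same_core S H K K' \<longleftrightarrow> same_box S H K K' \<and>
     (\<forall>p1\<in>Sm S. \<forall>p2\<in>Sm S. \<forall>A1\<in>Ob (Fib H (Cod S p1)). \<forall>A2\<in>Ob (Fib H (Cod S p2)).
        msm K p1 p2 A1 A2 = msm K' p1 p2 A1 A2) \<and>
     (\<forall>z1\<in>Cl S. \<forall>z2\<in>Cl S. \<forall>A1\<in>Ob (Fib H (Dom S z1)). \<forall>A2\<in>Ob (Fib H (Dom S z2)).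
        mbcl K z1 z2 A1 A2 = mbcl K' z1 z2 A1 A2)"

end

theory Submission
  imports Defs
begin

text \<open>
  All the data live over pairs. Write \<open>X = S \<times> S\<close> for the category of pairs of base objects. Over \<open>X\<close> there
  are two fibered categories, with fibres \<open>H(S1) \<times> H(S2)\<close> and \<open>H(S1 \<times> S2)\<close>, and \<open>\<boxtimes>\<close> is a functor \<open>F\<close> from
  the first to the second on each fibre. For an arrow \<open>f\<close> of \<open>X\<close> let \<open>N f\<close> be the set of natural
  transformations \<open>F f\<^sup>* \<rightarrow> f\<^sup>* F\<close>. A family over \<open>f\<close> and a family over \<open>g\<close> compose to a family over \<open>g f\<close>, and
  this composition is associative (\<open>star_assoc\<close>) by the cocycle condition of the connection isomorphisms:
  the sets \<open>N f\<close> are the arrows over \<open>f\<close> of a category over \<open>X\<close>. An external tensor structure is a section of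
  this category over \<open>X\<close>. The theorem is thus about extending a section given on the smooth and on the
  closed arrows to all arrows.

  This extension problem is solved formally, in \<open>two_sections\<close>. The value at \<open>f = p t\<close> must be the composite
  of the values at \<open>t\<close> and \<open>p\<close>, which gives uniqueness. That the composite does not depend on the
  factorization, and that it is compatible with composition, follows by forming fibre products of smooth
  arrows: the exchange law for cartesian squares moves a closed arrow past a smooth one, and the
  triangle condition \<open>q = p h\<close> absorbs the closed arrow \<open>h\<close> between two smooth ones.

  It remains to translate a core into such a pair of sections. On closed immersions a core has
  \<open>z\<^sub>*A1 \<boxtimes> z\<^sub>*A2 \<rightarrow> z\<^sub>*(A1 \<boxtimes> A2)\<close> instead of a comparison with \<open>z\<^sup>*\<close>. The two kinds of transformation are
  mates, which is expressed by one symmetric equation (\<open>mate_at\<close>). Taking transposes, the composition law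
  for one is equivalent to the composition law for the other (\<open>mate_composition\<close>). The base-change condition and
  the compatibility with shifts are both instances of a square of functors that commutes with \<open>F\<close> and with the
  adjunctions, and they are translated by \<open>low_exchange_iff\<close> and \<open>exchange_of_low\<close>.

  Passing from one kind to the other requires that the mate of an isomorphism is an isomorphism, and this
  is where the localic hypotheses enter. By composition one of the two closed immersions may be taken to
  be an identity (\<open>elementary_factorization\<close>). Let \<open>u\<close> be the open immersion complementary to \<open>z\<close>. From
  comparisons with \<open>z\<^sup>*\<close> one obtains an arrow into an object of the form \<open>z\<^sub>*B\<close> that is invertible after
  \<open>z\<^sup>*\<close>; after \<open>u\<^sup>*\<close> both of its sides vanish, since \<open>u\<^sup>* z\<^sub>* = 0\<close> by base change and \<open>\<boxtimes>\<close> commutes with \<open>u\<^sup>*\<close>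
  (\<open>elementary_low_Iso\<close>). In the other direction, what has to be inverted is \<open>z\<^sup>*\<close> applied to \<open>\<eta> \<boxtimes> A2\<close> for
  the unit \<open>\<eta> : A1 \<rightarrow> z\<^sub>* z\<^sup>* A1\<close>. The cone of \<open>\<eta>\<close> is of the form \<open>u\<^sub># D\<close>, and by smooth adjointability \<open>\<boxtimes>\<close>
  carries it to an object of the form \<open>(u \<times> T)\<^sub># D'\<close>, which is killed by \<open>(z \<times> T)\<^sup>*\<close>
  (\<open>elementary_minvP_Iso\<close>).
\<close>

section \<open>Arrows, functors and transformations\<close>

context category
begin

lemma Cmp_Ar [simp]: "f \<in> Ar C \<Longrightarrow> g \<in> Ar C \<Longrightarrow> Cod C f = Dom C g \<Longrightarrow> g \<cdot>\<^bsub>C\<^esub> f \<in> Ar C"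
  and Dom_Cmp [simp]: "f \<in> Ar C \<Longrightarrow> g \<in> Ar C \<Longrightarrow> Cod C f = Dom C g \<Longrightarrow> Dom C (g \<cdot>\<^bsub>C\<^esub> f) = Dom C f"
  and Cod_Cmp [simp]: "f \<in> Ar C \<Longrightarrow> g \<in> Ar C \<Longrightarrow> Cod C f = Dom C g \<Longrightarrow> Cod C (g \<cdot>\<^bsub>C\<^esub> f) = Cod C g"
  using Cmp_Hom[of f "Dom C f" "Cod C f" g "Cod C g"] by (auto simp: Hom_def)

lemma Idn_Ar [simp]: "a \<in> Ob C \<Longrightarrow> Idn C a \<in> Ar C"
  and Dom_Idn [simp]: "a \<in> Ob C \<Longrightarrow> Dom C (Idn C a) = a"
  and Cod_Idn [simp]: "a \<in> Ob C \<Longrightarrow> Cod C (Idn C a) = a"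
  using Idn_Hom[of a] by (auto simp: Hom_def)

lemma Cmp_Idn [simp]: "f \<in> Ar C \<Longrightarrow> a = Dom C f \<Longrightarrow> f \<cdot>\<^bsub>C\<^esub> Idn C a = f"
  and Idn_Cmp [simp]: "f \<in> Ar C \<Longrightarrow> a = Cod C f \<Longrightarrow> Idn C a \<cdot>\<^bsub>C\<^esub> f = f"
  using Idn_right[of f "Dom C f" "Cod C f"] Idn_left[of f "Dom C f" "Cod C f"] by (auto simp: Hom_def)

lemma assoc [simp]: "f \<in> Ar C \<Longrightarrow> g \<in> Ar C \<Longrightarrow> h \<in> Ar C \<Longrightarrow> Cod C f = Dom C g \<Longrightarrow> Cod C g = Dom C h
    \<Longrightarrow> (h \<cdot>\<^bsub>C\<^esub> g) \<cdot>\<^bsub>C\<^esub> f = h \<cdot>\<^bsub>C\<^esub> (g \<cdot>\<^bsub>C\<^esub> f)"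
  using Cmp_assoc[of f "Dom C f" "Cod C f" g "Cod C g" h "Cod C h"] by (auto simp: Hom_def)

declare Dom_Ob [simp] Cod_Ob [simp]

text \<open>Composites are kept nested to the right; an equation between two composites is then used inside a longer
  one in this form.\<close>

lemma precompose:
  assumes "g \<cdot>\<^bsub>C\<^esub> f = x" "f \<in> Ar C" "g \<in> Ar C" "Cod C f = Dom C g" "k \<in> Ar C" "Cod C k = Dom C f"
  shows "g \<cdot>\<^bsub>C\<^esub> f \<cdot>\<^bsub>C\<^esub> k = x \<cdot>\<^bsub>C\<^esub> k"
  using assms by (metis assoc)

lemma inverse_arrowsI:
  "f \<in> Ar C \<Longrightarrow> g \<in> Ar C \<Longrightarrow> Dom C g = Cod C f \<Longrightarrow> Cod C g = Dom C f \<Longrightarrow>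
    g \<cdot>\<^bsub>C\<^esub> f = Idn C (Dom C f) \<Longrightarrow> f \<cdot>\<^bsub>C\<^esub> g = Idn C (Cod C f) \<Longrightarrow> inverse_arrows C f g"
  by (simp add: inverse_arrows_def Hom_def)

lemma inverse_arrows_unique: "inverse_arrows C f g \<Longrightarrow> inverse_arrows C f h \<Longrightarrow> g = h"
  unfolding inverse_arrows_def Hom_def
  by (smt (verit, ccfv_threshold) Cmp_Idn Idn_Cmp assoc mem_Collect_eq)

lemma inv_ar_eq: "inverse_arrows C f g \<Longrightarrow> inv_ar C f = g"
  unfolding inv_ar_def using inverse_arrows_unique by blast

lemma Iso_inverse: "f \<in> Iso C \<Longrightarrow> inverse_arrows C f (inv_ar C f)"
  unfolding Iso_def using inv_ar_eq by auto

lemma inverse_arrows_Iso: "inverse_arrows C f g \<Longrightarrow> f \<in> Iso C"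
  by (auto simp: Iso_def)

lemma inverse_arrows_sym: "inverse_arrows C f g \<Longrightarrow> inverse_arrows C g f"
  by (auto simp: inverse_arrows_def Hom_def)

lemma Iso_Ar: "f \<in> Iso C \<Longrightarrow> f \<in> Ar C"
  by (auto simp: Iso_def inverse_arrows_def)

lemma inv_ar_Ar [simp]: "f \<in> Iso C \<Longrightarrow> inv_ar C f \<in> Ar C"
  and Dom_inv_ar [simp]: "f \<in> Iso C \<Longrightarrow> Dom C (inv_ar C f) = Cod C f"
  and Cod_inv_ar [simp]: "f \<in> Iso C \<Longrightarrow> Cod C (inv_ar C f) = Dom C f"
  and inv_ar_Cmp [simp]: "f \<in> Iso C \<Longrightarrow> inv_ar C f \<cdot>\<^bsub>C\<^esub> f = Idn C (Dom C f)"
  and Cmp_inv_ar [simp]: "f \<in> Iso C \<Longrightarrow> f \<cdot>\<^bsub>C\<^esub> inv_ar C f = Idn C (Cod C f)"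
  and inv_ar_Iso [simp]: "f \<in> Iso C \<Longrightarrow> inv_ar C f \<in> Iso C"
  using Iso_inverse[of f] inverse_arrows_sym inverse_arrows_Iso
  by (auto simp: inverse_arrows_def Hom_def)

lemma inv_ar_Cmp2 [simp]: "f \<in> Iso C \<Longrightarrow> k \<in> Ar C \<Longrightarrow> Cod C k = Dom C f \<Longrightarrow> inv_ar C f \<cdot>\<^bsub>C\<^esub> f \<cdot>\<^bsub>C\<^esub> k = k"
  and Cmp_inv_ar2 [simp]: "f \<in> Iso C \<Longrightarrow> k \<in> Ar C \<Longrightarrow> Cod C k = Cod C f \<Longrightarrow> f \<cdot>\<^bsub>C\<^esub> inv_ar C f \<cdot>\<^bsub>C\<^esub> k = k"
  using precompose[of "inv_ar C f" f _ k] precompose[of f "inv_ar C f" _ k] by (auto simp: Iso_Ar)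

lemma Iso_Cmp [simp]:
  assumes "f \<in> Iso C" "g \<in> Iso C" "Cod C f = Dom C g" shows "g \<cdot>\<^bsub>C\<^esub> f \<in> Iso C"
  using assms
  by (intro inverse_arrows_Iso[OF inverse_arrowsI[where g = "inv_ar C f \<cdot>\<^bsub>C\<^esub> inv_ar C g"]]) (simp_all add: Iso_Ar)

lemma Idn_Iso [simp]: "a \<in> Ob C \<Longrightarrow> Idn C a \<in> Iso C"
  by (intro inverse_arrows_Iso[OF inverse_arrowsI[where g = "Idn C a"]]) simp_all

lemma Iso_cancel_left:
  assumes "g \<in> Iso C" "f \<in> Ar C" "f' \<in> Ar C" "Cod C f = Dom C g" "Cod C f' = Dom C g"
    and "g \<cdot>\<^bsub>C\<^esub> f = g \<cdot>\<^bsub>C\<^esub> f'"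
  shows "f = f'"
  using assms inv_ar_Cmp2 by metis

lemma Iso_cancel_right:
  assumes "g \<in> Iso C" "f \<in> Ar C" "f' \<in> Ar C" "Dom C f = Cod C g" "Dom C f' = Cod C g"
    and "f \<cdot>\<^bsub>C\<^esub> g = f' \<cdot>\<^bsub>C\<^esub> g"
  shows "f = f'"
  using assms Cmp_inv_ar Cmp_Idn Iso_Ar assoc inv_ar_Ar Cod_inv_ar by metis

lemma Iso_left_factor:
  assumes "f \<in> Iso C" "g \<in> Ar C" "Cod C f = Dom C g" "g \<cdot>\<^bsub>C\<^esub> f \<in> Iso C" shows "g \<in> Iso C"
proof -
  have "(g \<cdot>\<^bsub>C\<^esub> f) \<cdot>\<^bsub>C\<^esub> inv_ar C f = g" using assms by (simp add: Iso_Ar)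
  moreover have "(g \<cdot>\<^bsub>C\<^esub> f) \<cdot>\<^bsub>C\<^esub> inv_ar C f \<in> Iso C"
    by (rule Iso_Cmp[of "inv_ar C f" "g \<cdot>\<^bsub>C\<^esub> f"]) (use assms in \<open>simp_all add: Iso_Ar\<close>)
  ultimately show ?thesis by metis
qed

lemma Iso_right_factor:
  assumes "g \<in> Iso C" "f \<in> Ar C" "Cod C f = Dom C g" "g \<cdot>\<^bsub>C\<^esub> f \<in> Iso C" shows "f \<in> Iso C"
proof -
  have "inv_ar C g \<cdot>\<^bsub>C\<^esub> (g \<cdot>\<^bsub>C\<^esub> f) = f" using assms by (simp add: Iso_Ar)
  moreover have "inv_ar C g \<cdot>\<^bsub>C\<^esub> (g \<cdot>\<^bsub>C\<^esub> f) \<in> Iso C"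
    by (rule Iso_Cmp[of "g \<cdot>\<^bsub>C\<^esub> f" "inv_ar C g"]) (use assms in \<open>simp_all add: Iso_Ar\<close>)
  ultimately show ?thesis by metis
qed

lemma Iso_of_right_inverse:
  assumes "g \<in> Iso C" "f \<in> Ar C" "Cod C f = Dom C g" "Dom C f = Cod C g" "g \<cdot>\<^bsub>C\<^esub> f = Idn C (Cod C g)"
  shows "inv_ar C g = f"
  using assms by (metis Cod_inv_ar Dom_inv_ar Cmp_inv_ar inv_ar_Ar Iso_cancel_left)

end

locale functor_on = C: category C + D: category D
  for C :: "('o, 'm, 'x) cat_scheme" and D :: "('p, 'n, 'y) cat_scheme" +
  fixes Fo :: "'o \<Rightarrow> 'p" and Fa :: "'m \<Rightarrow> 'n"
  assumes is_functor: "is_functor C D Fo Fa"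
begin

lemma obj [simp]: "a \<in> Ob C \<Longrightarrow> Fo a \<in> Ob D"
  and idn [simp]: "a \<in> Ob C \<Longrightarrow> Fa (Idn C a) = Idn D (Fo a)"
  and arr [simp]: "f \<in> Ar C \<Longrightarrow> Fa f \<in> Ar D"
  and dom [simp]: "f \<in> Ar C \<Longrightarrow> Dom D (Fa f) = Fo (Dom C f)"
  and cod [simp]: "f \<in> Ar C \<Longrightarrow> Cod D (Fa f) = Fo (Cod C f)"
  and cmp: "f \<in> Ar C \<Longrightarrow> g \<in> Ar C \<Longrightarrow> Cod C f = Dom C g \<Longrightarrow> Fa (g \<cdot>\<^bsub>C\<^esub> f) = Fa g \<cdot>\<^bsub>D\<^esub> Fa f"
  using is_functor by (auto simp: is_functor_def Hom_def)

lemma inverse_arrows: "inverse_arrows C f g \<Longrightarrow> inverse_arrows D (Fa f) (Fa g)"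
  unfolding inverse_arrows_def Hom_def
  by (auto simp: C.Dom_Ob C.Cod_Ob cmp[symmetric])

lemma iso [simp]: "f \<in> Iso C \<Longrightarrow> Fa f \<in> Iso D"
  using inverse_arrows C.Iso_inverse D.inverse_arrows_Iso by blast

lemma inv_ar: "f \<in> Iso C \<Longrightarrow> Fa (inv_ar C f) = inv_ar D (Fa f)"
  using inverse_arrows C.Iso_inverse D.inv_ar_eq by metis

lemma full:
  assumes "fully_faithful C D Fo Fa" "a \<in> Ob C" "b \<in> Ob C" "h \<in> Ar D" "Dom D h = Fo a" "Cod D h = Fo b"
  obtains g where "g \<in> Ar C" "Dom C g = a" "Cod C g = b" "Fa g = h"
proof -
  have "Fa ` Hom C a b = Hom D (Fo a) (Fo b)"
    using assms(1-3) unfolding fully_faithful_def by (intro bij_betw_imp_surj_on) blast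
  moreover have "h \<in> Hom D (Fo a) (Fo b)" using assms by (simp add: Hom_def)
  ultimately have "h \<in> Fa ` Hom C a b" by simp
  then show ?thesis using that by (auto simp: Hom_def)
qed

lemma faithful:
  assumes "fully_faithful C D Fo Fa" "g \<in> Ar C" "h \<in> Ar C" "Dom C g = Dom C h" "Cod C g = Cod C h" "Fa g = Fa h"
  shows "g = h"
proof -
  have "inj_on Fa (Hom C (Dom C g) (Cod C g))"
    using assms(1,2) C.Dom_Ob C.Cod_Ob unfolding fully_faithful_def by (intro bij_betw_imp_inj_on) blast
  then show ?thesis using assms by (auto simp: inj_on_def Hom_def)
qed

lemma reflects_iso:
  assumes ff: "fully_faithful C D Fo Fa" and f: "f \<in> Ar C" "Fa f \<in> Iso D"
  shows "f \<in> Iso C"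
proof -
  obtain g where g: "g \<in> Ar C" "Dom C g = Cod C f" "Cod C g = Dom C f" "Fa g = inv_ar D (Fa f)"
    using full[OF ff, of "Cod C f" "Dom C f" "inv_ar D (Fa f)"] f by auto
  have "g \<cdot>\<^bsub>C\<^esub> f = Idn C (Dom C f)" "f \<cdot>\<^bsub>C\<^esub> g = Idn C (Cod C f)"
    by (rule faithful[OF ff]; use f g in \<open>simp add: cmp\<close>)+
  then show ?thesis using C.inverse_arrowsI C.inverse_arrows_Iso f g by metis
qed

end

lemma (in category) identity_functor: "functor_on C C id id"
  by unfold_locales (auto simp: is_functor_def Hom_def)

locale adj = L: functor_on C D Lo La + R: functor_on D C Ro Ra
  for C :: "('o, 'm, 'x) cat_scheme" and D :: "('p, 'n, 'y) cat_scheme" and Lo La Ro Ra +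
  fixes \<eta> :: "'o \<Rightarrow> 'm" and \<epsilon> :: "'p \<Rightarrow> 'n"
  assumes adjunction: "adjunction C D Lo La Ro Ra \<eta> \<epsilon>"
begin

lemma unit_arr [simp]: "a \<in> Ob C \<Longrightarrow> \<eta> a \<in> Ar C"
  and unit_dom [simp]: "a \<in> Ob C \<Longrightarrow> Dom C (\<eta> a) = a"
  and unit_cod [simp]: "a \<in> Ob C \<Longrightarrow> Cod C (\<eta> a) = Ro (Lo a)"
  and counit_arr [simp]: "b \<in> Ob D \<Longrightarrow> \<epsilon> b \<in> Ar D"
  and counit_dom [simp]: "b \<in> Ob D \<Longrightarrow> Dom D (\<epsilon> b) = Lo (Ro b)"
  and counit_cod [simp]: "b \<in> Ob D \<Longrightarrow> Cod D (\<epsilon> b) = b"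
  and unit_nat: "f \<in> Ar C \<Longrightarrow> Dom C f = a \<Longrightarrow> Cod C f = a' \<Longrightarrow> Ra (La f) \<cdot>\<^bsub>C\<^esub> \<eta> a = \<eta> a' \<cdot>\<^bsub>C\<^esub> f"
  and counit_nat: "g \<in> Ar D \<Longrightarrow> Dom D g = c \<Longrightarrow> Cod D g = d \<Longrightarrow> g \<cdot>\<^bsub>D\<^esub> \<epsilon> c = \<epsilon> d \<cdot>\<^bsub>D\<^esub> La (Ra g)"
  and triangle_L [simp]: "a \<in> Ob C \<Longrightarrow> \<epsilon> (Lo a) \<cdot>\<^bsub>D\<^esub> La (\<eta> a) = Idn D (Lo a)"
  and triangle_R [simp]: "b \<in> Ob D \<Longrightarrow> Ra (\<epsilon> b) \<cdot>\<^bsub>C\<^esub> \<eta> (Ro b) = Idn C (Ro b)"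
  using adjunction by (auto simp: adjunction_def is_nat_def Hom_def)

lemma counit_nat2: "g \<in> Ar D \<Longrightarrow> Dom D g = c \<Longrightarrow> Cod D g = d \<Longrightarrow> k \<in> Ar D \<Longrightarrow> Cod D k = Lo (Ro c) \<Longrightarrow>
    \<epsilon> d \<cdot>\<^bsub>D\<^esub> La (Ra g) \<cdot>\<^bsub>D\<^esub> k = g \<cdot>\<^bsub>D\<^esub> \<epsilon> c \<cdot>\<^bsub>D\<^esub> k"
  using L.D.precompose[OF counit_nat[symmetric]] by (auto)

lemma triangle_R2 [simp]: "b \<in> Ob D \<Longrightarrow> k \<in> Ar C \<Longrightarrow> Cod C k = Ro b \<Longrightarrow> Ra (\<epsilon> b) \<cdot>\<^bsub>C\<^esub> \<eta> (Ro b) \<cdot>\<^bsub>C\<^esub> k = k"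
  using L.C.precompose[OF triangle_R, of b k] by simp

text \<open>The transposition \<open>x \<mapsto> \<epsilon> \<cdot> L x\<close> is injective on the arrows into \<open>R b\<close>, since it has this inverse. Equations
  between arrows into some \<open>z\<^sub>*B\<close> are proved below by comparing transposes.\<close>

lemma transpose_inverse:
  assumes "x \<in> Ar C" "Cod C x = Ro b" "b \<in> Ob D"
  shows "Ra (\<epsilon> b \<cdot>\<^bsub>D\<^esub> La x) \<cdot>\<^bsub>C\<^esub> \<eta> (Dom C x) = x"
proof -
  have "Ra (\<epsilon> b \<cdot>\<^bsub>D\<^esub> La x) \<cdot>\<^bsub>C\<^esub> \<eta> (Dom C x) = Ra (\<epsilon> b) \<cdot>\<^bsub>C\<^esub> (Ra (La x) \<cdot>\<^bsub>C\<^esub> \<eta> (Dom C x))"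
    using assms by (simp add: R.cmp)
  also have "\<dots> = (Ra (\<epsilon> b) \<cdot>\<^bsub>C\<^esub> \<eta> (Ro b)) \<cdot>\<^bsub>C\<^esub> x"
    using assms by (simp add: unit_nat[of x "Dom C x" "Ro b"])
  finally show ?thesis using assms by simp
qed

lemma transpose_inj:
  assumes "x \<in> Ar C" "y \<in> Ar C" "Dom C x = Dom C y" "Cod C x = Ro b" "Cod C y = Ro b" "b \<in> Ob D"
    and "\<epsilon> b \<cdot>\<^bsub>D\<^esub> La x = \<epsilon> b \<cdot>\<^bsub>D\<^esub> La y"
  shows "x = y"
  using assms transpose_inverse by metis

lemma transpose:
  assumes "g \<in> Ar D" "Dom D g = Lo a" "a \<in> Ob C"
  shows "\<epsilon> (Cod D g) \<cdot>\<^bsub>D\<^esub> La (Ra g \<cdot>\<^bsub>C\<^esub> \<eta> a) = g"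
proof -
  have "\<epsilon> (Cod D g) \<cdot>\<^bsub>D\<^esub> La (Ra g \<cdot>\<^bsub>C\<^esub> \<eta> a) = \<epsilon> (Cod D g) \<cdot>\<^bsub>D\<^esub> La (Ra g) \<cdot>\<^bsub>D\<^esub> La (\<eta> a)"
    using assms by (simp add: L.cmp)
  also have "\<dots> = g \<cdot>\<^bsub>D\<^esub> \<epsilon> (Lo a) \<cdot>\<^bsub>D\<^esub> La (\<eta> a)"
    using assms by (intro counit_nat2) simp_all
  finally show ?thesis using assms by simp
qed

lemma transpose_inj_left:
  assumes "x \<in> Ar D" "y \<in> Ar D" "Cod D x = Cod D y" "Dom D x = Lo a" "Dom D y = Lo a" "a \<in> Ob C"
    and "Ra x \<cdot>\<^bsub>C\<^esub> \<eta> a = Ra y \<cdot>\<^bsub>C\<^esub> \<eta> a"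
  shows "x = y"
  using assms transpose by metis

lemma counit_iso:
  assumes ff: "fully_faithful D C Ro Ra" and b: "b \<in> Ob D" shows "\<epsilon> b \<in> Iso D"
proof -
  obtain g where g: "g \<in> Ar D" "Dom D g = b" "Cod D g = Lo (Ro b)" "Ra g = \<eta> (Ro b)"
    using R.full[OF ff, of b "Lo (Ro b)" "\<eta> (Ro b)"] b by auto
  have 1: "\<epsilon> b \<cdot>\<^bsub>D\<^esub> g = Idn D b"
    by (rule R.faithful[OF ff]) (use b g in \<open>simp_all add: R.cmp\<close>)
  have "g \<cdot>\<^bsub>D\<^esub> \<epsilon> b = \<epsilon> (Lo (Ro b)) \<cdot>\<^bsub>D\<^esub> La (\<eta> (Ro b))"
    using counit_nat[of g b "Lo (Ro b)"] b g by simp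
  then have 2: "g \<cdot>\<^bsub>D\<^esub> \<epsilon> b = Idn D (Lo (Ro b))" using b by simp
  show ?thesis
    by (intro L.D.inverse_arrows_Iso[OF L.D.inverse_arrowsI[where g = g]]) (use b g 1 2 in simp_all)
qed

end

lemma is_natD:
  assumes "is_nat C D Fo Fa Go Ga \<tau>"
  shows "a \<in> Ob C \<Longrightarrow> \<tau> a \<in> Ar D" "a \<in> Ob C \<Longrightarrow> Dom D (\<tau> a) = Fo a" "a \<in> Ob C \<Longrightarrow> Cod D (\<tau> a) = Go a"
    and "f \<in> Ar C \<Longrightarrow> Ga f \<cdot>\<^bsub>D\<^esub> \<tau> (Dom C f) = \<tau> (Cod C f) \<cdot>\<^bsub>D\<^esub> Fa f"
  using assms by (auto simp: is_nat_def Hom_def)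

lemma is_natI:
  assumes "\<And>a. a \<in> Ob C \<Longrightarrow> \<tau> a \<in> Ar D" "\<And>a. a \<in> Ob C \<Longrightarrow> Dom D (\<tau> a) = Fo a" "\<And>a. a \<in> Ob C \<Longrightarrow> Cod D (\<tau> a) = Go a"
    and "\<And>f. f \<in> Ar C \<Longrightarrow> Ga f \<cdot>\<^bsub>D\<^esub> \<tau> (Dom C f) = \<tau> (Cod C f) \<cdot>\<^bsub>D\<^esub> Fa f"
  shows "is_nat C D Fo Fa Go Ga \<tau>"
  using assms by (auto simp: is_nat_def Hom_def)

section \<open>Cartesian squares\<close>

context category
begin

lemma cartesianD:
  assumes "cartesian C a b f g"
  shows "a \<in> Ar C" "b \<in> Ar C" "f \<in> Ar C" "g \<in> Ar C" "Dom C b = Dom C a" "Cod C a = Dom C f" "Cod C b = Dom C g"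
    "Cod C g = Cod C f" "f \<cdot>\<^bsub>C\<^esub> a = g \<cdot>\<^bsub>C\<^esub> b"
  using assms by (auto simp: cartesian_def)

lemma cartesian_lift:
  assumes c: "cartesian C a b f g" and "x \<in> Ar C" "y \<in> Ar C" "Dom C x = Dom C y" "Cod C x = Dom C f" "Cod C y = Dom C g"
    "f \<cdot>\<^bsub>C\<^esub> x = g \<cdot>\<^bsub>C\<^esub> y"
  shows "\<exists>!h. h \<in> Ar C \<and> Dom C h = Dom C x \<and> Cod C h = Dom C a \<and> a \<cdot>\<^bsub>C\<^esub> h = x \<and> b \<cdot>\<^bsub>C\<^esub> h = y"
proof -
  have "\<forall>T\<in>Ob C. \<forall>x\<in>Hom C T (Dom C f). \<forall>y\<in>Hom C T (Dom C g). f \<cdot>\<^bsub>C\<^esub> x = g \<cdot>\<^bsub>C\<^esub> y \<longrightarrow>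
        (\<exists>!h. h \<in> Hom C T (Dom C a) \<and> a \<cdot>\<^bsub>C\<^esub> h = x \<and> b \<cdot>\<^bsub>C\<^esub> h = y)"
    using c unfolding cartesian_def by (elim conjE)
  moreover have "x \<in> Hom C (Dom C x) (Dom C f)" "y \<in> Hom C (Dom C x) (Dom C g)" "Dom C x \<in> Ob C"
    using assms by (auto simp: Hom_def)
  ultimately have "\<exists>!h. h \<in> Hom C (Dom C x) (Dom C a) \<and> a \<cdot>\<^bsub>C\<^esub> h = x \<and> b \<cdot>\<^bsub>C\<^esub> h = y"
    using assms(7) by blast
  then show ?thesis by (simp add: Hom_def conj_assoc)
qed

lemma cartesian_factor:
  assumes "cartesian C a b f g" "x \<in> Ar C" "y \<in> Ar C" "Dom C x = Dom C y" "Cod C x = Dom C f" "Cod C y = Dom C g"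
    "f \<cdot>\<^bsub>C\<^esub> x = g \<cdot>\<^bsub>C\<^esub> y" "t = Dom C x" "w = Dom C a"
  shows "\<exists>h. h \<in> Ar C \<and> Dom C h = t \<and> Cod C h = w \<and> a \<cdot>\<^bsub>C\<^esub> h = x \<and> b \<cdot>\<^bsub>C\<^esub> h = y"
  unfolding assms(8,9) by (rule ex1_implies_ex[OF cartesian_lift[OF assms(1-7)]])

lemma cartesian_eq:
  assumes c: "cartesian C a b f g" and h: "h \<in> Ar C" "h' \<in> Ar C" "Dom C h = Dom C h'" "Cod C h = Dom C a" "Cod C h' = Dom C a"
    "a \<cdot>\<^bsub>C\<^esub> h = a \<cdot>\<^bsub>C\<^esub> h'" "b \<cdot>\<^bsub>C\<^esub> h = b \<cdot>\<^bsub>C\<^esub> h'"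
  shows "h = h'"
proof -
  note D = cartesianD[OF c]
  have "f \<cdot>\<^bsub>C\<^esub> (a \<cdot>\<^bsub>C\<^esub> h) = (f \<cdot>\<^bsub>C\<^esub> a) \<cdot>\<^bsub>C\<^esub> h" using D(1-8) h(1-5) by simp
  also have "\<dots> = g \<cdot>\<^bsub>C\<^esub> (b \<cdot>\<^bsub>C\<^esub> h)" unfolding D(9) using D(1-8) h(1-5) by simp
  finally have "\<exists>!k. k \<in> Ar C \<and> Dom C k = Dom C (a \<cdot>\<^bsub>C\<^esub> h) \<and> Cod C k = Dom C a \<and> a \<cdot>\<^bsub>C\<^esub> k = a \<cdot>\<^bsub>C\<^esub> h \<and> b \<cdot>\<^bsub>C\<^esub> k = b \<cdot>\<^bsub>C\<^esub> h"
    by (intro cartesian_lift[OF c]) (use D(1-8) h(1-5) in simp_all)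
  moreover have "Dom C (a \<cdot>\<^bsub>C\<^esub> h) = Dom C h" using D(1) h(1,4) by simp
  ultimately have "\<exists>!k. k \<in> Ar C \<and> Dom C k = Dom C h \<and> Cod C k = Dom C a \<and> a \<cdot>\<^bsub>C\<^esub> k = a \<cdot>\<^bsub>C\<^esub> h \<and> b \<cdot>\<^bsub>C\<^esub> k = b \<cdot>\<^bsub>C\<^esub> h"
    by simp
  then show ?thesis using h by (elim ex1E) metis
qed

lemma cartesianI:
  assumes "a \<in> Ar C" "b \<in> Ar C" "f \<in> Ar C" "g \<in> Ar C" "Dom C b = Dom C a" "Cod C a = Dom C f" "Cod C b = Dom C g"
    "Cod C g = Cod C f" "f \<cdot>\<^bsub>C\<^esub> a = g \<cdot>\<^bsub>C\<^esub> b"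
    and "\<And>x y. x \<in> Ar C \<Longrightarrow> y \<in> Ar C \<Longrightarrow> Dom C x = Dom C y \<Longrightarrow> Cod C x = Dom C f \<Longrightarrow> Cod C y = Dom C g \<Longrightarrow>
      f \<cdot>\<^bsub>C\<^esub> x = g \<cdot>\<^bsub>C\<^esub> y \<Longrightarrow> \<exists>h. h \<in> Ar C \<and> Dom C h = Dom C x \<and> Cod C h = Dom C a \<and> a \<cdot>\<^bsub>C\<^esub> h = x \<and> b \<cdot>\<^bsub>C\<^esub> h = y"
    and "\<And>h h'. h \<in> Ar C \<Longrightarrow> h' \<in> Ar C \<Longrightarrow> Dom C h = Dom C h' \<Longrightarrow> Cod C h = Dom C a \<Longrightarrow> Cod C h' = Dom C a \<Longrightarrow>
      a \<cdot>\<^bsub>C\<^esub> h = a \<cdot>\<^bsub>C\<^esub> h' \<Longrightarrow> b \<cdot>\<^bsub>C\<^esub> h = b \<cdot>\<^bsub>C\<^esub> h' \<Longrightarrow> h = h'"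
  shows "cartesian C a b f g"
  unfolding cartesian_def
proof (intro conjI ballI impI)
  fix T x y assume "T \<in> Ob C" and x: "x \<in> Hom C T (Dom C f)" and y: "y \<in> Hom C T (Dom C g)" and eq: "f \<cdot>\<^bsub>C\<^esub> x = g \<cdot>\<^bsub>C\<^esub> y"
  obtain h where h: "h \<in> Ar C" "Dom C h = T" "Cod C h = Dom C a" "a \<cdot>\<^bsub>C\<^esub> h = x" "b \<cdot>\<^bsub>C\<^esub> h = y"
    using assms(10)[of x y] x y eq by (auto simp: Hom_def)
  show "\<exists>!h. h \<in> Hom C T (Dom C a) \<and> a \<cdot>\<^bsub>C\<^esub> h = x \<and> b \<cdot>\<^bsub>C\<^esub> h = y"
  proof (rule ex1I[of _ h])
    show "h \<in> Hom C T (Dom C a) \<and> a \<cdot>\<^bsub>C\<^esub> h = x \<and> b \<cdot>\<^bsub>C\<^esub> h = y" using h by (simp add: Hom_def)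
    fix h' assume h': "h' \<in> Hom C T (Dom C a) \<and> a \<cdot>\<^bsub>C\<^esub> h' = x \<and> b \<cdot>\<^bsub>C\<^esub> h' = y"
    show "h' = h" by (rule assms(11)) (use h h' in \<open>simp_all add: Hom_def\<close>)
  qed
qed (use assms(1-9) in simp_all)

lemma cartesian_flip: "cartesian C a b f g \<Longrightarrow> cartesian C b a g f"
  unfolding cartesian_def
proof (elim conjE, intro conjI ballI impI)
  fix T x y
  assume "\<forall>T\<in>Ob C. \<forall>x\<in>Hom C T (Dom C f). \<forall>y\<in>Hom C T (Dom C g). f \<cdot>\<^bsub>C\<^esub> x = g \<cdot>\<^bsub>C\<^esub> y \<longrightarrow>
        (\<exists>!h. h \<in> Hom C T (Dom C a) \<and> a \<cdot>\<^bsub>C\<^esub> h = x \<and> b \<cdot>\<^bsub>C\<^esub> h = y)"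
    and "T \<in> Ob C" "x \<in> Hom C T (Dom C g)" "y \<in> Hom C T (Dom C f)" "g \<cdot>\<^bsub>C\<^esub> x = f \<cdot>\<^bsub>C\<^esub> y" and d: "Dom C a = Dom C b"
  then have "\<exists>!h. h \<in> Hom C T (Dom C a) \<and> a \<cdot>\<^bsub>C\<^esub> h = y \<and> b \<cdot>\<^bsub>C\<^esub> h = x" by metis
  moreover have "(\<exists>!h. h \<in> Hom C T (Dom C a) \<and> a \<cdot>\<^bsub>C\<^esub> h = y \<and> b \<cdot>\<^bsub>C\<^esub> h = x) =
      (\<exists>!h. h \<in> Hom C T (Dom C b) \<and> b \<cdot>\<^bsub>C\<^esub> h = x \<and> a \<cdot>\<^bsub>C\<^esub> h = y)"
    by (rule arg_cong[where f = Ex1]) (auto simp: d)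
  ultimately show "\<exists>!h. h \<in> Hom C T (Dom C b) \<and> b \<cdot>\<^bsub>C\<^esub> h = x \<and> a \<cdot>\<^bsub>C\<^esub> h = y" by simp
qed simp_all

end

section \<open>Extending a functor from two classes of arrows\<close>

text \<open>\<open>N f\<close> is the set of arrows over \<open>f\<close> of a category over \<open>X\<close> with the same objects as \<open>X\<close>, and
  \<open>star f g \<alpha> \<beta>\<close> is the composite over \<open>g \<cdot> f\<close> of \<open>\<alpha>\<close> over \<open>f\<close> and \<open>\<beta>\<close> over \<open>g\<close>. Sections \<open>ms\<close> and
  \<open>mc\<close> of the projection are given over \<open>Sm\<close> and over \<open>Cl\<close>; \<open>Sq\<close> is a class of cartesian squares rich
  enough to contain the base changes of the arrows in \<open>Sm\<close>. Over the category of pairs it consists of the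
  pairs of cartesian squares.\<close>

locale two_sections = category X for X :: "('x, 'f, 'z) cat_scheme" +
  fixes Sm Cl :: "'f set" and Sq :: "'f \<Rightarrow> 'f \<Rightarrow> 'f \<Rightarrow> 'f \<Rightarrow> bool"
    and N :: "'f \<Rightarrow> 'n set" and star :: "'f \<Rightarrow> 'f \<Rightarrow> 'n \<Rightarrow> 'n \<Rightarrow> 'n" and ms mc :: "'f \<Rightarrow> 'n"
  assumes Sm_sub: "wide_subcategory X Sm" and Cl_sub: "wide_subcategory X Cl"
    and fibre_product: "p \<in> Sm \<Longrightarrow> f \<in> Ar X \<Longrightarrow> Cod X f = Cod X p \<Longrightarrow> \<exists>f' p'. Sq f' p' p f"
    and Sq_cartesian: "Sq a b f g \<Longrightarrow> cartesian X a b f g"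
    and Sq_Sm: "Sq f' p' p f \<Longrightarrow> p \<in> Sm \<Longrightarrow> p' \<in> Sm"
    and Sq_Sm': "Sq f' p' p f \<Longrightarrow> f \<in> Sm \<Longrightarrow> f' \<in> Sm"
    and Sq_Cl: "Sq z' p' p z \<Longrightarrow> p \<in> Sm \<Longrightarrow> z \<in> Cl \<Longrightarrow> z' \<in> Cl"
    and Cl_cancel: "z \<in> Ar X \<Longrightarrow> g \<in> Ar X \<Longrightarrow> Cod X z = Dom X g \<Longrightarrow> g \<cdot>\<^bsub>X\<^esub> z \<in> Cl \<Longrightarrow> z \<in> Cl"
    and factorization: "f \<in> Ar X \<Longrightarrow> \<exists>t\<in>Cl. \<exists>p\<in>Sm. Cod X t = Dom X p \<and> f = p \<cdot>\<^bsub>X\<^esub> t"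
    and star_N: "f \<in> Ar X \<Longrightarrow> g \<in> Ar X \<Longrightarrow> Cod X f = Dom X g \<Longrightarrow> \<alpha> \<in> N f \<Longrightarrow> \<beta> \<in> N g \<Longrightarrow>
      star f g \<alpha> \<beta> \<in> N (g \<cdot>\<^bsub>X\<^esub> f)"
    and star_assoc: "f \<in> Ar X \<Longrightarrow> g \<in> Ar X \<Longrightarrow> h \<in> Ar X \<Longrightarrow> Cod X f = Dom X g \<Longrightarrow> Cod X g = Dom X h \<Longrightarrow>
      \<alpha> \<in> N f \<Longrightarrow> \<beta> \<in> N g \<Longrightarrow> \<gamma> \<in> N h \<Longrightarrow>
      star (g \<cdot>\<^bsub>X\<^esub> f) h (star f g \<alpha> \<beta>) \<gamma> = star f (h \<cdot>\<^bsub>X\<^esub> g) \<alpha> (star g h \<beta> \<gamma>)"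
    and ms_N: "p \<in> Sm \<Longrightarrow> ms p \<in> N p" and mc_N: "z \<in> Cl \<Longrightarrow> mc z \<in> N z"
    and ms_cmp: "p \<in> Sm \<Longrightarrow> q \<in> Sm \<Longrightarrow> Cod X p = Dom X q \<Longrightarrow> ms (q \<cdot>\<^bsub>X\<^esub> p) = star p q (ms p) (ms q)"
    and mc_cmp: "z \<in> Cl \<Longrightarrow> w \<in> Cl \<Longrightarrow> Cod X z = Dom X w \<Longrightarrow> mc (w \<cdot>\<^bsub>X\<^esub> z) = star z w (mc z) (mc w)"
    and ms_mc_idn: "x \<in> Ob X \<Longrightarrow> ms (Idn X x) = mc (Idn X x)"
    and exchange: "Sq z' p' p z \<Longrightarrow> p \<in> Sm \<Longrightarrow> z \<in> Cl \<Longrightarrow>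
      star z' p (mc z') (ms p) = star p' z (ms p') (mc z)"
    and triangle: "h \<in> Cl \<Longrightarrow> p \<in> Sm \<Longrightarrow> Cod X h = Dom X p \<Longrightarrow> p \<cdot>\<^bsub>X\<^esub> h \<in> Sm \<Longrightarrow>
      ms (p \<cdot>\<^bsub>X\<^esub> h) = star h p (mc h) (ms p)"
begin

lemma Sm_Ar [simp]: "p \<in> Sm \<Longrightarrow> p \<in> Ar X" and Cl_Ar [simp]: "z \<in> Cl \<Longrightarrow> z \<in> Ar X"
  and Idn_Sm [simp]: "x \<in> Ob X \<Longrightarrow> Idn X x \<in> Sm" and Idn_Cl [simp]: "x \<in> Ob X \<Longrightarrow> Idn X x \<in> Cl"
  and Sm_Cmp [simp]: "p \<in> Sm \<Longrightarrow> q \<in> Sm \<Longrightarrow> Cod X p = Dom X q \<Longrightarrow> q \<cdot>\<^bsub>X\<^esub> p \<in> Sm"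
  and Cl_Cmp [simp]: "z \<in> Cl \<Longrightarrow> w \<in> Cl \<Longrightarrow> Cod X z = Dom X w \<Longrightarrow> w \<cdot>\<^bsub>X\<^esub> z \<in> Cl"
  using Sm_sub Cl_sub by (auto simp: wide_subcategory_def)

declare ms_N [simp] mc_N [simp]

lemmas SqD = cartesianD[OF Sq_cartesian]

lemma Sq_lift:
  assumes "Sq a b f g" "x \<in> Ar X" "y \<in> Ar X" "Dom X x = Dom X y" "Cod X x = Dom X f" "Cod X y = Dom X g"
    "f \<cdot>\<^bsub>X\<^esub> x = g \<cdot>\<^bsub>X\<^esub> y"
  obtains h where "h \<in> Ar X" "Dom X h = Dom X x" "Cod X h = Dom X a" "a \<cdot>\<^bsub>X\<^esub> h = x" "b \<cdot>\<^bsub>X\<^esub> h = y"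
  using cartesian_factor[OF Sq_cartesian[OF assms(1)] assms(2-7) refl refl] that by blast

text \<open>A triangle in which the composite \<open>t = q \<tau>\<close> is closed, while the assumption \<open>triangle\<close> concerns smooth
  composites. The base change \<open>r\<close> of \<open>q\<close> along \<open>t\<close> has the section \<open>\<sigma>\<close> determined by \<open>\<tau>\<close>. By the triangle
  condition \<open>mc \<sigma>\<close> followed by \<open>ms r\<close> is the value at an identity, and exchange moves \<open>mc t\<close> across \<open>r\<close>.\<close>

lemma closed_triangle:
  assumes \<tau>: "\<tau> \<in> Cl" and q: "q \<in> Sm" and cod: "Cod X \<tau> = Dom X q" and t: "q \<cdot>\<^bsub>X\<^esub> \<tau> \<in> Cl"
  shows "mc (q \<cdot>\<^bsub>X\<^esub> \<tau>) = star \<tau> q (mc \<tau>) (ms q)"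
proof -
  let ?t = "q \<cdot>\<^bsub>X\<^esub> \<tau>" and ?i = "Idn X (Dom X \<tau>)"
  obtain t' r where sq: "Sq t' r q ?t" using fibre_product[OF q, of ?t] \<tau> q cod by auto
  note D = SqD[OF sq]
  have t': "t' \<in> Cl" and r: "r \<in> Sm" using Sq_Cl Sq_Sm sq q t by auto
  obtain \<sigma> where \<sigma>: "\<sigma> \<in> Ar X" "Dom X \<sigma> = Dom X \<tau>" "Cod X \<sigma> = Dom X t'" "t' \<cdot>\<^bsub>X\<^esub> \<sigma> = \<tau>" "r \<cdot>\<^bsub>X\<^esub> \<sigma> = ?i"
    using Sq_lift[OF sq, of \<tau> ?i] \<tau> q cod by auto
  have \<sigma>Cl: "\<sigma> \<in> Cl" using Cl_cancel[of \<sigma> t'] \<sigma> \<tau> D by simp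
  have idn: "mc ?i = star \<sigma> r (mc \<sigma>) (ms r)"
    using triangle[OF \<sigma>Cl r] \<sigma> D \<tau> ms_mc_idn[of "Dom X \<tau>"] by simp
  have "mc ?t = star ?i ?t (mc ?i) (mc ?t)"
    using mc_cmp[of ?i ?t] \<tau> q t cod by simp
  also have "\<dots> = star (r \<cdot>\<^bsub>X\<^esub> \<sigma>) ?t (star \<sigma> r (mc \<sigma>) (ms r)) (mc ?t)"
    by (simp add: idn \<sigma>)
  also have "\<dots> = star \<sigma> (?t \<cdot>\<^bsub>X\<^esub> r) (mc \<sigma>) (star r ?t (ms r) (mc ?t))"
    using \<sigma> \<sigma>Cl D r t q \<tau> cod by (intro star_assoc) simp_all
  also have "\<dots> = star \<sigma> (q \<cdot>\<^bsub>X\<^esub> t') (mc \<sigma>) (star t' q (mc t') (ms q))"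
    by (simp only: exchange[OF sq q t] D(9))
  also have "\<dots> = star (t' \<cdot>\<^bsub>X\<^esub> \<sigma>) q (star \<sigma> t' (mc \<sigma>) (mc t')) (ms q)"
    using \<sigma> \<sigma>Cl D t' q by (intro star_assoc[symmetric]) simp_all
  also have "\<dots> = star \<tau> q (mc \<tau>) (ms q)"
    using mc_cmp[OF \<sigma>Cl t'] \<sigma> by simp
  finally show ?thesis .
qed

text \<open>Two factorizations are compared through the fibre product of their smooth parts: the closed parts have a
  common lift \<open>\<tau>\<close> to it, and the value at each closed part is that at \<open>\<tau>\<close> followed by a smooth projection.\<close>

lemma factorization_independent:
  assumes t: "t \<in> Cl" "p \<in> Sm" "Cod X t = Dom X p" and t': "t' \<in> Cl" "p' \<in> Sm" "Cod X t' = Dom X p'"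
    and eq: "p \<cdot>\<^bsub>X\<^esub> t = p' \<cdot>\<^bsub>X\<^esub> t'"
  shows "star t p (mc t) (ms p) = star t' p' (mc t') (ms p')"
proof -
  have dc: "Dom X t = Dom X t'" "Cod X p = Cod X p'"
    using arg_cong[OF eq, of "Dom X"] arg_cong[OF eq, of "Cod X"] t t' by simp_all
  obtain q q' where sq: "Sq q q' p p'" using fibre_product[OF t(2), of p'] t t' dc by auto
  note D = SqD[OF sq]
  have q: "q \<in> Sm" "q' \<in> Sm" using Sq_Sm Sq_Sm' sq t t' by auto
  obtain \<tau> where \<tau>: "\<tau> \<in> Ar X" "Dom X \<tau> = Dom X t" "Cod X \<tau> = Dom X q" "q \<cdot>\<^bsub>X\<^esub> \<tau> = t" "q' \<cdot>\<^bsub>X\<^esub> \<tau> = t'"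
    using Sq_lift[OF sq, of t t'] t t' eq dc by auto
  have \<tau>Cl: "\<tau> \<in> Cl" using Cl_cancel[of \<tau> q] \<tau> t q by simp
  have *: "star s r (mc s) (ms r) = star \<tau> (r \<cdot>\<^bsub>X\<^esub> u) (mc \<tau>) (ms (r \<cdot>\<^bsub>X\<^esub> u))"
    if "s \<in> Cl" "r \<in> Sm" "u \<in> Sm" "Cod X \<tau> = Dom X u" "Cod X u = Dom X r" "u \<cdot>\<^bsub>X\<^esub> \<tau> = s" for s r u
  proof -
    have "star s r (mc s) (ms r) = star (u \<cdot>\<^bsub>X\<^esub> \<tau>) r (star \<tau> u (mc \<tau>) (ms u)) (ms r)"
      using closed_triangle[OF \<tau>Cl, of u] that by simp
    also have "\<dots> = star \<tau> (r \<cdot>\<^bsub>X\<^esub> u) (mc \<tau>) (star u r (ms u) (ms r))"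
      using \<tau>Cl that by (intro star_assoc) simp_all
    finally show ?thesis using ms_cmp[of u r] that by simp
  qed
  show ?thesis
    using *[of t p q] *[of t' p' q'] t t' q \<tau> D by simp
qed

definition ext :: "'f \<Rightarrow> 'n" where
  "ext f = (SOME \<alpha>. \<exists>t p. t \<in> Cl \<and> p \<in> Sm \<and> Cod X t = Dom X p \<and> f = p \<cdot>\<^bsub>X\<^esub> t \<and> \<alpha> = star t p (mc t) (ms p))"

lemma ext_factorization:
  assumes "t \<in> Cl" "p \<in> Sm" "Cod X t = Dom X p"
  shows "ext (p \<cdot>\<^bsub>X\<^esub> t) = star t p (mc t) (ms p)"
  unfolding ext_def
  by (rule someI2_ex) (use assms factorization_independent in \<open>blast, metis\<close>)

lemma ext_Cl: assumes "z \<in> Cl" shows "ext z = mc z"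
  using ext_factorization[of z "Idn X (Cod X z)"] mc_cmp[of z "Idn X (Cod X z)"] ms_mc_idn[of "Cod X z"] assms
  by simp

lemma ext_Sm: assumes "p \<in> Sm" shows "ext p = ms p"
  using ext_factorization[of "Idn X (Dom X p)" p] ms_cmp[of "Idn X (Dom X p)" p] ms_mc_idn[of "Dom X p"] assms
  by simp

text \<open>The fibre product of \<open>p'\<close> along \<open>s\<close>, with the closed immersion \<open>h\<close> into it, splits \<open>ms p\<close> by
  the triangle condition; exchange then moves \<open>mc s\<close> across.\<close>

lemma ext_smooth_then_closed:
  assumes p: "p \<in> Sm" and s: "s \<in> Cl" and cod: "Cod X p = Dom X s"
    and t': "t' \<in> Cl" and p': "p' \<in> Sm" and cod': "Cod X t' = Dom X p'" and eq: "s \<cdot>\<^bsub>X\<^esub> p = p' \<cdot>\<^bsub>X\<^esub> t'"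
  shows "star p s (ms p) (mc s) = star t' p' (mc t') (ms p')"
proof -
  have dc: "Dom X p = Dom X t'" "Cod X s = Cod X p'"
    using arg_cong[OF eq, of "Dom X"] arg_cong[OF eq, of "Cod X"] p s cod t' p' cod' by simp_all
  obtain s' r where sq: "Sq s' r p' s" using fibre_product[OF p', of s] s dc by auto
  note D = SqD[OF sq]
  have s': "s' \<in> Cl" and r: "r \<in> Sm" using Sq_Cl Sq_Sm sq p' s by auto
  obtain h where h: "h \<in> Ar X" "Dom X h = Dom X t'" "Cod X h = Dom X s'" "s' \<cdot>\<^bsub>X\<^esub> h = t'" "r \<cdot>\<^bsub>X\<^esub> h = p"
    using Sq_lift[OF sq, of t' p] t' p eq dc cod cod' by auto
  have hCl: "h \<in> Cl" using Cl_cancel[of h s'] h t' D by simp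
  have "star p s (ms p) (mc s) = star (r \<cdot>\<^bsub>X\<^esub> h) s (star h r (mc h) (ms r)) (mc s)"
    using triangle[OF hCl r] h D p by simp
  also have "\<dots> = star h (s \<cdot>\<^bsub>X\<^esub> r) (mc h) (star r s (ms r) (mc s))"
    using h hCl D s r by (intro star_assoc) simp_all
  also have "\<dots> = star h (p' \<cdot>\<^bsub>X\<^esub> s') (mc h) (star s' p' (mc s') (ms p'))"
    by (simp only: exchange[OF sq p' s] D(9))
  also have "\<dots> = star (s' \<cdot>\<^bsub>X\<^esub> h) p' (star h s' (mc h) (mc s')) (ms p')"
    using h hCl D s' p' by (intro star_assoc[symmetric]) simp_all
  also have "\<dots> = star t' p' (mc t') (ms p')"
    using mc_cmp[OF hCl s'] h by simp
  finally show ?thesis .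
qed

text \<open>For \<open>f = p t\<close> and \<open>g = q s\<close>, the middle part \<open>s p\<close> of \<open>q s p t\<close> is factored as \<open>p' t'\<close>, which leaves the
  factorization \<open>(q p') (t' t)\<close> of \<open>g f\<close>.\<close>

lemma ext_cmp:
  assumes f: "f \<in> Ar X" and g: "g \<in> Ar X" and cod: "Cod X f = Dom X g"
  shows "ext (g \<cdot>\<^bsub>X\<^esub> f) = star f g (ext f) (ext g)"
proof -
  obtain t p where t: "t \<in> Cl" "p \<in> Sm" "Cod X t = Dom X p" "f = p \<cdot>\<^bsub>X\<^esub> t" using factorization[OF f] by blast
  obtain s q where s: "s \<in> Cl" "q \<in> Sm" "Cod X s = Dom X q" "g = q \<cdot>\<^bsub>X\<^esub> s" using factorization[OF g] by blast
  have c: "Cod X p = Dom X s" using cod t s by simp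
  obtain t' p' where t': "t' \<in> Cl" "p' \<in> Sm" "Cod X t' = Dom X p'" "s \<cdot>\<^bsub>X\<^esub> p = p' \<cdot>\<^bsub>X\<^esub> t'"
    using factorization[of "s \<cdot>\<^bsub>X\<^esub> p"] s t c by auto
  have dc: "Dom X p = Dom X t'" "Cod X s = Cod X p'"
    using arg_cong[OF t'(4), of "Dom X"] arg_cong[OF t'(4), of "Cod X"] s t c t'(1-3) by simp_all
  have gf: "g \<cdot>\<^bsub>X\<^esub> f = (q \<cdot>\<^bsub>X\<^esub> p') \<cdot>\<^bsub>X\<^esub> (t' \<cdot>\<^bsub>X\<^esub> t)"
  proof -
    have "g \<cdot>\<^bsub>X\<^esub> f = q \<cdot>\<^bsub>X\<^esub> (s \<cdot>\<^bsub>X\<^esub> p) \<cdot>\<^bsub>X\<^esub> t" using s t c by simp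
    also have "\<dots> = q \<cdot>\<^bsub>X\<^esub> (p' \<cdot>\<^bsub>X\<^esub> t') \<cdot>\<^bsub>X\<^esub> t" by (simp only: t'(4))
    also have "\<dots> = (q \<cdot>\<^bsub>X\<^esub> p') \<cdot>\<^bsub>X\<^esub> (t' \<cdot>\<^bsub>X\<^esub> t)" using s t c t' dc by simp
    finally show ?thesis .
  qed
  have "star f g (ext f) (ext g)
      = star (p \<cdot>\<^bsub>X\<^esub> t) (q \<cdot>\<^bsub>X\<^esub> s) (star t p (mc t) (ms p)) (star s q (mc s) (ms q))"
    using t s by (simp add: ext_factorization)
  also have "\<dots> = star t ((q \<cdot>\<^bsub>X\<^esub> s) \<cdot>\<^bsub>X\<^esub> p) (mc t) (star p (q \<cdot>\<^bsub>X\<^esub> s) (ms p) (star s q (mc s) (ms q)))"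
    using t s c by (intro star_assoc star_N) simp_all
  also have "star p (q \<cdot>\<^bsub>X\<^esub> s) (ms p) (star s q (mc s) (ms q)) = star (s \<cdot>\<^bsub>X\<^esub> p) q (star p s (ms p) (mc s)) (ms q)"
    using t s c by (intro star_assoc[symmetric]) simp_all
  also have "\<dots> = star (p' \<cdot>\<^bsub>X\<^esub> t') q (star t' p' (mc t') (ms p')) (ms q)"
    using ext_smooth_then_closed[OF t(2) s(1) c t'] by (simp only: t'(4))
  also have "\<dots> = star t' (q \<cdot>\<^bsub>X\<^esub> p') (mc t') (star p' q (ms p') (ms q))"
    using t' s dc by (intro star_assoc) simp_all
  also have "\<dots> = star t' (q \<cdot>\<^bsub>X\<^esub> p') (mc t') (ms (q \<cdot>\<^bsub>X\<^esub> p'))"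
    using ms_cmp[of p' q] t' s dc by simp
  also have "(q \<cdot>\<^bsub>X\<^esub> s) \<cdot>\<^bsub>X\<^esub> p = (q \<cdot>\<^bsub>X\<^esub> p') \<cdot>\<^bsub>X\<^esub> t'"
    using t s c t' dc by simp
  also have "star t ((q \<cdot>\<^bsub>X\<^esub> p') \<cdot>\<^bsub>X\<^esub> t') (mc t) (star t' (q \<cdot>\<^bsub>X\<^esub> p') (mc t') (ms (q \<cdot>\<^bsub>X\<^esub> p')))
      = star (t' \<cdot>\<^bsub>X\<^esub> t) (q \<cdot>\<^bsub>X\<^esub> p') (star t t' (mc t) (mc t')) (ms (q \<cdot>\<^bsub>X\<^esub> p'))"
    using t t' s dc by (intro star_assoc[symmetric]) simp_all
  also have "\<dots> = ext (g \<cdot>\<^bsub>X\<^esub> f)"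
    using mc_cmp[of t t'] ext_factorization[of "t' \<cdot>\<^bsub>X\<^esub> t" "q \<cdot>\<^bsub>X\<^esub> p'"] t t' s dc gf by simp
  finally show ?thesis by simp
qed

end

section \<open>Families compatible with pull-back\<close>

locale fibration = X: category X for X :: "('x, 'f, 'z) cat_scheme" +
  fixes Fb :: "'x \<Rightarrow> ('a, 'b, 'w) cat_scheme" and Po :: "'f \<Rightarrow> 'a \<Rightarrow> 'a" and Pa :: "'f \<Rightarrow> 'b \<Rightarrow> 'b"
    and cn :: "'f \<Rightarrow> 'f \<Rightarrow> 'a \<Rightarrow> 'b"
  assumes fib: "s \<in> Ob X \<Longrightarrow> category (Fb s)"
    and pull_functor: "f \<in> Ar X \<Longrightarrow> is_functor (Fb (Cod X f)) (Fb (Dom X f)) (Po f) (Pa f)"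
    and cn_nat_iso: "f \<in> Ar X \<Longrightarrow> g \<in> Ar X \<Longrightarrow> Cod X f = Dom X g \<Longrightarrow>
      is_nat_iso (Fb (Cod X g)) (Fb (Dom X f))
        (Po (g \<cdot>\<^bsub>X\<^esub> f)) (Pa (g \<cdot>\<^bsub>X\<^esub> f)) (Po f \<circ> Po g) (Pa f \<circ> Pa g) (cn f g)"
    and cn_cocycle: "f \<in> Ar X \<Longrightarrow> g \<in> Ar X \<Longrightarrow> h \<in> Ar X \<Longrightarrow>
      Cod X f = Dom X g \<Longrightarrow> Cod X g = Dom X h \<Longrightarrow> A \<in> Ob (Fb (Cod X h)) \<Longrightarrow>
      Pa f (cn g h A) \<cdot>\<^bsub>Fb (Dom X f)\<^esub> cn f (h \<cdot>\<^bsub>X\<^esub> g) A =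
      cn f g (Po h A) \<cdot>\<^bsub>Fb (Dom X f)\<^esub> cn (g \<cdot>\<^bsub>X\<^esub> f) h A"
begin

declare X.Dom_Ob [simp] X.Cod_Ob [simp]

lemmas fib_simps [simp] =
  category.Cmp_Ar[OF fib] category.Dom_Cmp[OF fib] category.Cod_Cmp[OF fib]
  category.Idn_Ar[OF fib] category.Dom_Idn[OF fib] category.Cod_Idn[OF fib]
  category.Cmp_Idn[OF fib] category.Idn_Cmp[OF fib] category.assoc[OF fib]
  category.Dom_Ob[OF fib] category.Cod_Ob[OF fib]
  category.inv_ar_Ar[OF fib] category.Dom_inv_ar[OF fib] category.Cod_inv_ar[OF fib]
  category.inv_ar_Cmp[OF fib] category.Cmp_inv_ar[OF fib] category.inv_ar_Iso[OF fib]
  category.inv_ar_Cmp2[OF fib] category.Cmp_inv_ar2[OF fib] category.Iso_Cmp[OF fib]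
  category.Idn_Iso[OF fib]

lemma pull: "f \<in> Ar X \<Longrightarrow> functor_on (Fb (Cod X f)) (Fb (Dom X f)) (Po f) (Pa f)"
  by (simp add: functor_on_def functor_on_axioms_def fib pull_functor)

lemma Po_Ob [simp]: "f \<in> Ar X \<Longrightarrow> s = Dom X f \<Longrightarrow> A \<in> Ob (Fb (Cod X f)) \<Longrightarrow> Po f A \<in> Ob (Fb s)"
  and Pa_Ar [simp]: "f \<in> Ar X \<Longrightarrow> s = Dom X f \<Longrightarrow> \<phi> \<in> Ar (Fb (Cod X f)) \<Longrightarrow> Pa f \<phi> \<in> Ar (Fb s)"
  and Dom_Pa [simp]: "f \<in> Ar X \<Longrightarrow> s = Dom X f \<Longrightarrow> \<phi> \<in> Ar (Fb (Cod X f)) \<Longrightarrow>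
    Dom (Fb s) (Pa f \<phi>) = Po f (Dom (Fb (Cod X f)) \<phi>)"
  and Cod_Pa [simp]: "f \<in> Ar X \<Longrightarrow> s = Dom X f \<Longrightarrow> \<phi> \<in> Ar (Fb (Cod X f)) \<Longrightarrow>
    Cod (Fb s) (Pa f \<phi>) = Po f (Cod (Fb (Cod X f)) \<phi>)"
  and Pa_Iso [simp]: "f \<in> Ar X \<Longrightarrow> s = Dom X f \<Longrightarrow> \<phi> \<in> Iso (Fb (Cod X f)) \<Longrightarrow> Pa f \<phi> \<in> Iso (Fb s)"
  and Pa_cmp: "f \<in> Ar X \<Longrightarrow> t = Cod X f \<Longrightarrow> \<phi> \<in> Ar (Fb t) \<Longrightarrow> \<psi> \<in> Ar (Fb t) \<Longrightarrow>
    Cod (Fb t) \<phi> = Dom (Fb t) \<psi> \<Longrightarrow> Pa f (\<psi> \<cdot>\<^bsub>Fb t\<^esub> \<phi>) = Pa f \<psi> \<cdot>\<^bsub>Fb (Dom X f)\<^esub> Pa f \<phi>"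
  and Pa_inv_ar: "f \<in> Ar X \<Longrightarrow> t = Cod X f \<Longrightarrow> \<phi> \<in> Iso (Fb t) \<Longrightarrow> Pa f (inv_ar (Fb t) \<phi>) = inv_ar (Fb (Dom X f)) (Pa f \<phi>)"
  using functor_on.obj[OF pull] functor_on.arr[OF pull] functor_on.dom[OF pull] functor_on.cod[OF pull]
    functor_on.iso[OF pull] functor_on.cmp[OF pull] functor_on.inv_ar[OF pull]
  by simp_all

lemma cn_Ar [simp]: "f \<in> Ar X \<Longrightarrow> g \<in> Ar X \<Longrightarrow> Cod X f = Dom X g \<Longrightarrow> s = Dom X f \<Longrightarrow> A \<in> Ob (Fb (Cod X g)) \<Longrightarrow>
    cn f g A \<in> Ar (Fb s)"
  and cn_Iso [simp]: "f \<in> Ar X \<Longrightarrow> g \<in> Ar X \<Longrightarrow> Cod X f = Dom X g \<Longrightarrow> s = Dom X f \<Longrightarrow> A \<in> Ob (Fb (Cod X g)) \<Longrightarrow>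
    cn f g A \<in> Iso (Fb s)"
  and Dom_cn [simp]: "f \<in> Ar X \<Longrightarrow> g \<in> Ar X \<Longrightarrow> Cod X f = Dom X g \<Longrightarrow> s = Dom X f \<Longrightarrow> A \<in> Ob (Fb (Cod X g)) \<Longrightarrow>
    Dom (Fb s) (cn f g A) = Po (g \<cdot>\<^bsub>X\<^esub> f) A"
  and Cod_cn [simp]: "f \<in> Ar X \<Longrightarrow> g \<in> Ar X \<Longrightarrow> Cod X f = Dom X g \<Longrightarrow> s = Dom X f \<Longrightarrow> A \<in> Ob (Fb (Cod X g)) \<Longrightarrow>
    Cod (Fb s) (cn f g A) = Po f (Po g A)"
  and cn_nat: "f \<in> Ar X \<Longrightarrow> g \<in> Ar X \<Longrightarrow> Cod X f = Dom X g \<Longrightarrow> s = Dom X f \<Longrightarrow> t = Cod X g \<Longrightarrow> \<phi> \<in> Ar (Fb t) \<Longrightarrow>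
    Pa f (Pa g \<phi>) \<cdot>\<^bsub>Fb s\<^esub> cn f g (Dom (Fb t) \<phi>) = cn f g (Cod (Fb t) \<phi>) \<cdot>\<^bsub>Fb s\<^esub> Pa (g \<cdot>\<^bsub>X\<^esub> f) \<phi>"
  using cn_nat_iso[of f g] unfolding is_nat_iso_def is_nat_def Hom_def by auto

end

text \<open>A family over \<open>f\<close> is a natural transformation \<open>F f\<^sup>* \<rightarrow> f\<^sup>* F\<close>, cut off outside the objects so that
  equality of families is equality of functions.\<close>

locale fibration_map = A: fibration X FA PA PAa cA + B: fibration X FB PB PBa cB
  for X :: "('x, 'f, 'z) cat_scheme" and FA :: "'x \<Rightarrow> ('a, 'b, 'w) cat_scheme" and PA PAa cA
    and FB :: "'x \<Rightarrow> ('c, 'd, 'v) cat_scheme" and PB PBa cB +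
  fixes Fo :: "'x \<Rightarrow> 'a \<Rightarrow> 'c" and Fa :: "'x \<Rightarrow> 'b \<Rightarrow> 'd"
  assumes fibre_functor: "s \<in> Ob X \<Longrightarrow> is_functor (FA s) (FB s) (Fo s) (Fa s)"
begin

lemma ff: "s \<in> Ob X \<Longrightarrow> functor_on (FA s) (FB s) (Fo s) (Fa s)"
  by (simp add: functor_on_def functor_on_axioms_def A.fib B.fib fibre_functor)

lemmas ff_simps [simp] = functor_on.obj[OF ff] functor_on.arr[OF ff] functor_on.dom[OF ff] functor_on.cod[OF ff]
  functor_on.iso[OF ff] functor_on.idn[OF ff]

lemmas Fa_cmp = functor_on.cmp[OF ff]

definition family :: "'f \<Rightarrow> ('a \<Rightarrow> 'd) \<Rightarrow> bool" where
  "family f \<alpha> \<longleftrightarrow> is_nat (FA (Cod X f)) (FB (Dom X f))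
     (\<lambda>A. Fo (Dom X f) (PA f A)) (\<lambda>\<phi>. Fa (Dom X f) (PAa f \<phi>))
     (\<lambda>A. PB f (Fo (Cod X f) A)) (\<lambda>\<phi>. PBa f (Fa (Cod X f) \<phi>)) \<alpha>"

definition families :: "'f \<Rightarrow> ('a \<Rightarrow> 'd) set" where
  "families f = {\<alpha> \<in> extensional (Ob (FA (Cod X f))). family f \<alpha>}"

definition star :: "'f \<Rightarrow> 'f \<Rightarrow> ('a \<Rightarrow> 'd) \<Rightarrow> ('a \<Rightarrow> 'd) \<Rightarrow> 'a \<Rightarrow> 'd" where
  "star f g \<alpha> \<beta> = restrict (\<lambda>A. inv_ar (FB (Dom X f)) (cB f g (Fo (Cod X g) A)) \<cdot>\<^bsub>FB (Dom X f)\<^esub>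
     PBa f (\<beta> A) \<cdot>\<^bsub>FB (Dom X f)\<^esub> \<alpha> (PA g A) \<cdot>\<^bsub>FB (Dom X f)\<^esub> Fa (Dom X f) (cA f g A)) (Ob (FA (Cod X g)))"

lemma familyD [simp]:
  assumes "family f \<alpha>" "f \<in> Ar X" "A \<in> Ob (FA (Cod X f))" "s = Dom X f"
  shows "\<alpha> A \<in> Ar (FB s)" "Dom (FB s) (\<alpha> A) = Fo s (PA f A)" "Cod (FB s) (\<alpha> A) = PB f (Fo (Cod X f) A)"
  using assms unfolding family_def is_nat_def Hom_def by auto

lemma family_nat:
  assumes "family f \<alpha>" "f \<in> Ar X" "\<phi> \<in> Ar (FA (Cod X f))"
  shows "PBa f (Fa (Cod X f) \<phi>) \<cdot>\<^bsub>FB (Dom X f)\<^esub> \<alpha> (Dom (FA (Cod X f)) \<phi>)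
    = \<alpha> (Cod (FA (Cod X f)) \<phi>) \<cdot>\<^bsub>FB (Dom X f)\<^esub> Fa (Dom X f) (PAa f \<phi>)"
  using assms unfolding family_def is_nat_def by auto

lemma star_arrow:
  assumes "family f \<alpha>" "family g \<beta>" "f \<in> Ar X" "g \<in> Ar X" "Cod X f = Dom X g" "A \<in> Ob (FA (Cod X g))" "s = Dom X f"
  shows "star f g \<alpha> \<beta> A \<in> Ar (FB s)" "Dom (FB s) (star f g \<alpha> \<beta> A) = Fo s (PA (g \<cdot>\<^bsub>X\<^esub> f) A)"
    "Cod (FB s) (star f g \<alpha> \<beta> A) = PB (g \<cdot>\<^bsub>X\<^esub> f) (Fo (Cod X g) A)"
  using assms by (simp_all add: star_def)

text \<open>The equation \<open>\<gamma> = star f g \<alpha> \<beta>\<close> with the connection isomorphism moved to the other side, as in the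
  composition law of an external tensor structure.\<close>

definition cocycle_at :: "'f \<Rightarrow> 'f \<Rightarrow> ('a \<Rightarrow> 'd) \<Rightarrow> ('a \<Rightarrow> 'd) \<Rightarrow> ('a \<Rightarrow> 'd) \<Rightarrow> 'a \<Rightarrow> bool" where
  "cocycle_at f g \<alpha> \<beta> \<gamma> A \<longleftrightarrow> cB f g (Fo (Cod X g) A) \<cdot>\<^bsub>FB (Dom X f)\<^esub> \<gamma> A =
     PBa f (\<beta> A) \<cdot>\<^bsub>FB (Dom X f)\<^esub> \<alpha> (PA g A) \<cdot>\<^bsub>FB (Dom X f)\<^esub> Fa (Dom X f) (cA f g A)"

lemma star_cocycle:
  assumes "family f \<alpha>" "family g \<beta>" "f \<in> Ar X" "g \<in> Ar X" "Cod X f = Dom X g" "A \<in> Ob (FA (Cod X g))"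
  shows "cocycle_at f g \<alpha> \<beta> (star f g \<alpha> \<beta>) A"
  using assms by (simp add: cocycle_at_def star_def)

lemma cocycle_imp_star:
  assumes "family f \<alpha>" "family g \<beta>" "f \<in> Ar X" "g \<in> Ar X" "Cod X f = Dom X g" "A \<in> Ob (FA (Cod X g))"
    and "family (g \<cdot>\<^bsub>X\<^esub> f) \<gamma>" "cocycle_at f g \<alpha> \<beta> \<gamma> A"
  shows "\<gamma> A = star f g \<alpha> \<beta> A"
proof (rule category.Iso_cancel_left[OF B.fib])
  show "cB f g (Fo (Cod X g) A) \<cdot>\<^bsub>FB (Dom X f)\<^esub> \<gamma> A = cB f g (Fo (Cod X g) A) \<cdot>\<^bsub>FB (Dom X f)\<^esub> star f g \<alpha> \<beta> A"
    using assms(8) star_cocycle[OF assms(1-6)] by (simp add: cocycle_at_def)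
qed (use assms star_arrow[OF assms(1-6)] in simp_all)

lemma star_family:
  assumes "family f \<alpha>" "family g \<beta>" "f \<in> Ar X" "g \<in> Ar X" "Cod X f = Dom X g"
  shows "family (g \<cdot>\<^bsub>X\<^esub> f) (star f g \<alpha> \<beta>)"
proof -
  let ?D = "FB (Dom X f)" and ?C = "FA (Cod X g)" and ?h = "g \<cdot>\<^bsub>X\<^esub> f" and ?\<gamma> = "star f g \<alpha> \<beta>"
  interpret D: category ?D using assms by (simp add: B.fib)
  have "PBa ?h (Fa (Cod X g) \<phi>) \<cdot>\<^bsub>?D\<^esub> ?\<gamma> (Dom ?C \<phi>) = ?\<gamma> (Cod ?C \<phi>) \<cdot>\<^bsub>?D\<^esub> Fa (Dom X f) (PAa ?h \<phi>)"
    if \<phi>: "\<phi> \<in> Ar ?C" for \<phi>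
  proof -
    let ?A = "Dom ?C \<phi>" and ?A' = "Cod ?C \<phi>"
    note star = star_arrow[OF assms] star_cocycle[OF assms, unfolded cocycle_at_def]
    note S = assms \<phi> star
    have "cB f g (Fo (Cod X g) ?A') \<cdot>\<^bsub>?D\<^esub> PBa ?h (Fa (Cod X g) \<phi>) \<cdot>\<^bsub>?D\<^esub> ?\<gamma> ?A
        = (cB f g (Fo (Cod X g) ?A') \<cdot>\<^bsub>?D\<^esub> PBa ?h (Fa (Cod X g) \<phi>)) \<cdot>\<^bsub>?D\<^esub> ?\<gamma> ?A"
      using S by simp
    also have "cB f g (Fo (Cod X g) ?A') \<cdot>\<^bsub>?D\<^esub> PBa ?h (Fa (Cod X g) \<phi>)
        = PBa f (PBa g (Fa (Cod X g) \<phi>)) \<cdot>\<^bsub>?D\<^esub> cB f g (Fo (Cod X g) ?A)"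
      using S B.cn_nat[of f g "Dom X f" "Cod X g" "Fa (Cod X g) \<phi>"] by simp
    also have "(PBa f (PBa g (Fa (Cod X g) \<phi>)) \<cdot>\<^bsub>?D\<^esub> cB f g (Fo (Cod X g) ?A)) \<cdot>\<^bsub>?D\<^esub> ?\<gamma> ?A
        = PBa f (PBa g (Fa (Cod X g) \<phi>)) \<cdot>\<^bsub>?D\<^esub> (cB f g (Fo (Cod X g) ?A) \<cdot>\<^bsub>?D\<^esub> ?\<gamma> ?A)"
      using S by simp
    also have "\<dots> = PBa f (PBa g (Fa (Cod X g) \<phi>)) \<cdot>\<^bsub>?D\<^esub> PBa f (\<beta> ?A) \<cdot>\<^bsub>?D\<^esub> \<alpha> (PA g ?A) \<cdot>\<^bsub>?D\<^esub> Fa (Dom X f) (cA f g ?A)"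
      using S by simp
    also have "\<dots> = PBa f (PBa g (Fa (Cod X g) \<phi>) \<cdot>\<^bsub>FB (Cod X f)\<^esub> \<beta> ?A) \<cdot>\<^bsub>?D\<^esub> \<alpha> (PA g ?A) \<cdot>\<^bsub>?D\<^esub> Fa (Dom X f) (cA f g ?A)"
      using S by (simp add: B.Pa_cmp)
    also have "\<dots> = PBa f (\<beta> ?A' \<cdot>\<^bsub>FB (Cod X f)\<^esub> Fa (Cod X f) (PAa g \<phi>)) \<cdot>\<^bsub>?D\<^esub> \<alpha> (PA g ?A) \<cdot>\<^bsub>?D\<^esub> Fa (Dom X f) (cA f g ?A)"
      using S family_nat[of g \<beta> \<phi>] by simp
    also have "\<dots> = PBa f (\<beta> ?A') \<cdot>\<^bsub>?D\<^esub> (PBa f (Fa (Cod X f) (PAa g \<phi>)) \<cdot>\<^bsub>?D\<^esub> \<alpha> (PA g ?A)) \<cdot>\<^bsub>?D\<^esub> Fa (Dom X f) (cA f g ?A)"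
      using S by (simp add: B.Pa_cmp)
    also have "PBa f (Fa (Cod X f) (PAa g \<phi>)) \<cdot>\<^bsub>?D\<^esub> \<alpha> (PA g ?A) = \<alpha> (PA g ?A') \<cdot>\<^bsub>?D\<^esub> Fa (Dom X f) (PAa f (PAa g \<phi>))"
      using S family_nat[of f \<alpha> "PAa g \<phi>"] by simp
    also have "PBa f (\<beta> ?A') \<cdot>\<^bsub>?D\<^esub> (\<alpha> (PA g ?A') \<cdot>\<^bsub>?D\<^esub> Fa (Dom X f) (PAa f (PAa g \<phi>))) \<cdot>\<^bsub>?D\<^esub> Fa (Dom X f) (cA f g ?A)
        = PBa f (\<beta> ?A') \<cdot>\<^bsub>?D\<^esub> \<alpha> (PA g ?A') \<cdot>\<^bsub>?D\<^esub> Fa (Dom X f) (PAa f (PAa g \<phi>) \<cdot>\<^bsub>FA (Dom X f)\<^esub> cA f g ?A)"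
      using S by (simp add: Fa_cmp)
    also have "\<dots> = PBa f (\<beta> ?A') \<cdot>\<^bsub>?D\<^esub> \<alpha> (PA g ?A') \<cdot>\<^bsub>?D\<^esub> Fa (Dom X f) (cA f g ?A') \<cdot>\<^bsub>?D\<^esub> Fa (Dom X f) (PAa ?h \<phi>)"
      using S A.cn_nat[of f g "Dom X f" "Cod X g" \<phi>] by (simp add: Fa_cmp)
    also have "\<dots> = (cB f g (Fo (Cod X g) ?A') \<cdot>\<^bsub>?D\<^esub> ?\<gamma> ?A') \<cdot>\<^bsub>?D\<^esub> Fa (Dom X f) (PAa ?h \<phi>)"
      by (subst star(4)) (use S in simp_all)
    also have "\<dots> = cB f g (Fo (Cod X g) ?A') \<cdot>\<^bsub>?D\<^esub> ?\<gamma> ?A' \<cdot>\<^bsub>?D\<^esub> Fa (Dom X f) (PAa ?h \<phi>)"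
      using assms \<phi> star(1-3) by simp
    finally show ?thesis
      by (rule D.Iso_cancel_left[rotated 5]) (use S in simp_all)
  qed
  moreover have "?\<gamma> A \<in> Hom ?D (Fo (Dom X f) (PA ?h A)) (PB ?h (Fo (Cod X g) A))" if "A \<in> Ob ?C" for A
    using star_arrow[OF assms that] by (simp add: Hom_def)
  ultimately show ?thesis using assms by (simp add: family_def is_nat_def)
qed

lemma star_families:
  assumes "\<alpha> \<in> families f" "\<beta> \<in> families g" "f \<in> Ar X" "g \<in> Ar X" "Cod X f = Dom X g"
  shows "star f g \<alpha> \<beta> \<in> families (g \<cdot>\<^bsub>X\<^esub> f)"
  using assms star_family[of f \<alpha> g \<beta>] by (simp add: families_def) (simp add: star_def)

lemma star_Iso:
  assumes "family f \<alpha>" "family g \<beta>" "f \<in> Ar X" "g \<in> Ar X" "Cod X f = Dom X g" "A \<in> Ob (FA (Cod X g))"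
    and "\<alpha> (PA g A) \<in> Iso (FB (Dom X f))" "\<beta> A \<in> Iso (FB (Cod X f))"
  shows "star f g \<alpha> \<beta> A \<in> Iso (FB (Dom X f))"
  using assms by (simp add: star_def)

text \<open>After composition with a connection isomorphism into \<open>f\<^sup>* g\<^sup>* h\<^sup>* F\<close>, both sides become \<open>\<alpha>\<close>, \<open>\<beta>\<close> and \<open>\<gamma>\<close> one after
  the other, by the cocycle conditions of the two fibrations and the naturality of \<open>\<alpha>\<close> along the
  connection isomorphism \<open>(h g)\<^sup>* \<rightarrow> g\<^sup>* h\<^sup>*\<close>.\<close>

lemma star_assoc:
  assumes f: "f \<in> Ar X" and g: "g \<in> Ar X" and h: "h \<in> Ar X" and c: "Cod X f = Dom X g" "Cod X g = Dom X h"
    and a: "family f \<alpha>" "family g \<beta>" "family h \<gamma>"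
  shows "star (g \<cdot>\<^bsub>X\<^esub> f) h (star f g \<alpha> \<beta>) \<gamma> = star f (h \<cdot>\<^bsub>X\<^esub> g) \<alpha> (star g h \<beta> \<gamma>)"
proof
  fix A
  let ?D = "FB (Dom X f)" and ?s = "Dom X f"
  let ?gf = "g \<cdot>\<^bsub>X\<^esub> f" and ?hg = "h \<cdot>\<^bsub>X\<^esub> g" and ?FA = "Fo (Cod X h) A"
  let ?l = "star ?gf h (star f g \<alpha> \<beta>) \<gamma> A" and ?r = "star f ?hg \<alpha> (star g h \<beta> \<gamma>) A"
  interpret D: category ?D using f by (simp add: B.fib)
  show "?l = ?r"
  proof (cases "A \<in> Ob (FA (Cod X h))")
    case A: True
    note S = f g h c a A
    note c1 = star_cocycle[OF a(1,2) f g c(1), unfolded cocycle_at_def]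
    note c2 = star_cocycle[OF a(2,3) g h c(2) A, unfolded cocycle_at_def]
    note f1 = star_family[OF a(1,2) f g c(1)] and f2 = star_family[OF a(2,3) g h c(2)]
    have l: "cB ?gf h ?FA \<cdot>\<^bsub>?D\<^esub> ?l =
        PBa ?gf (\<gamma> A) \<cdot>\<^bsub>?D\<^esub> star f g \<alpha> \<beta> (PA h A) \<cdot>\<^bsub>?D\<^esub> Fa ?s (cA ?gf h A)"
      using star_cocycle[OF f1 a(3), of A, unfolded cocycle_at_def] S by simp
    have r: "cB f ?hg ?FA \<cdot>\<^bsub>?D\<^esub> ?r = PBa f (star g h \<beta> \<gamma> A) \<cdot>\<^bsub>?D\<^esub> \<alpha> (PA ?hg A) \<cdot>\<^bsub>?D\<^esub> Fa ?s (cA f ?hg A)"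
      using star_cocycle[OF a(1) f2, of A, unfolded cocycle_at_def] S by simp
    have tys [simp]: "?l \<in> Ar ?D" "?r \<in> Ar ?D" "Dom ?D ?l = Fo ?s (PA (h \<cdot>\<^bsub>X\<^esub> g \<cdot>\<^bsub>X\<^esub> f) A)"
      "Dom ?D ?r = Fo ?s (PA (h \<cdot>\<^bsub>X\<^esub> g \<cdot>\<^bsub>X\<^esub> f) A)" "Cod ?D ?l = PB (h \<cdot>\<^bsub>X\<^esub> g \<cdot>\<^bsub>X\<^esub> f) ?FA" "Cod ?D ?r = PB (h \<cdot>\<^bsub>X\<^esub> g \<cdot>\<^bsub>X\<^esub> f) ?FA"
      using star_arrow[OF f1 a(3), of A] star_arrow[OF a(1) f2, of A] S by simp_all
    have "(cB f g (PB h ?FA) \<cdot>\<^bsub>?D\<^esub> cB ?gf h ?FA) \<cdot>\<^bsub>?D\<^esub> ?l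
        = cB f g (PB h ?FA) \<cdot>\<^bsub>?D\<^esub> PBa ?gf (\<gamma> A) \<cdot>\<^bsub>?D\<^esub> star f g \<alpha> \<beta> (PA h A) \<cdot>\<^bsub>?D\<^esub> Fa ?s (cA ?gf h A)"
      using S l by simp
    also have "\<dots> = (cB f g (PB h ?FA) \<cdot>\<^bsub>?D\<^esub> PBa ?gf (\<gamma> A)) \<cdot>\<^bsub>?D\<^esub> star f g \<alpha> \<beta> (PA h A) \<cdot>\<^bsub>?D\<^esub> Fa ?s (cA ?gf h A)"
      using S f1 by simp
    also have "cB f g (PB h ?FA) \<cdot>\<^bsub>?D\<^esub> PBa ?gf (\<gamma> A) = PBa f (PBa g (\<gamma> A)) \<cdot>\<^bsub>?D\<^esub> cB f g (Fo (Cod X g) (PA h A))"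
      using S B.cn_nat[of f g ?s "Cod X g" "\<gamma> A"] by simp
    also have "(PBa f (PBa g (\<gamma> A)) \<cdot>\<^bsub>?D\<^esub> cB f g (Fo (Cod X g) (PA h A))) \<cdot>\<^bsub>?D\<^esub> star f g \<alpha> \<beta> (PA h A) \<cdot>\<^bsub>?D\<^esub> Fa ?s (cA ?gf h A)
        = PBa f (PBa g (\<gamma> A)) \<cdot>\<^bsub>?D\<^esub> (cB f g (Fo (Cod X g) (PA h A)) \<cdot>\<^bsub>?D\<^esub> star f g \<alpha> \<beta> (PA h A)) \<cdot>\<^bsub>?D\<^esub> Fa ?s (cA ?gf h A)"
      using S f1 by simp
    also have "\<dots> = PBa f (PBa g (\<gamma> A)) \<cdot>\<^bsub>?D\<^esub> PBa f (\<beta> (PA h A)) \<cdot>\<^bsub>?D\<^esub> \<alpha> (PA g (PA h A)) \<cdot>\<^bsub>?D\<^esub> Fa ?s (cA f g (PA h A)) \<cdot>\<^bsub>?D\<^esub> Fa ?s (cA ?gf h A)"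
      by (subst c1) (use S in simp_all)
    also have "\<dots> = PBa f (PBa g (\<gamma> A) \<cdot>\<^bsub>FB (Cod X f)\<^esub> \<beta> (PA h A)) \<cdot>\<^bsub>?D\<^esub> \<alpha> (PA g (PA h A)) \<cdot>\<^bsub>?D\<^esub> Fa ?s (cA f g (PA h A) \<cdot>\<^bsub>FA ?s\<^esub> cA ?gf h A)"
      using S by (simp add: B.Pa_cmp Fa_cmp)
    also have "cA f g (PA h A) \<cdot>\<^bsub>FA ?s\<^esub> cA ?gf h A = PAa f (cA g h A) \<cdot>\<^bsub>FA ?s\<^esub> cA f ?hg A"
      using A.cn_cocycle[OF f g h c A] by simp
    also have "PBa f (PBa g (\<gamma> A) \<cdot>\<^bsub>FB (Cod X f)\<^esub> \<beta> (PA h A)) \<cdot>\<^bsub>?D\<^esub> \<alpha> (PA g (PA h A)) \<cdot>\<^bsub>?D\<^esub> Fa ?s (PAa f (cA g h A) \<cdot>\<^bsub>FA ?s\<^esub> cA f ?hg A)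
        = PBa f (PBa g (\<gamma> A) \<cdot>\<^bsub>FB (Cod X f)\<^esub> \<beta> (PA h A)) \<cdot>\<^bsub>?D\<^esub> (\<alpha> (PA g (PA h A)) \<cdot>\<^bsub>?D\<^esub> Fa ?s (PAa f (cA g h A))) \<cdot>\<^bsub>?D\<^esub> Fa ?s (cA f ?hg A)"
      using S by (simp add: Fa_cmp)
    also have "\<alpha> (PA g (PA h A)) \<cdot>\<^bsub>?D\<^esub> Fa ?s (PAa f (cA g h A)) = PBa f (Fa (Cod X f) (cA g h A)) \<cdot>\<^bsub>?D\<^esub> \<alpha> (PA ?hg A)"
      using S family_nat[OF a(1) f, of "cA g h A"] by simp
    also have "PBa f (PBa g (\<gamma> A) \<cdot>\<^bsub>FB (Cod X f)\<^esub> \<beta> (PA h A)) \<cdot>\<^bsub>?D\<^esub> (PBa f (Fa (Cod X f) (cA g h A)) \<cdot>\<^bsub>?D\<^esub> \<alpha> (PA ?hg A)) \<cdot>\<^bsub>?D\<^esub> Fa ?s (cA f ?hg A)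
        = PBa f (PBa g (\<gamma> A) \<cdot>\<^bsub>FB (Cod X f)\<^esub> \<beta> (PA h A) \<cdot>\<^bsub>FB (Cod X f)\<^esub> Fa (Cod X f) (cA g h A)) \<cdot>\<^bsub>?D\<^esub> \<alpha> (PA ?hg A) \<cdot>\<^bsub>?D\<^esub> Fa ?s (cA f ?hg A)"
      using S by (simp add: B.Pa_cmp)
    also have "\<dots> = PBa f (cB g h ?FA \<cdot>\<^bsub>FB (Cod X f)\<^esub> star g h \<beta> \<gamma> A) \<cdot>\<^bsub>?D\<^esub> \<alpha> (PA ?hg A) \<cdot>\<^bsub>?D\<^esub> Fa ?s (cA f ?hg A)"
      using c2 S by simp
    also have "\<dots> = PBa f (cB g h ?FA) \<cdot>\<^bsub>?D\<^esub> cB f ?hg ?FA \<cdot>\<^bsub>?D\<^esub> ?r"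
      using S f2 by (simp add: B.Pa_cmp r)
    also have "\<dots> = (PBa f (cB g h ?FA) \<cdot>\<^bsub>?D\<^esub> cB f ?hg ?FA) \<cdot>\<^bsub>?D\<^esub> ?r"
      using S by simp
    also have "\<dots> = (cB f g (PB h ?FA) \<cdot>\<^bsub>?D\<^esub> cB ?gf h ?FA) \<cdot>\<^bsub>?D\<^esub> ?r"
      using B.cn_cocycle[OF f g h c, of ?FA] S by simp
    finally show ?thesis
      by (rule D.Iso_cancel_left[rotated 5]) (use S in simp_all)
  qed (use f g h c in \<open>simp add: star_def\<close>)
qed

text \<open>An invertible factor over \<open>g\<close> can be cancelled, which determines the other factor at the objects
  \<open>g\<^sup>* A\<close>; for an identity \<open>g\<close> these are all objects.\<close>

lemma star_cancel:
  assumes "family f \<alpha>" "family f \<alpha>'" "family g \<beta>" "f \<in> Ar X" "g \<in> Ar X" "Cod X f = Dom X g"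
    and A: "A \<in> Ob (FA (Cod X g))" and "\<beta> A \<in> Iso (FB (Cod X f))" and eq: "star f g \<alpha> \<beta> A = star f g \<alpha>' \<beta> A"
  shows "\<alpha> (PA g A) = \<alpha>' (PA g A)"
proof -
  let ?D = "FB (Dom X f)"
  interpret D: category ?D using assms by (simp add: B.fib)
  have "PBa f (\<beta> A) \<cdot>\<^bsub>?D\<^esub> \<alpha> (PA g A) \<cdot>\<^bsub>?D\<^esub> Fa (Dom X f) (cA f g A) = PBa f (\<beta> A) \<cdot>\<^bsub>?D\<^esub> \<alpha>' (PA g A) \<cdot>\<^bsub>?D\<^esub> Fa (Dom X f) (cA f g A)"
    using star_cocycle[of f \<alpha> g \<beta> A] star_cocycle[of f \<alpha>' g \<beta> A] assms by (simp add: cocycle_at_def)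
  then have "\<alpha> (PA g A) \<cdot>\<^bsub>?D\<^esub> Fa (Dom X f) (cA f g A) = \<alpha>' (PA g A) \<cdot>\<^bsub>?D\<^esub> Fa (Dom X f) (cA f g A)"
    by (rule D.Iso_cancel_left[rotated 5]) (use assms in simp_all)
  then show ?thesis
    by (rule D.Iso_cancel_right[rotated 5]) (use assms in simp_all)
qed

text \<open>\<open>eA\<close> and \<open>eB\<close> are the composite connection isomorphisms \<open>f\<^sup>* g\<^sup>* \<rightarrow> f'\<^sup>* g'\<^sup>*\<close> of a commutative square, so the
  equality of the two composite families is an exchange law free of connection isomorphisms for \<open>g f\<close>.\<close>

lemma star_eq_iff:
  assumes a: "family f \<alpha>" "family g \<beta>" "f \<in> Ar X" "g \<in> Ar X" "Cod X f = Dom X g"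
    and a': "family f' \<alpha>'" "family g' \<beta>'" "f' \<in> Ar X" "g' \<in> Ar X" "Cod X f' = Dom X g'"
    and eq: "g \<cdot>\<^bsub>X\<^esub> f = g' \<cdot>\<^bsub>X\<^esub> f'" and A: "A \<in> Ob (FA (Cod X g))"
    and eA: "eA \<in> Ar (FA (Dom X f))" "Dom (FA (Dom X f)) eA = PA f (PA g A)" "eA \<cdot>\<^bsub>FA (Dom X f)\<^esub> cA f g A = cA f' g' A"
    and eB: "eB \<in> Ar (FB (Dom X f))" "Dom (FB (Dom X f)) eB = PB f (PB g (Fo (Cod X g) A))"
      "eB \<cdot>\<^bsub>FB (Dom X f)\<^esub> cB f g (Fo (Cod X g) A) = cB f' g' (Fo (Cod X g) A)"
  shows "star f g \<alpha> \<beta> A = star f' g' \<alpha>' \<beta>' A \<longleftrightarrow>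
    eB \<cdot>\<^bsub>FB (Dom X f)\<^esub> PBa f (\<beta> A) \<cdot>\<^bsub>FB (Dom X f)\<^esub> \<alpha> (PA g A) =
    PBa f' (\<beta>' A) \<cdot>\<^bsub>FB (Dom X f)\<^esub> \<alpha>' (PA g' A) \<cdot>\<^bsub>FB (Dom X f)\<^esub> Fa (Dom X f) eA"
proof -
  let ?D = "FB (Dom X f)" and ?E = "FA (Dom X f)" and ?FA = "Fo (Cod X g) A"
  have dc: "Dom X f' = Dom X f" "Cod X g' = Cod X g"
    using arg_cong[OF eq, of "Dom X"] arg_cong[OF eq, of "Cod X"] a(3-5) a'(3-5) by simp_all
  interpret D: category ?D using a(3) by (simp add: B.fib)
  have A': "A \<in> Ob (FA (Cod X g'))" using A dc by simp
  note c = star_cocycle[OF a A, unfolded cocycle_at_def]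
  note c' = star_cocycle[OF a' A', unfolded cocycle_at_def dc]
  note st = star_arrow[OF a A, of "Dom X f", OF refl]
  note st' = star_arrow[OF a' A', of "Dom X f", unfolded dc, OF refl]
  note S = a a' A A' dc
  have cdA: "Cod ?E eA = PA f' (PA g' A)"
  proof -
    have "Cod ?E (eA \<cdot>\<^bsub>?E\<^esub> cA f g A) = Cod ?E eA" using S eA(1,2) by simp
    then show ?thesis unfolding eA(3) using S by simp
  qed
  have cdB: "Cod ?D eB = PB f' (PB g' ?FA)"
  proof -
    have "Cod ?D (eB \<cdot>\<^bsub>?D\<^esub> cB f g ?FA) = Cod ?D eB" using S eB(1,2) by simp
    then show ?thesis unfolding eB(3) using S by simp
  qed
  note tys = eA(1,2) eB(1,2) cdA cdB
  have "star f g \<alpha> \<beta> A = star f' g' \<alpha>' \<beta>' A \<longleftrightarrow> cB f' g' ?FA \<cdot>\<^bsub>?D\<^esub> star f g \<alpha> \<beta> A = cB f' g' ?FA \<cdot>\<^bsub>?D\<^esub> star f' g' \<alpha>' \<beta>' A"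
    using D.Iso_cancel_left[of "cB f' g' ?FA" "star f g \<alpha> \<beta> A" "star f' g' \<alpha>' \<beta>' A"] S st st' eq by auto
  also have "cB f' g' ?FA \<cdot>\<^bsub>?D\<^esub> star f g \<alpha> \<beta> A = eB \<cdot>\<^bsub>?D\<^esub> (cB f g ?FA \<cdot>\<^bsub>?D\<^esub> star f g \<alpha> \<beta> A)"
    unfolding eB(3)[symmetric] using S st tys by simp
  also have "\<dots> = (eB \<cdot>\<^bsub>?D\<^esub> PBa f (\<beta> A) \<cdot>\<^bsub>?D\<^esub> \<alpha> (PA g A)) \<cdot>\<^bsub>?D\<^esub> Fa (Dom X f) (cA f g A)"
    unfolding c using S tys by simp
  also have "cB f' g' ?FA \<cdot>\<^bsub>?D\<^esub> star f' g' \<alpha>' \<beta>' A = (PBa f' (\<beta>' A) \<cdot>\<^bsub>?D\<^esub> \<alpha>' (PA g' A) \<cdot>\<^bsub>?D\<^esub> Fa (Dom X f) eA) \<cdot>\<^bsub>?D\<^esub> Fa (Dom X f) (cA f g A)"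
    unfolding c' eA(3)[symmetric] using S tys by (simp add: Fa_cmp)
  finally have "star f g \<alpha> \<beta> A = star f' g' \<alpha>' \<beta>' A \<longleftrightarrow>
      (eB \<cdot>\<^bsub>?D\<^esub> PBa f (\<beta> A) \<cdot>\<^bsub>?D\<^esub> \<alpha> (PA g A)) \<cdot>\<^bsub>?D\<^esub> Fa (Dom X f) (cA f g A) =
      (PBa f' (\<beta>' A) \<cdot>\<^bsub>?D\<^esub> \<alpha>' (PA g' A) \<cdot>\<^bsub>?D\<^esub> Fa (Dom X f) eA) \<cdot>\<^bsub>?D\<^esub> Fa (Dom X f) (cA f g A)" (is "_ \<longleftrightarrow> ?l \<cdot>\<^bsub>?D\<^esub> ?k = ?r \<cdot>\<^bsub>?D\<^esub> ?k") .
  moreover have "?l \<cdot>\<^bsub>?D\<^esub> ?k = ?r \<cdot>\<^bsub>?D\<^esub> ?k \<longleftrightarrow> ?l = ?r"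
  proof
    assume "?l \<cdot>\<^bsub>?D\<^esub> ?k = ?r \<cdot>\<^bsub>?D\<^esub> ?k"
    then show "?l = ?r" by (rule D.Iso_cancel_right[rotated 5]) (use S tys in simp_all)
  qed simp
  ultimately show ?thesis by (rule trans)
qed

lemma star_cong:
  assumes "f \<in> Ar X" "g \<in> Ar X" "Cod X f = Dom X g"
    and "\<And>A. A \<in> Ob (FA (Cod X f)) \<Longrightarrow> \<alpha> A = \<alpha>' A" "\<And>A. A \<in> Ob (FA (Cod X g)) \<Longrightarrow> \<beta> A = \<beta>' A"
  shows "star f g \<alpha> \<beta> = star f g \<alpha>' \<beta>'"
  using assms by (auto simp: star_def restrict_def fun_eq_iff)

lemma family_cong:
  assumes "f \<in> Ar X" "\<And>A. A \<in> Ob (FA (Cod X f)) \<Longrightarrow> \<alpha> A = \<alpha>' A"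
  shows "family f \<alpha> \<longleftrightarrow> family f \<alpha>'"
proof -
  interpret category "FA (Cod X f)" using assms(1) by (simp add: A.fib)
  show ?thesis using assms(2) by (auto simp: family_def is_nat_def)
qed

lemma restrict_families: "family f \<alpha> \<Longrightarrow> f \<in> Ar X \<Longrightarrow> restrict \<alpha> (Ob (FA (Cod X f))) \<in> families f"
  using family_cong[of f \<alpha> "restrict \<alpha> (Ob (FA (Cod X f)))"] by (simp add: families_def)

lemma restrict_eq_star:
  assumes "family f \<alpha>" "family g \<beta>" "family (g \<cdot>\<^bsub>X\<^esub> f) \<gamma>" "f \<in> Ar X" "g \<in> Ar X" "Cod X f = Dom X g"
    and "\<And>A. A \<in> Ob (FA (Cod X g)) \<Longrightarrow> cocycle_at f g \<alpha> \<beta> \<gamma> A"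
  shows "restrict \<gamma> (Ob (FA (Cod X (g \<cdot>\<^bsub>X\<^esub> f)))) =
    star f g (restrict \<alpha> (Ob (FA (Cod X f)))) (restrict \<beta> (Ob (FA (Cod X g))))"
proof -
  have "star f g (restrict \<alpha> (Ob (FA (Cod X f)))) (restrict \<beta> (Ob (FA (Cod X g)))) = star f g \<alpha> \<beta>"
    by (rule star_cong) (use assms in simp_all)
  moreover have "restrict \<gamma> (Ob (FA (Cod X g))) A = star f g \<alpha> \<beta> A" for A
  proof (cases "A \<in> Ob (FA (Cod X g))")
    case True
    then show ?thesis using cocycle_imp_star[OF assms(1,2,4-6) True assms(3) assms(7)] by simp
  qed (simp add: star_def)
  ultimately show ?thesis using assms by (simp add: fun_eq_iff)
qed

end

text \<open>An endofunctor \<open>\<Sigma>\<close> on all fibres, commuting with pull-backs through \<open>\<sigma>\<close> and with \<open>F\<close> through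
  \<open>bx\<close>.\<close>

locale shifted_fibration_map = fibration_map X FA PA PAa cA FB PB PBa cB Fo Fa
  for X :: "('x, 'f, 'z) cat_scheme" and FA :: "'x \<Rightarrow> ('a, 'b, 'w) cat_scheme" and PA PAa cA
    and FB :: "'x \<Rightarrow> ('c, 'd, 'v) cat_scheme" and PB PBa cB Fo Fa +
  fixes \<Sigma>A :: "'x \<Rightarrow> 'a \<Rightarrow> 'a" and \<Sigma>Aa :: "'x \<Rightarrow> 'b \<Rightarrow> 'b" and \<Sigma>B :: "'x \<Rightarrow> 'c \<Rightarrow> 'c" and \<Sigma>Ba :: "'x \<Rightarrow> 'd \<Rightarrow> 'd"
    and \<sigma>A :: "'f \<Rightarrow> 'a \<Rightarrow> 'b" and \<sigma>B :: "'f \<Rightarrow> 'c \<Rightarrow> 'd" and bx :: "'x \<Rightarrow> 'a \<Rightarrow> 'd"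
  assumes \<Sigma>A_functor: "s \<in> Ob X \<Longrightarrow> is_functor (FA s) (FA s) (\<Sigma>A s) (\<Sigma>Aa s)"
    and \<Sigma>B_functor: "s \<in> Ob X \<Longrightarrow> is_functor (FB s) (FB s) (\<Sigma>B s) (\<Sigma>Ba s)"
    and \<sigma>A_Hom: "f \<in> Ar X \<Longrightarrow> A \<in> Ob (FA (Cod X f)) \<Longrightarrow>
      \<sigma>A f A \<in> Hom (FA (Dom X f)) (PA f (\<Sigma>A (Cod X f) A)) (\<Sigma>A (Dom X f) (PA f A))"
    and \<sigma>B_nat: "f \<in> Ar X \<Longrightarrow> is_nat (FB (Cod X f)) (FB (Dom X f))
      (\<lambda>A. PB f (\<Sigma>B (Cod X f) A)) (\<lambda>\<phi>. PBa f (\<Sigma>Ba (Cod X f) \<phi>))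
      (\<lambda>A. \<Sigma>B (Dom X f) (PB f A)) (\<lambda>\<phi>. \<Sigma>Ba (Dom X f) (PBa f \<phi>)) (\<sigma>B f)"
    and bx_nat: "s \<in> Ob X \<Longrightarrow> is_nat (FA s) (FB s) (\<lambda>A. Fo s (\<Sigma>A s A)) (\<lambda>\<phi>. Fa s (\<Sigma>Aa s \<phi>))
      (\<lambda>A. \<Sigma>B s (Fo s A)) (\<lambda>\<phi>. \<Sigma>Ba s (Fa s \<phi>)) (bx s)"
    and \<sigma>A_cn: "f \<in> Ar X \<Longrightarrow> g \<in> Ar X \<Longrightarrow> Cod X f = Dom X g \<Longrightarrow> A \<in> Ob (FA (Cod X g)) \<Longrightarrow>
      \<sigma>A f (PA g A) \<cdot>\<^bsub>FA (Dom X f)\<^esub> PAa f (\<sigma>A g A) \<cdot>\<^bsub>FA (Dom X f)\<^esub> cA f g (\<Sigma>A (Cod X g) A) =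
      \<Sigma>Aa (Dom X f) (cA f g A) \<cdot>\<^bsub>FA (Dom X f)\<^esub> \<sigma>A (g \<cdot>\<^bsub>X\<^esub> f) A"
    and \<sigma>B_cn: "f \<in> Ar X \<Longrightarrow> g \<in> Ar X \<Longrightarrow> Cod X f = Dom X g \<Longrightarrow> A' \<in> Ob (FB (Cod X g)) \<Longrightarrow>
      \<sigma>B f (PB g A') \<cdot>\<^bsub>FB (Dom X f)\<^esub> PBa f (\<sigma>B g A') \<cdot>\<^bsub>FB (Dom X f)\<^esub> cB f g (\<Sigma>B (Cod X g) A') =
      \<Sigma>Ba (Dom X f) (cB f g A') \<cdot>\<^bsub>FB (Dom X f)\<^esub> \<sigma>B (g \<cdot>\<^bsub>X\<^esub> f) A'"
begin

lemma \<Sigma>A: "s \<in> Ob X \<Longrightarrow> functor_on (FA s) (FA s) (\<Sigma>A s) (\<Sigma>Aa s)"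
  and \<Sigma>B: "s \<in> Ob X \<Longrightarrow> functor_on (FB s) (FB s) (\<Sigma>B s) (\<Sigma>Ba s)"
  by (simp_all add: functor_on_def functor_on_axioms_def A.fib B.fib \<Sigma>A_functor \<Sigma>B_functor)

lemmas \<Sigma>_simps [simp] =
  functor_on.obj[OF \<Sigma>A] functor_on.arr[OF \<Sigma>A] functor_on.dom[OF \<Sigma>A] functor_on.cod[OF \<Sigma>A] functor_on.iso[OF \<Sigma>A]
  functor_on.obj[OF \<Sigma>B] functor_on.arr[OF \<Sigma>B] functor_on.dom[OF \<Sigma>B] functor_on.cod[OF \<Sigma>B] functor_on.iso[OF \<Sigma>B]

lemmas \<Sigma>A_cmp = functor_on.cmp[OF \<Sigma>A] and \<Sigma>B_cmp = functor_on.cmp[OF \<Sigma>B]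

lemma \<sigma>_simps [simp]:
  "f \<in> Ar X \<Longrightarrow> s = Dom X f \<Longrightarrow> A \<in> Ob (FA (Cod X f)) \<Longrightarrow> \<sigma>A f A \<in> Ar (FA s)"
  "f \<in> Ar X \<Longrightarrow> s = Dom X f \<Longrightarrow> A \<in> Ob (FA (Cod X f)) \<Longrightarrow> Dom (FA s) (\<sigma>A f A) = PA f (\<Sigma>A (Cod X f) A)"
  "f \<in> Ar X \<Longrightarrow> s = Dom X f \<Longrightarrow> A \<in> Ob (FA (Cod X f)) \<Longrightarrow> Cod (FA s) (\<sigma>A f A) = \<Sigma>A s (PA f A)"
  "f \<in> Ar X \<Longrightarrow> s = Dom X f \<Longrightarrow> A' \<in> Ob (FB (Cod X f)) \<Longrightarrow> \<sigma>B f A' \<in> Ar (FB s)"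
  "f \<in> Ar X \<Longrightarrow> s = Dom X f \<Longrightarrow> A' \<in> Ob (FB (Cod X f)) \<Longrightarrow> Dom (FB s) (\<sigma>B f A') = PB f (\<Sigma>B (Cod X f) A')"
  "f \<in> Ar X \<Longrightarrow> s = Dom X f \<Longrightarrow> A' \<in> Ob (FB (Cod X f)) \<Longrightarrow> Cod (FB s) (\<sigma>B f A') = \<Sigma>B s (PB f A')"
  using \<sigma>A_Hom[of f A] \<sigma>B_nat[of f] by (auto simp: Hom_def is_nat_def)

lemma bx_simps [simp]:
  "s \<in> Ob X \<Longrightarrow> A \<in> Ob (FA s) \<Longrightarrow> bx s A \<in> Ar (FB s)"
  "s \<in> Ob X \<Longrightarrow> A \<in> Ob (FA s) \<Longrightarrow> Dom (FB s) (bx s A) = Fo s (\<Sigma>A s A)"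
  "s \<in> Ob X \<Longrightarrow> A \<in> Ob (FA s) \<Longrightarrow> Cod (FB s) (bx s A) = \<Sigma>B s (Fo s A)"
  using bx_nat[of s] by (auto simp: Hom_def is_nat_def)

definition shift_compatible :: "'f \<Rightarrow> ('a \<Rightarrow> 'd) \<Rightarrow> bool" where
  "shift_compatible f \<alpha> \<longleftrightarrow> (\<forall>A\<in>Ob (FA (Cod X f)).
     \<sigma>B f (Fo (Cod X f) A) \<cdot>\<^bsub>FB (Dom X f)\<^esub> PBa f (bx (Cod X f) A) \<cdot>\<^bsub>FB (Dom X f)\<^esub> \<alpha> (\<Sigma>A (Cod X f) A) =
     \<Sigma>Ba (Dom X f) (\<alpha> A) \<cdot>\<^bsub>FB (Dom X f)\<^esub> bx (Dom X f) (PA f A) \<cdot>\<^bsub>FB (Dom X f)\<^esub> Fa (Dom X f) (\<sigma>A f A))"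

lemma star_shift_compatible:
  assumes a: "family f \<alpha>" "family g \<beta>" and f: "f \<in> Ar X" and g: "g \<in> Ar X" and c: "Cod X f = Dom X g"
    and sc: "shift_compatible f \<alpha>" "shift_compatible g \<beta>"
  shows "shift_compatible (g \<cdot>\<^bsub>X\<^esub> f) (star f g \<alpha> \<beta>)"
  unfolding shift_compatible_def
proof
  let ?D = "FB (Dom X f)" and ?E = "FB (Cod X f)" and ?s = "Dom X f" and ?t = "Cod X f" and ?u = "Cod X g" and ?h = "g \<cdot>\<^bsub>X\<^esub> f"
  interpret D: category ?D using f by (simp add: B.fib)
  fix A assume "A \<in> Ob (FA (Cod X ?h))"
  then have A: "A \<in> Ob (FA ?u)" using f g c by simp
  let ?\<gamma> = "star f g \<alpha> \<beta>" and ?FA = "Fo ?u A" and ?SA = "\<Sigma>A ?u A"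
  have u: "?u \<in> Ob X" and SA: "?SA \<in> Ob (FA ?u)" using g A by simp_all
  note S = a f g c A u
  note st = star_arrow[OF a f g c]
  note cc = star_cocycle[OF a f g c, unfolded cocycle_at_def]
  have \<sigma>Bn: "\<sigma>B f (Cod ?E \<phi>) \<cdot>\<^bsub>?D\<^esub> PBa f (\<Sigma>Ba ?t \<phi>) = \<Sigma>Ba ?s (PBa f \<phi>) \<cdot>\<^bsub>?D\<^esub> \<sigma>B f (Dom ?E \<phi>)"
    if "\<phi> \<in> Ar ?E" for \<phi>
    using \<sigma>B_nat[OF f] that by (auto simp: is_nat_def)
  have bxn: "\<Sigma>Ba ?s (Fa ?s \<phi>) \<cdot>\<^bsub>?D\<^esub> bx ?s (Dom (FA ?s) \<phi>) = bx ?s (Cod (FA ?s) \<phi>) \<cdot>\<^bsub>?D\<^esub> Fa ?s (\<Sigma>Aa ?s \<phi>)"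
    if "\<phi> \<in> Ar (FA ?s)" for \<phi>
    using bx_nat[of ?s] f that by (auto simp: is_nat_def)
  have "\<Sigma>Ba ?s (cB f g ?FA) \<cdot>\<^bsub>?D\<^esub> \<sigma>B ?h ?FA \<cdot>\<^bsub>?D\<^esub> PBa ?h (bx ?u A) \<cdot>\<^bsub>?D\<^esub> ?\<gamma> ?SA
      = (\<sigma>B f (PB g ?FA) \<cdot>\<^bsub>?D\<^esub> PBa f (\<sigma>B g ?FA) \<cdot>\<^bsub>?D\<^esub> cB f g (\<Sigma>B ?u ?FA)) \<cdot>\<^bsub>?D\<^esub> PBa ?h (bx ?u A) \<cdot>\<^bsub>?D\<^esub> ?\<gamma> ?SA"
    by (subst \<sigma>B_cn) (use S SA st in simp_all)
  also have "\<dots> = \<sigma>B f (PB g ?FA) \<cdot>\<^bsub>?D\<^esub> PBa f (\<sigma>B g ?FA) \<cdot>\<^bsub>?D\<^esub> (cB f g (\<Sigma>B ?u ?FA) \<cdot>\<^bsub>?D\<^esub> PBa ?h (bx ?u A)) \<cdot>\<^bsub>?D\<^esub> ?\<gamma> ?SA"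
    using S SA st by simp
  also have "cB f g (\<Sigma>B ?u ?FA) \<cdot>\<^bsub>?D\<^esub> PBa ?h (bx ?u A) = PBa f (PBa g (bx ?u A)) \<cdot>\<^bsub>?D\<^esub> cB f g (Fo ?u ?SA)"
    using B.cn_nat[of f g ?s ?u "bx ?u A"] S by simp
  also have "\<sigma>B f (PB g ?FA) \<cdot>\<^bsub>?D\<^esub> PBa f (\<sigma>B g ?FA) \<cdot>\<^bsub>?D\<^esub> (PBa f (PBa g (bx ?u A)) \<cdot>\<^bsub>?D\<^esub> cB f g (Fo ?u ?SA)) \<cdot>\<^bsub>?D\<^esub> ?\<gamma> ?SA
      = \<sigma>B f (PB g ?FA) \<cdot>\<^bsub>?D\<^esub> PBa f (\<sigma>B g ?FA) \<cdot>\<^bsub>?D\<^esub> PBa f (PBa g (bx ?u A)) \<cdot>\<^bsub>?D\<^esub> (cB f g (Fo ?u ?SA) \<cdot>\<^bsub>?D\<^esub> ?\<gamma> ?SA)"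
    using S SA st by simp
  also have "\<dots> = \<sigma>B f (PB g ?FA) \<cdot>\<^bsub>?D\<^esub> PBa f (\<sigma>B g ?FA \<cdot>\<^bsub>?E\<^esub> PBa g (bx ?u A) \<cdot>\<^bsub>?E\<^esub> \<beta> ?SA) \<cdot>\<^bsub>?D\<^esub> \<alpha> (PA g ?SA) \<cdot>\<^bsub>?D\<^esub> Fa ?s (cA f g ?SA)"
    by (subst cc[OF SA]) (use S SA st in \<open>simp_all add: B.Pa_cmp\<close>)
  also have "\<sigma>B g ?FA \<cdot>\<^bsub>?E\<^esub> PBa g (bx ?u A) \<cdot>\<^bsub>?E\<^esub> \<beta> ?SA = \<Sigma>Ba ?t (\<beta> A) \<cdot>\<^bsub>?E\<^esub> bx ?t (PA g A) \<cdot>\<^bsub>?E\<^esub> Fa ?t (\<sigma>A g A)"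
    using sc(2) A c by (simp add: shift_compatible_def)
  also have "\<sigma>B f (PB g ?FA) \<cdot>\<^bsub>?D\<^esub> PBa f (\<Sigma>Ba ?t (\<beta> A) \<cdot>\<^bsub>?E\<^esub> bx ?t (PA g A) \<cdot>\<^bsub>?E\<^esub> Fa ?t (\<sigma>A g A)) \<cdot>\<^bsub>?D\<^esub> \<alpha> (PA g ?SA) \<cdot>\<^bsub>?D\<^esub> Fa ?s (cA f g ?SA)
      = (\<sigma>B f (PB g ?FA) \<cdot>\<^bsub>?D\<^esub> PBa f (\<Sigma>Ba ?t (\<beta> A))) \<cdot>\<^bsub>?D\<^esub> PBa f (bx ?t (PA g A)) \<cdot>\<^bsub>?D\<^esub> (PBa f (Fa ?t (\<sigma>A g A)) \<cdot>\<^bsub>?D\<^esub> \<alpha> (PA g ?SA)) \<cdot>\<^bsub>?D\<^esub> Fa ?s (cA f g ?SA)"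
    using S SA by (simp add: B.Pa_cmp)
  also have "\<sigma>B f (PB g ?FA) \<cdot>\<^bsub>?D\<^esub> PBa f (\<Sigma>Ba ?t (\<beta> A)) = \<Sigma>Ba ?s (PBa f (\<beta> A)) \<cdot>\<^bsub>?D\<^esub> \<sigma>B f (Fo ?t (PA g A))"
    using \<sigma>Bn[of "\<beta> A"] S by simp
  also have "PBa f (Fa ?t (\<sigma>A g A)) \<cdot>\<^bsub>?D\<^esub> \<alpha> (PA g ?SA) = \<alpha> (\<Sigma>A ?t (PA g A)) \<cdot>\<^bsub>?D\<^esub> Fa ?s (PAa f (\<sigma>A g A))"
    using family_nat[OF a(1) f, of "\<sigma>A g A"] S by simp
  also have "(\<Sigma>Ba ?s (PBa f (\<beta> A)) \<cdot>\<^bsub>?D\<^esub> \<sigma>B f (Fo ?t (PA g A))) \<cdot>\<^bsub>?D\<^esub> PBa f (bx ?t (PA g A)) \<cdot>\<^bsub>?D\<^esub>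
        (\<alpha> (\<Sigma>A ?t (PA g A)) \<cdot>\<^bsub>?D\<^esub> Fa ?s (PAa f (\<sigma>A g A))) \<cdot>\<^bsub>?D\<^esub> Fa ?s (cA f g ?SA)
      = \<Sigma>Ba ?s (PBa f (\<beta> A)) \<cdot>\<^bsub>?D\<^esub> (\<sigma>B f (Fo ?t (PA g A)) \<cdot>\<^bsub>?D\<^esub> PBa f (bx ?t (PA g A)) \<cdot>\<^bsub>?D\<^esub>
        \<alpha> (\<Sigma>A ?t (PA g A))) \<cdot>\<^bsub>?D\<^esub> Fa ?s (PAa f (\<sigma>A g A)) \<cdot>\<^bsub>?D\<^esub> Fa ?s (cA f g ?SA)"
    using S SA by simp
  also have "\<sigma>B f (Fo ?t (PA g A)) \<cdot>\<^bsub>?D\<^esub> PBa f (bx ?t (PA g A)) \<cdot>\<^bsub>?D\<^esub> \<alpha> (\<Sigma>A ?t (PA g A))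
      = \<Sigma>Ba ?s (\<alpha> (PA g A)) \<cdot>\<^bsub>?D\<^esub> bx ?s (PA f (PA g A)) \<cdot>\<^bsub>?D\<^esub> Fa ?s (\<sigma>A f (PA g A))"
    using sc(1) S by (simp add: shift_compatible_def)
  also have "\<Sigma>Ba ?s (PBa f (\<beta> A)) \<cdot>\<^bsub>?D\<^esub> (\<Sigma>Ba ?s (\<alpha> (PA g A)) \<cdot>\<^bsub>?D\<^esub> bx ?s (PA f (PA g A)) \<cdot>\<^bsub>?D\<^esub> Fa ?s (\<sigma>A f (PA g A))) \<cdot>\<^bsub>?D\<^esub>
        Fa ?s (PAa f (\<sigma>A g A)) \<cdot>\<^bsub>?D\<^esub> Fa ?s (cA f g ?SA)
      = \<Sigma>Ba ?s (PBa f (\<beta> A) \<cdot>\<^bsub>?D\<^esub> \<alpha> (PA g A)) \<cdot>\<^bsub>?D\<^esub> bx ?s (PA f (PA g A)) \<cdot>\<^bsub>?D\<^esub>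
        Fa ?s (\<sigma>A f (PA g A) \<cdot>\<^bsub>FA ?s\<^esub> PAa f (\<sigma>A g A) \<cdot>\<^bsub>FA ?s\<^esub> cA f g ?SA)"
    using S SA by (simp add: Fa_cmp \<Sigma>B_cmp)
  also have "\<sigma>A f (PA g A) \<cdot>\<^bsub>FA ?s\<^esub> PAa f (\<sigma>A g A) \<cdot>\<^bsub>FA ?s\<^esub> cA f g ?SA = \<Sigma>Aa ?s (cA f g A) \<cdot>\<^bsub>FA ?s\<^esub> \<sigma>A ?h A"
    by (rule \<sigma>A_cn[OF f g c A])
  also have "\<Sigma>Ba ?s (PBa f (\<beta> A) \<cdot>\<^bsub>?D\<^esub> \<alpha> (PA g A)) \<cdot>\<^bsub>?D\<^esub> bx ?s (PA f (PA g A)) \<cdot>\<^bsub>?D\<^esub> Fa ?s (\<Sigma>Aa ?s (cA f g A) \<cdot>\<^bsub>FA ?s\<^esub> \<sigma>A ?h A)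
      = \<Sigma>Ba ?s (PBa f (\<beta> A) \<cdot>\<^bsub>?D\<^esub> \<alpha> (PA g A)) \<cdot>\<^bsub>?D\<^esub> (bx ?s (PA f (PA g A)) \<cdot>\<^bsub>?D\<^esub> Fa ?s (\<Sigma>Aa ?s (cA f g A))) \<cdot>\<^bsub>?D\<^esub> Fa ?s (\<sigma>A ?h A)"
    using S by (simp add: Fa_cmp)
  also have "bx ?s (PA f (PA g A)) \<cdot>\<^bsub>?D\<^esub> Fa ?s (\<Sigma>Aa ?s (cA f g A)) = \<Sigma>Ba ?s (Fa ?s (cA f g A)) \<cdot>\<^bsub>?D\<^esub> bx ?s (PA ?h A)"
    using bxn[of "cA f g A"] S by simp
  also have "\<Sigma>Ba ?s (PBa f (\<beta> A) \<cdot>\<^bsub>?D\<^esub> \<alpha> (PA g A)) \<cdot>\<^bsub>?D\<^esub> (\<Sigma>Ba ?s (Fa ?s (cA f g A)) \<cdot>\<^bsub>?D\<^esub> bx ?s (PA ?h A)) \<cdot>\<^bsub>?D\<^esub> Fa ?s (\<sigma>A ?h A)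
      = \<Sigma>Ba ?s (PBa f (\<beta> A) \<cdot>\<^bsub>?D\<^esub> \<alpha> (PA g A) \<cdot>\<^bsub>?D\<^esub> Fa ?s (cA f g A)) \<cdot>\<^bsub>?D\<^esub> bx ?s (PA ?h A) \<cdot>\<^bsub>?D\<^esub> Fa ?s (\<sigma>A ?h A)"
    using S by (simp add: \<Sigma>B_cmp)
  also have "\<dots> = \<Sigma>Ba ?s (cB f g ?FA) \<cdot>\<^bsub>?D\<^esub> \<Sigma>Ba ?s (?\<gamma> A) \<cdot>\<^bsub>?D\<^esub> bx ?s (PA ?h A) \<cdot>\<^bsub>?D\<^esub> Fa ?s (\<sigma>A ?h A)"
    by (subst cc[OF A, symmetric]) (use S st in \<open>simp add: \<Sigma>B_cmp\<close>)
  finally have "\<sigma>B ?h ?FA \<cdot>\<^bsub>?D\<^esub> PBa ?h (bx ?u A) \<cdot>\<^bsub>?D\<^esub> ?\<gamma> ?SA = \<Sigma>Ba ?s (?\<gamma> A) \<cdot>\<^bsub>?D\<^esub> bx ?s (PA ?h A) \<cdot>\<^bsub>?D\<^esub> Fa ?s (\<sigma>A ?h A)"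
    by (rule D.Iso_cancel_left[rotated 5]) (use S SA st in simp_all)
  then show "\<sigma>B ?h (Fo (Cod X ?h) A) \<cdot>\<^bsub>FB (Dom X ?h)\<^esub> PBa ?h (bx (Cod X ?h) A) \<cdot>\<^bsub>FB (Dom X ?h)\<^esub> ?\<gamma> (\<Sigma>A (Cod X ?h) A) =
      \<Sigma>Ba (Dom X ?h) (?\<gamma> A) \<cdot>\<^bsub>FB (Dom X ?h)\<^esub> bx (Dom X ?h) (PA ?h A) \<cdot>\<^bsub>FB (Dom X ?h)\<^esub> Fa (Dom X ?h) (\<sigma>A ?h A)"
    using f g c by simp
qed

end

section \<open>Mates\<close>

text \<open>\<open>z\<close> stands for a pull-back \<open>z\<^sup>*\<close>, \<open>r\<close> for its fully faithful right adjoint \<open>z\<^sub>*\<close>, on the source and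
  on the target of a functor \<open>F\<close> given on the two fibres.\<close>

locale mate_square =
  LA: adj AS AZ zA zAa rA rAa etA epA + LB: adj BS BZ zB zBa rB rBa etB epB +
  GS: functor_on AS BS FS FSa + GZ: functor_on AZ BZ FZ FZa
  for AS :: "('a, 'b, 'w) cat_scheme" and AZ :: "('a, 'b, 'w) cat_scheme" and zA zAa rA rAa etA epA
    and BS :: "('c, 'd, 'v) cat_scheme" and BZ :: "('c, 'd, 'v) cat_scheme" and zB zBa rB rBa etB epB FS FSa FZ FZa +
  assumes epA_Iso [simp]: "A \<in> Ob AZ \<Longrightarrow> epA A \<in> Iso AZ"
    and epB_Iso [simp]: "A' \<in> Ob BZ \<Longrightarrow> epB A' \<in> Iso BZ"
begin

definition comparison :: "('a \<Rightarrow> 'd) \<Rightarrow> bool" where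
  "comparison m \<longleftrightarrow> is_nat_iso AS BZ (\<lambda>A. FZ (zA A)) (\<lambda>\<phi>. FZa (zAa \<phi>)) (\<lambda>A. zB (FS A)) (\<lambda>\<phi>. zBa (FSa \<phi>)) m"

definition low_comparison :: "('a \<Rightarrow> 'd) \<Rightarrow> bool" where
  "low_comparison mb \<longleftrightarrow> is_nat AZ BS (\<lambda>A. FS (rA A)) (\<lambda>\<phi>. FSa (rAa \<phi>)) (\<lambda>A. rB (FZ A)) (\<lambda>\<phi>. rBa (FZa \<phi>)) mb"

text \<open>For invertible \<open>m\<close> this says that the transpose of \<open>mb A\<close> is \<open>F \<epsilon>\<close> composed with the inverse of
  \<open>m\<close>. As an equation between \<open>m\<close> and \<open>mb\<close> it can serve to define either of the two from the other.\<close>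

definition mate_at :: "('a \<Rightarrow> 'd) \<Rightarrow> ('a \<Rightarrow> 'd) \<Rightarrow> 'a \<Rightarrow> bool" where
  "mate_at m mb A \<longleftrightarrow> epB (FZ A) \<cdot>\<^bsub>BZ\<^esub> zBa (mb A) \<cdot>\<^bsub>BZ\<^esub> m (rA A) = FZa (epA A)"

definition mbar :: "('a \<Rightarrow> 'd) \<Rightarrow> 'a \<Rightarrow> 'd" where
  "mbar m A = rBa (FZa (epA A)) \<cdot>\<^bsub>BS\<^esub> rBa (inv_ar BZ (m (rA A))) \<cdot>\<^bsub>BS\<^esub> etB (FS (rA A))"

definition minv :: "('a \<Rightarrow> 'd) \<Rightarrow> 'a \<Rightarrow> 'd" where
  "minv mb A = epB (FZ (zA A)) \<cdot>\<^bsub>BZ\<^esub> zBa (mb (zA A)) \<cdot>\<^bsub>BZ\<^esub> zBa (FSa (etA A))"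

lemma comparisonD [simp]:
  assumes "comparison m" "A \<in> Ob AS"
  shows "m A \<in> Ar BZ" "Dom BZ (m A) = FZ (zA A)" "Cod BZ (m A) = zB (FS A)" "m A \<in> Iso BZ"
  using assms by (auto simp: comparison_def is_nat_iso_def is_nat_def Hom_def)

lemma comparison_nat:
  assumes "comparison m" "\<phi> \<in> Ar AS"
  shows "zBa (FSa \<phi>) \<cdot>\<^bsub>BZ\<^esub> m (Dom AS \<phi>) = m (Cod AS \<phi>) \<cdot>\<^bsub>BZ\<^esub> FZa (zAa \<phi>)"
  using assms by (auto simp: comparison_def is_nat_iso_def is_nat_def)

lemma low_comparisonD [simp]:
  assumes "low_comparison mb" "A \<in> Ob AZ"
  shows "mb A \<in> Ar BS" "Dom BS (mb A) = FS (rA A)" "Cod BS (mb A) = rB (FZ A)"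
  using assms by (auto simp: low_comparison_def is_nat_def Hom_def)

lemma low_comparison_nat:
  assumes "low_comparison mb" "\<phi> \<in> Ar AZ"
  shows "rBa (FZa \<phi>) \<cdot>\<^bsub>BS\<^esub> mb (Dom AZ \<phi>) = mb (Cod AZ \<phi>) \<cdot>\<^bsub>BS\<^esub> FSa (rAa \<phi>)"
  using assms by (auto simp: low_comparison_def is_nat_def)

lemma mbar_arrow [simp]:
  assumes "comparison m" "A \<in> Ob AZ"
  shows "mbar m A \<in> Ar BS" "Dom BS (mbar m A) = FS (rA A)" "Cod BS (mbar m A) = rB (FZ A)"
  using assms by (simp_all add: mbar_def)

lemma mbar_mate:
  assumes "comparison m" "A \<in> Ob AZ"
  shows "mate_at m (mbar m) A"
proof -
  let ?g = "FZa (epA A) \<cdot>\<^bsub>BZ\<^esub> inv_ar BZ (m (rA A))"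
  have "mbar m A = rBa ?g \<cdot>\<^bsub>BS\<^esub> etB (FS (rA A))"
    using assms by (simp add: mbar_def LB.R.cmp)
  then have "epB (FZ A) \<cdot>\<^bsub>BZ\<^esub> zBa (mbar m A) = ?g"
    using LB.transpose[of ?g "FS (rA A)"] assms by simp
  then have "(epB (FZ A) \<cdot>\<^bsub>BZ\<^esub> zBa (mbar m A)) \<cdot>\<^bsub>BZ\<^esub> m (rA A) = FZa (epA A)"
    using assms by simp
  then show ?thesis using assms by (simp add: mate_at_def)
qed

lemma mate_unique:
  assumes "comparison m" "A \<in> Ob AZ" "mate_at m mb A" "mate_at m mb' A"
    and "mb A \<in> Ar BS" "Dom BS (mb A) = FS (rA A)" "Cod BS (mb A) = rB (FZ A)"
    and "mb' A \<in> Ar BS" "Dom BS (mb' A) = FS (rA A)" "Cod BS (mb' A) = rB (FZ A)"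
  shows "mb A = mb' A"
proof (rule LB.transpose_inj[where b = "FZ A"])
  have "(epB (FZ A) \<cdot>\<^bsub>BZ\<^esub> zBa (mb A)) \<cdot>\<^bsub>BZ\<^esub> m (rA A) = (epB (FZ A) \<cdot>\<^bsub>BZ\<^esub> zBa (mb' A)) \<cdot>\<^bsub>BZ\<^esub> m (rA A)"
    using assms by (simp add: mate_at_def)
  then show "epB (FZ A) \<cdot>\<^bsub>BZ\<^esub> zBa (mb A) = epB (FZ A) \<cdot>\<^bsub>BZ\<^esub> zBa (mb' A)"
    by (rule LB.L.D.Iso_cancel_right[rotated 5]) (use assms in simp_all)
qed (use assms in simp_all)

lemma mate_counit_Iso:
  assumes "comparison m" "A \<in> Ob AZ" "mate_at m mb A"
    and "mb A \<in> Ar BS" "Dom BS (mb A) = FS (rA A)" "Cod BS (mb A) = rB (FZ A)"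
  shows "epB (FZ A) \<cdot>\<^bsub>BZ\<^esub> zBa (mb A) \<in> Iso BZ"
proof (rule LB.L.D.Iso_left_factor[where f = "m (rA A)"])
  show "(epB (FZ A) \<cdot>\<^bsub>BZ\<^esub> zBa (mb A)) \<cdot>\<^bsub>BZ\<^esub> m (rA A) \<in> Iso BZ"
    using assms by (simp add: mate_at_def)
qed (use assms in simp_all)

lemma mate_pull_Iso:
  assumes "comparison m" "A \<in> Ob AZ" "mate_at m mb A"
    and "mb A \<in> Ar BS" "Dom BS (mb A) = FS (rA A)" "Cod BS (mb A) = rB (FZ A)"
  shows "zBa (mb A) \<in> Iso BZ"
  by (rule LB.L.D.Iso_right_factor[OF _ _ _ mate_counit_Iso[OF assms]]) (use assms in simp_all)

lemma mbar_low_comparison: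
  assumes m: "comparison m" shows "low_comparison (mbar m)"
  unfolding low_comparison_def
proof (rule is_natI)
  fix \<phi> assume \<phi>: "\<phi> \<in> Ar AZ"
  let ?A = "Dom AZ \<phi>" and ?A' = "Cod AZ \<phi>"
  have ob: "?A \<in> Ob AZ" "?A' \<in> Ob AZ" using \<phi> by simp_all
  note S = m \<phi> ob
  have M: "epB (FZ A) \<cdot>\<^bsub>BZ\<^esub> zBa (mbar m A) \<cdot>\<^bsub>BZ\<^esub> m (rA A) = FZa (epA A)" if "A \<in> Ob AZ" for A
    using mbar_mate[OF m that] by (simp add: mate_at_def)
  show "rBa (FZa \<phi>) \<cdot>\<^bsub>BS\<^esub> mbar m ?A = mbar m ?A' \<cdot>\<^bsub>BS\<^esub> FSa (rAa \<phi>)"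
  proof (rule LB.transpose_inj[where b = "FZ ?A'"])
    let ?l = "epB (FZ ?A') \<cdot>\<^bsub>BZ\<^esub> zBa (rBa (FZa \<phi>) \<cdot>\<^bsub>BS\<^esub> mbar m ?A)"
    let ?r = "epB (FZ ?A') \<cdot>\<^bsub>BZ\<^esub> zBa (mbar m ?A' \<cdot>\<^bsub>BS\<^esub> FSa (rAa \<phi>))"
    have "?l \<cdot>\<^bsub>BZ\<^esub> m (rA ?A) = (epB (FZ ?A') \<cdot>\<^bsub>BZ\<^esub> zBa (rBa (FZa \<phi>))) \<cdot>\<^bsub>BZ\<^esub> zBa (mbar m ?A) \<cdot>\<^bsub>BZ\<^esub> m (rA ?A)"
      using S by (simp add: LB.L.cmp)
    also have "epB (FZ ?A') \<cdot>\<^bsub>BZ\<^esub> zBa (rBa (FZa \<phi>)) = FZa \<phi> \<cdot>\<^bsub>BZ\<^esub> epB (FZ ?A)"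
      using LB.counit_nat[of "FZa \<phi>"] S by simp
    also have "(FZa \<phi> \<cdot>\<^bsub>BZ\<^esub> epB (FZ ?A)) \<cdot>\<^bsub>BZ\<^esub> zBa (mbar m ?A) \<cdot>\<^bsub>BZ\<^esub> m (rA ?A) = FZa \<phi> \<cdot>\<^bsub>BZ\<^esub> FZa (epA ?A)"
      using S M[of ?A] by simp
    also have "\<dots> = FZa (epA ?A' \<cdot>\<^bsub>AZ\<^esub> zAa (rAa \<phi>))"
      using S LA.counit_nat[of \<phi> ?A ?A'] by (simp add: GZ.cmp[symmetric])
    also have "\<dots> = (epB (FZ ?A') \<cdot>\<^bsub>BZ\<^esub> zBa (mbar m ?A') \<cdot>\<^bsub>BZ\<^esub> m (rA ?A')) \<cdot>\<^bsub>BZ\<^esub> FZa (zAa (rAa \<phi>))"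
      using S M[of ?A'] by (simp add: GZ.cmp)
    also have "\<dots> = epB (FZ ?A') \<cdot>\<^bsub>BZ\<^esub> zBa (mbar m ?A') \<cdot>\<^bsub>BZ\<^esub> (m (rA ?A') \<cdot>\<^bsub>BZ\<^esub> FZa (zAa (rAa \<phi>)))"
      using S by simp
    also have "m (rA ?A') \<cdot>\<^bsub>BZ\<^esub> FZa (zAa (rAa \<phi>)) = zBa (FSa (rAa \<phi>)) \<cdot>\<^bsub>BZ\<^esub> m (rA ?A)"
      using S comparison_nat[OF m, of "rAa \<phi>"] by simp
    also have "epB (FZ ?A') \<cdot>\<^bsub>BZ\<^esub> zBa (mbar m ?A') \<cdot>\<^bsub>BZ\<^esub> (zBa (FSa (rAa \<phi>)) \<cdot>\<^bsub>BZ\<^esub> m (rA ?A)) = ?r \<cdot>\<^bsub>BZ\<^esub> m (rA ?A)"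
      using S by (simp add: LB.L.cmp)
    finally show "?l = ?r"
      by (rule LB.L.D.Iso_cancel_right[rotated 5]) (use S in simp_all)
  qed (use S in simp_all)
qed (use m in simp_all)

lemma minv_arrow [simp]:
  assumes "A \<in> Ob AS" "mb (zA A) \<in> Ar BS" "Dom BS (mb (zA A)) = FS (rA (zA A))" "Cod BS (mb (zA A)) = rB (FZ (zA A))"
  shows "minv mb A \<in> Ar BZ" "Dom BZ (minv mb A) = zB (FS A)" "Cod BZ (minv mb A) = FZ (zA A)"
  using assms by (simp_all add: minv_def)

text \<open>The mate condition determines \<open>m\<close> from \<open>mb\<close>: by naturality of \<open>m\<close> along the unit \<open>A \<rightarrow> z\<^sub>* z\<^sup>* A\<close> and a
  triangle identity, \<open>m A\<close> is a right inverse of \<open>minv mb A\<close>.\<close>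

lemma minv_eq:
  assumes m: "comparison m" and A: "A \<in> Ob AS" and M: "mate_at m mb (zA A)"
    and mb: "mb (zA A) \<in> Ar BS" "Dom BS (mb (zA A)) = FS (rA (zA A))" "Cod BS (mb (zA A)) = rB (FZ (zA A))"
  shows "minv mb A \<in> Iso BZ" "inv_ar BZ (minv mb A) = m A"
proof -
  note S = m A mb
  have "minv mb A \<cdot>\<^bsub>BZ\<^esub> m A = epB (FZ (zA A)) \<cdot>\<^bsub>BZ\<^esub> zBa (mb (zA A)) \<cdot>\<^bsub>BZ\<^esub> (zBa (FSa (etA A)) \<cdot>\<^bsub>BZ\<^esub> m A)"
    using S by (simp add: minv_def)
  also have "zBa (FSa (etA A)) \<cdot>\<^bsub>BZ\<^esub> m A = m (rA (zA A)) \<cdot>\<^bsub>BZ\<^esub> FZa (zAa (etA A))"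
    using comparison_nat[OF m, of "etA A"] S by simp
  also have "epB (FZ (zA A)) \<cdot>\<^bsub>BZ\<^esub> zBa (mb (zA A)) \<cdot>\<^bsub>BZ\<^esub> (m (rA (zA A)) \<cdot>\<^bsub>BZ\<^esub> FZa (zAa (etA A)))
      = (epB (FZ (zA A)) \<cdot>\<^bsub>BZ\<^esub> zBa (mb (zA A)) \<cdot>\<^bsub>BZ\<^esub> m (rA (zA A))) \<cdot>\<^bsub>BZ\<^esub> FZa (zAa (etA A))"
    using S by simp
  also have "\<dots> = FZa (epA (zA A)) \<cdot>\<^bsub>BZ\<^esub> FZa (zAa (etA A))"
    using M by (simp add: mate_at_def)
  also have "\<dots> = Idn BZ (FZ (zA A))"
    using A by (simp add: GZ.cmp[symmetric])
  finally have eq: "minv mb A \<cdot>\<^bsub>BZ\<^esub> m A = Idn BZ (FZ (zA A))" .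
  show iso: "minv mb A \<in> Iso BZ"
    by (rule LB.L.D.Iso_left_factor[where f = "m A"]) (use S eq in simp_all)
  show "inv_ar BZ (minv mb A) = m A"
    by (rule LB.L.D.Iso_of_right_inverse[OF iso]) (use S eq in simp_all)
qed

lemma minv_nat:
  assumes mb: "low_comparison mb" and \<phi>: "\<phi> \<in> Ar AS"
  shows "FZa (zAa \<phi>) \<cdot>\<^bsub>BZ\<^esub> minv mb (Dom AS \<phi>) = minv mb (Cod AS \<phi>) \<cdot>\<^bsub>BZ\<^esub> zBa (FSa \<phi>)"
proof -
  let ?A = "Dom AS \<phi>" and ?A' = "Cod AS \<phi>"
  have ob: "?A \<in> Ob AS" "?A' \<in> Ob AS" using \<phi> by simp_all
  note S = mb \<phi> ob
  have "FZa (zAa \<phi>) \<cdot>\<^bsub>BZ\<^esub> minv mb ?A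
      = (FZa (zAa \<phi>) \<cdot>\<^bsub>BZ\<^esub> epB (FZ (zA ?A))) \<cdot>\<^bsub>BZ\<^esub> zBa (mb (zA ?A)) \<cdot>\<^bsub>BZ\<^esub> zBa (FSa (etA ?A))"
    using S by (simp add: minv_def)
  also have "FZa (zAa \<phi>) \<cdot>\<^bsub>BZ\<^esub> epB (FZ (zA ?A)) = epB (FZ (zA ?A')) \<cdot>\<^bsub>BZ\<^esub> zBa (rBa (FZa (zAa \<phi>)))"
    using LB.counit_nat[of "FZa (zAa \<phi>)"] S by simp
  also have "(epB (FZ (zA ?A')) \<cdot>\<^bsub>BZ\<^esub> zBa (rBa (FZa (zAa \<phi>)))) \<cdot>\<^bsub>BZ\<^esub> zBa (mb (zA ?A)) \<cdot>\<^bsub>BZ\<^esub> zBa (FSa (etA ?A))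
      = epB (FZ (zA ?A')) \<cdot>\<^bsub>BZ\<^esub> zBa ((rBa (FZa (zAa \<phi>)) \<cdot>\<^bsub>BS\<^esub> mb (zA ?A)) \<cdot>\<^bsub>BS\<^esub> FSa (etA ?A))"
    using S by (simp add: LB.L.cmp)
  also have "rBa (FZa (zAa \<phi>)) \<cdot>\<^bsub>BS\<^esub> mb (zA ?A) = mb (zA ?A') \<cdot>\<^bsub>BS\<^esub> FSa (rAa (zAa \<phi>))"
    using low_comparison_nat[OF mb, of "zAa \<phi>"] S by simp
  also have "(mb (zA ?A') \<cdot>\<^bsub>BS\<^esub> FSa (rAa (zAa \<phi>))) \<cdot>\<^bsub>BS\<^esub> FSa (etA ?A) = mb (zA ?A') \<cdot>\<^bsub>BS\<^esub> FSa (etA ?A') \<cdot>\<^bsub>BS\<^esub> FSa \<phi>"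
    using S LA.unit_nat[of \<phi> ?A ?A'] by (simp add: GS.cmp[symmetric])
  also have "epB (FZ (zA ?A')) \<cdot>\<^bsub>BZ\<^esub> zBa (mb (zA ?A') \<cdot>\<^bsub>BS\<^esub> FSa (etA ?A') \<cdot>\<^bsub>BS\<^esub> FSa \<phi>) = minv mb ?A' \<cdot>\<^bsub>BZ\<^esub> zBa (FSa \<phi>)"
    using S by (simp add: minv_def LB.L.cmp)
  finally show ?thesis .
qed

lemma comparison_of_minv:
  assumes mb: "low_comparison mb" and iso: "\<And>A. A \<in> Ob AS \<Longrightarrow> minv mb A \<in> Iso BZ"
  shows "comparison (\<lambda>A. inv_ar BZ (minv mb A))"
proof -
  have "zBa (FSa \<phi>) \<cdot>\<^bsub>BZ\<^esub> inv_ar BZ (minv mb (Dom AS \<phi>)) = inv_ar BZ (minv mb (Cod AS \<phi>)) \<cdot>\<^bsub>BZ\<^esub> FZa (zAa \<phi>)"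
    if \<phi>: "\<phi> \<in> Ar AS" for \<phi>
  proof -
    let ?A = "Dom AS \<phi>" and ?A' = "Cod AS \<phi>"
    have ob: "?A \<in> Ob AS" "?A' \<in> Ob AS" using \<phi> by simp_all
    note S = mb \<phi> ob iso[OF ob(1)] iso[OF ob(2)]
    have "zBa (FSa \<phi>) \<cdot>\<^bsub>BZ\<^esub> inv_ar BZ (minv mb ?A)
        = inv_ar BZ (minv mb ?A') \<cdot>\<^bsub>BZ\<^esub> (minv mb ?A' \<cdot>\<^bsub>BZ\<^esub> zBa (FSa \<phi>)) \<cdot>\<^bsub>BZ\<^esub> inv_ar BZ (minv mb ?A)"
      using S by simp
    also have "\<dots> = inv_ar BZ (minv mb ?A') \<cdot>\<^bsub>BZ\<^esub> (FZa (zAa \<phi>) \<cdot>\<^bsub>BZ\<^esub> minv mb ?A) \<cdot>\<^bsub>BZ\<^esub> inv_ar BZ (minv mb ?A)"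
      by (simp only: minv_nat[OF mb \<phi>])
    also have "\<dots> = inv_ar BZ (minv mb ?A') \<cdot>\<^bsub>BZ\<^esub> FZa (zAa \<phi>)" using S by simp
    finally show ?thesis .
  qed
  then show ?thesis
    unfolding comparison_def is_nat_iso_def using mb iso by (auto intro!: is_natI)
qed

text \<open>Conversely, \<open>minv mb\<close> at \<open>z\<^sub>*A\<close> composed with \<open>F \<epsilon>\<close> is the transpose of \<open>mb A\<close>, by naturality of \<open>mb\<close> along
  the counit.\<close>

lemma minv_mate:
  assumes mb: "low_comparison mb" and iso: "\<And>A. A \<in> Ob AS \<Longrightarrow> minv mb A \<in> Iso BZ" and A: "A \<in> Ob AZ"
  shows "mate_at (\<lambda>A. inv_ar BZ (minv mb A)) mb A"
proof -
  note S = mb A iso[of "rA A"]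
  have "FZa (epA A) \<cdot>\<^bsub>BZ\<^esub> minv mb (rA A)
      = (FZa (epA A) \<cdot>\<^bsub>BZ\<^esub> epB (FZ (zA (rA A)))) \<cdot>\<^bsub>BZ\<^esub> zBa (mb (zA (rA A))) \<cdot>\<^bsub>BZ\<^esub> zBa (FSa (etA (rA A)))"
    using S by (simp add: minv_def)
  also have "FZa (epA A) \<cdot>\<^bsub>BZ\<^esub> epB (FZ (zA (rA A))) = epB (FZ A) \<cdot>\<^bsub>BZ\<^esub> zBa (rBa (FZa (epA A)))"
    using LB.counit_nat[of "FZa (epA A)"] S by simp
  also have "(epB (FZ A) \<cdot>\<^bsub>BZ\<^esub> zBa (rBa (FZa (epA A)))) \<cdot>\<^bsub>BZ\<^esub> zBa (mb (zA (rA A))) \<cdot>\<^bsub>BZ\<^esub> zBa (FSa (etA (rA A)))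
      = epB (FZ A) \<cdot>\<^bsub>BZ\<^esub> zBa ((rBa (FZa (epA A)) \<cdot>\<^bsub>BS\<^esub> mb (zA (rA A))) \<cdot>\<^bsub>BS\<^esub> FSa (etA (rA A)))"
    using S by (simp add: LB.L.cmp)
  also have "rBa (FZa (epA A)) \<cdot>\<^bsub>BS\<^esub> mb (zA (rA A)) = mb A \<cdot>\<^bsub>BS\<^esub> FSa (rAa (epA A))"
    using low_comparison_nat[OF mb, of "epA A"] S by simp
  also have "(mb A \<cdot>\<^bsub>BS\<^esub> FSa (rAa (epA A))) \<cdot>\<^bsub>BS\<^esub> FSa (etA (rA A)) = mb A"
    using S by (simp add: GS.cmp[symmetric])
  finally have "(FZa (epA A) \<cdot>\<^bsub>BZ\<^esub> minv mb (rA A)) \<cdot>\<^bsub>BZ\<^esub> inv_ar BZ (minv mb (rA A))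
      = (epB (FZ A) \<cdot>\<^bsub>BZ\<^esub> zBa (mb A)) \<cdot>\<^bsub>BZ\<^esub> inv_ar BZ (minv mb (rA A))" by simp
  then show ?thesis using S by (simp add: mate_at_def)
qed

end

text \<open>Composition: \<open>w\<close> followed on the left by \<open>z\<close>, with \<open>v\<close> in the role of the composite. \<open>lcA\<close> and \<open>lcB\<close>
  compare the right adjoint of \<open>v\<close> with the composite of the right adjoints, and are described by their
  transposes.\<close>

locale mate_composition =
  W: mate_square AS AY wA wAa wrA wrAa wetA wepA BS BY wB wBa wrB wrBa wetB wepB FS FSa FY FYa +
  Z: mate_square AY AZ zA zAa zrA zrAa zetA zepA BY BZ zB zBa zrB zrBa zetB zepB FY FYa FZ FZa +
  V: mate_square AS AZ vA vAa vrA vrAa vetA vepA BS BZ vB vBa vrB vrBa vetB vepB FS FSa FZ FZa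
  for AS :: "('a, 'b, 'w) cat_scheme" and AY AZ :: "('a, 'b, 'w) cat_scheme"
    and BS :: "('c, 'd, 'v) cat_scheme" and BY BZ :: "('c, 'd, 'v) cat_scheme" and FS FSa FY FYa FZ FZa
    and wA wAa wrA wrAa wetA wepA wB wBa wrB wrBa wetB wepB
    and zA zAa zrA zrAa zetA zepA zB zBa zrB zrBa zetB zepB
    and vA vAa vrA vrAa vetA vepA vB vBa vrB vrBa vetB vepB +
  fixes cA :: "'a \<Rightarrow> 'b" and cB :: "'c \<Rightarrow> 'd" and lcA :: "'a \<Rightarrow> 'b" and lcB :: "'c \<Rightarrow> 'd"
  assumes cA_arrow [simp]: "A \<in> Ob AS \<Longrightarrow> cA A \<in> Ar AZ" "A \<in> Ob AS \<Longrightarrow> Dom AZ (cA A) = vA A" "A \<in> Ob AS \<Longrightarrow> Cod AZ (cA A) = zA (wA A)"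
    and cB_nat: "is_nat_iso BS BZ vB vBa (\<lambda>A. zB (wB A)) (\<lambda>\<phi>. zBa (wBa \<phi>)) cB"
    and lcA_arrow [simp]: "A \<in> Ob AZ \<Longrightarrow> lcA A \<in> Ar AS" "A \<in> Ob AZ \<Longrightarrow> Dom AS (lcA A) = vrA A" "A \<in> Ob AZ \<Longrightarrow> Cod AS (lcA A) = wrA (zrA A)"
    and lcB_arrow [simp]: "A' \<in> Ob BZ \<Longrightarrow> lcB A' \<in> Ar BS" "A' \<in> Ob BZ \<Longrightarrow> Dom BS (lcB A') = vrB A'" "A' \<in> Ob BZ \<Longrightarrow> Cod BS (lcB A') = wrB (zrB A')"
    and lcA_transpose: "A \<in> Ob AZ \<Longrightarrow>
      zepA A \<cdot>\<^bsub>AZ\<^esub> zAa (wepA (zrA A)) \<cdot>\<^bsub>AZ\<^esub> zAa (wAa (lcA A)) \<cdot>\<^bsub>AZ\<^esub> cA (vrA A) = vepA A"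
    and lcB_transpose: "A' \<in> Ob BZ \<Longrightarrow>
      zepB A' \<cdot>\<^bsub>BZ\<^esub> zBa (wepB (zrB A')) \<cdot>\<^bsub>BZ\<^esub> zBa (wBa (lcB A')) \<cdot>\<^bsub>BZ\<^esub> cB (vrB A') = vepB A'"
begin

lemma cB_simps [simp]:
  "A' \<in> Ob BS \<Longrightarrow> cB A' \<in> Ar BZ" "A' \<in> Ob BS \<Longrightarrow> Dom BZ (cB A') = vB A'" "A' \<in> Ob BS \<Longrightarrow> Cod BZ (cB A') = zB (wB A')"
  "A' \<in> Ob BS \<Longrightarrow> cB A' \<in> Iso BZ"
  using cB_nat by (auto simp: is_nat_iso_def is_nat_def Hom_def)

text \<open>The transpose of \<open>x : B \<rightarrow> w\<^sub>* z\<^sub>* A\<close> as an arrow \<open>v\<^sup>* B \<rightarrow> A\<close>.\<close>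

definition T :: "'d \<Rightarrow> 'c \<Rightarrow> 'd" where
  "T x A = zepB A \<cdot>\<^bsub>BZ\<^esub> zBa (wepB (zrB A) \<cdot>\<^bsub>BY\<^esub> wBa x) \<cdot>\<^bsub>BZ\<^esub> cB (Dom BS x)"

lemma T_inj:
  assumes "x \<in> Ar BS" "y \<in> Ar BS" "Dom BS x = Dom BS y" "Cod BS x = wrB (zrB A)" "Cod BS y = wrB (zrB A)"
    and A: "A \<in> Ob BZ" and eq: "T x A = T y A"
  shows "x = y"
proof -
  have "zepB A \<cdot>\<^bsub>BZ\<^esub> zBa (wepB (zrB A) \<cdot>\<^bsub>BY\<^esub> wBa x) = zepB A \<cdot>\<^bsub>BZ\<^esub> zBa (wepB (zrB A) \<cdot>\<^bsub>BY\<^esub> wBa y)"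
    by (rule Z.LB.L.D.Iso_cancel_right[where g = "cB (Dom BS x)"]) (use assms in \<open>simp_all add: T_def\<close>)
  then have "wepB (zrB A) \<cdot>\<^bsub>BY\<^esub> wBa x = wepB (zrB A) \<cdot>\<^bsub>BY\<^esub> wBa y"
    by (rule Z.LB.transpose_inj[rotated 6]) (use assms in simp_all)
  then show ?thesis
    by (rule W.LB.transpose_inj[rotated 6]) (use assms in simp_all)
qed

text \<open>Precomposed with \<open>mv\<close>, the transpose of one side of the composition law for \<open>mb\<close> is the left-hand
  side of the mate condition for \<open>v\<close>, and that of the other side is its right-hand side.\<close>

lemma mate_composition:
  assumes mw: "W.comparison mw" and mz: "Z.comparison mz" and mv: "V.comparison mv" and A: "A \<in> Ob AZ"
    and mbw: "mbw (zrA A) \<in> Ar BS" "Dom BS (mbw (zrA A)) = FS (wrA (zrA A))" "Cod BS (mbw (zrA A)) = wrB (FY (zrA A))"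
    and mbz: "mbz A \<in> Ar BY" "Dom BY (mbz A) = FY (zrA A)" "Cod BY (mbz A) = zrB (FZ A)"
    and mbv: "mbv A \<in> Ar BS" "Dom BS (mbv A) = FS (vrA A)" "Cod BS (mbv A) = vrB (FZ A)"
    and Mw: "W.mate_at mw mbw (zrA A)" and Mz: "Z.mate_at mz mbz A"
    and coc: "cB (FS (vrA A)) \<cdot>\<^bsub>BZ\<^esub> mv (vrA A) = zBa (mw (vrA A)) \<cdot>\<^bsub>BZ\<^esub> mz (wA (vrA A)) \<cdot>\<^bsub>BZ\<^esub> FZa (cA (vrA A))"
  shows "V.mate_at mv mbv A \<longleftrightarrow>
    lcB (FZ A) \<cdot>\<^bsub>BS\<^esub> mbv A = wrBa (mbz A) \<cdot>\<^bsub>BS\<^esub> mbw (zrA A) \<cdot>\<^bsub>BS\<^esub> FSa (lcA A)"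
proof -
  let ?B = "vrA A"
  let ?l = "lcB (FZ A) \<cdot>\<^bsub>BS\<^esub> mbv A" and ?r = "wrBa (mbz A) \<cdot>\<^bsub>BS\<^esub> mbw (zrA A) \<cdot>\<^bsub>BS\<^esub> FSa (lcA A)"
  note S = mw mz mv A mbw mbz mbv
  have "T ?l (FZ A) \<cdot>\<^bsub>BZ\<^esub> mv ?B
      = zepB (FZ A) \<cdot>\<^bsub>BZ\<^esub> zBa (wepB (zrB (FZ A))) \<cdot>\<^bsub>BZ\<^esub> zBa (wBa (lcB (FZ A))) \<cdot>\<^bsub>BZ\<^esub>
        (zBa (wBa (mbv A)) \<cdot>\<^bsub>BZ\<^esub> cB (FS ?B)) \<cdot>\<^bsub>BZ\<^esub> mv ?B"
    using S by (simp add: T_def W.LB.L.cmp Z.LB.L.cmp)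
  also have "zBa (wBa (mbv A)) \<cdot>\<^bsub>BZ\<^esub> cB (FS ?B) = cB (vrB (FZ A)) \<cdot>\<^bsub>BZ\<^esub> vBa (mbv A)"
    using cB_nat S is_natD(4)[of BS BZ vB vBa "\<lambda>A. zB (wB A)" "\<lambda>\<phi>. zBa (wBa \<phi>)" cB "mbv A"]
    by (simp add: is_nat_iso_def)
  also have "zepB (FZ A) \<cdot>\<^bsub>BZ\<^esub> zBa (wepB (zrB (FZ A))) \<cdot>\<^bsub>BZ\<^esub> zBa (wBa (lcB (FZ A))) \<cdot>\<^bsub>BZ\<^esub>
        (cB (vrB (FZ A)) \<cdot>\<^bsub>BZ\<^esub> vBa (mbv A)) \<cdot>\<^bsub>BZ\<^esub> mv ?B
      = (zepB (FZ A) \<cdot>\<^bsub>BZ\<^esub> zBa (wepB (zrB (FZ A))) \<cdot>\<^bsub>BZ\<^esub> zBa (wBa (lcB (FZ A))) \<cdot>\<^bsub>BZ\<^esub> cB (vrB (FZ A))) \<cdot>\<^bsub>BZ\<^esub>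
        vBa (mbv A) \<cdot>\<^bsub>BZ\<^esub> mv ?B"
    using S by simp
  also have "\<dots> = vepB (FZ A) \<cdot>\<^bsub>BZ\<^esub> vBa (mbv A) \<cdot>\<^bsub>BZ\<^esub> mv ?B"
    using lcB_transpose[of "FZ A"] S by simp
  finally have L: "T ?l (FZ A) \<cdot>\<^bsub>BZ\<^esub> mv ?B = vepB (FZ A) \<cdot>\<^bsub>BZ\<^esub> vBa (mbv A) \<cdot>\<^bsub>BZ\<^esub> mv ?B" .
  have "wepB (zrB (FZ A)) \<cdot>\<^bsub>BY\<^esub> wBa ?r
      = (wepB (zrB (FZ A)) \<cdot>\<^bsub>BY\<^esub> wBa (wrBa (mbz A))) \<cdot>\<^bsub>BY\<^esub> wBa (mbw (zrA A)) \<cdot>\<^bsub>BY\<^esub> wBa (FSa (lcA A))"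
    using S by (simp add: W.LB.L.cmp)
  also have "wepB (zrB (FZ A)) \<cdot>\<^bsub>BY\<^esub> wBa (wrBa (mbz A)) = mbz A \<cdot>\<^bsub>BY\<^esub> wepB (FY (zrA A))"
    using W.LB.counit_nat[of "mbz A"] S by simp
  finally have e1: "wepB (zrB (FZ A)) \<cdot>\<^bsub>BY\<^esub> wBa ?r
      = (mbz A \<cdot>\<^bsub>BY\<^esub> wepB (FY (zrA A))) \<cdot>\<^bsub>BY\<^esub> wBa (mbw (zrA A)) \<cdot>\<^bsub>BY\<^esub> wBa (FSa (lcA A))" .
  have "(wepB (zrB (FZ A)) \<cdot>\<^bsub>BY\<^esub> wBa ?r) \<cdot>\<^bsub>BY\<^esub> mw ?B
      = mbz A \<cdot>\<^bsub>BY\<^esub> wepB (FY (zrA A)) \<cdot>\<^bsub>BY\<^esub> wBa (mbw (zrA A)) \<cdot>\<^bsub>BY\<^esub> (wBa (FSa (lcA A)) \<cdot>\<^bsub>BY\<^esub> mw ?B)"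
    unfolding e1 using S by simp
  also have "wBa (FSa (lcA A)) \<cdot>\<^bsub>BY\<^esub> mw ?B = mw (wrA (zrA A)) \<cdot>\<^bsub>BY\<^esub> FYa (wAa (lcA A))"
    using W.comparison_nat[OF mw, of "lcA A"] S by simp
  also have "mbz A \<cdot>\<^bsub>BY\<^esub> wepB (FY (zrA A)) \<cdot>\<^bsub>BY\<^esub> wBa (mbw (zrA A)) \<cdot>\<^bsub>BY\<^esub> (mw (wrA (zrA A)) \<cdot>\<^bsub>BY\<^esub> FYa (wAa (lcA A)))
      = mbz A \<cdot>\<^bsub>BY\<^esub> (wepB (FY (zrA A)) \<cdot>\<^bsub>BY\<^esub> wBa (mbw (zrA A)) \<cdot>\<^bsub>BY\<^esub> mw (wrA (zrA A))) \<cdot>\<^bsub>BY\<^esub> FYa (wAa (lcA A))"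
    using S by simp
  also have "wepB (FY (zrA A)) \<cdot>\<^bsub>BY\<^esub> wBa (mbw (zrA A)) \<cdot>\<^bsub>BY\<^esub> mw (wrA (zrA A)) = FYa (wepA (zrA A))"
    using Mw by (simp add: W.mate_at_def)
  also have "mbz A \<cdot>\<^bsub>BY\<^esub> FYa (wepA (zrA A)) \<cdot>\<^bsub>BY\<^esub> FYa (wAa (lcA A)) = mbz A \<cdot>\<^bsub>BY\<^esub> FYa (wepA (zrA A) \<cdot>\<^bsub>AY\<^esub> wAa (lcA A))"
    using S by (simp add: W.GZ.cmp)
  finally have e2: "(wepB (zrB (FZ A)) \<cdot>\<^bsub>BY\<^esub> wBa ?r) \<cdot>\<^bsub>BY\<^esub> mw ?B = mbz A \<cdot>\<^bsub>BY\<^esub> FYa (wepA (zrA A) \<cdot>\<^bsub>AY\<^esub> wAa (lcA A))" .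
  have "T ?r (FZ A) \<cdot>\<^bsub>BZ\<^esub> mv ?B
      = zepB (FZ A) \<cdot>\<^bsub>BZ\<^esub> zBa (wepB (zrB (FZ A)) \<cdot>\<^bsub>BY\<^esub> wBa ?r) \<cdot>\<^bsub>BZ\<^esub> (cB (FS ?B) \<cdot>\<^bsub>BZ\<^esub> mv ?B)"
    using S by (simp add: T_def W.LB.L.cmp Z.LB.L.cmp)
  also have "\<dots> = zepB (FZ A) \<cdot>\<^bsub>BZ\<^esub> zBa ((wepB (zrB (FZ A)) \<cdot>\<^bsub>BY\<^esub> wBa ?r) \<cdot>\<^bsub>BY\<^esub> mw ?B) \<cdot>\<^bsub>BZ\<^esub> mz (wA ?B) \<cdot>\<^bsub>BZ\<^esub> FZa (cA ?B)"
    unfolding coc using S by (simp add: Z.LB.L.cmp W.LB.L.cmp)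
  also have "\<dots> = zepB (FZ A) \<cdot>\<^bsub>BZ\<^esub> zBa (mbz A \<cdot>\<^bsub>BY\<^esub> FYa (wepA (zrA A) \<cdot>\<^bsub>AY\<^esub> wAa (lcA A))) \<cdot>\<^bsub>BZ\<^esub> mz (wA ?B) \<cdot>\<^bsub>BZ\<^esub> FZa (cA ?B)"
    unfolding e2 ..
  also have "\<dots> = zepB (FZ A) \<cdot>\<^bsub>BZ\<^esub> zBa (mbz A) \<cdot>\<^bsub>BZ\<^esub> (zBa (FYa (wepA (zrA A) \<cdot>\<^bsub>AY\<^esub> wAa (lcA A))) \<cdot>\<^bsub>BZ\<^esub> mz (wA ?B)) \<cdot>\<^bsub>BZ\<^esub> FZa (cA ?B)"
    using S by (simp add: Z.LB.L.cmp)
  also have "zBa (FYa (wepA (zrA A) \<cdot>\<^bsub>AY\<^esub> wAa (lcA A))) \<cdot>\<^bsub>BZ\<^esub> mz (wA ?B) = mz (zrA A) \<cdot>\<^bsub>BZ\<^esub> FZa (zAa (wepA (zrA A) \<cdot>\<^bsub>AY\<^esub> wAa (lcA A)))"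
    using Z.comparison_nat[OF mz, of "wepA (zrA A) \<cdot>\<^bsub>AY\<^esub> wAa (lcA A)"] S by simp
  also have "zepB (FZ A) \<cdot>\<^bsub>BZ\<^esub> zBa (mbz A) \<cdot>\<^bsub>BZ\<^esub> (mz (zrA A) \<cdot>\<^bsub>BZ\<^esub> FZa (zAa (wepA (zrA A) \<cdot>\<^bsub>AY\<^esub> wAa (lcA A)))) \<cdot>\<^bsub>BZ\<^esub> FZa (cA ?B)
      = (zepB (FZ A) \<cdot>\<^bsub>BZ\<^esub> zBa (mbz A) \<cdot>\<^bsub>BZ\<^esub> mz (zrA A)) \<cdot>\<^bsub>BZ\<^esub> FZa (zAa (wepA (zrA A) \<cdot>\<^bsub>AY\<^esub> wAa (lcA A)) \<cdot>\<^bsub>AZ\<^esub> cA ?B)"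
    using S by (simp add: Z.GZ.cmp)
  also have "\<dots> = FZa (zepA A) \<cdot>\<^bsub>BZ\<^esub> FZa (zAa (wepA (zrA A) \<cdot>\<^bsub>AY\<^esub> wAa (lcA A)) \<cdot>\<^bsub>AZ\<^esub> cA ?B)"
    using Mz by (simp add: Z.mate_at_def)
  also have "\<dots> = FZa (zepA A \<cdot>\<^bsub>AZ\<^esub> zAa (wepA (zrA A)) \<cdot>\<^bsub>AZ\<^esub> zAa (wAa (lcA A)) \<cdot>\<^bsub>AZ\<^esub> cA ?B)"
    using S by (simp add: Z.GZ.cmp Z.LA.L.cmp)
  also have "\<dots> = FZa (vepA A)" using lcA_transpose[OF A] by simp
  finally have R: "T ?r (FZ A) \<cdot>\<^bsub>BZ\<^esub> mv ?B = FZa (vepA A)" .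
  show ?thesis
  proof
    assume M: "V.mate_at mv mbv A"
    have "T ?l (FZ A) \<cdot>\<^bsub>BZ\<^esub> mv ?B = T ?r (FZ A) \<cdot>\<^bsub>BZ\<^esub> mv ?B"
      using L R M by (simp add: V.mate_at_def)
    then have "T ?l (FZ A) = T ?r (FZ A)"
      by (rule Z.LB.L.D.Iso_cancel_right[rotated 5]) (use S in \<open>simp_all add: T_def\<close>)
    then show "?l = ?r" by (rule T_inj[rotated 6]) (use S in simp_all)
  next
    assume "?l = ?r"
    then show "V.mate_at mv mbv A" using L R by (simp add: V.mate_at_def)
  qed
qed

end

text \<open>A square of functors \<open>P\<close> on the fibres carrying the adjunctions, compatible with \<open>F\<close> through \<open>s\<close>
  and with the pull-backs \<open>z\<close> through \<open>e\<close>. With \<open>P\<close> a pull-back it expresses base change, with \<open>P\<close> a shift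
  the compatibility with shifts. \<open>cA\<close> and \<open>cB\<close> are the resulting transformations \<open>P z\<^sub>* \<rightarrow> z\<^sub>* P\<close>.\<close>

locale mate_exchange =
  M: mate_square AS AZ zA zAa rA rAa etA epA BS BZ zB zBa rB rBa etB epB FS FSa FZ FZa +
  N: mate_square AP AW zA' zAa' rA' rAa' etA' epA' BP BW zB' zBa' rB' rBa' etB' epB' FP FPa FW FWa +
  PA: functor_on AS AP PA PAa + PA': functor_on AZ AW PA' PAa' +
  PB: functor_on BS BP PB PBa + PB': functor_on BZ BW PB' PBa'
  for AS :: "('a, 'b, 'w) cat_scheme" and AZ AP AW :: "('a, 'b, 'w) cat_scheme"
    and BS :: "('c, 'd, 'v) cat_scheme" and BZ BP BW :: "('c, 'd, 'v) cat_scheme" and FS FSa FZ FZa FP FPa FW FWa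
    and zA zAa rA rAa etA epA zB zBa rB rBa etB epB
    and zA' zAa' rA' rAa' etA' epA' zB' zBa' rB' rBa' etB' epB'
    and PA PAa PA' PAa' PB PBa PB' PBa' +
  fixes eA :: "'a \<Rightarrow> 'b" and eB :: "'c \<Rightarrow> 'd" and s :: "'a \<Rightarrow> 'd" and s' :: "'a \<Rightarrow> 'd"
    and cA :: "'a \<Rightarrow> 'b" and cB :: "'c \<Rightarrow> 'd"
  assumes eA_nat: "is_nat AS AW (\<lambda>A. zA' (PA A)) (\<lambda>\<phi>. zAa' (PAa \<phi>)) (\<lambda>A. PA' (zA A)) (\<lambda>\<phi>. PAa' (zAa \<phi>)) eA"
    and eB_nat: "is_nat BS BW (\<lambda>A. zB' (PB A)) (\<lambda>\<phi>. zBa' (PBa \<phi>)) (\<lambda>A. PB' (zB A)) (\<lambda>\<phi>. PBa' (zBa \<phi>)) eB"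
    and s_nat: "is_nat AS BP (\<lambda>A. FP (PA A)) (\<lambda>\<phi>. FPa (PAa \<phi>)) (\<lambda>A. PB (FS A)) (\<lambda>\<phi>. PBa (FSa \<phi>)) s"
    and s'_nat: "is_nat AZ BW (\<lambda>A. FW (PA' A)) (\<lambda>\<phi>. FWa (PAa' \<phi>)) (\<lambda>A. PB' (FZ A)) (\<lambda>\<phi>. PBa' (FZa \<phi>)) s'"
    and cA_arrow [simp]: "A \<in> Ob AZ \<Longrightarrow> cA A \<in> Ar AP" "A \<in> Ob AZ \<Longrightarrow> Dom AP (cA A) = PA (rA A)" "A \<in> Ob AZ \<Longrightarrow> Cod AP (cA A) = rA' (PA' A)"
    and cB_arrow [simp]: "A' \<in> Ob BZ \<Longrightarrow> cB A' \<in> Ar BP" "A' \<in> Ob BZ \<Longrightarrow> Dom BP (cB A') = PB (rB A')" "A' \<in> Ob BZ \<Longrightarrow> Cod BP (cB A') = rB' (PB' A')"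
    and cA_transpose: "A \<in> Ob AZ \<Longrightarrow> epA' (PA' A) \<cdot>\<^bsub>AW\<^esub> zAa' (cA A) = PAa' (epA A) \<cdot>\<^bsub>AW\<^esub> eA (rA A)"
    and cB_transpose: "A' \<in> Ob BZ \<Longrightarrow> epB' (PB' A') \<cdot>\<^bsub>BW\<^esub> zBa' (cB A') = PBa' (epB A') \<cdot>\<^bsub>BW\<^esub> eB (rB A')"
begin

lemmas exchange_simps [simp] = is_natD(1-3)[OF eA_nat] is_natD(1-3)[OF eB_nat] is_natD(1-3)[OF s_nat] is_natD(1-3)[OF s'_nat]

definition exchange_at :: "('a \<Rightarrow> 'd) \<Rightarrow> ('a \<Rightarrow> 'd) \<Rightarrow> 'a \<Rightarrow> bool" where
  "exchange_at m m' A \<longleftrightarrow> eB (FS A) \<cdot>\<^bsub>BW\<^esub> zBa' (s A) \<cdot>\<^bsub>BW\<^esub> m' (PA A) = PBa' (m A) \<cdot>\<^bsub>BW\<^esub> s' (zA A) \<cdot>\<^bsub>BW\<^esub> FWa (eA A)"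

definition low_exchange_at :: "('a \<Rightarrow> 'd) \<Rightarrow> ('a \<Rightarrow> 'd) \<Rightarrow> 'a \<Rightarrow> bool" where
  "low_exchange_at mb mb' A \<longleftrightarrow> cB (FZ A) \<cdot>\<^bsub>BP\<^esub> PBa (mb A) \<cdot>\<^bsub>BP\<^esub> s (rA A) = rBa' (s' A) \<cdot>\<^bsub>BP\<^esub> mb' (PA' A) \<cdot>\<^bsub>BP\<^esub> FPa (cA A)"

text \<open>The transposes of the two sides of \<open>low_exchange_at\<close>, precomposed with the invertible \<open>m'\<close>, are the two
  sides of \<open>exchange_at\<close> at \<open>z\<^sub>*A\<close> followed by the same arrow \<open>k\<close>, the image under \<open>P'\<close> of the transpose of
  \<open>mb A\<close>; and \<open>k\<close> is invertible by the mate condition.\<close>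

lemma low_exchange_iff:
  assumes m: "M.comparison m" and m': "N.comparison m'" and A: "A \<in> Ob AZ"
    and mb: "mb A \<in> Ar BS" "Dom BS (mb A) = FS (rA A)" "Cod BS (mb A) = rB (FZ A)"
    and mb': "mb' (PA' A) \<in> Ar BP" "Dom BP (mb' (PA' A)) = FP (rA' (PA' A))" "Cod BP (mb' (PA' A)) = rB' (FW (PA' A))"
    and Ma: "M.mate_at m mb A" and Ma': "N.mate_at m' mb' (PA' A)"
  shows "low_exchange_at mb mb' A \<longleftrightarrow> exchange_at m m' (rA A)"
proof -
  note S = m m' A mb mb'
  let ?k = "PBa' (epB (FZ A) \<cdot>\<^bsub>BZ\<^esub> zBa (mb A))"
  let ?l = "cB (FZ A) \<cdot>\<^bsub>BP\<^esub> PBa (mb A) \<cdot>\<^bsub>BP\<^esub> s (rA A)" and ?r = "rBa' (s' A) \<cdot>\<^bsub>BP\<^esub> mb' (PA' A) \<cdot>\<^bsub>BP\<^esub> FPa (cA A)"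
  let ?L = "eB (FS (rA A)) \<cdot>\<^bsub>BW\<^esub> zBa' (s (rA A)) \<cdot>\<^bsub>BW\<^esub> m' (PA (rA A))"
  let ?R = "PBa' (m (rA A)) \<cdot>\<^bsub>BW\<^esub> s' (zA (rA A)) \<cdot>\<^bsub>BW\<^esub> FWa (eA (rA A))"
  have k: "?k \<in> Iso BW" using M.mate_counit_Iso[OF m A Ma mb] PB'.iso by blast
  have "(epB' (PB' (FZ A)) \<cdot>\<^bsub>BW\<^esub> zBa' ?l) \<cdot>\<^bsub>BW\<^esub> m' (PA (rA A))
      = (epB' (PB' (FZ A)) \<cdot>\<^bsub>BW\<^esub> zBa' (cB (FZ A))) \<cdot>\<^bsub>BW\<^esub> zBa' (PBa (mb A)) \<cdot>\<^bsub>BW\<^esub> zBa' (s (rA A)) \<cdot>\<^bsub>BW\<^esub> m' (PA (rA A))"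
    using S by (simp add: N.LB.L.cmp)
  also have "epB' (PB' (FZ A)) \<cdot>\<^bsub>BW\<^esub> zBa' (cB (FZ A)) = PBa' (epB (FZ A)) \<cdot>\<^bsub>BW\<^esub> eB (rB (FZ A))"
    using cB_transpose[of "FZ A"] S by simp
  also have "(PBa' (epB (FZ A)) \<cdot>\<^bsub>BW\<^esub> eB (rB (FZ A))) \<cdot>\<^bsub>BW\<^esub> zBa' (PBa (mb A)) \<cdot>\<^bsub>BW\<^esub> zBa' (s (rA A)) \<cdot>\<^bsub>BW\<^esub> m' (PA (rA A))
      = PBa' (epB (FZ A)) \<cdot>\<^bsub>BW\<^esub> (eB (rB (FZ A)) \<cdot>\<^bsub>BW\<^esub> zBa' (PBa (mb A))) \<cdot>\<^bsub>BW\<^esub> zBa' (s (rA A)) \<cdot>\<^bsub>BW\<^esub> m' (PA (rA A))"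
    using S by simp
  also have "eB (rB (FZ A)) \<cdot>\<^bsub>BW\<^esub> zBa' (PBa (mb A)) = PBa' (zBa (mb A)) \<cdot>\<^bsub>BW\<^esub> eB (FS (rA A))"
    using is_natD(4)[OF eB_nat, of "mb A"] S by simp
  also have "PBa' (epB (FZ A)) \<cdot>\<^bsub>BW\<^esub> (PBa' (zBa (mb A)) \<cdot>\<^bsub>BW\<^esub> eB (FS (rA A))) \<cdot>\<^bsub>BW\<^esub> zBa' (s (rA A)) \<cdot>\<^bsub>BW\<^esub> m' (PA (rA A)) = ?k \<cdot>\<^bsub>BW\<^esub> ?L"
    using S by (simp add: PB'.cmp)
  finally have L: "(epB' (PB' (FZ A)) \<cdot>\<^bsub>BW\<^esub> zBa' ?l) \<cdot>\<^bsub>BW\<^esub> m' (PA (rA A)) = ?k \<cdot>\<^bsub>BW\<^esub> ?L" .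
  have "(epB' (PB' (FZ A)) \<cdot>\<^bsub>BW\<^esub> zBa' ?r) \<cdot>\<^bsub>BW\<^esub> m' (PA (rA A))
      = (epB' (PB' (FZ A)) \<cdot>\<^bsub>BW\<^esub> zBa' (rBa' (s' A))) \<cdot>\<^bsub>BW\<^esub> zBa' (mb' (PA' A)) \<cdot>\<^bsub>BW\<^esub> (zBa' (FPa (cA A)) \<cdot>\<^bsub>BW\<^esub> m' (PA (rA A)))"
    using S by (simp add: N.LB.L.cmp)
  also have "epB' (PB' (FZ A)) \<cdot>\<^bsub>BW\<^esub> zBa' (rBa' (s' A)) = s' A \<cdot>\<^bsub>BW\<^esub> epB' (FW (PA' A))"
    using N.LB.counit_nat[of "s' A"] S by simp
  also have "zBa' (FPa (cA A)) \<cdot>\<^bsub>BW\<^esub> m' (PA (rA A)) = m' (rA' (PA' A)) \<cdot>\<^bsub>BW\<^esub> FWa (zAa' (cA A))"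
    using N.comparison_nat[OF m', of "cA A"] S by simp
  also have "(s' A \<cdot>\<^bsub>BW\<^esub> epB' (FW (PA' A))) \<cdot>\<^bsub>BW\<^esub> zBa' (mb' (PA' A)) \<cdot>\<^bsub>BW\<^esub> (m' (rA' (PA' A)) \<cdot>\<^bsub>BW\<^esub> FWa (zAa' (cA A)))
      = s' A \<cdot>\<^bsub>BW\<^esub> (epB' (FW (PA' A)) \<cdot>\<^bsub>BW\<^esub> zBa' (mb' (PA' A)) \<cdot>\<^bsub>BW\<^esub> m' (rA' (PA' A))) \<cdot>\<^bsub>BW\<^esub> FWa (zAa' (cA A))"
    using S by simp
  also have "epB' (FW (PA' A)) \<cdot>\<^bsub>BW\<^esub> zBa' (mb' (PA' A)) \<cdot>\<^bsub>BW\<^esub> m' (rA' (PA' A)) = FWa (epA' (PA' A))"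
    using Ma' by (simp add: N.mate_at_def)
  also have "s' A \<cdot>\<^bsub>BW\<^esub> FWa (epA' (PA' A)) \<cdot>\<^bsub>BW\<^esub> FWa (zAa' (cA A)) = s' A \<cdot>\<^bsub>BW\<^esub> FWa (PAa' (epA A) \<cdot>\<^bsub>AW\<^esub> eA (rA A))"
    using S by (simp add: N.GZ.cmp[symmetric] cA_transpose)
  also have "\<dots> = (s' A \<cdot>\<^bsub>BW\<^esub> FWa (PAa' (epA A))) \<cdot>\<^bsub>BW\<^esub> FWa (eA (rA A))"
    using S by (simp add: N.GZ.cmp)
  also have "s' A \<cdot>\<^bsub>BW\<^esub> FWa (PAa' (epA A)) = PBa' (FZa (epA A)) \<cdot>\<^bsub>BW\<^esub> s' (zA (rA A))"
    using is_natD(4)[OF s'_nat, of "epA A"] S by simp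
  also have "FZa (epA A) = epB (FZ A) \<cdot>\<^bsub>BZ\<^esub> zBa (mb A) \<cdot>\<^bsub>BZ\<^esub> m (rA A)"
    using Ma by (simp add: M.mate_at_def)
  also have "(PBa' (epB (FZ A) \<cdot>\<^bsub>BZ\<^esub> zBa (mb A) \<cdot>\<^bsub>BZ\<^esub> m (rA A)) \<cdot>\<^bsub>BW\<^esub> s' (zA (rA A))) \<cdot>\<^bsub>BW\<^esub> FWa (eA (rA A)) = ?k \<cdot>\<^bsub>BW\<^esub> ?R"
    using S by (simp add: PB'.cmp)
  finally have R: "(epB' (PB' (FZ A)) \<cdot>\<^bsub>BW\<^esub> zBa' ?r) \<cdot>\<^bsub>BW\<^esub> m' (PA (rA A)) = ?k \<cdot>\<^bsub>BW\<^esub> ?R" .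
  show ?thesis
    unfolding low_exchange_at_def exchange_at_def
  proof
    assume "?l = ?r"
    then have "?k \<cdot>\<^bsub>BW\<^esub> ?L = ?k \<cdot>\<^bsub>BW\<^esub> ?R" using L R by simp
    then show "?L = ?R" by (rule N.LB.L.D.Iso_cancel_left[OF k, rotated 4]) (use S in simp_all)
  next
    assume "?L = ?R"
    then have "(epB' (PB' (FZ A)) \<cdot>\<^bsub>BW\<^esub> zBa' ?l) \<cdot>\<^bsub>BW\<^esub> m' (PA (rA A)) = (epB' (PB' (FZ A)) \<cdot>\<^bsub>BW\<^esub> zBa' ?r) \<cdot>\<^bsub>BW\<^esub> m' (PA (rA A))"
      using L R by simp
    then have "epB' (PB' (FZ A)) \<cdot>\<^bsub>BW\<^esub> zBa' ?l = epB' (PB' (FZ A)) \<cdot>\<^bsub>BW\<^esub> zBa' ?r"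
      by (rule N.LB.L.D.Iso_cancel_right[rotated 5]) (use S in simp_all)
    then show "?l = ?r" by (rule N.LB.transpose_inj[rotated 6]) (use S in simp_all)
  qed
qed

text \<open>Both sides are natural, and the unit \<open>A \<rightarrow> z\<^sub>* z\<^sup>* A\<close> becomes invertible after \<open>z\<^sup>* F\<close>, by the comparison
  \<open>m\<close>; so the exchange law at \<open>A\<close> follows from that at \<open>z\<^sub>* z\<^sup>* A\<close>.\<close>

lemma exchange_of_low:
  assumes m: "M.comparison m" and m': "N.comparison m'" and A: "A \<in> Ob AS"
    and ex: "exchange_at m m' (rA (zA A))"
  shows "exchange_at m m' A"
proof -
  let ?B = "rA (zA A)"
  note S = m m' A
  let ?L = "\<lambda>A. eB (FS A) \<cdot>\<^bsub>BW\<^esub> zBa' (s A) \<cdot>\<^bsub>BW\<^esub> m' (PA A)"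
  let ?R = "\<lambda>A. PBa' (m A) \<cdot>\<^bsub>BW\<^esub> s' (zA A) \<cdot>\<^bsub>BW\<^esub> FWa (eA A)"
  let ?h = "etA A"
  have "zAa ?h \<in> Iso AZ"
    using M.LA.L.D.Iso_right_factor[of "epA (zA A)" "zAa ?h"] A by simp
  then have "m ?B \<cdot>\<^bsub>BZ\<^esub> FZa (zAa ?h) \<in> Iso BZ"
    using S by simp
  then have "zBa (FSa ?h) \<cdot>\<^bsub>BZ\<^esub> m A \<in> Iso BZ"
    using M.comparison_nat[OF m, of ?h] S by simp
  then have "zBa (FSa ?h) \<in> Iso BZ"
    by (rule M.LB.L.D.Iso_left_factor[rotated 3]) (use S in simp_all)
  then have k: "PBa' (zBa (FSa ?h)) \<in> Iso BW" by simp
  have "PBa' (zBa (FSa ?h)) \<cdot>\<^bsub>BW\<^esub> ?L A = (PBa' (zBa (FSa ?h)) \<cdot>\<^bsub>BW\<^esub> eB (FS A)) \<cdot>\<^bsub>BW\<^esub> zBa' (s A) \<cdot>\<^bsub>BW\<^esub> m' (PA A)"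
    using S by simp
  also have "PBa' (zBa (FSa ?h)) \<cdot>\<^bsub>BW\<^esub> eB (FS A) = eB (FS ?B) \<cdot>\<^bsub>BW\<^esub> zBa' (PBa (FSa ?h))"
    using is_natD(4)[OF eB_nat, of "FSa ?h"] S by simp
  also have "(eB (FS ?B) \<cdot>\<^bsub>BW\<^esub> zBa' (PBa (FSa ?h))) \<cdot>\<^bsub>BW\<^esub> zBa' (s A) \<cdot>\<^bsub>BW\<^esub> m' (PA A)
      = eB (FS ?B) \<cdot>\<^bsub>BW\<^esub> zBa' (PBa (FSa ?h) \<cdot>\<^bsub>BP\<^esub> s A) \<cdot>\<^bsub>BW\<^esub> m' (PA A)"
    using S by (simp add: N.LB.L.cmp)
  also have "PBa (FSa ?h) \<cdot>\<^bsub>BP\<^esub> s A = s ?B \<cdot>\<^bsub>BP\<^esub> FPa (PAa ?h)"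
    using is_natD(4)[OF s_nat, of ?h] S by simp
  also have "eB (FS ?B) \<cdot>\<^bsub>BW\<^esub> zBa' (s ?B \<cdot>\<^bsub>BP\<^esub> FPa (PAa ?h)) \<cdot>\<^bsub>BW\<^esub> m' (PA A)
      = eB (FS ?B) \<cdot>\<^bsub>BW\<^esub> zBa' (s ?B) \<cdot>\<^bsub>BW\<^esub> (zBa' (FPa (PAa ?h)) \<cdot>\<^bsub>BW\<^esub> m' (PA A))"
    using S by (simp add: N.LB.L.cmp)
  also have "zBa' (FPa (PAa ?h)) \<cdot>\<^bsub>BW\<^esub> m' (PA A) = m' (PA ?B) \<cdot>\<^bsub>BW\<^esub> FWa (zAa' (PAa ?h))"
    using N.comparison_nat[OF m', of "PAa ?h"] S by simp
  also have "eB (FS ?B) \<cdot>\<^bsub>BW\<^esub> zBa' (s ?B) \<cdot>\<^bsub>BW\<^esub> (m' (PA ?B) \<cdot>\<^bsub>BW\<^esub> FWa (zAa' (PAa ?h))) = ?L ?B \<cdot>\<^bsub>BW\<^esub> FWa (zAa' (PAa ?h))"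
    using S by simp
  also have "?L ?B = ?R ?B" using ex by (simp add: exchange_at_def)
  also have "?R ?B \<cdot>\<^bsub>BW\<^esub> FWa (zAa' (PAa ?h)) = PBa' (m ?B) \<cdot>\<^bsub>BW\<^esub> s' (zA ?B) \<cdot>\<^bsub>BW\<^esub> FWa (eA ?B \<cdot>\<^bsub>AW\<^esub> zAa' (PAa ?h))"
    using S by (simp add: N.GZ.cmp)
  also have "eA ?B \<cdot>\<^bsub>AW\<^esub> zAa' (PAa ?h) = PAa' (zAa ?h) \<cdot>\<^bsub>AW\<^esub> eA A"
    using is_natD(4)[OF eA_nat, of ?h] S by simp
  also have "PBa' (m ?B) \<cdot>\<^bsub>BW\<^esub> s' (zA ?B) \<cdot>\<^bsub>BW\<^esub> FWa (PAa' (zAa ?h) \<cdot>\<^bsub>AW\<^esub> eA A)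
      = PBa' (m ?B) \<cdot>\<^bsub>BW\<^esub> (s' (zA ?B) \<cdot>\<^bsub>BW\<^esub> FWa (PAa' (zAa ?h))) \<cdot>\<^bsub>BW\<^esub> FWa (eA A)"
    using S by (simp add: N.GZ.cmp)
  also have "s' (zA ?B) \<cdot>\<^bsub>BW\<^esub> FWa (PAa' (zAa ?h)) = PBa' (FZa (zAa ?h)) \<cdot>\<^bsub>BW\<^esub> s' (zA A)"
    using is_natD(4)[OF s'_nat, of "zAa ?h"] S by simp
  also have "PBa' (m ?B) \<cdot>\<^bsub>BW\<^esub> (PBa' (FZa (zAa ?h)) \<cdot>\<^bsub>BW\<^esub> s' (zA A)) \<cdot>\<^bsub>BW\<^esub> FWa (eA A)
      = PBa' (m ?B \<cdot>\<^bsub>BZ\<^esub> FZa (zAa ?h)) \<cdot>\<^bsub>BW\<^esub> s' (zA A) \<cdot>\<^bsub>BW\<^esub> FWa (eA A)"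
    using S by (simp add: PB'.cmp)
  also have "m ?B \<cdot>\<^bsub>BZ\<^esub> FZa (zAa ?h) = zBa (FSa ?h) \<cdot>\<^bsub>BZ\<^esub> m A"
    using M.comparison_nat[OF m, of ?h] S by simp
  also have "PBa' (zBa (FSa ?h) \<cdot>\<^bsub>BZ\<^esub> m A) \<cdot>\<^bsub>BW\<^esub> s' (zA A) \<cdot>\<^bsub>BW\<^esub> FWa (eA A) = PBa' (zBa (FSa ?h)) \<cdot>\<^bsub>BW\<^esub> ?R A"
    using S by (simp add: PB'.cmp)
  finally have "?L A = ?R A"
    by (rule N.LB.L.D.Iso_cancel_left[OF k, rotated 4]) (use S in simp_all)
  then show ?thesis by (simp add: exchange_at_def)
qed

end

section \<open>Zero objects and distinguished triangles\<close>

context additive_category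
begin

lemma hom_ops:
  assumes "a \<in> Ob C" "b \<in> Ob C"
  shows "Zero C a b \<in> Hom C a b" "f \<in> Hom C a b \<Longrightarrow> g \<in> Hom C a b \<Longrightarrow> Add C f g \<in> Hom C a b"
    and "f \<in> Hom C a b \<Longrightarrow> g \<in> Hom C a b \<Longrightarrow> Add C f g = Zero C a b \<Longrightarrow> neg_ar C f = g"
    and "f \<in> Hom C a b \<Longrightarrow> neg_ar C f \<in> Hom C a b"
    and "f \<in> Hom C a b \<Longrightarrow> neg_ar C (neg_ar C f) = f"
    and "f \<in> Hom C a b \<Longrightarrow> Add C f (neg_ar C f) = Zero C a b"
    and "f \<in> Hom C a b \<Longrightarrow> Add C f f = f \<Longrightarrow> f = Zero C a b"
proof -
  interpret comm_group "hom_group C a b" by (rule hom_comm_group[OF assms])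
  have c: "carrier (hom_group C a b) = Hom C a b" "monoid.mult (hom_group C a b) = Add C" "one (hom_group C a b) = Zero C a b"
    by (simp_all add: hom_group_def)
  have n: "neg_ar C f = inv\<^bsub>hom_group C a b\<^esub> f" if "f \<in> Hom C a b" for f
    using that by (simp add: neg_ar_def Hom_def)
  show "Zero C a b \<in> Hom C a b" using one_closed by (simp add: c)
  show "f \<in> Hom C a b \<Longrightarrow> g \<in> Hom C a b \<Longrightarrow> Add C f g \<in> Hom C a b" using m_closed[of f g] by (simp add: c)
  show "f \<in> Hom C a b \<Longrightarrow> g \<in> Hom C a b \<Longrightarrow> Add C f g = Zero C a b \<Longrightarrow> neg_ar C f = g"
    using inv_equality[of g f] m_comm[of f g] by (simp add: c n)
  show k: "f \<in> Hom C a b \<Longrightarrow> neg_ar C f \<in> Hom C a b" for f using inv_closed[of f] by (simp add: c n)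
  show "f \<in> Hom C a b \<Longrightarrow> neg_ar C (neg_ar C f) = f" using inv_inv[of f] inv_closed[of f] by (simp add: c n)
  show "f \<in> Hom C a b \<Longrightarrow> Add C f (neg_ar C f) = Zero C a b" using r_inv[of f] by (simp add: c n)
  show "f \<in> Hom C a b \<Longrightarrow> Add C f f = f \<Longrightarrow> f = Zero C a b" using r_cancel_one[of f f] by (simp add: c)
qed

lemma Zero_simps [simp]: "a \<in> Ob C \<Longrightarrow> b \<in> Ob C \<Longrightarrow> Zero C a b \<in> Ar C"
  "a \<in> Ob C \<Longrightarrow> b \<in> Ob C \<Longrightarrow> Dom C (Zero C a b) = a" "a \<in> Ob C \<Longrightarrow> b \<in> Ob C \<Longrightarrow> Cod C (Zero C a b) = b"
  using hom_ops(1)[of a b] by (auto simp: Hom_def)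

lemma neg_simps [simp]: "f \<in> Ar C \<Longrightarrow> neg_ar C f \<in> Ar C" "f \<in> Ar C \<Longrightarrow> Dom C (neg_ar C f) = Dom C f"
  "f \<in> Ar C \<Longrightarrow> Cod C (neg_ar C f) = Cod C f" "f \<in> Ar C \<Longrightarrow> neg_ar C (neg_ar C f) = f"
  using hom_ops(4,5)[of "Dom C f" "Cod C f" f] by (auto simp: Hom_def)

lemma Cmp_Zero [simp]:
  assumes "g \<in> Ar C" "a \<in> Ob C" "b = Dom C g" shows "g \<cdot>\<^bsub>C\<^esub> Zero C a b = Zero C a (Cod C g)"
proof -
  let ?z = "Zero C a (Dom C g)"
  have z: "?z \<in> Hom C a (Dom C g)" and g: "g \<in> Hom C (Dom C g) (Cod C g)"
    using assms by (auto simp: Hom_def)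
  have "Add C ?z ?z = ?z"
  proof -
    interpret comm_group "hom_group C a (Dom C g)" by (rule hom_comm_group) (use assms in simp_all)
    show ?thesis using l_one[OF one_closed] by (simp add: hom_group_def)
  qed
  then have "Add C (g \<cdot>\<^bsub>C\<^esub> ?z) (g \<cdot>\<^bsub>C\<^esub> ?z) = g \<cdot>\<^bsub>C\<^esub> ?z"
    using Cmp_Add_right[OF z z g] by simp
  then show ?thesis using assms hom_ops(7)[of a "Cod C g" "g \<cdot>\<^bsub>C\<^esub> ?z"] by (simp add: Hom_def)
qed

lemma Zero_Cmp [simp]:
  assumes "f \<in> Ar C" "c \<in> Ob C" "b = Cod C f" shows "Zero C b c \<cdot>\<^bsub>C\<^esub> f = Zero C (Dom C f) c"
proof -
  let ?z = "Zero C (Cod C f) c"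
  have z: "?z \<in> Hom C (Cod C f) c" and f: "f \<in> Hom C (Dom C f) (Cod C f)"
    using assms by (auto simp: Hom_def)
  have "Add C ?z ?z = ?z"
  proof -
    interpret comm_group "hom_group C (Cod C f) c" by (rule hom_comm_group) (use assms in simp_all)
    show ?thesis using l_one[OF one_closed] by (simp add: hom_group_def)
  qed
  then have "Add C (?z \<cdot>\<^bsub>C\<^esub> f) (?z \<cdot>\<^bsub>C\<^esub> f) = ?z \<cdot>\<^bsub>C\<^esub> f"
    using Cmp_Add_left[OF f z z] by simp
  then show ?thesis using assms hom_ops(7)[of "Dom C f" c "?z \<cdot>\<^bsub>C\<^esub> f"] by (simp add: Hom_def)
qed

lemma Cmp_neg:
  assumes "f \<in> Ar C" "g \<in> Ar C" "Cod C f = Dom C g"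
  shows "g \<cdot>\<^bsub>C\<^esub> neg_ar C f = neg_ar C (g \<cdot>\<^bsub>C\<^esub> f)" "neg_ar C g \<cdot>\<^bsub>C\<^esub> f = neg_ar C (g \<cdot>\<^bsub>C\<^esub> f)"
proof -
  have f: "f \<in> Hom C (Dom C f) (Dom C g)" and g: "g \<in> Hom C (Dom C g) (Cod C g)"
    using assms by (auto simp: Hom_def)
  have nf: "neg_ar C f \<in> Hom C (Dom C f) (Dom C g)" and ng: "neg_ar C g \<in> Hom C (Dom C g) (Cod C g)"
    using assms by (auto simp: Hom_def)
  have "Add C (g \<cdot>\<^bsub>C\<^esub> f) (g \<cdot>\<^bsub>C\<^esub> neg_ar C f) = g \<cdot>\<^bsub>C\<^esub> Add C f (neg_ar C f)"
    by (rule Cmp_Add_right[OF f nf g, symmetric])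
  also have "\<dots> = Zero C (Dom C f) (Cod C g)"
    using assms hom_ops(6)[OF _ _ f] by simp
  finally show "g \<cdot>\<^bsub>C\<^esub> neg_ar C f = neg_ar C (g \<cdot>\<^bsub>C\<^esub> f)"
    using hom_ops(3)[of "Dom C f" "Cod C g" "g \<cdot>\<^bsub>C\<^esub> f" "g \<cdot>\<^bsub>C\<^esub> neg_ar C f"] assms by (simp add: Hom_def)
  have "Add C (g \<cdot>\<^bsub>C\<^esub> f) (neg_ar C g \<cdot>\<^bsub>C\<^esub> f) = Add C g (neg_ar C g) \<cdot>\<^bsub>C\<^esub> f"
    by (rule Cmp_Add_left[OF f g ng, symmetric])
  also have "\<dots> = Zero C (Dom C f) (Cod C g)"
    using assms hom_ops(6)[OF _ _ g] by simp
  finally show "neg_ar C g \<cdot>\<^bsub>C\<^esub> f = neg_ar C (g \<cdot>\<^bsub>C\<^esub> f)"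
    using hom_ops(3)[of "Dom C f" "Cod C g" "g \<cdot>\<^bsub>C\<^esub> f" "neg_ar C g \<cdot>\<^bsub>C\<^esub> f"] assms by (simp add: Hom_def)
qed

lemma neg_inj: "f \<in> Ar C \<Longrightarrow> g \<in> Ar C \<Longrightarrow> neg_ar C f = neg_ar C g \<Longrightarrow> f = g"
  using neg_simps(4) by metis

lemma zero_object_Ob [simp]: "zero_object C a \<Longrightarrow> a \<in> Ob C"
  by (simp add: zero_object_def)

lemma zero_object_source:
  assumes "zero_object C a" "f \<in> Ar C" "g \<in> Ar C" "Dom C f = a" "Dom C g = a" "Cod C f = Cod C g"
  shows "f = g"
proof -
  have "f \<cdot>\<^bsub>C\<^esub> Zero C a a = g \<cdot>\<^bsub>C\<^esub> Zero C a a" using assms by simp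
  moreover have "Zero C a a = Idn C a" using assms(1) by (simp add: zero_object_def)
  ultimately have "f \<cdot>\<^bsub>C\<^esub> Idn C a = g \<cdot>\<^bsub>C\<^esub> Idn C a" by metis
  then show ?thesis using assms(2-5) by simp
qed

lemma zero_object_target:
  assumes "zero_object C a" "f \<in> Ar C" "g \<in> Ar C" "Cod C f = a" "Cod C g = a" "Dom C f = Dom C g"
  shows "f = g"
proof -
  have "Zero C a a \<cdot>\<^bsub>C\<^esub> f = Zero C a a \<cdot>\<^bsub>C\<^esub> g" using assms by simp
  moreover have "Zero C a a = Idn C a" using assms(1) by (simp add: zero_object_def)
  ultimately have "Idn C a \<cdot>\<^bsub>C\<^esub> f = Idn C a \<cdot>\<^bsub>C\<^esub> g" by metis
  then show ?thesis using assms(2-5) by simp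
qed

lemma zero_objectI:
  assumes "a \<in> Ob C" "\<And>f g. f \<in> Ar C \<Longrightarrow> g \<in> Ar C \<Longrightarrow> Dom C f = a \<Longrightarrow> Dom C g = a \<Longrightarrow> Cod C f = a \<Longrightarrow> Cod C g = a \<Longrightarrow> f = g"
  shows "zero_object C a"
proof -
  have "Idn C a = Zero C a a"
    by (rule assms(2)) (use assms(1) in simp_all)
  then show ?thesis using assms(1) by (simp add: zero_object_def)
qed

lemma zero_object_Iso:
  assumes "\<phi> \<in> Iso C" "zero_object C (Dom C \<phi>)" shows "zero_object C (Cod C \<phi>)"
proof (rule zero_objectI)
  fix f g assume fg: "f \<in> Ar C" "g \<in> Ar C" "Dom C f = Cod C \<phi>" "Dom C g = Cod C \<phi>" "Cod C f = Cod C \<phi>" "Cod C g = Cod C \<phi>"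
  have "f \<cdot>\<^bsub>C\<^esub> \<phi> = g \<cdot>\<^bsub>C\<^esub> \<phi>"
    by (rule zero_object_source[OF assms(2)]) (use fg Iso_Ar[OF assms(1)] in simp_all)
  then show "f = g" using Iso_cancel_right[OF assms(1)] fg by simp
qed (rule Cod_Ob[OF Iso_Ar[OF assms(1)]])

lemma zero_object_Iso':
  assumes "\<phi> \<in> Iso C" "zero_object C (Cod C \<phi>)" shows "zero_object C (Dom C \<phi>)"
  using zero_object_Iso[OF inv_ar_Iso[OF assms(1)]] assms by simp

lemma zero_objects_Iso:
  assumes "f \<in> Ar C" "zero_object C (Dom C f)" "zero_object C (Cod C f)" shows "f \<in> Iso C"
proof (rule inverse_arrows_Iso[OF inverse_arrowsI[where g = "Zero C (Cod C f) (Dom C f)"]])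
  show "Zero C (Cod C f) (Dom C f) \<cdot>\<^bsub>C\<^esub> f = Idn C (Dom C f)"
    by (rule zero_object_source[OF assms(2)]) (use assms in simp_all)
  show "f \<cdot>\<^bsub>C\<^esub> Zero C (Cod C f) (Dom C f) = Idn C (Cod C f)"
    by (rule zero_object_source[OF assms(3)]) (use assms in simp_all)
qed (use assms in simp_all)

end

lemma additive_functor_zero:
  assumes "additive_category C" "additive_category D" "additive_functor C D Fo Fa" "zero_object C a"
  shows "zero_object D (Fo a)"
proof -
  interpret C: additive_category C by fact
  interpret D: additive_category D by fact
  interpret functor_on C D Fo Fa
    using assms by unfold_locales (simp add: additive_functor_def)
  have a: "a \<in> Ob C" "Idn C a = Zero C a a" using assms(4) by (auto simp: zero_object_def)
  have z: "Zero C a a \<in> Hom C a a" using C.hom_ops(1) a by blast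
  have "Add C (Zero C a a) (Zero C a a) = Zero C a a"
  proof -
    interpret comm_group "hom_group C a a" by (rule C.hom_comm_group) (use a in simp_all)
    show ?thesis using l_one[OF one_closed] by (simp add: hom_group_def)
  qed
  moreover have "\<forall>f\<in>Hom C a a. \<forall>g\<in>Hom C a a. Fa (Add C f g) = Add D (Fa f) (Fa g)"
    using assms(3) a(1) unfolding additive_functor_def by blast
  ultimately have "Add D (Fa (Zero C a a)) (Fa (Zero C a a)) = Fa (Zero C a a)"
    using z by force
  then have "Fa (Zero C a a) = Zero D (Fo a) (Fo a)"
    using D.hom_ops(7)[of "Fo a" "Fo a" "Fa (Zero C a a)"] a by (simp add: Hom_def)
  then show ?thesis using a idn[of a] by (simp add: zero_object_def)
qed

text \<open>Two endomorphisms of \<open>L a\<close> agree because their transposes are arrows out of \<open>a\<close>.\<close>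

lemma left_adjoint_zero:
  assumes "additive_category C" "additive_category D" "adj C D Lo La Ro Ra \<eta> \<epsilon>" "zero_object C a"
  shows "zero_object D (Lo a)"
proof -
  interpret C: additive_category C by fact
  interpret D: additive_category D by fact
  interpret adj C D Lo La Ro Ra \<eta> \<epsilon> by fact
  have a: "a \<in> Ob C" using assms(4) by simp
  show ?thesis
  proof (rule D.zero_objectI)
    fix f g assume fg: "f \<in> Ar D" "g \<in> Ar D" "Dom D f = Lo a" "Dom D g = Lo a" "Cod D f = Lo a" "Cod D g = Lo a"
    have "Ra f \<cdot>\<^bsub>C\<^esub> \<eta> a = Ra g \<cdot>\<^bsub>C\<^esub> \<eta> a"
      by (rule C.zero_object_source[OF assms(4)]) (use fg a in simp_all)
    then show "f = g" by (rule transpose_inj_left[rotated 6]) (use fg a in simp_all)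
  qed (use a in simp)
qed

context triangulated_category
begin

lemma shift_functor: "functor_on C C (Sh C) (Sha C)"
  using shift_additive by unfold_locales (simp add: additive_functor_def)

lemma Sh_Zero:
  assumes "a \<in> Ob C" "b \<in> Ob C" shows "Sha C (Zero C a b) = Zero C (Sh C a) (Sh C b)"
proof -
  interpret sh: functor_on C C "Sh C" "Sha C" by (rule shift_functor)
  have z: "Zero C a b \<in> Hom C a b" using hom_ops(1) assms by blast
  have "Add C (Zero C a b) (Zero C a b) = Zero C a b"
  proof -
    interpret comm_group "hom_group C a b" by (rule hom_comm_group) (use assms in simp_all)
    show ?thesis using l_one[OF one_closed] by (simp add: hom_group_def)
  qed
  moreover have "\<forall>f\<in>Hom C a b. \<forall>g\<in>Hom C a b. Sha C (Add C f g) = Add C (Sha C f) (Sha C g)"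
    using shift_additive assms unfolding additive_functor_def by blast
  ultimately have "Add C (Sha C (Zero C a b)) (Sha C (Zero C a b)) = Sha C (Zero C a b)"
    using z by force
  then show ?thesis
    using hom_ops(7)[of "Sh C a" "Sh C b" "Sha C (Zero C a b)"] assms by (simp add: Hom_def)
qed

lemma shift_ff: "fully_faithful C C (Sh C) (Sha C)"
  using shift_equivalence by (simp add: equivalence_functor_def)

lemma TriD:
  assumes "(f, g, h) \<in> Tri C"
  shows "f \<in> Ar C" "g \<in> Ar C" "h \<in> Ar C" "Cod C f = Dom C g" "Cod C g = Dom C h" "Cod C h = Sh C (Dom C f)"
  using Tri_candidate[OF assms] by (auto simp: candidate_triangle_def)

lemma rotate: "(f, g, h) \<in> Tri C \<Longrightarrow> (g, h, neg_ar C (Sha C f)) \<in> Tri C"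
  using TR2 Tri_candidate by blast

lemma TR3':
  assumes "(f, g, h) \<in> Tri C" "(f', g', h') \<in> Tri C" "\<alpha> \<in> Ar C" "\<beta> \<in> Ar C" "Dom C \<alpha> = Dom C f" "Cod C \<alpha> = Dom C f'"
    "Dom C \<beta> = Dom C g" "Cod C \<beta> = Dom C g'" "\<beta> \<cdot>\<^bsub>C\<^esub> f = f' \<cdot>\<^bsub>C\<^esub> \<alpha>"
  shows "\<exists>\<gamma>. \<gamma> \<in> Ar C \<and> Dom C \<gamma> = Dom C h \<and> Cod C \<gamma> = Dom C h' \<and>
    \<gamma> \<cdot>\<^bsub>C\<^esub> g = g' \<cdot>\<^bsub>C\<^esub> \<beta> \<and> Sha C \<alpha> \<cdot>\<^bsub>C\<^esub> h = h' \<cdot>\<^bsub>C\<^esub> \<gamma>"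
proof -
  have "\<alpha> \<in> Hom C (Dom C f) (Dom C f')" "\<beta> \<in> Hom C (Dom C g) (Dom C g')" using assms(3-8) by (simp_all add: Hom_def)
  then obtain \<gamma> where "triangle_morphism C (f, g, h) (f', g', h') \<alpha> \<beta> \<gamma>"
    using TR3[OF assms(1,2) _ _ assms(9)] by blast
  then show ?thesis unfolding triangle_morphism_def Hom_def by auto
qed

text \<open>With a vanishing third object, comparison with the triangles of identities yields a left and a
  right inverse of the shift of the first arrow.\<close>

lemma triangle_zero_imp_Iso:
  assumes t: "(f, g, h) \<in> Tri C" and z: "zero_object C (Cod C g)"
  shows "f \<in> Iso C"
proof -
  interpret sh: functor_on C C "Sh C" "Sha C" by (rule shift_functor)
  let ?X = "Dom C f" and ?Y = "Cod C f" and ?Z = "Cod C g"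
  note D = TriD[OF t]
  have ob: "?X \<in> Ob C" "?Y \<in> Ob C" "?Z \<in> Ob C" using D by (metis Dom_Ob Cod_Ob)+
  note t1 = rotate[OF t]
  note t2 = rotate[OF t1]
  have idt: "(Zero C a ?Z, Zero C ?Z (Sh C a), neg_ar C (Idn C (Sh C a))) \<in> Tri C" if "a \<in> Ob C" for a
    using rotate[OF TR1_id[OF that z]] that by simp
  have "\<exists>\<gamma>. \<gamma> \<in> Ar C \<and> Dom C \<gamma> = Dom C (neg_ar C (Idn C (Sh C ?Y))) \<and> Cod C \<gamma> = Dom C (neg_ar C (Sha C f)) \<and>
      \<gamma> \<cdot>\<^bsub>C\<^esub> Zero C ?Z (Sh C ?Y) = h \<cdot>\<^bsub>C\<^esub> Idn C ?Z \<and>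
      Sha C (Idn C ?Y) \<cdot>\<^bsub>C\<^esub> neg_ar C (Idn C (Sh C ?Y)) = neg_ar C (Sha C f) \<cdot>\<^bsub>C\<^esub> \<gamma>"
  proof (rule TR3'[OF idt[OF ob(2)] t1])
    show "Idn C ?Z \<cdot>\<^bsub>C\<^esub> Zero C ?Y ?Z = g \<cdot>\<^bsub>C\<^esub> Idn C ?Y"
      by (rule zero_object_target[OF z]) (use D ob in simp_all)
  qed (use D ob in simp_all)
  then obtain \<gamma> where \<gamma>: "\<gamma> \<in> Ar C" "Dom C \<gamma> = Sh C ?Y" "Cod C \<gamma> = Sh C ?X"
    "Sha C (Idn C ?Y) \<cdot>\<^bsub>C\<^esub> neg_ar C (Idn C (Sh C ?Y)) = neg_ar C (Sha C f) \<cdot>\<^bsub>C\<^esub> \<gamma>"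
    using D ob by auto
  have r: "Sha C f \<cdot>\<^bsub>C\<^esub> \<gamma> = Idn C (Sh C ?Y)"
    by (rule neg_inj) (use \<gamma> D ob in \<open>simp_all add: Cmp_neg\<close>)
  have "\<exists>\<delta>. \<delta> \<in> Ar C \<and> Dom C \<delta> = Dom C (neg_ar C (Sha C g)) \<and> Cod C \<delta> = Dom C (neg_ar C (Sha C (Zero C ?X ?Z))) \<and>
      \<delta> \<cdot>\<^bsub>C\<^esub> neg_ar C (Sha C f) = neg_ar C (Idn C (Sh C ?X)) \<cdot>\<^bsub>C\<^esub> Idn C (Sh C ?X) \<and>
      Sha C (Idn C ?Z) \<cdot>\<^bsub>C\<^esub> neg_ar C (Sha C g) = neg_ar C (Sha C (Zero C ?X ?Z)) \<cdot>\<^bsub>C\<^esub> \<delta>"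
  proof (rule TR3'[OF t2 rotate[OF idt[OF ob(1)]]])
    show "Idn C (Sh C ?X) \<cdot>\<^bsub>C\<^esub> h = Zero C ?Z (Sh C ?X) \<cdot>\<^bsub>C\<^esub> Idn C ?Z"
      by (rule zero_object_source[OF z]) (use D ob in simp_all)
  qed (use D ob in simp_all)
  then obtain \<delta> where \<delta>: "\<delta> \<in> Ar C" "Dom C \<delta> = Sh C ?Y" "Cod C \<delta> = Sh C ?X"
    "\<delta> \<cdot>\<^bsub>C\<^esub> neg_ar C (Sha C f) = neg_ar C (Idn C (Sh C ?X)) \<cdot>\<^bsub>C\<^esub> Idn C (Sh C ?X)"
    using D ob by auto
  have l: "\<delta> \<cdot>\<^bsub>C\<^esub> Sha C f = Idn C (Sh C ?X)"
    by (rule neg_inj) (use \<delta> D ob in \<open>simp_all add: Cmp_neg\<close>)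
  have "\<delta> = \<delta> \<cdot>\<^bsub>C\<^esub> (Sha C f \<cdot>\<^bsub>C\<^esub> \<gamma>)" using r \<delta>(1-3) ob by simp
  also have "\<dots> = (\<delta> \<cdot>\<^bsub>C\<^esub> Sha C f) \<cdot>\<^bsub>C\<^esub> \<gamma>" using \<delta>(1-3) \<gamma>(1-3) D by simp
  finally have "\<delta> = \<gamma>" using l \<gamma>(1-3) ob by simp
  then have "inverse_arrows C (Sha C f) \<gamma>"
    using D(1) \<gamma>(1-3) r l by (intro inverse_arrowsI) simp_all
  then show ?thesis using sh.reflects_iso[OF shift_ff D(1)] inverse_arrows_Iso by blast
qed

text \<open>The triangle on an isomorphism may be compared with one whose third object vanishes, so its other
  two arrows vanish; then the identity of the third object factors through zero.\<close>

lemma triangle_Iso_imp_zero: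
  assumes t: "(f, g, h) \<in> Tri C" and f: "f \<in> Iso C"
  shows "zero_object C (Cod C g)"
proof -
  interpret sh: functor_on C C "Sh C" "Sha C" by (rule shift_functor)
  let ?X = "Dom C f" and ?Y = "Cod C f" and ?Z = "Cod C g"
  note D = TriD[OF t]
  have ob: "?X \<in> Ob C" "?Y \<in> Ob C" "?Z \<in> Ob C" using D by (metis Dom_Ob Cod_Ob)+
  obtain z where z: "zero_object C z" using zero_object_exists by blast
  then have zo: "z \<in> Ob C" by simp
  have t': "(f, Zero C ?Y z, Zero C z (Sh C ?X)) \<in> Tri C"
    by (rule TR1_iso[OF TR1_id[OF ob(1) z], where \<alpha> = "Idn C ?X" and \<beta> = f and \<gamma> = "Idn C z"])
      (use D ob f zo in \<open>simp_all add: candidate_triangle_def triangle_morphism_def Hom_def\<close>)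
  have "\<exists>\<gamma>. \<gamma> \<in> Ar C \<and> Dom C \<gamma> = Dom C h \<and> Cod C \<gamma> = Dom C (Zero C z (Sh C ?X)) \<and>
      \<gamma> \<cdot>\<^bsub>C\<^esub> g = Zero C ?Y z \<cdot>\<^bsub>C\<^esub> Idn C ?Y \<and> Sha C (Idn C ?X) \<cdot>\<^bsub>C\<^esub> h = Zero C z (Sh C ?X) \<cdot>\<^bsub>C\<^esub> \<gamma>"
    by (rule TR3'[OF t t']) (use D ob zo in simp_all)
  then obtain \<gamma> where \<gamma>: "\<gamma> \<in> Ar C" "Dom C \<gamma> = Dom C h" "Cod C \<gamma> = Dom C (Zero C z (Sh C ?X))"
      "Sha C (Idn C ?X) \<cdot>\<^bsub>C\<^esub> h = Zero C z (Sh C ?X) \<cdot>\<^bsub>C\<^esub> \<gamma>" by blast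
  have "Sha C (Idn C ?X) \<cdot>\<^bsub>C\<^esub> h = h" using D(3,6) ob by simp
  moreover have "Zero C z (Sh C ?X) \<cdot>\<^bsub>C\<^esub> \<gamma> = Zero C (Dom C \<gamma>) (Sh C ?X)" using \<gamma>(1,3) ob zo by simp
  ultimately have h: "h = Zero C ?Z (Sh C ?X)" using \<gamma>(2,4) D(5) by metis
  have "\<exists>\<delta>. \<delta> \<in> Ar C \<and> Dom C \<delta> = Dom C (Zero C z (Sh C ?X)) \<and> Cod C \<delta> = Dom C h \<and>
      \<delta> \<cdot>\<^bsub>C\<^esub> Zero C ?Y z = g \<cdot>\<^bsub>C\<^esub> Idn C ?Y \<and> Sha C (Idn C ?X) \<cdot>\<^bsub>C\<^esub> Zero C z (Sh C ?X) = h \<cdot>\<^bsub>C\<^esub> \<delta>"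
    by (rule TR3'[OF t' t]) (use D ob zo in simp_all)
  then obtain \<delta> where \<delta>: "\<delta> \<in> Ar C" "Dom C \<delta> = Dom C (Zero C z (Sh C ?X))" "Cod C \<delta> = Dom C h"
      "\<delta> \<cdot>\<^bsub>C\<^esub> Zero C ?Y z = g \<cdot>\<^bsub>C\<^esub> Idn C ?Y" by blast
  have "g \<cdot>\<^bsub>C\<^esub> Idn C ?Y = g" using D(2,4) by simp
  moreover have "\<delta> \<cdot>\<^bsub>C\<^esub> Zero C ?Y z = Zero C ?Y (Cod C \<delta>)" using \<delta>(1,2) ob zo by simp
  ultimately have g: "g = Zero C ?Y ?Z" using \<delta>(3,4) D(5) by metis
  have idt: "(Zero C ?Z z, Zero C z (Sh C ?Z), neg_ar C (Idn C (Sh C ?Z))) \<in> Tri C"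
    using rotate[OF TR1_id[OF ob(3) z]] ob by simp
  have "\<exists>k. k \<in> Ar C \<and> Dom C k = Dom C (neg_ar C (Idn C (Sh C ?Z))) \<and> Cod C k = Dom C (neg_ar C (Sha C g)) \<and>
      k \<cdot>\<^bsub>C\<^esub> Zero C z (Sh C ?Z) = neg_ar C (Sha C f) \<cdot>\<^bsub>C\<^esub> Zero C z (Sh C ?X) \<and>
      Sha C (Idn C ?Z) \<cdot>\<^bsub>C\<^esub> neg_ar C (Idn C (Sh C ?Z)) = neg_ar C (Sha C g) \<cdot>\<^bsub>C\<^esub> k"
  proof (rule TR3'[OF idt rotate[OF rotate[OF t]]])
    show "Zero C z (Sh C ?X) \<cdot>\<^bsub>C\<^esub> Zero C ?Z z = h \<cdot>\<^bsub>C\<^esub> Idn C ?Z"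
      by (subst h) (use ob zo in simp)
  qed (use D ob zo in simp_all)
  then obtain k where k: "k \<in> Ar C" "Dom C k = Sh C ?Z" "Cod C k = Sh C ?Y"
    "Sha C (Idn C ?Z) \<cdot>\<^bsub>C\<^esub> neg_ar C (Idn C (Sh C ?Z)) = neg_ar C (Sha C g) \<cdot>\<^bsub>C\<^esub> k"
    using D(1-4) ob by auto
  have "neg_ar C (Idn C (Sh C ?Z)) = neg_ar C (Sha C g \<cdot>\<^bsub>C\<^esub> k)"
    using k D(2,4) ob by (simp add: Cmp_neg)
  then have "Idn C (Sh C ?Z) = Sha C g \<cdot>\<^bsub>C\<^esub> k"
    by (rule neg_inj[rotated 2]) (use k(1-3) D(2,4) ob in simp_all)
  also have "\<dots> = Zero C (Sh C ?Z) (Sh C ?Z)"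
    by (subst g) (use k(1-3) ob in \<open>simp add: Sh_Zero\<close>)
  finally have "Sha C (Idn C ?Z) = Sha C (Zero C ?Z ?Z)" using ob by (simp add: Sh_Zero)
  then have "Idn C ?Z = Zero C ?Z ?Z"
    by (rule sh.faithful[OF shift_ff, rotated 4]) (use ob in simp_all)
  then show ?thesis using ob by (simp add: zero_object_def)
qed

end

section \<open>Products and complements in the base\<close>

definition (in category) product_cone :: "'o \<Rightarrow> 'o \<Rightarrow> 'o \<Rightarrow> 'm \<Rightarrow> 'm \<Rightarrow> bool" where
  "product_cone Y a b q1 q2 \<longleftrightarrow> Y \<in> Ob C \<and> a \<in> Ob C \<and> b \<in> Ob C \<and> q1 \<in> Hom C Y a \<and> q2 \<in> Hom C Y b \<and>
     (\<forall>t x y. x \<in> Hom C t a \<longrightarrow> y \<in> Hom C t b \<longrightarrow> (\<exists>!h. h \<in> Hom C t Y \<and> q1 \<cdot>\<^bsub>C\<^esub> h = x \<and> q2 \<cdot>\<^bsub>C\<^esub> h = y))"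

context category
begin

lemma product_coneD:
  assumes "product_cone Y a b q1 q2"
  shows "Y \<in> Ob C" "a \<in> Ob C" "b \<in> Ob C" "q1 \<in> Ar C" "q2 \<in> Ar C" "Dom C q1 = Y" "Dom C q2 = Y" "Cod C q1 = a" "Cod C q2 = b"
  using assms by (auto simp: product_cone_def Hom_def)

lemma product_cone_pair:
  assumes "product_cone Y a b q1 q2" "x \<in> Ar C" "y \<in> Ar C" "Dom C x = Dom C y" "Cod C x = a" "Cod C y = b" "t = Dom C x"
  shows "\<exists>h. h \<in> Ar C \<and> Dom C h = t \<and> Cod C h = Y \<and> q1 \<cdot>\<^bsub>C\<^esub> h = x \<and> q2 \<cdot>\<^bsub>C\<^esub> h = y"
proof -
  have "x \<in> Hom C t a" "y \<in> Hom C t b" using assms by (auto simp: Hom_def)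
  then have "\<exists>h. h \<in> Hom C t Y \<and> q1 \<cdot>\<^bsub>C\<^esub> h = x \<and> q2 \<cdot>\<^bsub>C\<^esub> h = y"
    using assms(1) unfolding product_cone_def by blast
  then show ?thesis by (auto simp: Hom_def)
qed

lemma product_cone_eq:
  assumes P: "product_cone Y a b q1 q2" and "g \<in> Ar C" "h \<in> Ar C" "Dom C g = Dom C h" "Cod C g = Y" "Cod C h = Y"
    and "q1 \<cdot>\<^bsub>C\<^esub> g = q1 \<cdot>\<^bsub>C\<^esub> h" "q2 \<cdot>\<^bsub>C\<^esub> g = q2 \<cdot>\<^bsub>C\<^esub> h"
  shows "g = h"
proof -
  have "q1 \<cdot>\<^bsub>C\<^esub> h \<in> Hom C (Dom C h) a" "q2 \<cdot>\<^bsub>C\<^esub> h \<in> Hom C (Dom C h) b"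
    using assms(2-6) product_coneD[OF P] by (simp_all add: Hom_def)
  then have "\<exists>!k. k \<in> Hom C (Dom C h) Y \<and> q1 \<cdot>\<^bsub>C\<^esub> k = q1 \<cdot>\<^bsub>C\<^esub> h \<and> q2 \<cdot>\<^bsub>C\<^esub> k = q2 \<cdot>\<^bsub>C\<^esub> h"
    using P unfolding product_cone_def by blast
  moreover have "g \<in> Hom C (Dom C h) Y" "h \<in> Hom C (Dom C h) Y" using assms by (simp_all add: Hom_def)
  ultimately show ?thesis using assms(7,8) by blast
qed

end

context base_category
begin

lemma from_empty: "T \<in> Ob S \<Longrightarrow> from_empty S T \<in> Ar S \<and> Dom S (from_empty S T) = Empt S \<and> Cod S (from_empty S T) = T"
  and from_empty_unique: "h \<in> Ar S \<Longrightarrow> Dom S h = Empt S \<Longrightarrow> Cod S h = T \<Longrightarrow> h = from_empty S T"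
proof -
  show 1: "from_empty S T \<in> Ar S \<and> Dom S (from_empty S T) = Empt S \<and> Cod S (from_empty S T) = T" if "T \<in> Ob S" for T
    using theI'[OF Empt_initial[OF that]] by (simp add: from_empty_def Hom_def)
  show "h = from_empty S T" if "h \<in> Ar S" "Dom S h = Empt S" "Cod S h = T"
  proof -
    have "T \<in> Ob S" using that by auto
    then show ?thesis using Empt_initial[of T] 1[of T] that by (auto simp: Hom_def)
  qed
qed

lemma from_empty_simps [simp]:
  "T \<in> Ob S \<Longrightarrow> from_empty S T \<in> Ar S" "T \<in> Ob S \<Longrightarrow> Dom S (from_empty S T) = Empt S"
  "T \<in> Ob S \<Longrightarrow> Cod S (from_empty S T) = T"
  using from_empty by auto

lemma Cmp_from_empty: "g \<in> Ar S \<Longrightarrow> T = Dom S g \<Longrightarrow> g \<cdot>\<^bsub>S\<^esub> from_empty S T = from_empty S (Cod S g)"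
  by (rule from_empty_unique) simp_all

abbreviation disjoint :: "'m \<Rightarrow> 'm \<Rightarrow> bool" where
  "disjoint f z \<equiv> cartesian S (from_empty S (Dom S f)) (from_empty S (Dom S z)) f z"

text \<open>With \<open>\<zeta> = z \<times> T\<close>, the fibre products of \<open>f\<close> with \<open>\<zeta>\<close> and of \<open>q1 f\<close> with \<open>z\<close> have the same points, since
  the component in \<open>T\<close> of a point of \<open>Z'\<close> is determined by \<open>f\<close>.\<close>

lemma disjoint_product_iff:
  assumes Y: "product_cone Y a T q1 q2" and Z: "product_cone Z' b T r1 r2"
    and z: "z \<in> Ar S" "Dom S z = b" "Cod S z = a"
    and \<zeta>: "\<zeta> \<in> Ar S" "Dom S \<zeta> = Z'" "Cod S \<zeta> = Y" "q1 \<cdot>\<^bsub>S\<^esub> \<zeta> = z \<cdot>\<^bsub>S\<^esub> r1" "q2 \<cdot>\<^bsub>S\<^esub> \<zeta> = r2"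
    and f: "f \<in> Ar S" "Cod S f = Y"
  shows "disjoint f \<zeta> \<longleftrightarrow> disjoint (q1 \<cdot>\<^bsub>S\<^esub> f) z"
proof -
  note P = product_coneD[OF Y] product_coneD[OF Z]
  note S = P z \<zeta>(1-3) f
  let ?X = "Dom S f"
  have ob: "?X \<in> Ob S" using f by simp
  note fe = Cmp_from_empty
  show ?thesis
  proof
    assume d: "disjoint f \<zeta>"
    show "disjoint (q1 \<cdot>\<^bsub>S\<^esub> f) z"
    proof (rule cartesianI)
      show "(q1 \<cdot>\<^bsub>S\<^esub> f) \<cdot>\<^bsub>S\<^esub> from_empty S (Dom S (q1 \<cdot>\<^bsub>S\<^esub> f)) = z \<cdot>\<^bsub>S\<^esub> from_empty S (Dom S z)"
        using S ob by (subst (1 2) fe) simp_all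
    next
      fix x y assume xy: "x \<in> Ar S" "y \<in> Ar S" "Dom S x = Dom S y" "Cod S x = Dom S (q1 \<cdot>\<^bsub>S\<^esub> f)" "Cod S y = Dom S z"
        and eq: "(q1 \<cdot>\<^bsub>S\<^esub> f) \<cdot>\<^bsub>S\<^esub> x = z \<cdot>\<^bsub>S\<^esub> y"
      have xc: "Cod S x = ?X" using xy S by simp
      have "\<exists>v. v \<in> Ar S \<and> Dom S v = Dom S y \<and> Cod S v = Z' \<and> r1 \<cdot>\<^bsub>S\<^esub> v = y \<and> r2 \<cdot>\<^bsub>S\<^esub> v = q2 \<cdot>\<^bsub>S\<^esub> f \<cdot>\<^bsub>S\<^esub> x"
        by (rule product_cone_pair[OF Z]) (use S xy xc in simp_all)
      then obtain v where v: "v \<in> Ar S" "Dom S v = Dom S y" "Cod S v = Z'" "r1 \<cdot>\<^bsub>S\<^esub> v = y" "r2 \<cdot>\<^bsub>S\<^esub> v = q2 \<cdot>\<^bsub>S\<^esub> f \<cdot>\<^bsub>S\<^esub> x"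
        by blast
      have "f \<cdot>\<^bsub>S\<^esub> x = \<zeta> \<cdot>\<^bsub>S\<^esub> v"
      proof (rule product_cone_eq[OF Y])
        have "q1 \<cdot>\<^bsub>S\<^esub> \<zeta> \<cdot>\<^bsub>S\<^esub> v = (q1 \<cdot>\<^bsub>S\<^esub> \<zeta>) \<cdot>\<^bsub>S\<^esub> v" using S v by simp
        also have "\<dots> = z \<cdot>\<^bsub>S\<^esub> r1 \<cdot>\<^bsub>S\<^esub> v" unfolding \<zeta>(4) using S v by simp
        finally show "q1 \<cdot>\<^bsub>S\<^esub> f \<cdot>\<^bsub>S\<^esub> x = q1 \<cdot>\<^bsub>S\<^esub> \<zeta> \<cdot>\<^bsub>S\<^esub> v" using eq v(4) S xy(1) xc by simp
        have "q2 \<cdot>\<^bsub>S\<^esub> \<zeta> \<cdot>\<^bsub>S\<^esub> v = (q2 \<cdot>\<^bsub>S\<^esub> \<zeta>) \<cdot>\<^bsub>S\<^esub> v" using S v by simp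
        then show "q2 \<cdot>\<^bsub>S\<^esub> f \<cdot>\<^bsub>S\<^esub> x = q2 \<cdot>\<^bsub>S\<^esub> \<zeta> \<cdot>\<^bsub>S\<^esub> v" using \<zeta>(5) v(5) by simp
      qed (use S v xy xc in simp_all)
      then have "\<exists>h. h \<in> Ar S \<and> Dom S h = Dom S x \<and> Cod S h = Empt S \<and>
          from_empty S ?X \<cdot>\<^bsub>S\<^esub> h = x \<and> from_empty S (Dom S \<zeta>) \<cdot>\<^bsub>S\<^esub> h = v"
        by (intro cartesian_factor[OF d]) (use S v(1-3) xy xc ob in simp_all)
      then obtain h where h: "h \<in> Ar S" "Dom S h = Dom S x" "Cod S h = Empt S"
          "from_empty S ?X \<cdot>\<^bsub>S\<^esub> h = x" "from_empty S Z' \<cdot>\<^bsub>S\<^esub> h = v"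
        unfolding \<zeta>(2) by blast
      have "from_empty S b \<cdot>\<^bsub>S\<^esub> h = (r1 \<cdot>\<^bsub>S\<^esub> from_empty S Z') \<cdot>\<^bsub>S\<^esub> h" using S by (simp add: fe)
      also have "\<dots> = y" using S h v by simp
      finally show "\<exists>h. h \<in> Ar S \<and> Dom S h = Dom S x \<and> Cod S h = Dom S (from_empty S (Dom S (q1 \<cdot>\<^bsub>S\<^esub> f))) \<and>
          from_empty S (Dom S (q1 \<cdot>\<^bsub>S\<^esub> f)) \<cdot>\<^bsub>S\<^esub> h = x \<and> from_empty S (Dom S z) \<cdot>\<^bsub>S\<^esub> h = y"
        using S h ob by (intro exI[of _ h]) simp
    next
      fix h h' assume h: "h \<in> Ar S" "h' \<in> Ar S" "Dom S h = Dom S h'" "Cod S h = Dom S (from_empty S (Dom S (q1 \<cdot>\<^bsub>S\<^esub> f)))"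
        "Cod S h' = Dom S (from_empty S (Dom S (q1 \<cdot>\<^bsub>S\<^esub> f)))" "from_empty S (Dom S (q1 \<cdot>\<^bsub>S\<^esub> f)) \<cdot>\<^bsub>S\<^esub> h = from_empty S (Dom S (q1 \<cdot>\<^bsub>S\<^esub> f)) \<cdot>\<^bsub>S\<^esub> h'"
        "from_empty S (Dom S z) \<cdot>\<^bsub>S\<^esub> h = from_empty S (Dom S z) \<cdot>\<^bsub>S\<^esub> h'"
      have hc: "Cod S h = Empt S" "Cod S h' = Empt S" "from_empty S ?X \<cdot>\<^bsub>S\<^esub> h = from_empty S ?X \<cdot>\<^bsub>S\<^esub> h'" "from_empty S b \<cdot>\<^bsub>S\<^esub> h = from_empty S b \<cdot>\<^bsub>S\<^esub> h'"
        using h S ob by simp_all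
      have Th: "from_empty S T \<cdot>\<^bsub>S\<^esub> k = (q2 \<cdot>\<^bsub>S\<^esub> f) \<cdot>\<^bsub>S\<^esub> from_empty S ?X \<cdot>\<^bsub>S\<^esub> k" if "k \<in> Ar S" "Cod S k = Empt S" for k
      proof -
        have "(q2 \<cdot>\<^bsub>S\<^esub> f) \<cdot>\<^bsub>S\<^esub> from_empty S ?X \<cdot>\<^bsub>S\<^esub> k = ((q2 \<cdot>\<^bsub>S\<^esub> f) \<cdot>\<^bsub>S\<^esub> from_empty S ?X) \<cdot>\<^bsub>S\<^esub> k"
          using S ob that by simp
        also have "(q2 \<cdot>\<^bsub>S\<^esub> f) \<cdot>\<^bsub>S\<^esub> from_empty S ?X = from_empty S T" using S ob by (subst fe) simp_all
        finally show ?thesis by simp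
      qed
      have e: "from_empty S Z' \<cdot>\<^bsub>S\<^esub> h = from_empty S Z' \<cdot>\<^bsub>S\<^esub> h'"
      proof (rule product_cone_eq[OF Z])
        have r: "r1 \<cdot>\<^bsub>S\<^esub> from_empty S Z' \<cdot>\<^bsub>S\<^esub> k = from_empty S b \<cdot>\<^bsub>S\<^esub> k" "r2 \<cdot>\<^bsub>S\<^esub> from_empty S Z' \<cdot>\<^bsub>S\<^esub> k = from_empty S T \<cdot>\<^bsub>S\<^esub> k"
          if "k \<in> Ar S" "Cod S k = Empt S" for k
          using precompose[OF fe[of r1 Z'], of k] precompose[OF fe[of r2 Z'], of k] S that by simp_all
        show "r1 \<cdot>\<^bsub>S\<^esub> from_empty S Z' \<cdot>\<^bsub>S\<^esub> h = r1 \<cdot>\<^bsub>S\<^esub> from_empty S Z' \<cdot>\<^bsub>S\<^esub> h'"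
          using r[of h] r[of h'] h hc by simp
        show "r2 \<cdot>\<^bsub>S\<^esub> from_empty S Z' \<cdot>\<^bsub>S\<^esub> h = r2 \<cdot>\<^bsub>S\<^esub> from_empty S Z' \<cdot>\<^bsub>S\<^esub> h'"
          using r[of h] r[of h'] Th[of h] Th[of h'] h(1,2) hc by metis
      qed (use S h hc in simp_all)
      show "h = h'" by (rule cartesian_eq[OF d]) (use h(1-3) hc e S ob in simp_all)
    qed (use S ob in simp_all)
  next
    assume d: "disjoint (q1 \<cdot>\<^bsub>S\<^esub> f) z"
    show "disjoint f \<zeta>"
    proof (rule cartesianI)
      show "f \<cdot>\<^bsub>S\<^esub> from_empty S ?X = \<zeta> \<cdot>\<^bsub>S\<^esub> from_empty S (Dom S \<zeta>)"
        using S ob by (subst (1 2) fe) simp_all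
    next
      fix x y assume xy: "x \<in> Ar S" "y \<in> Ar S" "Dom S x = Dom S y" "Cod S x = ?X" "Cod S y = Dom S \<zeta>"
        and eq: "f \<cdot>\<^bsub>S\<^esub> x = \<zeta> \<cdot>\<^bsub>S\<^esub> y"
      have y: "Cod S y = Z'" using xy S by simp
      have "z \<cdot>\<^bsub>S\<^esub> (r1 \<cdot>\<^bsub>S\<^esub> y) = (q1 \<cdot>\<^bsub>S\<^esub> \<zeta>) \<cdot>\<^bsub>S\<^esub> y" unfolding \<zeta>(4) using S xy y by simp
      also have "\<dots> = q1 \<cdot>\<^bsub>S\<^esub> \<zeta> \<cdot>\<^bsub>S\<^esub> y" using S xy y by simp
      also have "\<dots> = (q1 \<cdot>\<^bsub>S\<^esub> f) \<cdot>\<^bsub>S\<^esub> x" unfolding eq[symmetric] using S xy by simp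
      finally have "(q1 \<cdot>\<^bsub>S\<^esub> f) \<cdot>\<^bsub>S\<^esub> x = z \<cdot>\<^bsub>S\<^esub> (r1 \<cdot>\<^bsub>S\<^esub> y)" ..
      then have "\<exists>h. h \<in> Ar S \<and> Dom S h = Dom S x \<and> Cod S h = Empt S \<and>
          from_empty S (Dom S (q1 \<cdot>\<^bsub>S\<^esub> f)) \<cdot>\<^bsub>S\<^esub> h = x \<and> from_empty S (Dom S z) \<cdot>\<^bsub>S\<^esub> h = r1 \<cdot>\<^bsub>S\<^esub> y"
        by (intro cartesian_factor[OF d]) (use S xy y ob in simp_all)
      moreover have "Dom S (q1 \<cdot>\<^bsub>S\<^esub> f) = ?X" using S by simp
      ultimately obtain h where h: "h \<in> Ar S" "Dom S h = Dom S x" "Cod S h = Empt S" "from_empty S ?X \<cdot>\<^bsub>S\<^esub> h = x"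
          "from_empty S b \<cdot>\<^bsub>S\<^esub> h = r1 \<cdot>\<^bsub>S\<^esub> y"
        unfolding z(2) by auto
      have "from_empty S Z' \<cdot>\<^bsub>S\<^esub> h = y"
      proof (rule product_cone_eq[OF Z])
        show "r1 \<cdot>\<^bsub>S\<^esub> from_empty S Z' \<cdot>\<^bsub>S\<^esub> h = r1 \<cdot>\<^bsub>S\<^esub> y"
          using precompose[OF fe[of r1 Z'], of h] S h by simp
        have "r2 \<cdot>\<^bsub>S\<^esub> from_empty S Z' \<cdot>\<^bsub>S\<^esub> h = from_empty S T \<cdot>\<^bsub>S\<^esub> h"
          using precompose[OF fe[of r2 Z'], of h] S h by simp
        also have "\<dots> = (q2 \<cdot>\<^bsub>S\<^esub> f) \<cdot>\<^bsub>S\<^esub> from_empty S ?X \<cdot>\<^bsub>S\<^esub> h"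
          using precompose[OF fe[of "q2 \<cdot>\<^bsub>S\<^esub> f" ?X], of h] S ob h(1-3) by simp
        also have "\<dots> = q2 \<cdot>\<^bsub>S\<^esub> (f \<cdot>\<^bsub>S\<^esub> x)" using S xy h(4) by simp
        also have "\<dots> = (q2 \<cdot>\<^bsub>S\<^esub> \<zeta>) \<cdot>\<^bsub>S\<^esub> y" unfolding eq using S xy y by simp
        finally show "r2 \<cdot>\<^bsub>S\<^esub> from_empty S Z' \<cdot>\<^bsub>S\<^esub> h = r2 \<cdot>\<^bsub>S\<^esub> y" using \<zeta>(5) by simp
      qed (use S h xy y in simp_all)
      then show "\<exists>h. h \<in> Ar S \<and> Dom S h = Dom S x \<and> Cod S h = Dom S (from_empty S ?X) \<and>
          from_empty S ?X \<cdot>\<^bsub>S\<^esub> h = x \<and> from_empty S (Dom S \<zeta>) \<cdot>\<^bsub>S\<^esub> h = y"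
        using S h ob by (intro exI[of _ h]) simp
    next
      fix h h' assume h: "h \<in> Ar S" "h' \<in> Ar S" "Dom S h = Dom S h'" "Cod S h = Dom S (from_empty S ?X)" "Cod S h' = Dom S (from_empty S ?X)"
        "from_empty S ?X \<cdot>\<^bsub>S\<^esub> h = from_empty S ?X \<cdot>\<^bsub>S\<^esub> h'" "from_empty S (Dom S \<zeta>) \<cdot>\<^bsub>S\<^esub> h = from_empty S (Dom S \<zeta>) \<cdot>\<^bsub>S\<^esub> h'"
      have hc: "Cod S h = Empt S" "Cod S h' = Empt S" using h ob by simp_all
      have e: "from_empty S b \<cdot>\<^bsub>S\<^esub> h = from_empty S b \<cdot>\<^bsub>S\<^esub> h'"
        using precompose[OF fe[of r1 Z'], of h] precompose[OF fe[of r1 Z'], of h'] S h hc by simp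
      show "h = h'" by (rule cartesian_eq[OF d]) (use h hc e S ob in simp_all)
    qed (use S ob in simp_all)
  qed
qed

lemma Sm_Ar [simp]: "p \<in> Sm S \<Longrightarrow> p \<in> Ar S" and Cl_Ar [simp]: "z \<in> Cl S \<Longrightarrow> z \<in> Ar S"
  and Idn_Sm [simp]: "x \<in> Ob S \<Longrightarrow> Idn S x \<in> Sm S" and Idn_Cl [simp]: "x \<in> Ob S \<Longrightarrow> Idn S x \<in> Cl S"
  and Sm_Cmp [simp]: "p \<in> Sm S \<Longrightarrow> q \<in> Sm S \<Longrightarrow> Cod S p = Dom S q \<Longrightarrow> q \<cdot>\<^bsub>S\<^esub> p \<in> Sm S"
  and Cl_Cmp [simp]: "z \<in> Cl S \<Longrightarrow> w \<in> Cl S \<Longrightarrow> Cod S z = Dom S w \<Longrightarrow> w \<cdot>\<^bsub>S\<^esub> z \<in> Cl S"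
  using Sm_subcategory Cl_subcategory by (auto simp: wide_subcategory_def)

lemma disjoint_iff_factors_Compl:
  assumes z: "z \<in> Cl S" and f: "f \<in> Ar S" "Cod S f = Cod S z"
  shows "disjoint f z \<longleftrightarrow> (\<exists>k. k \<in> Ar S \<and> Dom S k = Dom S f \<and> Cod S k = Dom S (Compl S z) \<and> f = Compl S z \<cdot>\<^bsub>S\<^esub> k)"
proof -
  have "(\<lambda>h. Compl S z \<cdot>\<^bsub>S\<^esub> h) ` Hom S (Dom S f) (Dom S (Compl S z)) =
      {f' \<in> Hom S (Dom S f) (Cod S z). cartesian S (from_empty S (Dom S f)) (from_empty S (Dom S z)) f' z}"
    using Compl_universal[OF z, of "Dom S f"] f by (simp add: bij_betw_def)
  then have "f \<in> (\<lambda>h. Compl S z \<cdot>\<^bsub>S\<^esub> h) ` Hom S (Dom S f) (Dom S (Compl S z)) \<longleftrightarrow> disjoint f z"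
    using f by (simp add: Hom_def)
  then show ?thesis by (auto simp: Hom_def)
qed

lemma Compl_mono:
  assumes z: "z \<in> Cl S" and "h \<in> Ar S" "k \<in> Ar S" "Dom S h = Dom S k" "Cod S h = Dom S (Compl S z)" "Cod S k = Dom S (Compl S z)"
    and "Compl S z \<cdot>\<^bsub>S\<^esub> h = Compl S z \<cdot>\<^bsub>S\<^esub> k"
  shows "h = k"
  using Compl_universal[OF z, of "Dom S k"] assms by (auto simp: bij_betw_def inj_on_def Hom_def)

lemma Compl_simps [simp]: "z \<in> Cl S \<Longrightarrow> Compl S z \<in> Ar S" "z \<in> Cl S \<Longrightarrow> Compl S z \<in> Sm S"
  "z \<in> Cl S \<Longrightarrow> Cod S (Compl S z) = Cod S z"
  using Compl_Sm Compl_Cod Sm_Ar by auto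

lemma Compl_disjoint: "z \<in> Cl S \<Longrightarrow> disjoint (Compl S z) z"
  by (subst disjoint_iff_factors_Compl) (auto intro!: exI[of _ "Idn S (Dom S (Compl S z))"])

text \<open>Both \<open>\<upsilon> = u \<times> T\<close> and the distinguished complement of \<open>\<zeta> = z \<times> T\<close> consist of the points of \<open>Y\<close> whose first
  component avoids \<open>z\<close>. Stating this for an arbitrary product cone covers \<open>z \<times> T\<close> and \<open>T \<times> z\<close> at once.\<close>

lemma complement_of_product:
  assumes z: "z \<in> Cl S" and \<zeta>Cl: "\<zeta> \<in> Cl S"
    and Y: "product_cone Y (Cod S z) T q1 q2" and Z: "product_cone Z' (Dom S z) T r1 r2"
    and U: "product_cone U' (Dom S (Compl S z)) T s1 s2"
    and \<zeta>: "Dom S \<zeta> = Z'" "Cod S \<zeta> = Y" "q1 \<cdot>\<^bsub>S\<^esub> \<zeta> = z \<cdot>\<^bsub>S\<^esub> r1" "q2 \<cdot>\<^bsub>S\<^esub> \<zeta> = r2"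
    and \<upsilon>: "\<upsilon> \<in> Ar S" "Dom S \<upsilon> = U'" "Cod S \<upsilon> = Y" "q1 \<cdot>\<^bsub>S\<^esub> \<upsilon> = Compl S z \<cdot>\<^bsub>S\<^esub> s1" "q2 \<cdot>\<^bsub>S\<^esub> \<upsilon> = s2"
  shows "disjoint \<upsilon> \<zeta>"
    and "\<exists>k. k \<in> Ar S \<and> Dom S k = Dom S (Compl S \<zeta>) \<and> Cod S k = U' \<and> Compl S \<zeta> = \<upsilon> \<cdot>\<^bsub>S\<^esub> k"
proof -
  note P = product_coneD[OF Y] product_coneD[OF Z] product_coneD[OF U]
  have D: "disjoint f \<zeta> \<longleftrightarrow> disjoint (q1 \<cdot>\<^bsub>S\<^esub> f) z" if "f \<in> Ar S" "Cod S f = Y" for f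
    using disjoint_product_iff[OF Y Z _ _ _ _ _ _ \<zeta>(3,4) that] z \<zeta>Cl \<zeta> by simp
  show "disjoint \<upsilon> \<zeta>"
  proof -
    have "disjoint (q1 \<cdot>\<^bsub>S\<^esub> \<upsilon>) z"
      using z P \<upsilon> by (subst disjoint_iff_factors_Compl) auto
    then show ?thesis by (simp only: D[OF \<upsilon>(1,3)])
  qed
  let ?u = "Compl S \<zeta>"
  have u: "?u \<in> Ar S" "Cod S ?u = Y" using \<zeta>Cl \<zeta> by simp_all
  have "disjoint (q1 \<cdot>\<^bsub>S\<^esub> ?u) z" using D[OF u] Compl_disjoint[OF \<zeta>Cl] by simp
  then obtain k1 where k1: "k1 \<in> Ar S" "Dom S k1 = Dom S ?u" "Cod S k1 = Dom S (Compl S z)" "q1 \<cdot>\<^bsub>S\<^esub> ?u = Compl S z \<cdot>\<^bsub>S\<^esub> k1"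
    using disjoint_iff_factors_Compl[OF z, of "q1 \<cdot>\<^bsub>S\<^esub> ?u"] P u by auto
  have "\<exists>k. k \<in> Ar S \<and> Dom S k = Dom S k1 \<and> Cod S k = U' \<and> s1 \<cdot>\<^bsub>S\<^esub> k = k1 \<and> s2 \<cdot>\<^bsub>S\<^esub> k = q2 \<cdot>\<^bsub>S\<^esub> ?u"
    by (rule product_cone_pair[OF U]) (use k1(1-3) P u in simp_all)
  then obtain k where k: "k \<in> Ar S" "Dom S k = Dom S k1" "Cod S k = U'" "s1 \<cdot>\<^bsub>S\<^esub> k = k1" "s2 \<cdot>\<^bsub>S\<^esub> k = q2 \<cdot>\<^bsub>S\<^esub> ?u"
    by blast
  have "?u = \<upsilon> \<cdot>\<^bsub>S\<^esub> k"
  proof (rule product_cone_eq[OF Y])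
    have "q1 \<cdot>\<^bsub>S\<^esub> \<upsilon> \<cdot>\<^bsub>S\<^esub> k = (q1 \<cdot>\<^bsub>S\<^esub> \<upsilon>) \<cdot>\<^bsub>S\<^esub> k" using P \<upsilon>(1-3) k by simp
    also have "\<dots> = Compl S z \<cdot>\<^bsub>S\<^esub> s1 \<cdot>\<^bsub>S\<^esub> k" unfolding \<upsilon>(4) using P z k(1-3) by simp
    finally show "q1 \<cdot>\<^bsub>S\<^esub> ?u = q1 \<cdot>\<^bsub>S\<^esub> \<upsilon> \<cdot>\<^bsub>S\<^esub> k" using k(4) k1(4) by simp
    have "q2 \<cdot>\<^bsub>S\<^esub> \<upsilon> \<cdot>\<^bsub>S\<^esub> k = (q2 \<cdot>\<^bsub>S\<^esub> \<upsilon>) \<cdot>\<^bsub>S\<^esub> k" using P \<upsilon>(1-3) k by simp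
    then show "q2 \<cdot>\<^bsub>S\<^esub> ?u = q2 \<cdot>\<^bsub>S\<^esub> \<upsilon> \<cdot>\<^bsub>S\<^esub> k" using k(5) \<upsilon>(5) by simp
  qed (use u \<upsilon> k k1 in simp_all)
  then show "\<exists>k. k \<in> Ar S \<and> Dom S k = Dom S ?u \<and> Cod S k = U' \<and> ?u = \<upsilon> \<cdot>\<^bsub>S\<^esub> k"
    using k k1 by auto
qed

lemma product_base_change:
  assumes u: "u \<in> Ar S" and Y: "product_cone Y (Cod S u) T q1 q2" and U: "product_cone U' (Dom S u) T s1 s2"
    and \<upsilon>: "\<upsilon> \<in> Ar S" "Dom S \<upsilon> = U'" "Cod S \<upsilon> = Y" "q1 \<cdot>\<^bsub>S\<^esub> \<upsilon> = u \<cdot>\<^bsub>S\<^esub> s1" "q2 \<cdot>\<^bsub>S\<^esub> \<upsilon> = s2"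
  shows "cartesian S s1 \<upsilon> u q1"
proof (rule cartesianI)
  note P = product_coneD[OF Y] product_coneD[OF U]
  fix x y assume xy: "x \<in> Ar S" "y \<in> Ar S" "Dom S x = Dom S y" "Cod S x = Dom S u" "Cod S y = Dom S q1" and eq: "u \<cdot>\<^bsub>S\<^esub> x = q1 \<cdot>\<^bsub>S\<^esub> y"
  have yc: "Cod S y = Y" using xy P by simp
  have "\<exists>h. h \<in> Ar S \<and> Dom S h = Dom S x \<and> Cod S h = U' \<and> s1 \<cdot>\<^bsub>S\<^esub> h = x \<and> s2 \<cdot>\<^bsub>S\<^esub> h = q2 \<cdot>\<^bsub>S\<^esub> y"
    by (rule product_cone_pair[OF U]) (use xy yc P in simp_all)
  then obtain h where h: "h \<in> Ar S" "Dom S h = Dom S x" "Cod S h = U'" "s1 \<cdot>\<^bsub>S\<^esub> h = x" "s2 \<cdot>\<^bsub>S\<^esub> h = q2 \<cdot>\<^bsub>S\<^esub> y"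
    by blast
  have "\<upsilon> \<cdot>\<^bsub>S\<^esub> h = y"
  proof (rule product_cone_eq[OF Y])
    have "q1 \<cdot>\<^bsub>S\<^esub> \<upsilon> \<cdot>\<^bsub>S\<^esub> h = (q1 \<cdot>\<^bsub>S\<^esub> \<upsilon>) \<cdot>\<^bsub>S\<^esub> h" using P \<upsilon>(1-3) h by simp
    also have "\<dots> = u \<cdot>\<^bsub>S\<^esub> s1 \<cdot>\<^bsub>S\<^esub> h" unfolding \<upsilon>(4) using P u h(1-3) by simp
    finally show "q1 \<cdot>\<^bsub>S\<^esub> \<upsilon> \<cdot>\<^bsub>S\<^esub> h = q1 \<cdot>\<^bsub>S\<^esub> y" using h(4) eq by simp
    have "q2 \<cdot>\<^bsub>S\<^esub> \<upsilon> \<cdot>\<^bsub>S\<^esub> h = (q2 \<cdot>\<^bsub>S\<^esub> \<upsilon>) \<cdot>\<^bsub>S\<^esub> h" using P \<upsilon>(1-3) h by simp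
    then show "q2 \<cdot>\<^bsub>S\<^esub> \<upsilon> \<cdot>\<^bsub>S\<^esub> h = q2 \<cdot>\<^bsub>S\<^esub> y" using h(5) \<upsilon>(5) by simp
  qed (use \<upsilon> h xy yc in simp_all)
  then show "\<exists>h. h \<in> Ar S \<and> Dom S h = Dom S x \<and> Cod S h = Dom S s1 \<and> s1 \<cdot>\<^bsub>S\<^esub> h = x \<and> \<upsilon> \<cdot>\<^bsub>S\<^esub> h = y"
    using h P by auto
next
  note P = product_coneD[OF Y] product_coneD[OF U]
  fix h h' assume h: "h \<in> Ar S" "h' \<in> Ar S" "Dom S h = Dom S h'" "Cod S h = Dom S s1" "Cod S h' = Dom S s1"
    "s1 \<cdot>\<^bsub>S\<^esub> h = s1 \<cdot>\<^bsub>S\<^esub> h'" "\<upsilon> \<cdot>\<^bsub>S\<^esub> h = \<upsilon> \<cdot>\<^bsub>S\<^esub> h'"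
  show "h = h'"
  proof (rule product_cone_eq[OF U])
    have "s2 \<cdot>\<^bsub>S\<^esub> h = q2 \<cdot>\<^bsub>S\<^esub> \<upsilon> \<cdot>\<^bsub>S\<^esub> h" "s2 \<cdot>\<^bsub>S\<^esub> h' = q2 \<cdot>\<^bsub>S\<^esub> \<upsilon> \<cdot>\<^bsub>S\<^esub> h'"
      using P \<upsilon>(1-3) h(1-5) by (simp_all flip: \<upsilon>(5))
    then show "s2 \<cdot>\<^bsub>S\<^esub> h = s2 \<cdot>\<^bsub>S\<^esub> h'" using h(7) by simp
  qed (use h P in simp_all)
qed (use product_coneD[OF Y] product_coneD[OF U] u \<upsilon> in simp_all)

lemma Pr_cone: "a \<in> Ob S \<Longrightarrow> b \<in> Ob S \<Longrightarrow> product_cone (Pr S a b) a b (pr1 S a b) (pr2 S a b)"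
  using Pr_Ob pr1_Hom pr2_Hom Pr_universal by (simp add: product_cone_def)

lemma product_cone_swap: "product_cone Y a b q1 q2 \<Longrightarrow> product_cone Y b a q2 q1"
  unfolding product_cone_def
proof (elim conjE, intro conjI allI impI)
  fix t x y
  assume "\<forall>t x y. x \<in> Hom S t a \<longrightarrow> y \<in> Hom S t b \<longrightarrow> (\<exists>!h. h \<in> Hom S t Y \<and> q1 \<cdot>\<^bsub>S\<^esub> h = x \<and> q2 \<cdot>\<^bsub>S\<^esub> h = y)"
    and "x \<in> Hom S t b" "y \<in> Hom S t a"
  then have "\<exists>!h. h \<in> Hom S t Y \<and> q1 \<cdot>\<^bsub>S\<^esub> h = y \<and> q2 \<cdot>\<^bsub>S\<^esub> h = x" by blast
  moreover have "(\<exists>!h. h \<in> Hom S t Y \<and> q1 \<cdot>\<^bsub>S\<^esub> h = y \<and> q2 \<cdot>\<^bsub>S\<^esub> h = x) =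
      (\<exists>!h. h \<in> Hom S t Y \<and> q2 \<cdot>\<^bsub>S\<^esub> h = x \<and> q1 \<cdot>\<^bsub>S\<^esub> h = y)"
    by (rule arg_cong[where f = Ex1]) auto
  ultimately show "\<exists>!h. h \<in> Hom S t Y \<and> q2 \<cdot>\<^bsub>S\<^esub> h = x \<and> q1 \<cdot>\<^bsub>S\<^esub> h = y" by simp
qed

lemma prod_ar:
  assumes "f \<in> Ar S" "g \<in> Ar S"
  shows "prod_ar S f g \<in> Ar S" "Dom S (prod_ar S f g) = Pr S (Dom S f) (Dom S g)" "Cod S (prod_ar S f g) = Pr S (Cod S f) (Cod S g)"
    "pr1 S (Cod S f) (Cod S g) \<cdot>\<^bsub>S\<^esub> prod_ar S f g = f \<cdot>\<^bsub>S\<^esub> pr1 S (Dom S f) (Dom S g)"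
    "pr2 S (Cod S f) (Cod S g) \<cdot>\<^bsub>S\<^esub> prod_ar S f g = g \<cdot>\<^bsub>S\<^esub> pr2 S (Dom S f) (Dom S g)"
proof -
  note P = product_coneD[OF Pr_cone[of "Dom S f" "Dom S g"]]
  have "\<exists>!h. h \<in> Hom S (Pr S (Dom S f) (Dom S g)) (Pr S (Cod S f) (Cod S g)) \<and>
     pr1 S (Cod S f) (Cod S g) \<cdot>\<^bsub>S\<^esub> h = f \<cdot>\<^bsub>S\<^esub> pr1 S (Dom S f) (Dom S g) \<and>
     pr2 S (Cod S f) (Cod S g) \<cdot>\<^bsub>S\<^esub> h = g \<cdot>\<^bsub>S\<^esub> pr2 S (Dom S f) (Dom S g)"
    using assms P by (intro Pr_universal) (simp_all add: Hom_def)
  from theI'[OF this]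
  show "prod_ar S f g \<in> Ar S" "Dom S (prod_ar S f g) = Pr S (Dom S f) (Dom S g)" "Cod S (prod_ar S f g) = Pr S (Cod S f) (Cod S g)"
    "pr1 S (Cod S f) (Cod S g) \<cdot>\<^bsub>S\<^esub> prod_ar S f g = f \<cdot>\<^bsub>S\<^esub> pr1 S (Dom S f) (Dom S g)"
    "pr2 S (Cod S f) (Cod S g) \<cdot>\<^bsub>S\<^esub> prod_ar S f g = g \<cdot>\<^bsub>S\<^esub> pr2 S (Dom S f) (Dom S g)"
    by (simp_all add: prod_ar_def Hom_def)
qed

declare prod_ar(1-3) [simp]
declare Pr_Ob [simp]

lemma pr_simps [simp]:
  "a \<in> Ob S \<Longrightarrow> b \<in> Ob S \<Longrightarrow> pr1 S a b \<in> Ar S" "a \<in> Ob S \<Longrightarrow> b \<in> Ob S \<Longrightarrow> pr2 S a b \<in> Ar S"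
  "a \<in> Ob S \<Longrightarrow> b \<in> Ob S \<Longrightarrow> Dom S (pr1 S a b) = Pr S a b" "a \<in> Ob S \<Longrightarrow> b \<in> Ob S \<Longrightarrow> Dom S (pr2 S a b) = Pr S a b"
  "a \<in> Ob S \<Longrightarrow> b \<in> Ob S \<Longrightarrow> Cod S (pr1 S a b) = a" "a \<in> Ob S \<Longrightarrow> b \<in> Ob S \<Longrightarrow> Cod S (pr2 S a b) = b"
  using product_coneD[OF Pr_cone[of a b]] by simp_all

lemma prod_ar_eqI:
  assumes "f \<in> Ar S" "g \<in> Ar S" "h \<in> Ar S" "Dom S h = Pr S (Dom S f) (Dom S g)" "Cod S h = Pr S (Cod S f) (Cod S g)"
    "pr1 S (Cod S f) (Cod S g) \<cdot>\<^bsub>S\<^esub> h = f \<cdot>\<^bsub>S\<^esub> pr1 S (Dom S f) (Dom S g)"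
    "pr2 S (Cod S f) (Cod S g) \<cdot>\<^bsub>S\<^esub> h = g \<cdot>\<^bsub>S\<^esub> pr2 S (Dom S f) (Dom S g)"
  shows "h = prod_ar S f g"
  by (rule product_cone_eq[OF Pr_cone[of "Cod S f" "Cod S g"]]) (use assms prod_ar[of f g] in simp_all)

lemma prod_ar_Cmp [simp]:
  assumes "f1 \<in> Ar S" "g1 \<in> Ar S" "f2 \<in> Ar S" "g2 \<in> Ar S" "Cod S f1 = Dom S g1" "Cod S f2 = Dom S g2"
  shows "prod_ar S g1 g2 \<cdot>\<^bsub>S\<^esub> prod_ar S f1 f2 = prod_ar S (g1 \<cdot>\<^bsub>S\<^esub> f1) (g2 \<cdot>\<^bsub>S\<^esub> f2)"
proof (rule prod_ar_eqI)
  let ?g = "prod_ar S g1 g2" and ?f = "prod_ar S f1 f2"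
  have "pr1 S (Cod S g1) (Cod S g2) \<cdot>\<^bsub>S\<^esub> ?g \<cdot>\<^bsub>S\<^esub> ?f = (pr1 S (Cod S g1) (Cod S g2) \<cdot>\<^bsub>S\<^esub> ?g) \<cdot>\<^bsub>S\<^esub> ?f"
    using assms by simp
  also have "\<dots> = g1 \<cdot>\<^bsub>S\<^esub> (pr1 S (Cod S f1) (Cod S f2) \<cdot>\<^bsub>S\<^esub> ?f)"
    using assms prod_ar(4)[of g1 g2] by simp
  also have "\<dots> = (g1 \<cdot>\<^bsub>S\<^esub> f1) \<cdot>\<^bsub>S\<^esub> pr1 S (Dom S f1) (Dom S f2)"
    using assms prod_ar(4)[of f1 f2] by simp
  finally show "pr1 S (Cod S (g1 \<cdot>\<^bsub>S\<^esub> f1)) (Cod S (g2 \<cdot>\<^bsub>S\<^esub> f2)) \<cdot>\<^bsub>S\<^esub> ?g \<cdot>\<^bsub>S\<^esub> ?f = (g1 \<cdot>\<^bsub>S\<^esub> f1) \<cdot>\<^bsub>S\<^esub> pr1 S (Dom S (g1 \<cdot>\<^bsub>S\<^esub> f1)) (Dom S (g2 \<cdot>\<^bsub>S\<^esub> f2))"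
    using assms by simp
  have "pr2 S (Cod S g1) (Cod S g2) \<cdot>\<^bsub>S\<^esub> ?g \<cdot>\<^bsub>S\<^esub> ?f = (pr2 S (Cod S g1) (Cod S g2) \<cdot>\<^bsub>S\<^esub> ?g) \<cdot>\<^bsub>S\<^esub> ?f"
    using assms by simp
  also have "\<dots> = g2 \<cdot>\<^bsub>S\<^esub> (pr2 S (Cod S f1) (Cod S f2) \<cdot>\<^bsub>S\<^esub> ?f)"
    using assms prod_ar(5)[of g1 g2] by simp
  also have "\<dots> = (g2 \<cdot>\<^bsub>S\<^esub> f2) \<cdot>\<^bsub>S\<^esub> pr2 S (Dom S f1) (Dom S f2)"
    using assms prod_ar(5)[of f1 f2] by simp
  finally show "pr2 S (Cod S (g1 \<cdot>\<^bsub>S\<^esub> f1)) (Cod S (g2 \<cdot>\<^bsub>S\<^esub> f2)) \<cdot>\<^bsub>S\<^esub> ?g \<cdot>\<^bsub>S\<^esub> ?f = (g2 \<cdot>\<^bsub>S\<^esub> f2) \<cdot>\<^bsub>S\<^esub> pr2 S (Dom S (g1 \<cdot>\<^bsub>S\<^esub> f1)) (Dom S (g2 \<cdot>\<^bsub>S\<^esub> f2))"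
    using assms by simp
qed (use assms in simp_all)

end

section \<open>Transposes and vanishing in a localic fibered category\<close>

locale localic_over_base = base_category S + localic_fibered_category S H
  for S :: "('s, 'm, 'x) base_cat_scheme" and H :: "('s, 'm, 'a, 'b, 'y) adj_fib_cat_scheme"
begin

sublocale fib: fibration S "Fib H" "pbo H" "pba H" "conn H"
  by (intro fibration.intro fibration_axioms.intro)
    (fact category_axioms fibre_category pb_functor conn_nat_iso conn_cocycle)+

lemma fibre_additive: "s \<in> Ob S \<Longrightarrow> additive_category (Fib H s)"
  using fibre_triangulated triangulated_category_def by blast

lemma pull: "f \<in> Ar S \<Longrightarrow> Dom S f = a \<Longrightarrow> Cod S f = b \<Longrightarrow> functor_on (Fib H b) (Fib H a) (pbo H f) (pba H f)"
  using fib.pull by blast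

lemma pull_additive: "f \<in> Ar S \<Longrightarrow> additive_functor (Fib H (Cod S f)) (Fib H (Dom S f)) (pbo H f) (pba H f)"
  using pb_triangulated by (simp add: triangulated_functor_def)

lemma low: "z \<in> Cl S \<Longrightarrow> Dom S z = a \<Longrightarrow> Cod S z = b \<Longrightarrow>
    adj (Fib H b) (Fib H a) (pbo H z) (pba H z) (lowo H z) (lowa H z) (low_unit H z) (low_counit H z)"
  using low_adjunction[of z] fibre_category[OF Dom_Ob, of z] fibre_category[OF Cod_Ob, of z]
  by (auto simp: adj_def adj_axioms_def functor_on_def functor_on_axioms_def adjunction_def)

lemma sharp: "p \<in> Sm S \<Longrightarrow> Dom S p = a \<Longrightarrow> Cod S p = b \<Longrightarrow>
    adj (Fib H a) (Fib H b) (sho H p) (sha H p) (pbo H p) (pba H p) (sh_unit H p) (sh_counit H p)"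
  using sharp_adjunction[of p] fibre_category[OF Dom_Ob, of p] fibre_category[OF Cod_Ob, of p]
  by (auto simp: adj_def adj_axioms_def functor_on_def functor_on_axioms_def adjunction_def)

lemma low_counit_Iso: "z \<in> Cl S \<Longrightarrow> A \<in> Ob (Fib H (Dom S z)) \<Longrightarrow> low_counit H z A \<in> Iso (Fib H (Dom S z))"
  by (rule adj.counit_iso[OF low low_fully_faithful]) simp_all

lemma exch_simps:
  assumes "a \<in> Ar S" "b \<in> Ar S" "f \<in> Ar S" "g \<in> Ar S" "Dom S b = Dom S a" "Cod S a = Dom S f" "Cod S b = Dom S g"
    "f \<cdot>\<^bsub>S\<^esub> a = g \<cdot>\<^bsub>S\<^esub> b" "A \<in> Ob (Fib H (Cod S g))" "s = Dom S a"
  shows "exch S H a b f g A \<in> Ar (Fib H s)" "Dom (Fib H s) (exch S H a b f g A) = pbo H a (pbo H f A)"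
    "Cod (Fib H s) (exch S H a b f g A) = pbo H b (pbo H g A)" "exch S H a b f g A \<in> Iso (Fib H s)"
proof -
  have c: "Cod S f = Cod S g" using arg_cong[OF assms(8), of "Cod S"] assms(1-7) by simp
  have "Dom (Fib H (Dom S a)) (conn H b g A) = pbo H (f \<cdot>\<^bsub>S\<^esub> a) A"
    unfolding assms(8) using assms(1-7,9) by simp
  then show "exch S H a b f g A \<in> Ar (Fib H s)" "Dom (Fib H s) (exch S H a b f g A) = pbo H a (pbo H f A)"
    "Cod (Fib H s) (exch S H a b f g A) = pbo H b (pbo H g A)" "exch S H a b f g A \<in> Iso (Fib H s)"
    using assms(1-7,9,10) c by (simp_all add: exch_def)
qed

lemma exch_nat:
  assumes "a \<in> Ar S" "b \<in> Ar S" "f \<in> Ar S" "g \<in> Ar S" "Dom S b = Dom S a" "Cod S a = Dom S f" "Cod S b = Dom S g"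
    "f \<cdot>\<^bsub>S\<^esub> a = g \<cdot>\<^bsub>S\<^esub> b"
  shows "is_nat (Fib H (Cod S g)) (Fib H (Dom S a)) (\<lambda>A. pbo H a (pbo H f A)) (\<lambda>\<phi>. pba H a (pba H f \<phi>))
    (\<lambda>A. pbo H b (pbo H g A)) (\<lambda>\<phi>. pba H b (pba H g \<phi>)) (exch S H a b f g)"
proof (rule is_natI)
  let ?C = "Fib H (Cod S g)" and ?D = "Fib H (Dom S a)"
  interpret D: category ?D using assms(1) by (simp add: fibre_category)
  have c: "Cod S f = Cod S g" using arg_cong[OF assms(8), of "Cod S"] assms(1-7) by simp
  note E = exch_simps[OF assms]
  fix \<phi> assume \<phi>: "\<phi> \<in> Ar ?C"
  let ?A = "Dom ?C \<phi>" and ?A' = "Cod ?C \<phi>"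
  have ob: "?A \<in> Ob ?C" "?A' \<in> Ob ?C" using \<phi> assms(4) by simp_all
  note S = assms(1-7) c \<phi> ob
  have d: "Dom ?D (conn H b g A) = pbo H (f \<cdot>\<^bsub>S\<^esub> a) A" if "A \<in> Ob ?C" for A
    unfolding assms(8) using S that by simp
  have ca: "exch S H a b f g A \<cdot>\<^bsub>?D\<^esub> conn H a f A = conn H b g A" if "A \<in> Ob ?C" for A
    using S that d[OF that] by (simp add: exch_def)
  have "(pba H b (pba H g \<phi>) \<cdot>\<^bsub>?D\<^esub> exch S H a b f g ?A) \<cdot>\<^bsub>?D\<^esub> conn H a f ?A
      = pba H b (pba H g \<phi>) \<cdot>\<^bsub>?D\<^esub> (exch S H a b f g ?A \<cdot>\<^bsub>?D\<^esub> conn H a f ?A)"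
    using S E[OF ob(1) refl] by simp
  also have "\<dots> = pba H b (pba H g \<phi>) \<cdot>\<^bsub>?D\<^esub> conn H b g ?A" by (simp only: ca[OF ob(1)])
  also have "\<dots> = conn H b g ?A' \<cdot>\<^bsub>?D\<^esub> pba H (f \<cdot>\<^bsub>S\<^esub> a) \<phi>"
    unfolding assms(8) using S fib.cn_nat[of b g "Dom S a" "Cod S g" \<phi>] by simp
  also have "\<dots> = (exch S H a b f g ?A' \<cdot>\<^bsub>?D\<^esub> conn H a f ?A') \<cdot>\<^bsub>?D\<^esub> pba H (f \<cdot>\<^bsub>S\<^esub> a) \<phi>"
    by (simp only: ca[OF ob(2)])
  also have "\<dots> = exch S H a b f g ?A' \<cdot>\<^bsub>?D\<^esub> (conn H a f ?A' \<cdot>\<^bsub>?D\<^esub> pba H (f \<cdot>\<^bsub>S\<^esub> a) \<phi>)"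
    using S E[OF ob(2) refl] by simp
  also have "conn H a f ?A' \<cdot>\<^bsub>?D\<^esub> pba H (f \<cdot>\<^bsub>S\<^esub> a) \<phi> = pba H a (pba H f \<phi>) \<cdot>\<^bsub>?D\<^esub> conn H a f ?A"
    using S fib.cn_nat[of a f "Dom S a" "Cod S g" \<phi>] by simp
  also have "exch S H a b f g ?A' \<cdot>\<^bsub>?D\<^esub> (pba H a (pba H f \<phi>) \<cdot>\<^bsub>?D\<^esub> conn H a f ?A)
      = (exch S H a b f g ?A' \<cdot>\<^bsub>?D\<^esub> pba H a (pba H f \<phi>)) \<cdot>\<^bsub>?D\<^esub> conn H a f ?A"
    using S E[OF ob(2) refl] by simp
  finally show "pba H b (pba H g \<phi>) \<cdot>\<^bsub>?D\<^esub> exch S H a b f g ?A = exch S H a b f g ?A' \<cdot>\<^bsub>?D\<^esub> pba H a (pba H f \<phi>)"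
    by (rule D.Iso_cancel_right[rotated 5]) (use S E[OF ob(1) refl] E[OF ob(2) refl] in simp_all)
qed (use exch_simps[OF assms] in simp_all)

lemma exch_conn:
  assumes "a \<in> Ar S" "b \<in> Ar S" "f \<in> Ar S" "g \<in> Ar S" "Dom S b = Dom S a" "Cod S a = Dom S f" "Cod S b = Dom S g"
    "f \<cdot>\<^bsub>S\<^esub> a = g \<cdot>\<^bsub>S\<^esub> b" "A \<in> Ob (Fib H (Cod S g))"
  shows "exch S H a b f g A \<cdot>\<^bsub>Fib H (Dom S a)\<^esub> conn H a f A = conn H b g A"
proof -
  have c: "Cod S f = Cod S g" using arg_cong[OF assms(8), of "Cod S"] assms(1-7) by simp
  have "Dom (Fib H (Dom S a)) (conn H b g A) = pbo H (f \<cdot>\<^bsub>S\<^esub> a) A"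
    unfolding assms(8) using assms(1-7,9) by simp
  then show ?thesis using assms(1-7,9) c by (simp add: exch_def)
qed

text \<open>The transformations \<open>closed_bc\<close>, \<open>low_shift\<close> and \<open>low_conn\<close> are used below only through the formulas for
  their transposes that the next three lemmas give.\<close>

lemma closed_bc:
  assumes z: "z \<in> Cl S" "z' \<in> Cl S" and p: "p \<in> Ar S" "p' \<in> Ar S" and d: "Dom S p' = Dom S z'" "Cod S z' = Dom S p" "Cod S p' = Dom S z"
    and c: "p \<cdot>\<^bsub>S\<^esub> z' = z \<cdot>\<^bsub>S\<^esub> p'" and A: "A \<in> Ob (Fib H (Dom S z))" "s = Dom S p" "t = Dom S z'"
  shows "closed_bc S H z' p' p z A \<in> Ar (Fib H s)" "Dom (Fib H s) (closed_bc S H z' p' p z A) = pbo H p (lowo H z A)"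
    "Cod (Fib H s) (closed_bc S H z' p' p z A) = lowo H z' (pbo H p' A)"
    "low_counit H z' (pbo H p' A) \<cdot>\<^bsub>Fib H t\<^esub> pba H z' (closed_bc S H z' p' p z A) =
       pba H p' (low_counit H z A) \<cdot>\<^bsub>Fib H t\<^esub> exch S H z' p' p z (lowo H z A)"
proof -
  interpret Z: adj "Fib H (Cod S z)" "Fib H (Dom S z)" "pbo H z" "pba H z" "lowo H z" "lowa H z" "low_unit H z" "low_counit H z"
    using low z by blast
  interpret Z': adj "Fib H (Dom S p)" "Fib H (Dom S z')" "pbo H z'" "pba H z'" "lowo H z'" "lowa H z'" "low_unit H z'" "low_counit H z'"
    using low z d by blast
  have cc: "Cod S p = Cod S z" using arg_cong[OF c, of "Cod S"] z p d by simp
  let ?g = "pba H p' (low_counit H z A) \<cdot>\<^bsub>Fib H (Dom S z')\<^esub> exch S H z' p' p z (lowo H z A)"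
  have E: "exch S H z' p' p z (lowo H z A) \<in> Ar (Fib H (Dom S z'))" "Dom (Fib H (Dom S z')) (exch S H z' p' p z (lowo H z A)) = pbo H z' (pbo H p (lowo H z A))"
    "Cod (Fib H (Dom S z')) (exch S H z' p' p z (lowo H z A)) = pbo H p' (pbo H z (lowo H z A))"
    using exch_simps[of z' p' p z "lowo H z A"] z p d c A by simp_all
  note S = z p d cc A(1) E
  have g: "?g \<in> Ar (Fib H (Dom S z'))" "Dom (Fib H (Dom S z')) ?g = pbo H z' (pbo H p (lowo H z A))" "Cod (Fib H (Dom S z')) ?g = pbo H p' A"
    using S by simp_all
  have eq: "closed_bc S H z' p' p z A = lowa H z' ?g \<cdot>\<^bsub>Fib H (Dom S p)\<^esub> low_unit H z' (pbo H p (lowo H z A))"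
    using S by (simp add: closed_bc_def Let_def Z'.R.cmp)
  have ob: "pbo H p (lowo H z A) \<in> Ob (Fib H (Dom S p))" using S by simp
  show "closed_bc S H z' p' p z A \<in> Ar (Fib H s)" "Dom (Fib H s) (closed_bc S H z' p' p z A) = pbo H p (lowo H z A)"
    "Cod (Fib H s) (closed_bc S H z' p' p z A) = lowo H z' (pbo H p' A)"
    unfolding eq A(2) using g ob by simp_all
  show "low_counit H z' (pbo H p' A) \<cdot>\<^bsub>Fib H t\<^esub> pba H z' (closed_bc S H z' p' p z A) =
       pba H p' (low_counit H z A) \<cdot>\<^bsub>Fib H t\<^esub> exch S H z' p' p z (lowo H z A)"
    unfolding eq A(3) using Z'.transpose[OF g(1,2) ob] unfolding g(3) .
qed

lemma low_shift:
  assumes z: "z \<in> Cl S" and A: "A \<in> Ob (Fib H (Dom S z))" and st: "s = Cod S z" "t = Dom S z"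
  shows "low_shift S H z A \<in> Ar (Fib H s)" "Dom (Fib H s) (low_shift S H z A) = Sh (Fib H s) (lowo H z A)"
    "Cod (Fib H s) (low_shift S H z A) = lowo H z (Sh (Fib H t) A)"
    "low_counit H z (Sh (Fib H t) A) \<cdot>\<^bsub>Fib H t\<^esub> pba H z (low_shift S H z A) =
       Sha (Fib H t) (low_counit H z A) \<cdot>\<^bsub>Fib H t\<^esub> pbsh H z (lowo H z A)"
proof -
  let ?C = "Fib H (Cod S z)" and ?D = "Fib H (Dom S z)"
  interpret Z: adj ?C ?D "pbo H z" "pba H z" "lowo H z" "lowa H z" "low_unit H z" "low_counit H z"
    using low z by blast
  interpret C: functor_on ?C ?C "Sh ?C" "Sha ?C"
    by (rule triangulated_category.shift_functor[OF fibre_triangulated]) (use z in simp)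
  interpret D: functor_on ?D ?D "Sh ?D" "Sha ?D"
    by (rule triangulated_category.shift_functor[OF fibre_triangulated]) (use z in simp)
  have nat: "is_nat ?C ?D (pbo H z \<circ> Sh ?C) (pba H z \<circ> Sha ?C) (Sh ?D \<circ> pbo H z) (Sha ?D \<circ> pba H z) (pbsh H z)"
    using pb_triangulated[of z] z by (simp add: triangulated_functor_def is_nat_iso_def)
  note sh = is_natD(1-3)[OF nat, simplified]
  let ?g = "Sha ?D (low_counit H z A) \<cdot>\<^bsub>?D\<^esub> pbsh H z (lowo H z A)"
  have g: "?g \<in> Ar ?D" "Dom ?D ?g = pbo H z (Sh ?C (lowo H z A))" "Cod ?D ?g = Sh ?D A"
    using z A sh[of "lowo H z A"] by simp_all
  have eq: "low_shift S H z A = lowa H z ?g \<cdot>\<^bsub>?C\<^esub> low_unit H z (Sh ?C (lowo H z A))"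
    using z A sh[of "lowo H z A"] by (simp add: low_shift_def Let_def Z.R.cmp)
  have ob: "Sh ?C (lowo H z A) \<in> Ob ?C" using A by simp
  show "low_shift S H z A \<in> Ar (Fib H s)" "Dom (Fib H s) (low_shift S H z A) = Sh (Fib H s) (lowo H z A)"
    "Cod (Fib H s) (low_shift S H z A) = lowo H z (Sh (Fib H t) A)"
    unfolding eq st using g ob by simp_all
  show "low_counit H z (Sh (Fib H t) A) \<cdot>\<^bsub>Fib H t\<^esub> pba H z (low_shift S H z A) =
       Sha (Fib H t) (low_counit H z A) \<cdot>\<^bsub>Fib H t\<^esub> pbsh H z (lowo H z A)"
    unfolding eq st using Z.transpose[OF g(1,2) ob] unfolding g(3) .
qed

text \<open>The inverse of \<open>low_conn\<close> is the arrow whose transpose, for the pull-back along the composite, is the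
  composite of the two counits.\<close>

lemma low_conn:
  assumes z: "z \<in> Cl S" "w \<in> Cl S" and d: "Cod S z = Dom S w" and A: "A \<in> Ob (Fib H (Dom S z))" and st: "s = Cod S w" "t = Dom S z"
  shows "low_conn S H w z A \<in> Ar (Fib H s)" "Dom (Fib H s) (low_conn S H w z A) = lowo H (w \<cdot>\<^bsub>S\<^esub> z) A"
    "Cod (Fib H s) (low_conn S H w z A) = lowo H w (lowo H z A)"
    "low_counit H z A \<cdot>\<^bsub>Fib H t\<^esub> pba H z (low_counit H w (lowo H z A)) \<cdot>\<^bsub>Fib H t\<^esub>
       pba H z (pba H w (low_conn S H w z A)) \<cdot>\<^bsub>Fib H t\<^esub> conn H z w (lowo H (w \<cdot>\<^bsub>S\<^esub> z) A) = low_counit H (w \<cdot>\<^bsub>S\<^esub> z) A"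
    "low_conn S H w z A \<in> Iso (Fib H s)"
proof -
  let ?v = "w \<cdot>\<^bsub>S\<^esub> z" and ?E = "Fib H (Cod S w)" and ?Y = "Fib H (Dom S w)" and ?D = "Fib H (Dom S z)"
  have v: "?v \<in> Cl S" "Dom S ?v = Dom S z" "Cod S ?v = Cod S w" using z d by simp_all
  interpret Z: adj ?Y ?D "pbo H z" "pba H z" "lowo H z" "lowa H z" "low_unit H z" "low_counit H z" using low z d by blast
  interpret W: adj ?E ?Y "pbo H w" "pba H w" "lowo H w" "lowa H w" "low_unit H w" "low_counit H w" using low z by blast
  interpret V: adj ?E ?D "pbo H ?v" "pba H ?v" "lowo H ?v" "lowa H ?v" "low_unit H ?v" "low_counit H ?v" using low v by blast
  let ?B = "lowo H ?v A" and ?R = "lowo H w (lowo H z A)" and ?l = "low_conn S H w z A"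
  have ob: "?B \<in> Ob ?E" "?R \<in> Ob ?E" using A by simp_all
  note S = z d A ob
  let ?T = "\<lambda>x. low_counit H z A \<cdot>\<^bsub>?D\<^esub> pba H z (low_counit H w (lowo H z A) \<cdot>\<^bsub>?Y\<^esub> pba H w x) \<cdot>\<^bsub>?D\<^esub> conn H z w (Dom ?E x)"
  have T_inj: "x = y" if "x \<in> Ar ?E" "y \<in> Ar ?E" "Dom ?E x = Dom ?E y" "Cod ?E x = ?R" "Cod ?E y = ?R" "?T x = ?T y" for x y
  proof -
    have dx: "Dom ?E x \<in> Ob ?E" using that W.L.C.Dom_Ob by simp
    have "low_counit H z A \<cdot>\<^bsub>?D\<^esub> pba H z (low_counit H w (lowo H z A) \<cdot>\<^bsub>?Y\<^esub> pba H w x)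
        = low_counit H z A \<cdot>\<^bsub>?D\<^esub> pba H z (low_counit H w (lowo H z A) \<cdot>\<^bsub>?Y\<^esub> pba H w y)"
      by (rule Z.L.D.Iso_cancel_right[where g = "conn H z w (Dom ?E x)"]) (use that S dx in simp_all)
    then have "low_counit H w (lowo H z A) \<cdot>\<^bsub>?Y\<^esub> pba H w x = low_counit H w (lowo H z A) \<cdot>\<^bsub>?Y\<^esub> pba H w y"
      by (rule Z.transpose_inj[rotated 6]) (use that S in simp_all)
    then show ?thesis by (rule W.transpose_inj[rotated 6]) (use that S in simp_all)
  qed
  have T_cmp: "?T (x \<cdot>\<^bsub>?E\<^esub> y) = ?T x \<cdot>\<^bsub>?D\<^esub> pba H ?v y" if "x \<in> Ar ?E" "y \<in> Ar ?E" "Cod ?E y = Dom ?E x" "Cod ?E x = ?R" for x y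
  proof -
    have dx: "Dom ?E x \<in> Ob ?E" "Dom ?E y \<in> Ob ?E" using that W.L.C.Dom_Ob by simp_all
    have "?T (x \<cdot>\<^bsub>?E\<^esub> y) = low_counit H z A \<cdot>\<^bsub>?D\<^esub> pba H z (low_counit H w (lowo H z A) \<cdot>\<^bsub>?Y\<^esub> pba H w x) \<cdot>\<^bsub>?D\<^esub> (pba H z (pba H w y) \<cdot>\<^bsub>?D\<^esub> conn H z w (Dom ?E y))"
      using that S dx by (simp add: Z.L.cmp W.L.cmp)
    also have "pba H z (pba H w y) \<cdot>\<^bsub>?D\<^esub> conn H z w (Dom ?E y) = conn H z w (Dom ?E x) \<cdot>\<^bsub>?D\<^esub> pba H ?v y"
      using fib.cn_nat[of z w "Dom S z" "Cod S w" y] that S by simp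
    finally show ?thesis using that S dx by (simp add: Z.L.cmp W.L.cmp)
  qed
  let ?c = "low_counit H ?v A \<cdot>\<^bsub>?D\<^esub> inv_ar ?D (conn H z w ?B)"
  have c: "?c \<in> Ar ?D" "Dom ?D ?c = pbo H z (pbo H w ?B)" "Cod ?D ?c = A" using S by simp_all
  let ?e = "lowa H z ?c \<cdot>\<^bsub>?Y\<^esub> low_unit H z (pbo H w ?B)"
  have e: "?e \<in> Ar ?Y" "Dom ?Y ?e = pbo H w ?B" "Cod ?Y ?e = lowo H z A" using S c by simp_all
  have l: "?l = lowa H w ?e \<cdot>\<^bsub>?E\<^esub> low_unit H w ?B"
    using S by (simp add: low_conn_def Let_def Z.R.cmp W.R.cmp)
  have la: "?l \<in> Ar ?E" "Dom ?E ?l = ?B" "Cod ?E ?l = ?R" unfolding l using S e by simp_all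
  have le: "low_counit H w (lowo H z A) \<cdot>\<^bsub>?Y\<^esub> pba H w ?l = ?e"
    unfolding l using W.transpose[OF e(1,2) ob(1)] unfolding e(3) .
  have lc: "low_counit H z A \<cdot>\<^bsub>?D\<^esub> pba H z ?e = ?c"
    using Z.transpose[OF c(1,2)] S unfolding c(3) by simp
  have Tl: "?T ?l = low_counit H ?v A"
  proof -
    have "?T ?l = (low_counit H z A \<cdot>\<^bsub>?D\<^esub> pba H z ?e) \<cdot>\<^bsub>?D\<^esub> conn H z w ?B"
      unfolding le la(2) using S e by simp
    also have "\<dots> = low_counit H ?v A" unfolding lc using S by simp
    finally show ?thesis .
  qed
  show "?l \<in> Ar (Fib H s)" "Dom (Fib H s) ?l = ?B" "Cod (Fib H s) ?l = ?R"
    using la st by simp_all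
  show "low_counit H z A \<cdot>\<^bsub>Fib H t\<^esub> pba H z (low_counit H w (lowo H z A)) \<cdot>\<^bsub>Fib H t\<^esub>
       pba H z (pba H w ?l) \<cdot>\<^bsub>Fib H t\<^esub> conn H z w ?B = low_counit H ?v A"
    using Tl S la by (simp add: Z.L.cmp st)
  let ?g = "low_counit H z A \<cdot>\<^bsub>?D\<^esub> pba H z (low_counit H w (lowo H z A)) \<cdot>\<^bsub>?D\<^esub> conn H z w ?R"
  have g: "?g \<in> Ar ?D" "Dom ?D ?g = pbo H ?v ?R" "Cod ?D ?g = A" using S by simp_all
  let ?y = "lowa H ?v ?g \<cdot>\<^bsub>?E\<^esub> low_unit H ?v ?R"
  have y: "?y \<in> Ar ?E" "Dom ?E ?y = ?R" "Cod ?E ?y = ?B" using S g by simp_all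
  have yg: "low_counit H ?v A \<cdot>\<^bsub>?D\<^esub> pba H ?v ?y = ?g"
    using V.transpose[OF g(1,2) ob(2)] unfolding g(3) .
  have "?l \<cdot>\<^bsub>?E\<^esub> ?y = Idn ?E ?R"
  proof (rule T_inj)
    have "?T (?l \<cdot>\<^bsub>?E\<^esub> ?y) = ?g" using T_cmp[OF la(1) y(1)] la y Tl yg by simp
    also have "\<dots> = ?T (Idn ?E ?R)" using S by simp
    finally show "?T (?l \<cdot>\<^bsub>?E\<^esub> ?y) = ?T (Idn ?E ?R)" .
  qed (use la y ob in simp_all)
  moreover have "?y \<cdot>\<^bsub>?E\<^esub> ?l = Idn ?E ?B"
  proof (rule V.transpose_inj[where b = A])
    have "low_counit H ?v A \<cdot>\<^bsub>?D\<^esub> pba H ?v (?y \<cdot>\<^bsub>?E\<^esub> ?l) = (low_counit H ?v A \<cdot>\<^bsub>?D\<^esub> pba H ?v ?y) \<cdot>\<^bsub>?D\<^esub> pba H ?v ?l"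
      using la y A by (simp add: V.L.cmp)
    also have "\<dots> = ?T (Idn ?E ?R) \<cdot>\<^bsub>?D\<^esub> pba H ?v ?l" unfolding yg using S by simp
    also have "\<dots> = ?T (Idn ?E ?R \<cdot>\<^bsub>?E\<^esub> ?l)"
      by (rule T_cmp[symmetric]) (use la ob in simp_all)
    also have "\<dots> = low_counit H ?v A" using la Tl by simp
    finally show "low_counit H ?v A \<cdot>\<^bsub>?D\<^esub> pba H ?v (?y \<cdot>\<^bsub>?E\<^esub> ?l) = low_counit H ?v A \<cdot>\<^bsub>?D\<^esub> pba H ?v (Idn ?E ?B)"
      using A ob by simp
  qed (use la y A ob in simp_all)
  ultimately have "inverse_arrows ?E ?l ?y"
    using la y by (intro W.L.C.inverse_arrowsI) simp_all
  then show "?l \<in> Iso (Fib H s)" unfolding st by (rule W.L.C.inverse_arrows_Iso)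
qed

end

context localic_over_base
begin

text \<open>By base change \<open>z\<^sup>* u\<^sub># D\<close> is obtained from an object over the empty fibre product.\<close>

lemma pull_sharp_zero:
  assumes z: "z \<in> Cl S" and u: "u \<in> Sm S" and dj: "disjoint u z" and D: "D \<in> Ob (Fib H (Dom S u))"
  shows "zero_object (Fib H (Dom S z)) (pbo H z (sho H u D))"
proof -
  let ?e = "from_empty S (Dom S z)" and ?e' = "from_empty S (Dom S u)"
  let ?Z = "Fib H (Dom S z)" and ?E = "Fib H (Empt S)"
  note C = cartesianD[OF dj]
  have eSm: "?e \<in> Sm S" by (rule smooth_base_change[OF u dj])
  have ob: "Dom S z \<in> Ob S" "Dom S u \<in> Ob S" using z u by simp_all
  have e: "?e' \<in> Ar S" "Dom S ?e' = Empt S" "Cod S ?e' = Dom S u" "?e \<in> Ar S" "Dom S ?e = Empt S" "Cod S ?e = Dom S z"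
    using ob by simp_all
  interpret E: adj ?E ?Z "sho H ?e" "sha H ?e" "pbo H ?e" "pba H ?e" "sh_unit H ?e" "sh_counit H ?e"
    by (rule sharp[OF eSm e(5,6)])
  interpret U: adj "Fib H (Dom S u)" "Fib H (Cod S u)" "sho H u" "sha H u" "pbo H u" "pba H u" "sh_unit H u" "sh_counit H u"
    using sharp[OF u] by blast
  have cc: "Cod S z = Cod S u" using C(8) .
  have X: "sho H u D \<in> Ob (Fib H (Cod S z))" unfolding cc using D by simp
  note ex = exch_simps[OF e(1,4) Sm_Ar[OF u] Cl_Ar[OF z] C(5-7,9) X, of "Empt S", unfolded e, OF refl]
  have fu: "functor_on (Fib H (Dom S u)) ?E (pbo H ?e') (pba H ?e')" by (rule pull[OF e(1-3)])
  interpret F: functor_on "Fib H (Dom S u)" ?E "pbo H ?e'" "pba H ?e'" by (rule fu)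
  have "Dom ?Z (smooth_bc S H ?e' ?e u z D) = sho H ?e (pbo H ?e' D)" "Cod ?Z (smooth_bc S H ?e' ?e u z D) = pbo H z (sho H u D)"
    using ex D X z by (simp_all add: smooth_bc_def Let_def)
  moreover have "smooth_bc S H ?e' ?e u z D \<in> Iso ?Z" by (rule smooth_bc_iso[OF u dj D])
  moreover have "zero_object ?E (pbo H ?e' D)" using D by (intro fibre_Empt) simp
  then have "zero_object ?Z (sho H ?e (pbo H ?e' D))"
    by (rule left_adjoint_zero[OF fibre_additive fibre_additive E.adj_axioms, rotated 2]) (use ob Empt_Ob in simp_all)
  ultimately show ?thesis
    using additive_category.zero_object_Iso[OF fibre_additive[OF ob(1)]] by metis
qed

text \<open>Endomorphisms of \<open>u\<^sup>* z\<^sub>* A\<close> correspond by the two adjunctions to arrows \<open>z\<^sup>* u\<^sub># u\<^sup>* z\<^sub>* A \<rightarrow> A\<close>, and \<open>z\<^sup>* u\<^sub># = 0\<close>.\<close>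

lemma pull_low_zero:
  assumes z: "z \<in> Cl S" and u: "u \<in> Sm S" and dj: "disjoint u z" and A: "A \<in> Ob (Fib H (Dom S z))"
  shows "zero_object (Fib H (Dom S u)) (pbo H u (lowo H z A))"
proof -
  note C = cartesianD[OF dj]
  let ?U = "Fib H (Dom S u)" and ?Y = "Fib H (Cod S u)" and ?Z = "Fib H (Dom S z)"
  interpret Z: adj ?Y ?Z "pbo H z" "pba H z" "lowo H z" "lowa H z" "low_unit H z" "low_counit H z"
    by (rule low[OF z refl C(8)])
  interpret U: adj ?U ?Y "sho H u" "sha H u" "pbo H u" "pba H u" "sh_unit H u" "sh_counit H u"
    by (rule sharp[OF u refl refl])
  interpret ZA: additive_category ?Z by (rule fibre_additive) (use z in simp)
  interpret UA: additive_category ?U by (rule fibre_additive) (use u in simp)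
  let ?B = "lowo H z A" and ?X = "pbo H u (lowo H z A)"
  have ob: "?B \<in> Ob ?Y" "?X \<in> Ob ?U" using A by simp_all
  have zero: "zero_object ?Z (pbo H z (sho H u ?X))" by (rule pull_sharp_zero[OF z u dj ob(2)])
  show ?thesis
  proof (rule UA.zero_objectI)
    fix f g assume fg: "f \<in> Ar ?U" "g \<in> Ar ?U" "Dom ?U f = ?X" "Dom ?U g = ?X" "Cod ?U f = ?X" "Cod ?U g = ?X"
    let ?f = "sh_counit H u ?B \<cdot>\<^bsub>?Y\<^esub> sha H u f" and ?g = "sh_counit H u ?B \<cdot>\<^bsub>?Y\<^esub> sha H u g"
    have t: "?f \<in> Ar ?Y" "?g \<in> Ar ?Y" "Dom ?Y ?f = sho H u ?X" "Dom ?Y ?g = sho H u ?X" "Cod ?Y ?f = ?B" "Cod ?Y ?g = ?B"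
      using fg ob by simp_all
    have "low_counit H z A \<cdot>\<^bsub>?Z\<^esub> pba H z ?f = low_counit H z A \<cdot>\<^bsub>?Z\<^esub> pba H z ?g"
      by (rule ZA.zero_object_source[OF zero]) (use t A ob in \<open>simp_all del: Z.L.D.assoc\<close>)
    then have "?f = ?g" by (rule Z.transpose_inj[rotated 6]) (use t A in simp_all)
    then show "f = g" by (rule U.transpose_inj[rotated 6]) (use fg ob in simp_all)
  qed (rule ob)
qed

text \<open>An open immersion is a monomorphism, so its fibre product with itself is trivial and base change
  identifies the unit with an isomorphism.\<close>

lemma sh_unit_Iso:
  assumes z: "z \<in> Cl S" and D: "D \<in> Ob (Fib H (Dom S (Compl S z)))"
  shows "sh_unit H (Compl S z) D \<in> Iso (Fib H (Dom S (Compl S z)))"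
proof -
  let ?u = "Compl S z" and ?U = "Fib H (Dom S (Compl S z))" and ?Y = "Fib H (Cod S z)"
  let ?i = "Idn S (Dom S ?u)"
  have u: "?u \<in> Ar S" "?u \<in> Sm S" "Cod S ?u = Cod S z" "Dom S ?u \<in> Ob S" using z by simp_all
  interpret U: adj ?U ?Y "sho H ?u" "sha H ?u" "pbo H ?u" "pba H ?u" "sh_unit H ?u" "sh_counit H ?u"
    by (rule sharp[OF u(2) refl u(3)])
  have c: "cartesian S ?i ?i ?u ?u"
  proof (rule cartesianI)
    fix x y assume xy: "x \<in> Ar S" "y \<in> Ar S" "Dom S x = Dom S y" "Cod S x = Dom S ?u" "Cod S y = Dom S ?u" "?u \<cdot>\<^bsub>S\<^esub> x = ?u \<cdot>\<^bsub>S\<^esub> y"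
    then have "x = y" using Compl_mono[OF z] by blast
    then show "\<exists>h. h \<in> Ar S \<and> Dom S h = Dom S x \<and> Cod S h = Dom S ?i \<and> ?i \<cdot>\<^bsub>S\<^esub> h = x \<and> ?i \<cdot>\<^bsub>S\<^esub> h = y"
      using xy u by (intro exI[of _ x]) simp
  qed (use u in simp_all)
  let ?X = "sho H ?u D"
  have X: "?X \<in> Ob ?Y" "pbo H ?u ?X \<in> Ob ?U" using D by simp_all
  have "exch S H ?i ?i ?u ?u ?X = Idn ?U (pbo H ?u ?X)"
    using u X by (simp add: exch_def pbo_Idn)
  then have "smooth_bc S H ?i ?i ?u ?u D = sh_unit H ?u D"
    using u X D by (simp add: smooth_bc_def Let_def sharp_Idn sharp_Idn_ar pba_Idn)
  then show ?thesis using smooth_bc_iso[OF u(2) c D] by simp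
qed

text \<open>By joint conservativity: \<open>z\<^sup>*\<close> kills both sides, and \<open>u\<^sup>*\<close> of the counit is a one-sided inverse of the unit,
  which is invertible.\<close>

lemma sh_counit_Iso:
  assumes z: "z \<in> Cl S" and C: "C \<in> Ob (Fib H (Cod S z))" and zero: "zero_object (Fib H (Dom S z)) (pbo H z C)"
  shows "sh_counit H (Compl S z) C \<in> Iso (Fib H (Cod S z))"
proof -
  let ?u = "Compl S z" and ?U = "Fib H (Dom S (Compl S z))" and ?Y = "Fib H (Cod S z)" and ?Z = "Fib H (Dom S z)"
  have u: "?u \<in> Ar S" "?u \<in> Sm S" "Cod S ?u = Cod S z" using z by simp_all
  interpret U: adj ?U ?Y "sho H ?u" "sha H ?u" "pbo H ?u" "pba H ?u" "sh_unit H ?u" "sh_counit H ?u"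
    by (rule sharp[OF u(2) refl u(3)])
  interpret Z: functor_on ?Y ?Z "pbo H z" "pba H z" by (rule pull[OF Cl_Ar[OF z] refl refl])
  interpret ZA: additive_category ?Z by (rule fibre_additive) (use z in simp)
  let ?c = "sh_counit H ?u C"
  have o: "pbo H ?u C \<in> Ob ?U" using C by simp
  show ?thesis
  proof (rule jointly_conservative[OF z])
    show "pba H z ?c \<in> Iso ?Z"
    proof (rule ZA.zero_objects_Iso)
      show "zero_object ?Z (Dom ?Z (pba H z ?c))"
        using pull_sharp_zero[OF z u(2) Compl_disjoint[OF z] o] C by simp
    qed (use zero C in simp_all)
    show "pba H ?u ?c \<in> Iso ?U"
      by (rule U.L.C.Iso_left_factor[OF sh_unit_Iso[OF z o]]) (use C in simp_all)
  qed (use C in simp)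
qed

text \<open>The cone \<open>K\<close> of the unit \<open>A \<rightarrow> z\<^sub>* z\<^sup>* A\<close> is killed by \<open>z\<^sup>*\<close>, so it is isomorphic to \<open>u\<^sub># u\<^sup>* K\<close>;
  hence \<open>G K\<close> is isomorphic to some \<open>\<upsilon>\<^sub># D'\<close> and is killed by \<open>\<zeta>\<^sup>*\<close>. The functor \<open>G\<close> will be \<open>- \<boxtimes> A2\<close> or
  \<open>A1 \<boxtimes> -\<close>, with \<open>\<zeta>\<close> and \<open>\<upsilon>\<close> the products of \<open>z\<close> and \<open>u\<close> with an identity.\<close>

lemma pull_triangulated_unit_Iso:
  assumes z: "z \<in> Cl S" and \<zeta>: "\<zeta> \<in> Cl S" and \<upsilon>: "\<upsilon> \<in> Sm S" and dj: "disjoint \<upsilon> \<zeta>"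
    and G: "triangulated_functor (Fib H (Cod S z)) (Fib H (Cod S \<zeta>)) Go Ga \<phi>"
    and GU: "\<And>D. D \<in> Ob (Fib H (Dom S (Compl S z))) \<Longrightarrow> \<exists>D'\<in>Ob (Fib H (Dom S \<upsilon>)). \<exists>i\<in>Iso (Fib H (Cod S \<zeta>)).
      Dom (Fib H (Cod S \<zeta>)) i = sho H \<upsilon> D' \<and> Cod (Fib H (Cod S \<zeta>)) i = Go (sho H (Compl S z) D)"
    and A: "A \<in> Ob (Fib H (Cod S z))"
  shows "pba H \<zeta> (Ga (low_unit H z A)) \<in> Iso (Fib H (Dom S \<zeta>))"
proof -
  let ?u = "Compl S z" and ?C = "Fib H (Cod S z)" and ?D = "Fib H (Cod S \<zeta>)" and ?Z = "Fib H (Dom S z)" and ?Z' = "Fib H (Dom S \<zeta>)"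
  have ob: "Cod S z \<in> Ob S" "Cod S \<zeta> \<in> Ob S" "Dom S z \<in> Ob S" "Dom S \<zeta> \<in> Ob S" using z \<zeta> by simp_all
  interpret C: triangulated_category ?C by (rule fibre_triangulated[OF ob(1)])
  interpret D: triangulated_category ?D by (rule fibre_triangulated[OF ob(2)])
  interpret ZT: triangulated_category ?Z by (rule fibre_triangulated[OF ob(3)])
  interpret Z'T: triangulated_category ?Z' by (rule fibre_triangulated[OF ob(4)])
  interpret Z: adj ?C ?Z "pbo H z" "pba H z" "lowo H z" "lowa H z" "low_unit H z" "low_counit H z" by (rule low[OF z refl refl])
  interpret Z': functor_on ?D ?Z' "pbo H \<zeta>" "pba H \<zeta>" by (rule pull[OF Cl_Ar[OF \<zeta>] refl refl])
  interpret G: functor_on ?C ?D Go Ga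
    using G by unfold_locales (simp add: triangulated_functor_def additive_functor_def)
  have u: "?u \<in> Sm S" "Cod S ?u = Cod S z" using z by simp_all
  interpret U: adj "Fib H (Dom S ?u)" ?C "sho H ?u" "sha H ?u" "pbo H ?u" "pba H ?u" "sh_unit H ?u" "sh_counit H ?u"
    by (rule sharp[OF u(1) refl u(2)])
  let ?f = "low_unit H z A"
  obtain g h where t: "(?f, g, h) \<in> Tri ?C" using C.TR1_cone[of ?f] A by auto
  note T = C.TriD[OF t]
  have tri: "(Ka f, Ka g, \<psi> (Dom K f) \<cdot>\<^bsub>L\<^esub> Ka h) \<in> Tri L" if "triangulated_functor K L Ko Ka \<psi>" "(f, g, h) \<in> Tri K" for K L Ko Ka \<psi> f g h
    using that by (simp add: triangulated_functor_def)
  have "pba H z ?f \<in> Iso ?Z"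
    by (rule ZT.Iso_right_factor[OF low_counit_Iso[OF z, of "pbo H z A"]]) (use A in simp_all)
  then have "zero_object ?Z (Cod ?Z (pba H z g))"
    using ZT.triangle_Iso_imp_zero[OF tri[OF pb_triangulated[OF Cl_Ar[OF z]] t]] by blast
  then have zero: "zero_object ?Z (pbo H z (Cod ?C g))" using T(2) by simp
  let ?K = "Cod ?C g"
  have K: "?K \<in> Ob ?C" using T(2) by simp
  note ci = sh_counit_Iso[OF z K zero]
  obtain D' i where i: "D' \<in> Ob (Fib H (Dom S \<upsilon>))" "i \<in> Iso ?D" "Dom ?D i = sho H \<upsilon> D'" "Cod ?D i = Go (sho H ?u (pbo H ?u ?K))"
    using GU[of "pbo H ?u ?K"] K by auto
  let ?j = "Ga (sh_counit H ?u ?K) \<cdot>\<^bsub>?D\<^esub> i"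
  have j: "?j \<in> Iso ?D" "Dom ?D ?j = sho H \<upsilon> D'" "Cod ?D ?j = Go ?K"
    using ci i K by (simp_all add: D.Iso_Ar)
  have "zero_object ?Z' (pbo H \<zeta> (sho H \<upsilon> D'))" by (rule pull_sharp_zero[OF \<zeta> \<upsilon> dj i(1)])
  then have "zero_object ?Z' (Dom ?Z' (pba H \<zeta> ?j))" using j D.Iso_Ar[OF j(1)] by (simp del: D.Iso_Ar)
  then have "zero_object ?Z' (Cod ?Z' (pba H \<zeta> ?j))" using Z'T.zero_object_Iso[OF Z'.iso[OF j(1)]] by blast
  then have "zero_object ?Z' (pbo H \<zeta> (Go ?K))" using j D.Iso_Ar[OF j(1)] by simp
  then have "zero_object ?Z' (Cod ?Z' (pba H \<zeta> (Ga g)))" using T(2) by simp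
  then show ?thesis
    using Z'T.triangle_zero_imp_Iso[OF tri[OF pb_triangulated[OF Cl_Ar[OF \<zeta>]] tri[OF G t]]] by blast
qed

text \<open>By joint conservativity: on the complement of \<open>\<zeta>\<close>, which factors through \<open>\<upsilon>\<close>, the source vanishes by
  hypothesis and the target by \<open>u\<^sup>* \<zeta>\<^sub>* = 0\<close>.\<close>

lemma Iso_of_vanishing:
  assumes \<zeta>: "\<zeta> \<in> Cl S" and \<upsilon>: "\<upsilon> \<in> Ar S" and k: "k \<in> Ar S" "Cod S k = Dom S \<upsilon>" "Compl S \<zeta> = \<upsilon> \<cdot>\<^bsub>S\<^esub> k"
    and \<phi>: "\<phi> \<in> Ar (Fib H (Cod S \<zeta>))" "Cod (Fib H (Cod S \<zeta>)) \<phi> = lowo H \<zeta> B" "B \<in> Ob (Fib H (Dom S \<zeta>))"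
    and zero: "zero_object (Fib H (Dom S \<upsilon>)) (pbo H \<upsilon> (Dom (Fib H (Cod S \<zeta>)) \<phi>))"
    and iso: "pba H \<zeta> \<phi> \<in> Iso (Fib H (Dom S \<zeta>))"
  shows "\<phi> \<in> Iso (Fib H (Cod S \<zeta>))"
proof (rule jointly_conservative[OF \<zeta> \<phi>(1) iso])
  let ?u = "Compl S \<zeta>" and ?Y = "Fib H (Cod S \<zeta>)" and ?U = "Fib H (Dom S (Compl S \<zeta>))"
  let ?X = "Dom ?Y \<phi>"
  have u: "?u \<in> Sm S" "?u \<in> Ar S" "Cod S ?u = Cod S \<zeta>" "Dom S ?u \<in> Ob S" using \<zeta> by simp_all
  interpret UA: additive_category ?U by (rule fibre_additive[OF u(4)])
  interpret U: functor_on ?Y ?U "pbo H ?u" "pba H ?u" by (rule pull[OF u(2) refl u(3)])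
  have d: "Dom S k = Dom S ?u" "Cod S \<upsilon> = Cod S \<zeta>"
    using k(3) \<upsilon> k(1,2) u(3) by simp_all
  have X: "?X \<in> Ob ?Y" using \<phi>(1) by simp
  have "zero_object (Fib H (Dom S k)) (pbo H k (pbo H \<upsilon> ?X))"
    by (rule additive_functor_zero[OF _ _ pull_additive[OF k(1)]]) (use zero k \<upsilon> fibre_additive in simp_all)
  then have "zero_object ?U (pbo H k (pbo H \<upsilon> ?X))" unfolding d(1) .
  moreover have "conn H k \<upsilon> ?X \<in> Iso ?U" "Dom ?U (conn H k \<upsilon> ?X) = pbo H ?u ?X" "Cod ?U (conn H k \<upsilon> ?X) = pbo H k (pbo H \<upsilon> ?X)"
    unfolding k(3) using k(1,2) \<upsilon> X d by simp_all
  ultimately have "zero_object ?U (pbo H ?u ?X)"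
    using UA.zero_object_Iso' by metis
  moreover have "zero_object ?U (pbo H ?u (lowo H \<zeta> B))"
    by (rule pull_low_zero[OF \<zeta> u(1) Compl_disjoint[OF \<zeta>] \<phi>(3)])
  ultimately show "pba H ?u \<phi> \<in> Iso ?U"
    using \<phi> by (intro UA.zero_objects_Iso) simp_all
qed

end

section \<open>Products of categories\<close>

lemma prod_cat_simps:
  "Ob (prod_cat C D) = Ob C \<times> Ob D" "Ar (prod_cat C D) = Ar C \<times> Ar D"
  "Dom (prod_cat C D) f = (Dom C (fst f), Dom D (snd f))" "Cod (prod_cat C D) f = (Cod C (fst f), Cod D (snd f))"
  "Idn (prod_cat C D) a = (Idn C (fst a), Idn D (snd a))"
  "g \<cdot>\<^bsub>prod_cat C D\<^esub> f = (fst g \<cdot>\<^bsub>C\<^esub> fst f, snd g \<cdot>\<^bsub>D\<^esub> snd f)"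
  by (simp_all add: prod_cat_def map_prod_def case_prod_beta)

lemma Hom_prod_cat: "f \<in> Hom (prod_cat C D) a b \<longleftrightarrow> fst f \<in> Hom C (fst a) (fst b) \<and> snd f \<in> Hom D (snd a) (snd b)"
  by (cases f; cases a; cases b) (auto simp: Hom_def prod_cat_simps)

lemma category_prod_cat:
  assumes "category C" "category D" shows "category (prod_cat C D)"
proof -
  interpret C: category C by fact
  interpret D: category D by fact
  show ?thesis
  proof
    show "Dom (prod_cat C D) f \<in> Ob (prod_cat C D)" "Cod (prod_cat C D) f \<in> Ob (prod_cat C D)" if "f \<in> Ar (prod_cat C D)" for f
      using that by (auto simp: prod_cat_simps)
    show "Idn (prod_cat C D) a \<in> Hom (prod_cat C D) a a" if "a \<in> Ob (prod_cat C D)" for a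
      using that by (cases a) (simp add: Hom_prod_cat prod_cat_simps C.Idn_Hom D.Idn_Hom)
    show "g \<cdot>\<^bsub>prod_cat C D\<^esub> f \<in> Hom (prod_cat C D) a c" if "f \<in> Hom (prod_cat C D) a b" "g \<in> Hom (prod_cat C D) b c" for f g a b c
      using that by (auto simp: Hom_prod_cat prod_cat_simps intro: C.Cmp_Hom D.Cmp_Hom)
    show "f \<cdot>\<^bsub>prod_cat C D\<^esub> Idn (prod_cat C D) a = f" "Idn (prod_cat C D) b \<cdot>\<^bsub>prod_cat C D\<^esub> f = f" if "f \<in> Hom (prod_cat C D) a b" for f a b
      using that by (auto simp: Hom_prod_cat prod_cat_simps Hom_def prod_eq_iff)
    show "(h \<cdot>\<^bsub>prod_cat C D\<^esub> g) \<cdot>\<^bsub>prod_cat C D\<^esub> f = h \<cdot>\<^bsub>prod_cat C D\<^esub> g \<cdot>\<^bsub>prod_cat C D\<^esub> f"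
      if "f \<in> Hom (prod_cat C D) a b" "g \<in> Hom (prod_cat C D) b c" "h \<in> Hom (prod_cat C D) c d" for f g h a b c d
      using that by (auto simp: Hom_prod_cat prod_cat_simps Hom_def)
  qed
qed

lemma Iso_prod_cat: "f \<in> Iso (prod_cat C D) \<longleftrightarrow> fst f \<in> Iso C \<and> snd f \<in> Iso D"
proof -
  have "inverse_arrows (prod_cat C D) f g \<longleftrightarrow> inverse_arrows C (fst f) (fst g) \<and> inverse_arrows D (snd f) (snd g)" for g
    by (cases f; cases g) (auto simp: inverse_arrows_def Hom_prod_cat prod_cat_simps)
  then show ?thesis by (simp add: Iso_def) 
qed

lemma functor_prod:
  assumes "functor_on C D Fo Fa" "functor_on C' D' Fo' Fa'"
  shows "functor_on (prod_cat C C') (prod_cat D D') (map_prod Fo Fo') (map_prod Fa Fa')"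
proof -
  interpret F: functor_on C D Fo Fa by fact
  interpret F': functor_on C' D' Fo' Fa' by fact
  show ?thesis
    using F.C.category_axioms F'.C.category_axioms F.D.category_axioms F'.D.category_axioms
    by (auto simp: functor_on_def functor_on_axioms_def category_prod_cat is_functor_def Hom_prod_cat prod_cat_simps Hom_def F.cmp F'.cmp)
qed

lemma nat_prod:
  assumes "is_nat C D Fo Fa Go Ga \<tau>" "is_nat C' D' Fo' Fa' Go' Ga' \<tau>'"
  shows "is_nat (prod_cat C C') (prod_cat D D') (map_prod Fo Fo') (map_prod Fa Fa') (map_prod Go Go') (map_prod Ga Ga') (map_prod \<tau> \<tau>')"
  using assms by (auto simp: is_nat_def Hom_prod_cat prod_cat_simps)

lemma adj_prod:
  assumes "adj C D Lo La Ro Ra \<eta> \<epsilon>" "adj C' D' Lo' La' Ro' Ra' \<eta>' \<epsilon>'"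
  shows "adj (prod_cat C C') (prod_cat D D') (map_prod Lo Lo') (map_prod La La') (map_prod Ro Ro') (map_prod Ra Ra') (map_prod \<eta> \<eta>') (map_prod \<epsilon> \<epsilon>')"
proof -
  interpret J: adj C D Lo La Ro Ra \<eta> \<epsilon> by fact
  interpret J': adj C' D' Lo' La' Ro' Ra' \<eta>' \<epsilon>' by fact
  interpret L: functor_on "prod_cat C C'" "prod_cat D D'" "map_prod Lo Lo'" "map_prod La La'"
    by (rule functor_prod) unfold_locales
  interpret R: functor_on "prod_cat D D'" "prod_cat C C'" "map_prod Ro Ro'" "map_prod Ra Ra'"
    by (rule functor_prod) unfold_locales
  have "adjunction (prod_cat C C') (prod_cat D D') (map_prod Lo Lo') (map_prod La La') (map_prod Ro Ro') (map_prod Ra Ra') (map_prod \<eta> \<eta>') (map_prod \<epsilon> \<epsilon>')"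
    using J.adjunction J'.adjunction L.is_functor R.is_functor
    by (auto simp: adjunction_def is_nat_def Hom_prod_cat prod_cat_simps)
  then show ?thesis by unfold_locales
qed

section \<open>The two fibrations over pairs\<close>

text \<open>The functors \<open>\<boxtimes>\<close> form a \<^locale>\<open>fibration_map\<close> over the category of pairs. Its source has the fibres
  \<open>H(S1) \<times> H(S2)\<close>, its target the fibres \<open>H(S1 \<times> S2)\<close>. Among the names below \<open>px f\<close> is \<open>f1 \<times> f2\<close>; \<open>pF\<close>, \<open>pO\<close>,
  \<open>pA\<close>, \<open>pC\<close> are the fibres, pull-backs and connection isomorphisms of the source, \<open>rO\<close>, \<open>rA\<close>, \<open>pEt\<close>,
  \<open>pEp\<close> the right adjoints with units and counits; \<open>bF\<close> are the fibres of the target.\<close>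

locale box_over = localic_over_base S H
  for S :: "('s, 'm, 'x) base_cat_scheme" and H :: "('s, 'm, 'a, 'b, 'y) adj_fib_cat_scheme" +
  fixes B :: "('s, 'a, 'b, 'z) box_scheme"
  assumes box_functors: "box_functors S H B" and box_triangulated: "box_triangulated S H B"
begin

definition SS where "SS = prod_cat S S"
definition px :: "'m \<times> 'm \<Rightarrow> 'm" where "px f = prod_ar S (fst f) (snd f)"
definition pF where "pF s = prod_cat (Fib H (fst s)) (Fib H (snd s))"
definition pO where "pO f = map_prod (pbo H (fst f)) (pbo H (snd f))"
definition pA where "pA f = map_prod (pba H (fst f)) (pba H (snd f))"
definition pC where "pC f g = map_prod (conn H (fst f) (fst g)) (conn H (snd f) (snd g))"
definition rO where "rO f = map_prod (lowo H (fst f)) (lowo H (snd f))"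
definition rA where "rA f = map_prod (lowa H (fst f)) (lowa H (snd f))"
definition pEt where "pEt f = map_prod (low_unit H (fst f)) (low_unit H (snd f))"
definition pEp where "pEp f = map_prod (low_counit H (fst f)) (low_counit H (snd f))"
definition bF where "bF s = Fib H (Pr S (fst s) (snd s))"
definition Fo where "Fo s A = bxo B (fst s) (snd s) (fst A) (snd A)"
definition Fa where "Fa s \<phi> = bxa B (fst s) (snd s) (fst \<phi>) (snd \<phi>)"

lemma SS_simps:
  "s \<in> Ob SS \<longleftrightarrow> fst s \<in> Ob S \<and> snd s \<in> Ob S" "f \<in> Ar SS \<longleftrightarrow> fst f \<in> Ar S \<and> snd f \<in> Ar S"
  "Dom SS f = (Dom S (fst f), Dom S (snd f))" "Cod SS f = (Cod S (fst f), Cod S (snd f))"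
  "Idn SS s = (Idn S (fst s), Idn S (snd s))" "g \<cdot>\<^bsub>SS\<^esub> f = (fst g \<cdot>\<^bsub>S\<^esub> fst f, snd g \<cdot>\<^bsub>S\<^esub> snd f)"
  by (simp_all add: SS_def prod_cat_simps mem_Times_iff)

lemma pF_simps:
  "A \<in> Ob (pF s) \<longleftrightarrow> fst A \<in> Ob (Fib H (fst s)) \<and> snd A \<in> Ob (Fib H (snd s))"
  "\<phi> \<in> Ar (pF s) \<longleftrightarrow> fst \<phi> \<in> Ar (Fib H (fst s)) \<and> snd \<phi> \<in> Ar (Fib H (snd s))"
  "Dom (pF s) \<phi> = (Dom (Fib H (fst s)) (fst \<phi>), Dom (Fib H (snd s)) (snd \<phi>))"
  "Cod (pF s) \<phi> = (Cod (Fib H (fst s)) (fst \<phi>), Cod (Fib H (snd s)) (snd \<phi>))"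
  "Idn (pF s) A = (Idn (Fib H (fst s)) (fst A), Idn (Fib H (snd s)) (snd A))"
  "\<psi> \<cdot>\<^bsub>pF s\<^esub> \<phi> = (fst \<psi> \<cdot>\<^bsub>Fib H (fst s)\<^esub> fst \<phi>, snd \<psi> \<cdot>\<^bsub>Fib H (snd s)\<^esub> snd \<phi>)"
  by (simp_all add: pF_def prod_cat_simps mem_Times_iff)

lemmas p_defs = pO_def pA_def pC_def rO_def rA_def pEt_def pEp_def

lemma px:
  assumes "f \<in> Ar SS"
  shows "px f \<in> Ar S" "Fib H (Dom S (px f)) = bF (Dom SS f)" "Fib H (Cod S (px f)) = bF (Cod SS f)"
  using assms by (simp_all add: px_def SS_simps bF_def)

lemma px_Cmp: "f \<in> Ar SS \<Longrightarrow> g \<in> Ar SS \<Longrightarrow> Cod SS f = Dom SS g \<Longrightarrow> px (g \<cdot>\<^bsub>SS\<^esub> f) = px g \<cdot>\<^bsub>S\<^esub> px f"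
  and px_composable: "f \<in> Ar SS \<Longrightarrow> g \<in> Ar SS \<Longrightarrow> Cod SS f = Dom SS g \<Longrightarrow> Cod S (px f) = Dom S (px g)"
  by (simp_all add: px_def SS_simps)

lemma category_SS: "category SS"
  unfolding SS_def by (intro category_prod_cat category_axioms)

sublocale pairs: fibration_map SS pF pO pA pC bF "\<lambda>f. pbo H (px f)" "\<lambda>f. pba H (px f)" "\<lambda>f g. conn H (px f) (px g)" Fo Fa
proof -
  interpret X: category SS by (rule category_SS)
  have fA: "functor_on (pF (Cod SS f)) (pF (Dom SS f)) (pO f) (pA f)" if "f \<in> Ar SS" for f
    using that unfolding pF_def pO_def pA_def by (intro functor_prod pull) (simp_all add: SS_simps)
  have fB: "functor_on (bF (Cod SS f)) (bF (Dom SS f)) (pbo H (px f)) (pba H (px f))" if "f \<in> Ar SS" for f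
    using fib.pull[OF px(1)[OF that]] px(2,3)[OF that] by simp
  show "fibration_map SS pF pO pA pC bF (\<lambda>f. pbo H (px f)) (\<lambda>f. pba H (px f)) (\<lambda>f g. conn H (px f) (px g)) Fo Fa"
  proof (intro fibration_map.intro fibration.intro fibration_axioms.intro fibration_map_axioms.intro category_SS)
    fix s assume s: "s \<in> Ob SS"
    show "category (pF s)" using s unfolding pF_def by (intro category_prod_cat fibre_category) (simp_all add: SS_simps)
    show "category (bF s)" using s unfolding bF_def by (intro fibre_category) (simp add: SS_simps)
    have "is_functor (prod_cat (Fib H (fst s)) (Fib H (snd s))) (Fib H (Pr S (fst s) (snd s)))
       (\<lambda>(A1, A2). bxo B (fst s) (snd s) A1 A2) (\<lambda>(\<phi>1, \<phi>2). bxa B (fst s) (snd s) \<phi>1 \<phi>2)"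
      using box_functors s by (simp add: box_functors_def SS_simps)
    then show "is_functor (pF s) (bF s) (Fo s) (Fa s)"
      by (simp add: pF_def bF_def Fo_def[abs_def] Fa_def[abs_def] case_prod_beta')
  next
    fix f assume f: "f \<in> Ar SS"
    show "is_functor (pF (Cod SS f)) (pF (Dom SS f)) (pO f) (pA f)" using fA[OF f] by (rule functor_on.is_functor)
    show "is_functor (bF (Cod SS f)) (bF (Dom SS f)) (pbo H (px f)) (pba H (px f))" using fB[OF f] by (rule functor_on.is_functor)
    fix g assume g: "g \<in> Ar SS" and c: "Cod SS f = Dom SS g"
    have n1: "is_nat_iso (Fib H (Cod S g)) (Fib H (Dom S f)) (pbo H (g \<cdot>\<^bsub>S\<^esub> f)) (pba H (g \<cdot>\<^bsub>S\<^esub> f))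
        (\<lambda>A. pbo H f (pbo H g A)) (\<lambda>\<phi>. pba H f (pba H g \<phi>)) (conn H f g)" if "f \<in> Ar S" "g \<in> Ar S" "Cod S f = Dom S g" for f g
      using conn_nat_iso[OF that] by (simp add: o_def)
    show "is_nat_iso (pF (Cod SS g)) (pF (Dom SS f)) (pO (g \<cdot>\<^bsub>SS\<^esub> f)) (pA (g \<cdot>\<^bsub>SS\<^esub> f)) (pO f \<circ> pO g) (pA f \<circ> pA g) (pC f g)"
      using f g c conn_nat_iso[of "fst f" "fst g"] conn_nat_iso[of "snd f" "snd g"]
        nat_prod[of "Fib H (Cod S (fst g))" "Fib H (Dom S (fst f))" _ _ _ _ "conn H (fst f) (fst g)"
          "Fib H (Cod S (snd g))" "Fib H (Dom S (snd f))" _ _ _ _ "conn H (snd f) (snd g)"]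
      by (simp add: is_nat_iso_def pF_def SS_simps pO_def pA_def pC_def Iso_prod_cat prod_cat_simps map_prod.comp mem_Times_iff)
    show "is_nat_iso (bF (Cod SS g)) (bF (Dom SS f)) (pbo H (px (g \<cdot>\<^bsub>SS\<^esub> f))) (pba H (px (g \<cdot>\<^bsub>SS\<^esub> f)))
        (pbo H (px f) \<circ> pbo H (px g)) (pba H (px f) \<circ> pba H (px g)) (conn H (px f) (px g))"
      using conn_nat_iso[of "px f" "px g"] f g c by (simp add: px px_Cmp px_composable)
    fix h A assume h: "h \<in> Ar SS" and c': "Cod SS g = Dom SS h"
    show "pA f (pC g h A) \<cdot>\<^bsub>pF (Dom SS f)\<^esub> pC f (h \<cdot>\<^bsub>SS\<^esub> g) A = pC f g (pO h A) \<cdot>\<^bsub>pF (Dom SS f)\<^esub> pC (g \<cdot>\<^bsub>SS\<^esub> f) h A"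
      if "A \<in> Ob (pF (Cod SS h))"
      using that f g h c c' by (simp add: pF_simps SS_simps p_defs conn_cocycle)
    show "pba H (px f) (conn H (px g) (px h) A') \<cdot>\<^bsub>bF (Dom SS f)\<^esub> conn H (px f) (px (h \<cdot>\<^bsub>SS\<^esub> g)) A' =
        conn H (px f) (px g) (pbo H (px h) A') \<cdot>\<^bsub>bF (Dom SS f)\<^esub> conn H (px (g \<cdot>\<^bsub>SS\<^esub> f)) (px h) A'"
      if "A' \<in> Ob (bF (Cod SS h))" for A'
      using conn_cocycle[of "px f" "px g" "px h" A'] that f g h c c' by (simp add: px px_Cmp px_composable)
  qed
qed

definition Cl2 where "Cl2 = Cl S \<times> Cl S"
definition Sm2 where "Sm2 = Sm S \<times> Sm S"
definition at :: "('m \<Rightarrow> 'm \<Rightarrow> 'a \<Rightarrow> 'a \<Rightarrow> 'b) \<Rightarrow> 'm \<times> 'm \<Rightarrow> 'a \<times> 'a \<Rightarrow> 'b" where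
  "at m f A = m (fst f) (snd f) (fst A) (snd A)"

lemma Cl2_Ar: "z \<in> Cl2 \<Longrightarrow> z \<in> Ar SS" and Sm2_Ar: "p \<in> Sm2 \<Longrightarrow> p \<in> Ar SS"
  by (auto simp: Cl2_def Sm2_def SS_simps)

lemma px_Cl: "z \<in> Cl2 \<Longrightarrow> px z \<in> Cl S"
  by (auto simp: Cl2_def px_def closed_product)

lemma Cl2_mate_square:
  assumes z: "z \<in> Cl2"
  shows "mate_square (pF (Cod SS z)) (pF (Dom SS z)) (pO z) (pA z) (rO z) (rA z) (pEt z) (pEp z)
    (bF (Cod SS z)) (bF (Dom SS z)) (pbo H (px z)) (pba H (px z)) (lowo H (px z)) (lowa H (px z)) (low_unit H (px z)) (low_counit H (px z))
    (Fo (Cod SS z)) (Fa (Cod SS z)) (Fo (Dom SS z)) (Fa (Dom SS z))"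
proof (intro mate_square.intro mate_square_axioms.intro)
  have zA: "z \<in> Ar SS" using Cl2_Ar z by blast
  have z12: "fst z \<in> Cl S" "snd z \<in> Cl S" using z by (auto simp: Cl2_def)
  show "adj (pF (Cod SS z)) (pF (Dom SS z)) (pO z) (pA z) (rO z) (rA z) (pEt z) (pEp z)"
    unfolding pF_def p_defs using z12 by (intro adj_prod low) (simp_all add: SS_simps)
  show "adj (bF (Cod SS z)) (bF (Dom SS z)) (pbo H (px z)) (pba H (px z)) (lowo H (px z)) (lowa H (px z)) (low_unit H (px z)) (low_counit H (px z))"
    using low[OF px_Cl[OF z] refl refl] px[OF zA] by simp
  show "functor_on (pF (Cod SS z)) (bF (Cod SS z)) (Fo (Cod SS z)) (Fa (Cod SS z))"
    "functor_on (pF (Dom SS z)) (bF (Dom SS z)) (Fo (Dom SS z)) (Fa (Dom SS z))"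
    using zA by (intro pairs.ff; simp)+
  show "pEp z A \<in> Iso (pF (Dom SS z))" if "A \<in> Ob (pF (Dom SS z))" for A
    using that z12 low_counit_Iso by (simp add: pF_def Iso_prod_cat SS_simps prod_cat_simps p_defs mem_Times_iff)
  show "low_counit H (px z) A' \<in> Iso (bF (Dom SS z))" if "A' \<in> Ob (bF (Dom SS z))" for A'
    using low_counit_Iso[OF px_Cl[OF z]] that px[OF zA] by simp
qed

end

section \<open>Mates over pairs of closed immersions\<close>

context box_over
begin

text \<open>The notions of \<^locale>\<open>mate_square\<close> for the square attached to a pair \<open>z\<close> of closed immersions.\<close>

definition fam_iso :: "'m \<times> 'm \<Rightarrow> ('a \<times> 'a \<Rightarrow> 'b) \<Rightarrow> bool" where
  "fam_iso f \<alpha> \<longleftrightarrow> pairs.family f \<alpha> \<and> (\<forall>A\<in>Ob (pF (Cod SS f)). \<alpha> A \<in> Iso (bF (Dom SS f)))"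

definition low_fam :: "'m \<times> 'm \<Rightarrow> ('a \<times> 'a \<Rightarrow> 'b) \<Rightarrow> bool" where
  "low_fam z \<beta> \<longleftrightarrow> is_nat (pF (Dom SS z)) (bF (Cod SS z)) (\<lambda>A. Fo (Cod SS z) (rO z A)) (\<lambda>\<phi>. Fa (Cod SS z) (rA z \<phi>))
     (\<lambda>A. lowo H (px z) (Fo (Dom SS z) A)) (\<lambda>\<phi>. lowa H (px z) (Fa (Dom SS z) \<phi>)) \<beta>"

definition mate :: "'m \<times> 'm \<Rightarrow> ('a \<times> 'a \<Rightarrow> 'b) \<Rightarrow> ('a \<times> 'a \<Rightarrow> 'b) \<Rightarrow> 'a \<times> 'a \<Rightarrow> bool" where
  "mate z \<alpha> \<beta> A \<longleftrightarrow> low_counit H (px z) (Fo (Dom SS z) A) \<cdot>\<^bsub>bF (Dom SS z)\<^esub> pba H (px z) (\<beta> A) \<cdot>\<^bsub>bF (Dom SS z)\<^esub> \<alpha> (rO z A) =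
     Fa (Dom SS z) (pEp z A)"

definition mbarP :: "'m \<times> 'm \<Rightarrow> ('a \<times> 'a \<Rightarrow> 'b) \<Rightarrow> 'a \<times> 'a \<Rightarrow> 'b" where
  "mbarP z \<alpha> A = lowa H (px z) (Fa (Dom SS z) (pEp z A)) \<cdot>\<^bsub>bF (Cod SS z)\<^esub> lowa H (px z) (inv_ar (bF (Dom SS z)) (\<alpha> (rO z A)))
     \<cdot>\<^bsub>bF (Cod SS z)\<^esub> low_unit H (px z) (Fo (Cod SS z) (rO z A))"

definition minvP :: "'m \<times> 'm \<Rightarrow> ('a \<times> 'a \<Rightarrow> 'b) \<Rightarrow> 'a \<times> 'a \<Rightarrow> 'b" where
  "minvP z \<beta> A = low_counit H (px z) (Fo (Dom SS z) (pO z A)) \<cdot>\<^bsub>bF (Dom SS z)\<^esub> pba H (px z) (\<beta> (pO z A))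
     \<cdot>\<^bsub>bF (Dom SS z)\<^esub> pba H (px z) (Fa (Cod SS z) (pEt z A))"

definition lcP :: "'m \<times> 'm \<Rightarrow> 'm \<times> 'm \<Rightarrow> 'a \<times> 'a \<Rightarrow> 'b \<times> 'b" where
  "lcP w z = map_prod (low_conn S H (fst w) (fst z)) (low_conn S H (snd w) (snd z))"

lemma fam_isoD: "fam_iso f \<alpha> \<Longrightarrow> pairs.family f \<alpha>"
  "fam_iso f \<alpha> \<Longrightarrow> A \<in> Ob (pF (Cod SS f)) \<Longrightarrow> s = Dom SS f \<Longrightarrow> \<alpha> A \<in> Iso (bF s)"
  by (auto simp: fam_iso_def)

lemma low_famD:
  assumes "low_fam z \<beta>" "A \<in> Ob (pF (Dom SS z))" "s = Cod SS z"
  shows "\<beta> A \<in> Ar (bF s)" "Dom (bF s) (\<beta> A) = Fo s (rO z A)" "Cod (bF s) (\<beta> A) = lowo H (px z) (Fo (Dom SS z) A)"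
  using assms by (auto simp: low_fam_def is_nat_def Hom_def)

context
  fixes z assumes z: "z \<in> Cl2"
begin

interpretation Q: mate_square "pF (Cod SS z)" "pF (Dom SS z)" "pO z" "pA z" "rO z" "rA z" "pEt z" "pEp z"
    "bF (Cod SS z)" "bF (Dom SS z)" "pbo H (px z)" "pba H (px z)" "lowo H (px z)" "lowa H (px z)" "low_unit H (px z)" "low_counit H (px z)"
    "Fo (Cod SS z)" "Fa (Cod SS z)" "Fo (Dom SS z)" "Fa (Dom SS z)"
  by (rule Cl2_mate_square[OF z])

lemma comparison_iff: "Q.comparison \<alpha> \<longleftrightarrow> fam_iso z \<alpha>"
  by (simp add: Q.comparison_def fam_iso_def pairs.family_def is_nat_iso_def)

lemma low_comparison_iff: "Q.low_comparison \<beta> \<longleftrightarrow> low_fam z \<beta>"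
  by (simp add: Q.low_comparison_def low_fam_def)

lemma mate_iff: "Q.mate_at \<alpha> \<beta> A \<longleftrightarrow> mate z \<alpha> \<beta> A"
  by (simp add: Q.mate_at_def mate_def)

lemma mbarP_eq: "Q.mbar \<alpha> = mbarP z \<alpha>"
  by (simp add: Q.mbar_def[abs_def] mbarP_def[abs_def])

lemma minvP_eq: "Q.minv \<beta> = minvP z \<beta>"
  by (simp add: Q.minv_def[abs_def] minvP_def[abs_def])

lemmas bridge = comparison_iff low_comparison_iff mate_iff mbarP_eq minvP_eq

lemma rO_Ob: "A \<in> Ob (pF (Dom SS z)) \<Longrightarrow> rO z A \<in> Ob (pF (Cod SS z))"
  and pO_Ob: "A \<in> Ob (pF (Cod SS z)) \<Longrightarrow> pO z A \<in> Ob (pF (Dom SS z))"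
  by simp_all

lemma mbarP_low_fam: "fam_iso z \<alpha> \<Longrightarrow> low_fam z (mbarP z \<alpha>)"
  using Q.mbar_low_comparison by (simp add: bridge)

lemma mbarP_mate: "fam_iso z \<alpha> \<Longrightarrow> A \<in> Ob (pF (Dom SS z)) \<Longrightarrow> mate z \<alpha> (mbarP z \<alpha>) A"
  using Q.mbar_mate by (simp add: bridge)

lemma mate_unique:
  assumes "fam_iso z \<alpha>" "A \<in> Ob (pF (Dom SS z))" "mate z \<alpha> \<beta> A" "mate z \<alpha> \<beta>' A" "low_fam z \<beta>" "low_fam z \<beta>'"
  shows "\<beta> A = \<beta>' A"
  using Q.mate_unique[of \<alpha> A \<beta> \<beta>'] assms low_famD[OF assms(5,2) refl] low_famD[OF assms(6,2) refl] by (simp add: bridge)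

lemma mate_pull_Iso:
  assumes "fam_iso z \<alpha>" "A \<in> Ob (pF (Dom SS z))" "mate z \<alpha> \<beta> A" "low_fam z \<beta>"
  shows "pba H (px z) (\<beta> A) \<in> Iso (bF (Dom SS z))"
  using Q.mate_pull_Iso[of \<alpha> A \<beta>] assms low_famD[OF assms(4,2) refl] by (simp add: bridge)

lemma minvP_Iso:
  assumes "fam_iso z \<alpha>" "\<And>A. A \<in> Ob (pF (Dom SS z)) \<Longrightarrow> mate z \<alpha> \<beta> A" "low_fam z \<beta>" "A \<in> Ob (pF (Cod SS z))"
  shows "minvP z \<beta> A \<in> Iso (bF (Dom SS z))" "inv_ar (bF (Dom SS z)) (minvP z \<beta> A) = \<alpha> A"
  using Q.minv_eq[of \<alpha> A \<beta>] assms low_famD[OF assms(3) pO_Ob[OF assms(4)] refl] by (simp_all add: bridge)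

lemma minvP_mate:
  assumes "low_fam z \<beta>" "\<And>A. A \<in> Ob (pF (Cod SS z)) \<Longrightarrow> minvP z \<beta> A \<in> Iso (bF (Dom SS z))"
  shows "fam_iso z (\<lambda>A. inv_ar (bF (Dom SS z)) (minvP z \<beta> A))"
    and "A \<in> Ob (pF (Dom SS z)) \<Longrightarrow> mate z (\<lambda>A. inv_ar (bF (Dom SS z)) (minvP z \<beta> A)) \<beta> A"
  using Q.comparison_of_minv[of \<beta>] Q.minv_mate[of \<beta>] assms by (simp_all add: bridge)

lemma minvP_factor_Iso:
  assumes "low_fam z \<beta>" "A \<in> Ob (pF (Cod SS z))" "\<And>A. A \<in> Ob (pF (Dom SS z)) \<Longrightarrow> \<beta> A \<in> Iso (bF (Cod SS z))"
    and "pba H (px z) (Fa (Cod SS z) (pEt z A)) \<in> Iso (bF (Dom SS z))"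
  shows "minvP z \<beta> A \<in> Iso (bF (Dom SS z))"
  using assms low_famD[OF assms(1) pO_Ob[OF assms(2)] refl] by (simp add: minvP_def)

end

text \<open>For a composite of pairs of closed immersions whose comparisons satisfy the composition law, the mate
  condition for the composite amounts to the composition law on the side of the right adjoints.\<close>

lemma mate_composition_iff:
  assumes z: "z \<in> Cl2" and w: "w \<in> Cl2" and d: "Cod SS z = Dom SS w" and A: "A \<in> Ob (pF (Dom SS z))"
    and \<alpha>: "fam_iso w \<alpha>w" "fam_iso z \<alpha>z" "fam_iso (w \<cdot>\<^bsub>SS\<^esub> z) \<alpha>v"
    and \<beta>: "low_fam w \<beta>w" "low_fam z \<beta>z"
    and \<beta>v: "\<beta>v A \<in> Ar (bF (Cod SS w))" "Dom (bF (Cod SS w)) (\<beta>v A) = Fo (Cod SS w) (rO (w \<cdot>\<^bsub>SS\<^esub> z) A)"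
      "Cod (bF (Cod SS w)) (\<beta>v A) = lowo H (px (w \<cdot>\<^bsub>SS\<^esub> z)) (Fo (Dom SS z) A)"
    and M: "mate w \<alpha>w \<beta>w (rO z A)" "mate z \<alpha>z \<beta>z A"
    and coc: "pairs.cocycle_at z w \<alpha>z \<alpha>w \<alpha>v (rO (w \<cdot>\<^bsub>SS\<^esub> z) A)"
  shows "mate (w \<cdot>\<^bsub>SS\<^esub> z) \<alpha>v \<beta>v A \<longleftrightarrow>
    low_conn S H (px w) (px z) (Fo (Dom SS z) A) \<cdot>\<^bsub>bF (Cod SS w)\<^esub> \<beta>v A =
    lowa H (px w) (\<beta>z A) \<cdot>\<^bsub>bF (Cod SS w)\<^esub> \<beta>w (rO z A) \<cdot>\<^bsub>bF (Cod SS w)\<^esub> Fa (Cod SS w) (lcP w z A)"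
proof -
  let ?v = "w \<cdot>\<^bsub>SS\<^esub> z"
  interpret X: category SS by (rule category_SS)
  have zA: "z \<in> Ar SS" "w \<in> Ar SS" using z w Cl2_Ar by auto
  have v: "?v \<in> Cl2" using z w d by (auto simp: Cl2_def SS_simps)
  have vd: "Dom SS ?v = Dom SS z" "Cod SS ?v = Cod SS w" using zA d by simp_all
  have pxv: "px ?v = px w \<cdot>\<^bsub>S\<^esub> px z" "Cod S (px z) = Dom S (px w)" using px_Cmp[OF zA d] px_composable[OF zA d] by simp_all
  note P = px[OF zA(1)] px[OF zA(2)]
  interpret mate_composition "pF (Cod SS w)" "pF (Dom SS w)" "pF (Dom SS z)" "bF (Cod SS w)" "bF (Dom SS w)" "bF (Dom SS z)"
    "Fo (Cod SS w)" "Fa (Cod SS w)" "Fo (Dom SS w)" "Fa (Dom SS w)" "Fo (Dom SS z)" "Fa (Dom SS z)"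
    "pO w" "pA w" "rO w" "rA w" "pEt w" "pEp w" "pbo H (px w)" "pba H (px w)" "lowo H (px w)" "lowa H (px w)" "low_unit H (px w)" "low_counit H (px w)"
    "pO z" "pA z" "rO z" "rA z" "pEt z" "pEp z" "pbo H (px z)" "pba H (px z)" "lowo H (px z)" "lowa H (px z)" "low_unit H (px z)" "low_counit H (px z)"
    "pO ?v" "pA ?v" "rO ?v" "rA ?v" "pEt ?v" "pEp ?v" "pbo H (px ?v)" "pba H (px ?v)" "lowo H (px ?v)" "lowa H (px ?v)" "low_unit H (px ?v)" "low_counit H (px ?v)"
    "pC z w" "conn H (px z) (px w)" "lcP w z" "low_conn S H (px w) (px z)"
  proof (intro mate_composition.intro mate_composition_axioms.intro)
    note Cl2_mate_square[OF v, unfolded vd]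
    then show "mate_square (pF (Cod SS w)) (pF (Dom SS z)) (pO ?v) (pA ?v) (rO ?v) (rA ?v) (pEt ?v) (pEp ?v) (bF (Cod SS w)) (bF (Dom SS z))
      (pbo H (px ?v)) (pba H (px ?v)) (lowo H (px ?v)) (lowa H (px ?v)) (low_unit H (px ?v)) (low_counit H (px ?v))
      (Fo (Cod SS w)) (Fa (Cod SS w)) (Fo (Dom SS z)) (Fa (Dom SS z))" .
    show "mate_square (pF (Cod SS w)) (pF (Dom SS w)) (pO w) (pA w) (rO w) (rA w) (pEt w) (pEp w) (bF (Cod SS w)) (bF (Dom SS w))
      (pbo H (px w)) (pba H (px w)) (lowo H (px w)) (lowa H (px w)) (low_unit H (px w)) (low_counit H (px w))
      (Fo (Cod SS w)) (Fa (Cod SS w)) (Fo (Dom SS w)) (Fa (Dom SS w))" by (rule Cl2_mate_square[OF w])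
    show "mate_square (pF (Dom SS w)) (pF (Dom SS z)) (pO z) (pA z) (rO z) (rA z) (pEt z) (pEp z) (bF (Dom SS w)) (bF (Dom SS z))
      (pbo H (px z)) (pba H (px z)) (lowo H (px z)) (lowa H (px z)) (low_unit H (px z)) (low_counit H (px z))
      (Fo (Dom SS w)) (Fa (Dom SS w)) (Fo (Dom SS z)) (Fa (Dom SS z))" using Cl2_mate_square[OF z] unfolding d .
    show "pC z w A \<in> Ar (pF (Dom SS z))" "Dom (pF (Dom SS z)) (pC z w A) = pO ?v A" "Cod (pF (Dom SS z)) (pC z w A) = pO z (pO w A)"
      if "A \<in> Ob (pF (Cod SS w))" for A
      using zA d that by simp_all
    show "is_nat_iso (bF (Cod SS w)) (bF (Dom SS z)) (pbo H (px ?v)) (pba H (px ?v)) (\<lambda>A. pbo H (px z) (pbo H (px w) A))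
        (\<lambda>\<phi>. pba H (px z) (pba H (px w) \<phi>)) (conn H (px z) (px w))"
      using conn_nat_iso[of "px z" "px w"] P pxv by (simp add: o_def)
    note L = low_conn[OF px_Cl[OF z] px_Cl[OF w] pxv(2), folded pxv(1), unfolded P]
    show "low_conn S H (px w) (px z) A' \<in> Ar (bF (Cod SS w))" "Dom (bF (Cod SS w)) (low_conn S H (px w) (px z) A') = lowo H (px ?v) A'"
      "Cod (bF (Cod SS w)) (low_conn S H (px w) (px z) A') = lowo H (px w) (lowo H (px z) A')"
      "low_counit H (px z) A' \<cdot>\<^bsub>bF (Dom SS z)\<^esub> pba H (px z) (low_counit H (px w) (lowo H (px z) A')) \<cdot>\<^bsub>bF (Dom SS z)\<^esub>
        pba H (px z) (pba H (px w) (low_conn S H (px w) (px z) A')) \<cdot>\<^bsub>bF (Dom SS z)\<^esub> conn H (px z) (px w) (lowo H (px ?v) A') = low_counit H (px ?v) A'"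
      if "A' \<in> Ob (bF (Dom SS z))" for A'
      using L(1-4)[OF that refl refl] unfolding P by blast+
    have zw: "fst z \<in> Cl S" "snd z \<in> Cl S" "fst w \<in> Cl S" "snd w \<in> Cl S" "Cod S (fst z) = Dom S (fst w)" "Cod S (snd z) = Dom S (snd w)"
      using z w d by (auto simp: Cl2_def SS_simps)
    show "lcP w z A \<in> Ar (pF (Cod SS w))" "Dom (pF (Cod SS w)) (lcP w z A) = rO ?v A" "Cod (pF (Cod SS w)) (lcP w z A) = rO w (rO z A)"
      "pEp z A \<cdot>\<^bsub>pF (Dom SS z)\<^esub> pA z (pEp w (rO z A)) \<cdot>\<^bsub>pF (Dom SS z)\<^esub> pA z (pA w (lcP w z A)) \<cdot>\<^bsub>pF (Dom SS z)\<^esub> pC z w (rO ?v A) = pEp ?v A"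
      if "A \<in> Ob (pF (Dom SS z))" for A
      using that zw low_conn[of "fst z" "fst w" "fst A"] low_conn[of "snd z" "snd w" "snd A"]
      by (simp_all add: pF_simps SS_simps p_defs lcP_def prod_eq_iff)
  qed
  have rz: "rO z A \<in> Ob (pF (Dom SS w))" using rO_Ob[OF z A] d by simp
  show ?thesis
    using mate_composition[of \<alpha>w \<alpha>z \<alpha>v A \<beta>w \<beta>z \<beta>v] A \<alpha> M coc \<beta>v
      low_famD[OF \<beta>(1) rz refl] low_famD[OF \<beta>(2) A refl]
      comparison_iff[OF w, of \<alpha>w] comparison_iff[OF z, of \<alpha>z] comparison_iff[OF v, of \<alpha>v]
      mate_iff[OF w, of \<alpha>w \<beta>w "rO z A"] mate_iff[OF z, of \<alpha>z \<beta>z A] mate_iff[OF v, of \<alpha>v \<beta>v A]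
    unfolding vd pairs.cocycle_at_def d by blast
qed

lemma low_conn_isos:
  assumes z: "z \<in> Cl2" and w: "w \<in> Cl2" and d: "Cod SS z = Dom SS w" and A: "A \<in> Ob (pF (Dom SS z))"
  shows "low_conn S H (px w) (px z) (Fo (Dom SS z) A) \<in> Iso (bF (Cod SS w))" "lcP w z A \<in> Iso (pF (Cod SS w))"
    "Dom (bF (Cod SS w)) (low_conn S H (px w) (px z) (Fo (Dom SS z) A)) = lowo H (px (w \<cdot>\<^bsub>SS\<^esub> z)) (Fo (Dom SS z) A)"
    "Cod (bF (Cod SS w)) (low_conn S H (px w) (px z) (Fo (Dom SS z) A)) = lowo H (px w) (lowo H (px z) (Fo (Dom SS z) A))"
    "Dom (pF (Cod SS w)) (lcP w z A) = rO (w \<cdot>\<^bsub>SS\<^esub> z) A" "Cod (pF (Cod SS w)) (lcP w z A) = rO w (rO z A)"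
proof -
  interpret X: category SS by (rule category_SS)
  have zA: "z \<in> Ar SS" "w \<in> Ar SS" using z w Cl2_Ar by auto
  have pxv: "px (w \<cdot>\<^bsub>SS\<^esub> z) = px w \<cdot>\<^bsub>S\<^esub> px z" "Cod S (px z) = Dom S (px w)" using px_Cmp[OF zA d] px_composable[OF zA d] by simp_all
  note P = px[OF zA(1)] px[OF zA(2)]
  have F: "Fo (Dom SS z) A \<in> Ob (Fib H (Dom S (px z)))" unfolding P using A zA by simp
  note L = low_conn[OF px_Cl[OF z] px_Cl[OF w] pxv(2) F refl refl, folded pxv(1), unfolded P]
  show "low_conn S H (px w) (px z) (Fo (Dom SS z) A) \<in> Iso (bF (Cod SS w))"
    "Dom (bF (Cod SS w)) (low_conn S H (px w) (px z) (Fo (Dom SS z) A)) = lowo H (px (w \<cdot>\<^bsub>SS\<^esub> z)) (Fo (Dom SS z) A)"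
    "Cod (bF (Cod SS w)) (low_conn S H (px w) (px z) (Fo (Dom SS z) A)) = lowo H (px w) (lowo H (px z) (Fo (Dom SS z) A))"
    using L by blast+
  have zw: "fst z \<in> Cl S" "snd z \<in> Cl S" "fst w \<in> Cl S" "snd w \<in> Cl S" "Cod S (fst z) = Dom S (fst w)" "Cod S (snd z) = Dom S (snd w)"
    using z w d by (auto simp: Cl2_def SS_simps)
  show "lcP w z A \<in> Iso (pF (Cod SS w))" "Dom (pF (Cod SS w)) (lcP w z A) = rO (w \<cdot>\<^bsub>SS\<^esub> z) A" "Cod (pF (Cod SS w)) (lcP w z A) = rO w (rO z A)"
    using A zw low_conn[of "fst z" "fst w" "fst A"] low_conn[of "snd z" "snd w" "snd A"]
    by (simp_all add: pF_def Iso_prod_cat prod_cat_simps SS_simps p_defs lcP_def prod_eq_iff mem_Times_iff)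
qed

definition cbP :: "'m \<times> 'm \<Rightarrow> 'm \<times> 'm \<Rightarrow> 'm \<times> 'm \<Rightarrow> 'm \<times> 'm \<Rightarrow> 'a \<times> 'a \<Rightarrow> 'b \<times> 'b" where
  "cbP z' p' p z = map_prod (closed_bc S H (fst z') (fst p') (fst p) (fst z)) (closed_bc S H (snd z') (snd p') (snd p) (snd z))"

definition exP :: "'m \<times> 'm \<Rightarrow> 'm \<times> 'm \<Rightarrow> 'm \<times> 'm \<Rightarrow> 'm \<times> 'm \<Rightarrow> 'a \<times> 'a \<Rightarrow> 'b \<times> 'b" where
  "exP z' p' p z = map_prod (exch S H (fst z') (fst p') (fst p) (fst z)) (exch S H (snd z') (snd p') (snd p) (snd z))"

definition low_square where
  "low_square z' p' p z \<sigma> \<sigma>' \<beta> \<beta>' A \<longleftrightarrow>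
    closed_bc S H (px z') (px p') (px p) (px z) (Fo (Dom SS z) A) \<cdot>\<^bsub>bF (Dom SS p)\<^esub> pba H (px p) (\<beta> A) \<cdot>\<^bsub>bF (Dom SS p)\<^esub> \<sigma> (rO z A) =
    lowa H (px z') (\<sigma>' A) \<cdot>\<^bsub>bF (Dom SS p)\<^esub> \<beta>' (pO p' A) \<cdot>\<^bsub>bF (Dom SS p)\<^esub> Fa (Dom SS p) (cbP z' p' p z A)"

context
  fixes z z' p p' \<alpha> \<alpha>' \<sigma> \<sigma>' \<beta> \<beta>'
  assumes z: "z \<in> Cl2" "z' \<in> Cl2" and p: "p \<in> Ar SS" "p' \<in> Ar SS"
    and d: "Dom SS p' = Dom SS z'" "Cod SS z' = Dom SS p" "Cod SS p' = Dom SS z" and sq: "p \<cdot>\<^bsub>SS\<^esub> z' = z \<cdot>\<^bsub>SS\<^esub> p'"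
    and \<alpha>: "fam_iso z \<alpha>" "fam_iso z' \<alpha>'" and \<sigma>: "pairs.family p \<sigma>" "pairs.family p' \<sigma>'"
    and \<beta>: "low_fam z \<beta>" "low_fam z' \<beta>'"
    and M: "\<And>A. A \<in> Ob (pF (Dom SS z)) \<Longrightarrow> mate z \<alpha> \<beta> A" "\<And>A. A \<in> Ob (pF (Dom SS z')) \<Longrightarrow> mate z' \<alpha>' \<beta>' A"
begin

text \<open>The case of \<^locale>\<open>mate_exchange\<close> in which the functors \<open>P\<close> are the pull-backs along \<open>p\<close> and \<open>p'\<close>; the
  exchange law is then the equality of the two composite families over \<open>p z' = z p'\<close>.\<close>

lemma base_change_iff:
  shows "A \<in> Ob (pF (Dom SS z)) \<Longrightarrow> low_square z' p' p z \<sigma> \<sigma>' \<beta> \<beta>' A \<longleftrightarrow> pairs.star z' p \<alpha>' \<sigma> (rO z A) = pairs.star p' z \<sigma>' \<alpha> (rO z A)"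
    and "A' \<in> Ob (pF (Cod SS z)) \<Longrightarrow> low_square z' p' p z \<sigma> \<sigma>' \<beta> \<beta>' (pO z A') \<Longrightarrow> pairs.star z' p \<alpha>' \<sigma> A' = pairs.star p' z \<sigma>' \<alpha> A'"
proof -
  interpret X: category SS by (rule category_SS)
  have zA: "z \<in> Ar SS" "z' \<in> Ar SS" using z Cl2_Ar by auto
  have cc: "Cod SS p = Cod SS z" using arg_cong[OF sq, of "Cod SS"] zA p d by simp
  note P = px[OF zA(1)] px[OF zA(2)] px[OF p(1)] px[OF p(2)]
  have c: "Dom S (px p') = Dom S (px z')" "Cod S (px z') = Dom S (px p)" "Cod S (px p') = Dom S (px z)"
    using d px_composable zA p by (simp_all add: px_def SS_simps)
  have sqx: "px p \<cdot>\<^bsub>S\<^esub> px z' = px z \<cdot>\<^bsub>S\<^esub> px p'"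
    using px_Cmp[of z' p] px_Cmp[of p' z] zA p d sq by simp
  have comp: "fst z \<in> Cl S" "snd z \<in> Cl S" "fst z' \<in> Cl S" "snd z' \<in> Cl S" "fst p \<in> Ar S" "snd p \<in> Ar S" "fst p' \<in> Ar S" "snd p' \<in> Ar S"
    "Dom S (fst p') = Dom S (fst z')" "Dom S (snd p') = Dom S (snd z')" "Cod S (fst z') = Dom S (fst p)" "Cod S (snd z') = Dom S (snd p)"
    "Cod S (fst p') = Dom S (fst z)" "Cod S (snd p') = Dom S (snd z)"
    "fst p \<cdot>\<^bsub>S\<^esub> fst z' = fst z \<cdot>\<^bsub>S\<^esub> fst p'" "snd p \<cdot>\<^bsub>S\<^esub> snd z' = snd z \<cdot>\<^bsub>S\<^esub> snd p'"
    using z p d sq by (auto simp: Cl2_def SS_simps)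
  let ?eB = "exch S H (px z') (px p') (px p) (px z)" and ?eA = "exP z' p' p z"
  have eA: "is_nat (pF (Cod SS z)) (pF (Dom SS z')) (\<lambda>A. pO z' (pO p A)) (\<lambda>\<phi>. pA z' (pA p \<phi>)) (\<lambda>A. pO p' (pO z A)) (\<lambda>\<phi>. pA p' (pA z \<phi>)) ?eA"
  proof -
    have "is_nat (Fib H (Cod S (fst z))) (Fib H (Dom S (fst z'))) (\<lambda>A. pbo H (fst z') (pbo H (fst p) A)) (\<lambda>\<phi>. pba H (fst z') (pba H (fst p) \<phi>))
        (\<lambda>A. pbo H (fst p') (pbo H (fst z) A)) (\<lambda>\<phi>. pba H (fst p') (pba H (fst z) \<phi>)) (exch S H (fst z') (fst p') (fst p) (fst z))"
      "is_nat (Fib H (Cod S (snd z))) (Fib H (Dom S (snd z'))) (\<lambda>A. pbo H (snd z') (pbo H (snd p) A)) (\<lambda>\<phi>. pba H (snd z') (pba H (snd p) \<phi>))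
        (\<lambda>A. pbo H (snd p') (pbo H (snd z) A)) (\<lambda>\<phi>. pba H (snd p') (pba H (snd z) \<phi>)) (exch S H (snd z') (snd p') (snd p) (snd z))"
      using comp by (intro exch_nat; simp)+
    from nat_prod[OF this] show ?thesis
      by (simp add: pF_def SS_simps p_defs exP_def map_prod_def case_prod_beta')
  qed
  have eB: "is_nat (bF (Cod SS z)) (bF (Dom SS z')) (\<lambda>A. pbo H (px z') (pbo H (px p) A)) (\<lambda>\<phi>. pba H (px z') (pba H (px p) \<phi>))
      (\<lambda>A. pbo H (px p') (pbo H (px z) A)) (\<lambda>\<phi>. pba H (px p') (pba H (px z) \<phi>)) ?eB"
    using exch_nat[OF P(4,10,7,1) c sqx] unfolding P .
  note cbB = closed_bc[OF px_Cl[OF z(1)] px_Cl[OF z(2)] P(7,10) c sqx, unfolded P, OF _ refl refl, unfolded P]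
  interpret E: mate_exchange "pF (Cod SS z)" "pF (Dom SS z)" "pF (Dom SS p)" "pF (Dom SS z')" "bF (Cod SS z)" "bF (Dom SS z)" "bF (Dom SS p)" "bF (Dom SS z')"
    "Fo (Cod SS z)" "Fa (Cod SS z)" "Fo (Dom SS z)" "Fa (Dom SS z)" "Fo (Dom SS p)" "Fa (Dom SS p)" "Fo (Dom SS z')" "Fa (Dom SS z')"
    "pO z" "pA z" "rO z" "rA z" "pEt z" "pEp z" "pbo H (px z)" "pba H (px z)" "lowo H (px z)" "lowa H (px z)" "low_unit H (px z)" "low_counit H (px z)"
    "pO z'" "pA z'" "rO z'" "rA z'" "pEt z'" "pEp z'" "pbo H (px z')" "pba H (px z')" "lowo H (px z')" "lowa H (px z')" "low_unit H (px z')" "low_counit H (px z')"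
    "pO p" "pA p" "pO p'" "pA p'" "pbo H (px p)" "pba H (px p)" "pbo H (px p')" "pba H (px p')"
    ?eA ?eB \<sigma> \<sigma>' "cbP z' p' p z" "closed_bc S H (px z') (px p') (px p) (px z)"
  proof (intro mate_exchange.intro mate_exchange_axioms.intro)
    show "mate_square (pF (Dom SS p)) (pF (Dom SS z')) (pO z') (pA z') (rO z') (rA z') (pEt z') (pEp z') (bF (Dom SS p)) (bF (Dom SS z'))
        (pbo H (px z')) (pba H (px z')) (lowo H (px z')) (lowa H (px z')) (low_unit H (px z')) (low_counit H (px z'))
        (Fo (Dom SS p)) (Fa (Dom SS p)) (Fo (Dom SS z')) (Fa (Dom SS z'))"
      using Cl2_mate_square[OF z(2)] unfolding d .
    show "functor_on (pF (Cod SS z)) (pF (Dom SS p)) (pO p) (pA p)" "functor_on (pF (Dom SS z)) (pF (Dom SS z')) (pO p') (pA p')"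
      "functor_on (bF (Cod SS z)) (bF (Dom SS p)) (pbo H (px p)) (pba H (px p))" "functor_on (bF (Dom SS z)) (bF (Dom SS z')) (pbo H (px p')) (pba H (px p'))"
      using pairs.A.pull[OF p(1)] pairs.A.pull[OF p(2)] pairs.B.pull[OF p(1)] pairs.B.pull[OF p(2)] unfolding d cc by blast+
    show "is_nat (pF (Cod SS z)) (bF (Dom SS p)) (\<lambda>A. Fo (Dom SS p) (pO p A)) (\<lambda>\<phi>. Fa (Dom SS p) (pA p \<phi>))
        (\<lambda>A. pbo H (px p) (Fo (Cod SS z) A)) (\<lambda>\<phi>. pba H (px p) (Fa (Cod SS z) \<phi>)) \<sigma>"
      using \<sigma>(1) unfolding pairs.family_def cc .
    show "is_nat (pF (Dom SS z)) (bF (Dom SS z')) (\<lambda>A. Fo (Dom SS z') (pO p' A)) (\<lambda>\<phi>. Fa (Dom SS z') (pA p' \<phi>))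
        (\<lambda>A. pbo H (px p') (Fo (Dom SS z) A)) (\<lambda>\<phi>. pba H (px p') (Fa (Dom SS z) \<phi>)) \<sigma>'"
      using \<sigma>(2) unfolding pairs.family_def d .
    show "cbP z' p' p z A \<in> Ar (pF (Dom SS p))" "Dom (pF (Dom SS p)) (cbP z' p' p z A) = pO p (rO z A)" "Cod (pF (Dom SS p)) (cbP z' p' p z A) = rO z' (pO p' A)"
      "pEp z' (pO p' A) \<cdot>\<^bsub>pF (Dom SS z')\<^esub> pA z' (cbP z' p' p z A) = pA p' (pEp z A) \<cdot>\<^bsub>pF (Dom SS z')\<^esub> ?eA (rO z A)"
      if "A \<in> Ob (pF (Dom SS z))" for A
      using that comp closed_bc[of "fst z" "fst z'" "fst p" "fst p'" "fst A"] closed_bc[of "snd z" "snd z'" "snd p" "snd p'" "snd A"]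
      by (simp_all add: pF_simps SS_simps p_defs cbP_def exP_def prod_eq_iff)
    show "closed_bc S H (px z') (px p') (px p) (px z) A' \<in> Ar (bF (Dom SS p))"
      "Dom (bF (Dom SS p)) (closed_bc S H (px z') (px p') (px p) (px z) A') = pbo H (px p) (lowo H (px z) A')"
      "Cod (bF (Dom SS p)) (closed_bc S H (px z') (px p') (px p) (px z) A') = lowo H (px z') (pbo H (px p') A')"
      "low_counit H (px z') (pbo H (px p') A') \<cdot>\<^bsub>bF (Dom SS z')\<^esub> pba H (px z') (closed_bc S H (px z') (px p') (px p) (px z) A') =
        pba H (px p') (low_counit H (px z) A') \<cdot>\<^bsub>bF (Dom SS z')\<^esub> ?eB (lowo H (px z) A')"
      if "A' \<in> Ob (bF (Dom SS z))" for A'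
      using cbB[OF that] by blast+
  qed (fact Cl2_mate_square[OF z(1)] eA eB)+
  have ls: "low_square z' p' p z \<sigma> \<sigma>' \<beta> \<beta>' A \<longleftrightarrow> E.low_exchange_at \<beta> \<beta>' A" for A
    by (simp add: low_square_def E.low_exchange_at_def)
  have st: "pairs.star z' p \<alpha>' \<sigma> A = pairs.star p' z \<sigma>' \<alpha> A \<longleftrightarrow> E.exchange_at \<alpha> \<alpha>' A" if A: "A \<in> Ob (pF (Cod SS z))" for A
  proof -
    have eAc: "?eA A \<cdot>\<^bsub>pF (Dom SS z')\<^esub> pC z' p A = pC p' z A"
      using A comp exch_conn[of "fst z'" "fst p'" "fst p" "fst z" "fst A"] exch_conn[of "snd z'" "snd p'" "snd p" "snd z" "snd A"]
      by (simp add: pF_simps SS_simps p_defs exP_def prod_eq_iff)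
    have F: "Fo (Cod SS z) A \<in> Ob (bF (Cod SS z))" using A zA by simp
    then have "Fo (Cod SS z) A \<in> Ob (Fib H (Cod S (px z)))" unfolding P .
    then have eBc: "?eB (Fo (Cod SS z) A) \<cdot>\<^bsub>bF (Dom SS z')\<^esub> conn H (px z') (px p) (Fo (Cod SS z) A) = conn H (px p') (px z) (Fo (Cod SS z) A)"
      using exch_conn[OF P(4,10,7,1) c sqx] unfolding P by blast
    have "A \<in> Ob (pF (Cod SS p))" using A cc by simp
    then show ?thesis
      using pairs.star_eq_iff[OF fam_isoD(1)[OF \<alpha>(2)] \<sigma>(1) zA(2) p(1) d(2) \<sigma>(2) fam_isoD(1)[OF \<alpha>(1)] p(2) zA(1) d(3) sq, of A "?eA A" "?eB (Fo (Cod SS z) A)"]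
        is_natD(1-2)[OF eA A] is_natD(1-2)[OF eB F] eAc eBc
      unfolding E.exchange_at_def cc by blast
  qed
  have b: "E.M.comparison \<alpha>" "E.N.comparison \<alpha>'"
    using comparison_iff[OF z(1)] comparison_iff[OF z(2)] \<alpha> unfolding d by blast+
  have mates: "E.M.mate_at \<alpha> \<beta> A" "E.N.mate_at \<alpha>' \<beta>' (pO p' A)" if "A \<in> Ob (pF (Dom SS z))" for A
    using M(1)[OF that] M(2)[of "pO p' A"] that p d mate_iff[OF z(1)] mate_iff[OF z(2)] unfolding d by simp_all
  have pp: "pO p' A \<in> Ob (pF (Dom SS z'))" if "A \<in> Ob (pF (Dom SS z))" for A using that p d by simp
  have main: "low_square z' p' p z \<sigma> \<sigma>' \<beta> \<beta>' A \<longleftrightarrow> E.exchange_at \<alpha> \<alpha>' (rO z A)" if A: "A \<in> Ob (pF (Dom SS z))" for A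
    unfolding ls
    by (rule E.low_exchange_iff[OF b A low_famD[OF \<beta>(1) A refl] low_famD[OF \<beta>(2) pp[OF A] d(2)[symmetric]] mates[OF A]])
  show "A \<in> Ob (pF (Dom SS z)) \<Longrightarrow> low_square z' p' p z \<sigma> \<sigma>' \<beta> \<beta>' A \<longleftrightarrow> pairs.star z' p \<alpha>' \<sigma> (rO z A) = pairs.star p' z \<sigma>' \<alpha> (rO z A)"
    using main st rO_Ob[OF z(1)] by blast
  show "A' \<in> Ob (pF (Cod SS z)) \<Longrightarrow> low_square z' p' p z \<sigma> \<sigma>' \<beta> \<beta>' (pO z A') \<Longrightarrow> pairs.star z' p \<alpha>' \<sigma> A' = pairs.star p' z \<sigma>' \<alpha> A'"
    using main[OF pO_Ob[OF z(1)]] st E.exchange_of_low[OF b] by blast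
qed

end

end

section \<open>Shifts over pairs\<close>

context localic_over_base
begin

text \<open>The shift for \<open>c = True\<close>, the identity for \<open>c = False\<close>. Compatibility with the shift of either variable
  is then one statement about the functor \<open>hO c \<times> hO (\<not> c)\<close> on pairs.\<close>

definition hO where "hO c s = (if c then Sh (Fib H s) else id)"
definition hA where "hA c s = (if c then Sha (Fib H s) else id)"
definition hs where "hs c f A = (if c then pbsh H f A else Idn (Fib H (Dom S f)) (pbo H f A))"
definition hl where "hl c z A = (if c then low_shift S H z A else Idn (Fib H (Cod S z)) (lowo H z A))"

lemma h_functor: assumes "s \<in> Ob S" shows "functor_on (Fib H s) (Fib H s) (hO c s) (hA c s)"
  using triangulated_category.shift_functor[OF fibre_triangulated[OF assms]]
    category.identity_functor[OF fibre_category[OF assms]] by (simp add: hO_def hA_def)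

lemma pbsh_nat:
  assumes "f \<in> Ar S"
  shows "is_nat (Fib H (Cod S f)) (Fib H (Dom S f)) (\<lambda>A. pbo H f (Sh (Fib H (Cod S f)) A)) (\<lambda>\<phi>. pba H f (Sha (Fib H (Cod S f)) \<phi>))
    (\<lambda>A. Sh (Fib H (Dom S f)) (pbo H f A)) (\<lambda>\<phi>. Sha (Fib H (Dom S f)) (pba H f \<phi>)) (pbsh H f)"
  using pb_triangulated[OF assms] by (simp add: triangulated_functor_def is_nat_iso_def o_def)

lemma hs_nat:
  assumes f: "f \<in> Ar S"
  shows "is_nat (Fib H (Cod S f)) (Fib H (Dom S f)) (\<lambda>A. pbo H f (hO c (Cod S f) A)) (\<lambda>\<phi>. pba H f (hA c (Cod S f) \<phi>))
    (\<lambda>A. hO c (Dom S f) (pbo H f A)) (\<lambda>\<phi>. hA c (Dom S f) (pba H f \<phi>)) (hs c f)"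
  using pbsh_nat[OF f] f by (cases c) (auto simp: hO_def hA_def hs_def[abs_def] is_nat_def Hom_def)

lemma hs_conn:
  assumes "f \<in> Ar S" "g \<in> Ar S" "Cod S f = Dom S g" "A \<in> Ob (Fib H (Cod S g))"
  shows "hs c f (pbo H g A) \<cdot>\<^bsub>Fib H (Dom S f)\<^esub> pba H f (hs c g A) \<cdot>\<^bsub>Fib H (Dom S f)\<^esub> conn H f g (hO c (Cod S g) A) =
    hA c (Dom S f) (conn H f g A) \<cdot>\<^bsub>Fib H (Dom S f)\<^esub> hs c (g \<cdot>\<^bsub>S\<^esub> f) A"
proof -
  interpret F: functor_on "Fib H (Dom S g)" "Fib H (Dom S f)" "pbo H f" "pba H f" by (rule pull) (use assms in simp_all)
  show ?thesis using conn_shift[OF assms] assms by (cases c) (simp_all add: hO_def hA_def hs_def)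
qed

lemma hl:
  assumes z: "z \<in> Cl S" and A: "A \<in> Ob (Fib H (Dom S z))"
  shows "hl c z A \<in> Ar (Fib H (Cod S z))" "Dom (Fib H (Cod S z)) (hl c z A) = hO c (Cod S z) (lowo H z A)"
    "Cod (Fib H (Cod S z)) (hl c z A) = lowo H z (hO c (Dom S z) A)"
    "low_counit H z (hO c (Dom S z) A) \<cdot>\<^bsub>Fib H (Dom S z)\<^esub> pba H z (hl c z A) =
      hA c (Dom S z) (low_counit H z A) \<cdot>\<^bsub>Fib H (Dom S z)\<^esub> hs c z (lowo H z A)"
proof -
  interpret Z: adj "Fib H (Cod S z)" "Fib H (Dom S z)" "pbo H z" "pba H z" "lowo H z" "lowa H z" "low_unit H z" "low_counit H z"
    by (rule low[OF z refl refl])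
  show "hl c z A \<in> Ar (Fib H (Cod S z))" "Dom (Fib H (Cod S z)) (hl c z A) = hO c (Cod S z) (lowo H z A)"
    "Cod (Fib H (Cod S z)) (hl c z A) = lowo H z (hO c (Dom S z) A)"
    "low_counit H z (hO c (Dom S z) A) \<cdot>\<^bsub>Fib H (Dom S z)\<^esub> pba H z (hl c z A) =
      hA c (Dom S z) (low_counit H z A) \<cdot>\<^bsub>Fib H (Dom S z)\<^esub> hs c z (lowo H z A)"
    using low_shift[OF z A refl refl] z A by (cases c; simp add: hl_def hO_def hA_def hs_def)+
qed

end

context box_over
begin

text \<open>The shift in the first variable for \<open>l = True\<close>, in the second for \<open>l = False\<close>.\<close>

definition shO where "shO l s = map_prod (hO l (fst s)) (hO (\<not> l) (snd s))"
definition shA where "shA l s = map_prod (hA l (fst s)) (hA (\<not> l) (snd s))"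
definition shs where "shs l f = map_prod (hs l (fst f)) (hs (\<not> l) (snd f))"
definition shl where "shl l z = map_prod (hl l (fst z)) (hl (\<not> l) (snd z))"
definition bxs where "bxs l s A = (if l then bxl else bxr) B (fst s) (snd s) (fst A) (snd A)"

lemmas sh_defs = shO_def shA_def shs_def shl_def

lemma bxs_nat:
  assumes s: "s \<in> Ob SS"
  shows "is_nat (pF s) (bF s) (\<lambda>A. Fo s (shO l s A)) (\<lambda>\<phi>. Fa s (shA l s \<phi>)) (\<lambda>A. Sh (bF s) (Fo s A)) (\<lambda>\<phi>. Sha (bF s) (Fa s \<phi>)) (bxs l s)"
  using box_triangulated s
  by (cases l) (simp_all add: box_triangulated_def Let_def SS_simps pF_def bF_def Fo_def Fa_def sh_defs bxs_def[abs_def]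
      hO_def hA_def is_nat_iso_def case_prod_beta')

lemma shs_nat:
  assumes f: "f \<in> Ar SS"
  shows "is_nat (pF (Cod SS f)) (pF (Dom SS f)) (\<lambda>A. pO f (shO l (Cod SS f) A)) (\<lambda>\<phi>. pA f (shA l (Cod SS f) \<phi>))
    (\<lambda>A. shO l (Dom SS f) (pO f A)) (\<lambda>\<phi>. shA l (Dom SS f) (pA f \<phi>)) (shs l f)"
  using nat_prod[OF hs_nat[of "fst f" l] hs_nat[of "snd f" "\<not> l"]] f
  by (simp add: pF_def SS_simps p_defs sh_defs map_prod_def case_prod_beta')

lemma bshift_nat:
  assumes f: "f \<in> Ar SS"
  shows "is_nat (bF (Cod SS f)) (bF (Dom SS f)) (\<lambda>A. pbo H (px f) (Sh (bF (Cod SS f)) A)) (\<lambda>\<phi>. pba H (px f) (Sha (bF (Cod SS f)) \<phi>))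
    (\<lambda>A. Sh (bF (Dom SS f)) (pbo H (px f) A)) (\<lambda>\<phi>. Sha (bF (Dom SS f)) (pba H (px f) \<phi>)) (pbsh H (px f))"
  using pbsh_nat[OF px(1)[OF f]] unfolding px[OF f] .

lemma shO_functor: "s \<in> Ob SS \<Longrightarrow> functor_on (pF s) (pF s) (shO l s) (shA l s)"
  unfolding pF_def sh_defs by (intro functor_prod h_functor) (simp_all add: SS_simps)

lemma Sh_functor: "s \<in> Ob SS \<Longrightarrow> functor_on (bF s) (bF s) (Sh (bF s)) (Sha (bF s))"
  unfolding bF_def by (intro triangulated_category.shift_functor fibre_triangulated) (simp add: SS_simps)

lemma shifted_pairs:
  "shifted_fibration_map SS pF pO pA pC bF (\<lambda>f. pbo H (px f)) (\<lambda>f. pba H (px f)) (\<lambda>f g. conn H (px f) (px g)) Fo Fa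
    (shO l) (shA l) (\<lambda>s. Sh (bF s)) (\<lambda>s. Sha (bF s)) (shs l) (\<lambda>f. pbsh H (px f)) (bxs l)"
proof (intro shifted_fibration_map.intro shifted_fibration_map_axioms.intro pairs.fibration_map_axioms)
  interpret X: category SS by (rule category_SS)
  show "is_functor (pF s) (pF s) (shO l s) (shA l s)" "is_functor (bF s) (bF s) (Sh (bF s)) (Sha (bF s))" if "s \<in> Ob SS" for s
    using shO_functor[OF that] Sh_functor[OF that] by (simp_all add: functor_on.is_functor)
  show "shs l f A \<in> Hom (pF (Dom SS f)) (pO f (shO l (Cod SS f) A)) (shO l (Dom SS f) (pO f A))"
    if "f \<in> Ar SS" "A \<in> Ob (pF (Cod SS f))" for f A
    using shs_nat[OF that(1)] that(2) by (simp add: is_nat_def)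
  show "shs l f (pO g A) \<cdot>\<^bsub>pF (Dom SS f)\<^esub> pA f (shs l g A) \<cdot>\<^bsub>pF (Dom SS f)\<^esub> pC f g (shO l (Cod SS g) A) =
      shA l (Dom SS f) (pC f g A) \<cdot>\<^bsub>pF (Dom SS f)\<^esub> shs l (g \<cdot>\<^bsub>SS\<^esub> f) A"
    if "f \<in> Ar SS" "g \<in> Ar SS" "Cod SS f = Dom SS g" "A \<in> Ob (pF (Cod SS g))" for f g A
    using that hs_conn by (simp add: SS_simps pF_simps p_defs sh_defs prod_eq_iff)
  show "pbsh H (px f) (pbo H (px g) A') \<cdot>\<^bsub>bF (Dom SS f)\<^esub> pba H (px f) (pbsh H (px g) A') \<cdot>\<^bsub>bF (Dom SS f)\<^esub>
        conn H (px f) (px g) (Sh (bF (Cod SS g)) A') =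
      Sha (bF (Dom SS f)) (conn H (px f) (px g) A') \<cdot>\<^bsub>bF (Dom SS f)\<^esub> pbsh H (px (g \<cdot>\<^bsub>SS\<^esub> f)) A'"
    if "f \<in> Ar SS" "g \<in> Ar SS" "Cod SS f = Dom SS g" "A' \<in> Ob (bF (Cod SS g))" for f g A'
    using conn_shift[of "px f" "px g" A'] that by (simp add: px px_Cmp px_composable)
qed (use bshift_nat bxs_nat in auto)

definition shc where
  "shc l f \<alpha> A \<longleftrightarrow> pbsh H (px f) (Fo (Cod SS f) A) \<cdot>\<^bsub>bF (Dom SS f)\<^esub> pba H (px f) (bxs l (Cod SS f) A) \<cdot>\<^bsub>bF (Dom SS f)\<^esub> \<alpha> (shO l (Cod SS f) A) =
     Sha (bF (Dom SS f)) (\<alpha> A) \<cdot>\<^bsub>bF (Dom SS f)\<^esub> bxs l (Dom SS f) (pO f A) \<cdot>\<^bsub>bF (Dom SS f)\<^esub> Fa (Dom SS f) (shs l f A)"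

definition low_shc where
  "low_shc l z \<beta> A \<longleftrightarrow> lowa H (px z) (bxs l (Dom SS z) A) \<cdot>\<^bsub>bF (Cod SS z)\<^esub> \<beta> (shO l (Dom SS z) A) \<cdot>\<^bsub>bF (Cod SS z)\<^esub> Fa (Cod SS z) (shl l z A) =
     low_shift S H (px z) (Fo (Dom SS z) A) \<cdot>\<^bsub>bF (Cod SS z)\<^esub> Sha (bF (Cod SS z)) (\<beta> A) \<cdot>\<^bsub>bF (Cod SS z)\<^esub> bxs l (Cod SS z) (rO z A)"

lemma star_shc:
  assumes "pairs.family f \<alpha>" "pairs.family g \<beta>" "f \<in> Ar SS" "g \<in> Ar SS" "Cod SS f = Dom SS g"
    and "\<And>A. A \<in> Ob (pF (Cod SS f)) \<Longrightarrow> shc l f \<alpha> A" "\<And>A. A \<in> Ob (pF (Cod SS g)) \<Longrightarrow> shc l g \<beta> A"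
    and "A \<in> Ob (pF (Cod SS (g \<cdot>\<^bsub>SS\<^esub> f)))"
  shows "shc l (g \<cdot>\<^bsub>SS\<^esub> f) (pairs.star f g \<alpha> \<beta>) A"
proof -
  interpret shifted_fibration_map SS pF pO pA pC bF "\<lambda>f. pbo H (px f)" "\<lambda>f. pba H (px f)" "\<lambda>f g. conn H (px f) (px g)" Fo Fa
    "shO l" "shA l" "\<lambda>s. Sh (bF s)" "\<lambda>s. Sha (bF s)" "shs l" "\<lambda>f. pbsh H (px f)" "bxs l"
    by (rule shifted_pairs)
  show ?thesis
    using star_shift_compatible[OF assms(1-5)] assms(6-8) by (simp add: shift_compatible_def shc_def)
qed

context
  fixes z \<alpha> \<beta>
  assumes z: "z \<in> Cl2" and \<alpha>: "fam_iso z \<alpha>" and \<beta>: "low_fam z \<beta>" and M: "\<And>A. A \<in> Ob (pF (Dom SS z)) \<Longrightarrow> mate z \<alpha> \<beta> A"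
begin

text \<open>The case of \<^locale>\<open>mate_exchange\<close> in which the functors \<open>P\<close> are shifts.\<close>

lemma low_shc_iff:
  shows "A \<in> Ob (pF (Dom SS z)) \<Longrightarrow> low_shc l z \<beta> A \<longleftrightarrow> shc l z \<alpha> (rO z A)"
    and "A' \<in> Ob (pF (Cod SS z)) \<Longrightarrow> low_shc l z \<beta> (pO z A') \<Longrightarrow> shc l z \<alpha> A'"
proof -
  interpret X: category SS by (rule category_SS)
  have zA: "z \<in> Ar SS" using z Cl2_Ar by auto
  note P = px[OF zA]
  have comp: "fst z \<in> Cl S" "snd z \<in> Cl S" using z by (auto simp: Cl2_def)
  have ob: "Cod SS z \<in> Ob SS" "Dom SS z \<in> Ob SS" using zA by simp_all
  note lsB = low_shift[OF px_Cl[OF z], unfolded P, OF _ refl refl, unfolded P]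
  interpret E: mate_exchange "pF (Cod SS z)" "pF (Dom SS z)" "pF (Cod SS z)" "pF (Dom SS z)" "bF (Cod SS z)" "bF (Dom SS z)" "bF (Cod SS z)" "bF (Dom SS z)"
    "Fo (Cod SS z)" "Fa (Cod SS z)" "Fo (Dom SS z)" "Fa (Dom SS z)" "Fo (Cod SS z)" "Fa (Cod SS z)" "Fo (Dom SS z)" "Fa (Dom SS z)"
    "pO z" "pA z" "rO z" "rA z" "pEt z" "pEp z" "pbo H (px z)" "pba H (px z)" "lowo H (px z)" "lowa H (px z)" "low_unit H (px z)" "low_counit H (px z)"
    "pO z" "pA z" "rO z" "rA z" "pEt z" "pEp z" "pbo H (px z)" "pba H (px z)" "lowo H (px z)" "lowa H (px z)" "low_unit H (px z)" "low_counit H (px z)"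
    "shO l (Cod SS z)" "shA l (Cod SS z)" "shO l (Dom SS z)" "shA l (Dom SS z)"
    "Sh (bF (Cod SS z))" "Sha (bF (Cod SS z))" "Sh (bF (Dom SS z))" "Sha (bF (Dom SS z))"
    "shs l z" "pbsh H (px z)" "bxs l (Cod SS z)" "bxs l (Dom SS z)" "shl l z" "low_shift S H (px z)"
  proof (intro mate_exchange.intro mate_exchange_axioms.intro)
    show "shl l z A \<in> Ar (pF (Cod SS z))" "Dom (pF (Cod SS z)) (shl l z A) = shO l (Cod SS z) (rO z A)" "Cod (pF (Cod SS z)) (shl l z A) = rO z (shO l (Dom SS z) A)"
      "pEp z (shO l (Dom SS z) A) \<cdot>\<^bsub>pF (Dom SS z)\<^esub> pA z (shl l z A) = shA l (Dom SS z) (pEp z A) \<cdot>\<^bsub>pF (Dom SS z)\<^esub> shs l z (rO z A)"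
      if "A \<in> Ob (pF (Dom SS z))" for A
      using that hl[OF comp(1), of "fst A" l] hl[OF comp(2), of "snd A" "\<not> l"]
      by (simp_all add: pF_simps SS_simps p_defs sh_defs prod_eq_iff)
    show "low_shift S H (px z) A' \<in> Ar (bF (Cod SS z))"
      "Dom (bF (Cod SS z)) (low_shift S H (px z) A') = Sh (bF (Cod SS z)) (lowo H (px z) A')"
      "Cod (bF (Cod SS z)) (low_shift S H (px z) A') = lowo H (px z) (Sh (bF (Dom SS z)) A')"
      "low_counit H (px z) (Sh (bF (Dom SS z)) A') \<cdot>\<^bsub>bF (Dom SS z)\<^esub> pba H (px z) (low_shift S H (px z) A') =
        Sha (bF (Dom SS z)) (low_counit H (px z) A') \<cdot>\<^bsub>bF (Dom SS z)\<^esub> pbsh H (px z) (lowo H (px z) A')"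
      if "A' \<in> Ob (bF (Dom SS z))" for A'
      using lsB[OF that] by blast+
  qed (fact Cl2_mate_square[OF z] shO_functor[OF ob(1)] shO_functor[OF ob(2)] Sh_functor[OF ob(1)] Sh_functor[OF ob(2)]
        shs_nat[OF zA] bshift_nat[OF zA] bxs_nat[OF ob(1)] bxs_nat[OF ob(2)])+
  have b: "E.M.comparison \<alpha>" using comparison_iff[OF z] \<alpha> by blast
  have mates: "E.M.mate_at \<alpha> \<beta> A" if "A \<in> Ob (pF (Dom SS z))" for A
    using M[OF that] mate_iff[OF z] by simp
  have main: "low_shc l z \<beta> A \<longleftrightarrow> shc l z \<alpha> (rO z A)" if A: "A \<in> Ob (pF (Dom SS z))" for A
  proof -
    have S: "shO l (Dom SS z) A \<in> Ob (pF (Dom SS z))" using E.PA'.obj[OF A] .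
    have "E.low_exchange_at \<beta> \<beta> A \<longleftrightarrow> E.exchange_at \<alpha> \<alpha> (rO z A)"
      by (rule E.low_exchange_iff[OF b b A low_famD[OF \<beta> A refl] low_famD[OF \<beta> S refl] mates[OF A] mates[OF S]])
    then show ?thesis unfolding E.low_exchange_at_def E.exchange_at_def low_shc_def shc_def by (metis (no_types))
  qed
  show "A \<in> Ob (pF (Dom SS z)) \<Longrightarrow> low_shc l z \<beta> A \<longleftrightarrow> shc l z \<alpha> (rO z A)" by (rule main)
  show "shc l z \<alpha> A'" if A': "A' \<in> Ob (pF (Cod SS z))" and ls: "low_shc l z \<beta> (pO z A')"
  proof -
    have "E.exchange_at \<alpha> \<alpha> (rO z (pO z A'))"
      using main[OF pO_Ob[OF z A']] ls by (simp add: E.exchange_at_def shc_def)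
    then have "E.exchange_at \<alpha> \<alpha> A'" by (rule E.exchange_of_low[OF b b A'])
    then show ?thesis by (simp add: E.exchange_at_def shc_def)
  qed
qed

end

section \<open>External tensor structures and cores as families over pairs\<close>

lemma Ball_pF: "(\<forall>A\<in>Ob (pF s). P A) \<longleftrightarrow> (\<forall>A1\<in>Ob (Fib H (fst s)). \<forall>A2\<in>Ob (Fib H (snd s)). P (A1, A2))"
  by (simp add: pF_def prod_cat_simps)

lemma fam_iso_at_iff:
  "fam_iso (f1, f2) (at m (f1, f2)) \<longleftrightarrow> is_nat_iso (prod_cat (Fib H (Cod S f1)) (Fib H (Cod S f2))) (Fib H (Pr S (Dom S f1) (Dom S f2)))
    (\<lambda>(A1, A2). bxo B (Dom S f1) (Dom S f2) (pbo H f1 A1) (pbo H f2 A2)) (\<lambda>(\<phi>1, \<phi>2). bxa B (Dom S f1) (Dom S f2) (pba H f1 \<phi>1) (pba H f2 \<phi>2))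
    (\<lambda>(A1, A2). pbo H (prod_ar S f1 f2) (bxo B (Cod S f1) (Cod S f2) A1 A2)) (\<lambda>(\<phi>1, \<phi>2). pba H (prod_ar S f1 f2) (bxa B (Cod S f1) (Cod S f2) \<phi>1 \<phi>2))
    (\<lambda>(A1, A2). m f1 f2 A1 A2)"
  unfolding fam_iso_def pairs.family_def is_nat_iso_def
  by (simp add: at_def[abs_def] case_prod_beta' SS_simps p_defs px_def Fo_def Fa_def pF_def bF_def prod_cat_simps)

lemma cocycle_at_iff:
  "pairs.cocycle_at (f1, f2) (g1, g2) \<alpha> \<beta> \<gamma> (A1, A2) \<longleftrightarrow>
    conn H (prod_ar S f1 f2) (prod_ar S g1 g2) (bxo B (Cod S g1) (Cod S g2) A1 A2) \<cdot>\<^bsub>Fib H (Pr S (Dom S f1) (Dom S f2))\<^esub> \<gamma> (A1, A2) =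
    pba H (prod_ar S f1 f2) (\<beta> (A1, A2)) \<cdot>\<^bsub>Fib H (Pr S (Dom S f1) (Dom S f2))\<^esub> \<alpha> (pbo H g1 A1, pbo H g2 A2)
      \<cdot>\<^bsub>Fib H (Pr S (Dom S f1) (Dom S f2))\<^esub> bxa B (Dom S f1) (Dom S f2) (conn H f1 g1 A1) (conn H f2 g2 A2)"
  unfolding pairs.cocycle_at_def by (simp add: SS_simps p_defs px_def Fo_def Fa_def bF_def)

lemma ext_tensor_iff:
  "ext_tensor S H M B m \<longleftrightarrow> (\<forall>f\<in>M \<times> M. fam_iso f (at m f)) \<and>
    (\<forall>f\<in>M \<times> M. \<forall>g\<in>M \<times> M. Cod SS f = Dom SS g \<longrightarrow>
      (\<forall>A\<in>Ob (pF (Cod SS g)). pairs.cocycle_at f g (at m f) (at m g) (at m (g \<cdot>\<^bsub>SS\<^esub> f)) A))"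
  by (simp add: ext_tensor_def box_functors fam_iso_at_iff cocycle_at_iff Ball_pF Let_def SS_simps imp_conjL) (simp add: at_def)

lemma shc_at_iff:
  "(\<forall>l. shc l (f1, f2) (at m (f1, f2)) (A1, A2)) \<longleftrightarrow>
    (let T1 = Dom S f1; T2 = Dom S f2; S1 = Cod S f1; S2 = Cod S f2; f = prod_ar S f1 f2; D = Fib H (Pr S T1 T2) in
        pbsh H f (bxo B S1 S2 A1 A2) \<cdot>\<^bsub>D\<^esub> pba H f (bxl B S1 S2 A1 A2) \<cdot>\<^bsub>D\<^esub> m f1 f2 (Sh (Fib H S1) A1) A2 =
        Sha D (m f1 f2 A1 A2) \<cdot>\<^bsub>D\<^esub> bxl B T1 T2 (pbo H f1 A1) (pbo H f2 A2) \<cdot>\<^bsub>D\<^esub> bxa B T1 T2 (pbsh H f1 A1) (Idn (Fib H T2) (pbo H f2 A2)) \<and>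
        pbsh H f (bxo B S1 S2 A1 A2) \<cdot>\<^bsub>D\<^esub> pba H f (bxr B S1 S2 A1 A2) \<cdot>\<^bsub>D\<^esub> m f1 f2 A1 (Sh (Fib H S2) A2) =
        Sha D (m f1 f2 A1 A2) \<cdot>\<^bsub>D\<^esub> bxr B T1 T2 (pbo H f1 A1) (pbo H f2 A2) \<cdot>\<^bsub>D\<^esub> bxa B T1 T2 (Idn (Fib H T1) (pbo H f1 A1)) (pbsh H f2 A2))"
  by (simp add: all_bool_eq shc_def Let_def at_def SS_simps p_defs px_def Fo_def Fa_def bF_def sh_defs bxs_def hO_def hA_def hs_def conj_commute)

lemma tensor_shift_compatible_iff:
  "tensor_shift_compatible S H M B m \<longleftrightarrow> (\<forall>f\<in>M \<times> M. \<forall>A\<in>Ob (pF (Cod SS f)). \<forall>l. shc l f (at m f) A)"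
  unfolding tensor_shift_compatible_def split_paired_Ball_Sigma Ball_pF shc_at_iff[symmetric] by (simp add: SS_simps)

definition low_cocycle where
  "low_cocycle z w \<beta>z \<beta>w \<beta>v A \<longleftrightarrow> low_conn S H (px w) (px z) (Fo (Dom SS z) A) \<cdot>\<^bsub>bF (Cod SS w)\<^esub> \<beta>v A =
    lowa H (px w) (\<beta>z A) \<cdot>\<^bsub>bF (Cod SS w)\<^esub> \<beta>w (rO z A) \<cdot>\<^bsub>bF (Cod SS w)\<^esub> Fa (Cod SS w) (lcP w z A)"

lemma low_fam_at_iff:
  "low_fam (z1, z2) (at mb (z1, z2)) \<and> (\<forall>A\<in>Ob (pF (Dom SS (z1, z2))). at mb (z1, z2) A \<in> Iso (bF (Cod SS (z1, z2)))) \<longleftrightarrow>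
    is_nat_iso (prod_cat (Fib H (Dom S z1)) (Fib H (Dom S z2))) (Fib H (Pr S (Cod S z1) (Cod S z2)))
    (\<lambda>(A1, A2). bxo B (Cod S z1) (Cod S z2) (lowo H z1 A1) (lowo H z2 A2)) (\<lambda>(\<phi>1, \<phi>2). bxa B (Cod S z1) (Cod S z2) (lowa H z1 \<phi>1) (lowa H z2 \<phi>2))
    (\<lambda>(A1, A2). lowo H (prod_ar S z1 z2) (bxo B (Dom S z1) (Dom S z2) A1 A2)) (\<lambda>(\<phi>1, \<phi>2). lowa H (prod_ar S z1 z2) (bxa B (Dom S z1) (Dom S z2) \<phi>1 \<phi>2))
    (\<lambda>(A1, A2). mb z1 z2 A1 A2)"
  unfolding low_fam_def is_nat_iso_def
  by (simp add: at_def[abs_def] case_prod_beta' SS_simps p_defs px_def Fo_def Fa_def pF_def bF_def prod_cat_simps)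

lemma low_cocycle_iff:
  "low_cocycle (z1, z2) (w1, w2) \<beta>z \<beta>w \<beta>v (A1, A2) \<longleftrightarrow>
    low_conn S H (prod_ar S w1 w2) (prod_ar S z1 z2) (bxo B (Dom S z1) (Dom S z2) A1 A2) \<cdot>\<^bsub>Fib H (Pr S (Cod S w1) (Cod S w2))\<^esub> \<beta>v (A1, A2) =
    lowa H (prod_ar S w1 w2) (\<beta>z (A1, A2)) \<cdot>\<^bsub>Fib H (Pr S (Cod S w1) (Cod S w2))\<^esub> \<beta>w (lowo H z1 A1, lowo H z2 A2)
      \<cdot>\<^bsub>Fib H (Pr S (Cod S w1) (Cod S w2))\<^esub> bxa B (Cod S w1) (Cod S w2) (low_conn S H w1 z1 A1) (low_conn S H w2 z2 A2)"
  unfolding low_cocycle_def by (simp add: SS_simps p_defs px_def Fo_def Fa_def bF_def lcP_def)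

lemma ext_tensor_cl_op_iff:
  "ext_tensor_cl_op S H B mb \<longleftrightarrow>
    (\<forall>z\<in>Cl2. low_fam z (at mb z) \<and> (\<forall>A\<in>Ob (pF (Dom SS z)). at mb z A \<in> Iso (bF (Cod SS z)))) \<and>
    (\<forall>z\<in>Cl2. \<forall>w\<in>Cl2. Cod SS z = Dom SS w \<longrightarrow>
      (\<forall>A\<in>Ob (pF (Dom SS z)). low_cocycle z w (at mb z) (at mb w) (at mb (w \<cdot>\<^bsub>SS\<^esub> z)) A))"
  unfolding Cl2_def split_paired_Ball_Sigma low_fam_at_iff ext_tensor_cl_op_def Let_def
  by (simp add: box_functors low_cocycle_iff Ball_pF SS_simps imp_conjL) (simp add: at_def)

lemma low_shc_at_iff:
  "(\<forall>l. low_shc l (z1, z2) (at mb (z1, z2)) (A1, A2)) \<longleftrightarrow>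
    (let Z1 = Dom S z1; Z2 = Dom S z2; S1 = Cod S z1; S2 = Cod S z2; z = prod_ar S z1 z2; D = Fib H (Pr S S1 S2) in
        lowa H z (bxl B Z1 Z2 A1 A2) \<cdot>\<^bsub>D\<^esub> mb z1 z2 (Sh (Fib H Z1) A1) A2 \<cdot>\<^bsub>D\<^esub> bxa B S1 S2 (low_shift S H z1 A1) (Idn (Fib H S2) (lowo H z2 A2)) =
        low_shift S H z (bxo B Z1 Z2 A1 A2) \<cdot>\<^bsub>D\<^esub> Sha D (mb z1 z2 A1 A2) \<cdot>\<^bsub>D\<^esub> bxl B S1 S2 (lowo H z1 A1) (lowo H z2 A2) \<and>
        lowa H z (bxr B Z1 Z2 A1 A2) \<cdot>\<^bsub>D\<^esub> mb z1 z2 A1 (Sh (Fib H Z2) A2) \<cdot>\<^bsub>D\<^esub> bxa B S1 S2 (Idn (Fib H S1) (lowo H z1 A1)) (low_shift S H z2 A2) =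
        low_shift S H z (bxo B Z1 Z2 A1 A2) \<cdot>\<^bsub>D\<^esub> Sha D (mb z1 z2 A1 A2) \<cdot>\<^bsub>D\<^esub> bxr B S1 S2 (lowo H z1 A1) (lowo H z2 A2))"
  by (simp add: all_bool_eq low_shc_def Let_def at_def SS_simps p_defs px_def Fo_def Fa_def bF_def sh_defs bxs_def hO_def hA_def hl_def conj_commute)

lemma tensor_cl_op_shift_compatible_iff:
  "tensor_cl_op_shift_compatible S H B mb \<longleftrightarrow> (\<forall>z\<in>Cl2. \<forall>A\<in>Ob (pF (Dom SS z)). \<forall>l. low_shc l z (at mb z) A)"
  unfolding tensor_cl_op_shift_compatible_def Cl2_def split_paired_Ball_Sigma Ball_pF low_shc_at_iff[symmetric] by (simp add: SS_simps)

definition Sq2 where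
  "Sq2 z' p' p z \<longleftrightarrow> cartesian S (fst z') (fst p') (fst p) (fst z) \<and> cartesian S (snd z') (snd p') (snd p) (snd z)"

text \<open>The base-change condition with its composites bracketed as in \<open>core_base_change\<close>.\<close>

definition low_square' where
  "low_square' z' p' p z \<sigma> \<sigma>' \<beta> \<beta>' A \<longleftrightarrow>
    closed_bc S H (px z') (px p') (px p) (px z) (Fo (Dom SS z) A) \<cdot>\<^bsub>bF (Dom SS p)\<^esub> (pba H (px p) (\<beta> A) \<cdot>\<^bsub>bF (Dom SS p)\<^esub> \<sigma> (rO z A)) =
    (lowa H (px z') (\<sigma>' A) \<cdot>\<^bsub>bF (Dom SS p)\<^esub> \<beta>' (pO p' A)) \<cdot>\<^bsub>bF (Dom SS p)\<^esub> Fa (Dom SS p) (cbP z' p' p z A)"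

lemma core_base_change_iff:
  "core_base_change S H B ms mb \<longleftrightarrow> (\<forall>z' p' p z. Sq2 z' p' p z \<longrightarrow> p \<in> Sm2 \<longrightarrow> z \<in> Cl2 \<longrightarrow>
    (\<forall>A\<in>Ob (pF (Dom SS z)). low_square' z' p' p z (at ms p) (at ms p') (at mb z) (at mb z') A))"
proof -
  have *: "low_square' (z1', z2') (p1', p2') (p1, p2) (z1, z2) (at ms (p1, p2)) (at ms (p1', p2')) (at mb (z1, z2)) (at mb (z1', z2')) (A1, A2) \<longleftrightarrow>
    (let P1 = Dom S p1; P2 = Dom S p2; D = Fib H (Pr S P1 P2); z = prod_ar S z1 z2; p = prod_ar S p1 p2; z' = prod_ar S z1' z2'; p' = prod_ar S p1' p2' in
      closed_bc S H z' p' p z (bxo B (Dom S z1) (Dom S z2) A1 A2) \<cdot>\<^bsub>D\<^esub> (pba H p (mb z1 z2 A1 A2) \<cdot>\<^bsub>D\<^esub> ms p1 p2 (lowo H z1 A1) (lowo H z2 A2)) =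
      (lowa H z' (ms p1' p2' A1 A2) \<cdot>\<^bsub>D\<^esub> mb z1' z2' (pbo H p1' A1) (pbo H p2' A2))
            \<cdot>\<^bsub>D\<^esub> bxa B P1 P2 (closed_bc S H z1' p1' p1 z1 A1) (closed_bc S H z2' p2' p2 z2 A2))" for z1 z2 z1' z2' p1 p2 p1' p2' A1 A2
    by (simp add: low_square'_def Let_def at_def SS_simps p_defs px_def Fo_def Fa_def bF_def cbP_def)
  show ?thesis
    unfolding core_base_change_def split_paired_All Ball_pF *
    by (simp add: Sq2_def Sm2_def Cl2_def SS_simps) meson
qed

lemma core_triangles_iff:
  "core_triangles S H B ms mb \<longleftrightarrow> (\<forall>h\<in>Cl2. \<forall>p\<in>Sm2. Cod SS h = Dom SS p \<longrightarrow> p \<cdot>\<^bsub>SS\<^esub> h \<in> Sm2 \<longrightarrow>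
    (\<forall>A\<in>Ob (pF (Cod SS p)). pairs.cocycle_at h p (\<lambda>A. inv_ar (bF (Dom SS h)) (minvP h (at mb h) A)) (at ms p) (at ms (p \<cdot>\<^bsub>SS\<^esub> h)) A))"
proof -
  have *: "inv_ar (bF (Dom SS (h1, h2))) (minvP (h1, h2) (at mb (h1, h2)) (A1, A2)) = mcl_of S H B mb h1 h2 A1 A2" for h1 h2 A1 A2
    by (simp add: mcl_of_def minvP_def Let_def at_def SS_simps p_defs px_def Fo_def Fa_def bF_def)
  show ?thesis
    unfolding core_triangles_def Ball_pF Cl2_def Sm2_def split_paired_Ball_Sigma cocycle_at_iff * Let_def
    by (simp add: SS_simps at_def) blast
qed

end

section \<open>Closed immersions in one variable\<close>

context box_over
begin

text \<open>Pairs of closed immersions with one member an identity, and the complementary open immersions. For these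
  \<open>u1 \<times> u2\<close> is complementary to \<open>z1 \<times> z2\<close>, and \<open>\<boxtimes>\<close> is only used as a triangulated functor of one
  variable.\<close>

definition elementary :: "'m \<times> 'm \<Rightarrow> 'm \<times> 'm \<Rightarrow> bool" where
  "elementary z u \<longleftrightarrow> (\<exists>z1\<in>Cl S. \<exists>T\<in>Ob S.
     z = (z1, Idn S T) \<and> u = (Compl S z1, Idn S T) \<or> z = (Idn S T, z1) \<and> u = (Idn S T, Compl S z1))"

lemma elementary:
  assumes "elementary z u"
  shows "z \<in> Cl2" "u \<in> Sm2" "Cod SS u = Cod SS z" "px u \<in> Sm S" "disjoint (px u) (px z)"
    "\<exists>k. k \<in> Ar S \<and> Cod S k = Dom S (px u) \<and> Compl S (px z) = px u \<cdot>\<^bsub>S\<^esub> k"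
proof -
  obtain z1 T where z1: "z1 \<in> Cl S" and T: "T \<in> Ob S"
    and zu: "z = (z1, Idn S T) \<and> u = (Compl S z1, Idn S T) \<or> z = (Idn S T, z1) \<and> u = (Idn S T, Compl S z1)"
    using assms unfolding elementary_def by blast
  have zd: "Dom S z1 \<in> Ob S" "Cod S z1 \<in> Ob S" "Dom S (Compl S z1) \<in> Ob S" using z1 by simp_all
  show zC: "z \<in> Cl2" and uS: "u \<in> Sm2" using zu z1 T by (auto simp: Cl2_def Sm2_def)
  show "Cod SS u = Cod SS z" using zu z1 T by (auto simp: SS_simps)
  have zA: "z \<in> Ar SS" "u \<in> Ar SS" using zC uS Cl2_Ar Sm2_Ar by auto
  note Pz = prod_ar[of "fst z" "snd z"] and Pu = prod_ar[of "fst u" "snd u"]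
  have "px u \<in> Sm S \<and> disjoint (px u) (px z) \<and>
    (\<exists>k. k \<in> Ar S \<and> Dom S k = Dom S (Compl S (px z)) \<and> Cod S k = Dom S (px u) \<and> Compl S (px z) = px u \<cdot>\<^bsub>S\<^esub> k)"
    using zu
  proof
    assume e: "z = (z1, Idn S T) \<and> u = (Compl S z1, Idn S T)"
    note Y = Pr_cone[OF zd(2) T] and Z = Pr_cone[OF zd(1) T] and U = Pr_cone[OF zd(3) T]
    have c: "Dom S (px z) = Pr S (Dom S z1) T" "Cod S (px z) = Pr S (Cod S z1) T" "pr1 S (Cod S z1) T \<cdot>\<^bsub>S\<^esub> px z = z1 \<cdot>\<^bsub>S\<^esub> pr1 S (Dom S z1) T"
      "pr2 S (Cod S z1) T \<cdot>\<^bsub>S\<^esub> px z = pr2 S (Dom S z1) T"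
      using Pz e z1 T zd by (simp_all add: px_def)
    have c': "px u \<in> Ar S" "Dom S (px u) = Pr S (Dom S (Compl S z1)) T" "Cod S (px u) = Pr S (Cod S z1) T"
      "pr1 S (Cod S z1) T \<cdot>\<^bsub>S\<^esub> px u = Compl S z1 \<cdot>\<^bsub>S\<^esub> pr1 S (Dom S (Compl S z1)) T"
      "pr2 S (Cod S z1) T \<cdot>\<^bsub>S\<^esub> px u = pr2 S (Dom S (Compl S z1)) T"
      using Pu e z1 T zd by (simp_all add: px_def)
    have "cartesian S (pr1 S (Dom S (Compl S z1)) T) (px u) (Compl S z1) (pr1 S (Cod S z1) T)"
      by (rule product_base_change[OF _ _ U c']) (use z1 Y in simp_all)
    then have "px u \<in> Sm S" using smooth_base_change z1 Compl_simps(2) by blast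
    then show ?thesis
      using complement_of_product[OF z1 px_Cl[OF zC] Y Z U c c'] unfolding c'(2) by blast
  next
    assume e: "z = (Idn S T, z1) \<and> u = (Idn S T, Compl S z1)"
    note Y = product_cone_swap[OF Pr_cone[OF T zd(2)]] and Z = product_cone_swap[OF Pr_cone[OF T zd(1)]] and U = product_cone_swap[OF Pr_cone[OF T zd(3)]]
    have c: "Dom S (px z) = Pr S T (Dom S z1)" "Cod S (px z) = Pr S T (Cod S z1)" "pr2 S T (Cod S z1) \<cdot>\<^bsub>S\<^esub> px z = z1 \<cdot>\<^bsub>S\<^esub> pr2 S T (Dom S z1)"
      "pr1 S T (Cod S z1) \<cdot>\<^bsub>S\<^esub> px z = pr1 S T (Dom S z1)"
      using Pz e z1 T zd by (simp_all add: px_def)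
    have c': "px u \<in> Ar S" "Dom S (px u) = Pr S T (Dom S (Compl S z1))" "Cod S (px u) = Pr S T (Cod S z1)"
      "pr2 S T (Cod S z1) \<cdot>\<^bsub>S\<^esub> px u = Compl S z1 \<cdot>\<^bsub>S\<^esub> pr2 S T (Dom S (Compl S z1))"
      "pr1 S T (Cod S z1) \<cdot>\<^bsub>S\<^esub> px u = pr1 S T (Dom S (Compl S z1))"
      using Pu e z1 T zd by (simp_all add: px_def)
    have "cartesian S (pr2 S T (Dom S (Compl S z1))) (px u) (Compl S z1) (pr2 S T (Cod S z1))"
      by (rule product_base_change[OF _ _ U c']) (use z1 Y in simp_all)
    then have "px u \<in> Sm S" using smooth_base_change z1 Compl_simps(2) by blast
    then show ?thesis
      using complement_of_product[OF z1 px_Cl[OF zC] Y Z U c c'] unfolding c'(2) by blast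
  qed
  then show "px u \<in> Sm S" "disjoint (px u) (px z)"
    "\<exists>k. k \<in> Ar S \<and> Cod S k = Dom S (px u) \<and> Compl S (px z) = px u \<cdot>\<^bsub>S\<^esub> k" by blast+
qed

lemma elementary_factorization:
  assumes "z \<in> Cl2"
  obtains w z' uw uz where "elementary w uw" "elementary z' uz" "Cod SS z' = Dom SS w" "z = w \<cdot>\<^bsub>SS\<^esub> z'" "Cod SS w = Cod SS z" "Dom SS z' = Dom SS z"
proof -
  let ?w = "(fst z, Idn S (Cod S (snd z)))" and ?z' = "(Idn S (Dom S (fst z)), snd z)"
  have c: "fst z \<in> Cl S" "snd z \<in> Cl S" using assms by (auto simp: Cl2_def)
  then have "elementary ?w (Compl S (fst z), Idn S (Cod S (snd z)))"
    unfolding elementary_def by (intro bexI[of _ "fst z"] bexI[of _ "Cod S (snd z)"]) simp_all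
  moreover have "elementary ?z' (Idn S (Dom S (fst z)), Compl S (snd z))"
    unfolding elementary_def using c by (intro bexI[of _ "snd z"] bexI[of _ "Dom S (fst z)"]) simp_all
  ultimately show ?thesis using that c by (simp add: SS_simps prod_eq_iff)
qed

lemma box_triangulated_functors:
  assumes "S1 \<in> Ob S" "S2 \<in> Ob S"
  shows "A2 \<in> Ob (Fib H S2) \<Longrightarrow> triangulated_functor (Fib H S1) (Fib H (Pr S S1 S2))
      (\<lambda>A1. bxo B S1 S2 A1 A2) (\<lambda>\<phi>1. bxa B S1 S2 \<phi>1 (Idn (Fib H S2) A2)) (\<lambda>A1. bxl B S1 S2 A1 A2)"
    and "A1 \<in> Ob (Fib H S1) \<Longrightarrow> triangulated_functor (Fib H S2) (Fib H (Pr S S1 S2))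
      (\<lambda>A2. bxo B S1 S2 A1 A2) (\<lambda>\<phi>2. bxa B S1 S2 (Idn (Fib H S1) A1) \<phi>2) (\<lambda>A2. bxr B S1 S2 A1 A2)"
  using box_triangulated assms unfolding box_triangulated_def Let_def by blast+

lemma Fo_zero:
  assumes s: "s \<in> Ob SS" and A: "A \<in> Ob (pF s)"
    and zero: "zero_object (Fib H (fst s)) (fst A) \<or> zero_object (Fib H (snd s)) (snd A)"
  shows "zero_object (bF s) (Fo s A)"
proof -
  have o: "fst s \<in> Ob S" "snd s \<in> Ob S" "fst A \<in> Ob (Fib H (fst s))" "snd A \<in> Ob (Fib H (snd s))"
    using s A by (simp_all add: SS_simps pF_simps)
  note t = box_triangulated_functors(1)[OF o(1,2,4)] box_triangulated_functors(2)[OF o(1,2,3)]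
  note a = t[unfolded triangulated_functor_def]
  show ?thesis unfolding bF_def Fo_def using zero
  proof
    assume "zero_object (Fib H (fst s)) (fst A)"
    then show "zero_object (Fib H (Pr S (fst s) (snd s))) (bxo B (fst s) (snd s) (fst A) (snd A))"
      using additive_functor_zero[OF fibre_additive fibre_additive conjunct1[OF a(1)]] o Pr_Ob by blast
  next
    assume "zero_object (Fib H (snd s)) (snd A)"
    then show "zero_object (Fib H (Pr S (fst s) (snd s))) (bxo B (fst s) (snd s) (fst A) (snd A))"
      using additive_functor_zero[OF fibre_additive fibre_additive conjunct1[OF a(2)]] o Pr_Ob by blast
  qed
qed

text \<open>The mate of an isomorphism \<open>\<alpha>\<close> becomes invertible after \<open>z\<^sup>*\<close>. On the complement both sides of \<open>\<beta>\<close> vanish: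
  the target because it is a direct image along \<open>z\<close>, the source because \<open>\<boxtimes>\<close> commutes with the restriction
  along \<open>u\<close>, by \<open>\<alpha>u\<close>, and one of its arguments vanishes there.\<close>

lemma elementary_low_Iso:
  assumes e: "elementary z u" and \<alpha>: "fam_iso z \<alpha>" and \<alpha>u: "fam_iso u \<alpha>u" and \<beta>: "low_fam z \<beta>"
    and A: "A \<in> Ob (pF (Dom SS z))" and M: "mate z \<alpha> \<beta> A"
  shows "\<beta> A \<in> Iso (bF (Cod SS z))"
proof -
  note E = elementary[OF e]
  have zA: "z \<in> Ar SS" "u \<in> Ar SS" using E(1,2) Cl2_Ar Sm2_Ar by auto
  note P = px[OF zA(1)] px[OF zA(2)]
  interpret X: category SS by (rule category_SS)
  obtain k where k: "k \<in> Ar S" "Cod S k = Dom S (px u)" "Compl S (px z) = px u \<cdot>\<^bsub>S\<^esub> k" using E(6) by blast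
  let ?B = "rO z A"
  have B: "?B \<in> Ob (pF (Cod SS u))" using rO_Ob[OF E(1) A] E(3) by simp
  have "zero_object (bF (Dom SS u)) (Fo (Dom SS u) (pO u ?B))"
  proof (rule Fo_zero)
    obtain z1 T where z1: "z1 \<in> Cl S" and T: "T \<in> Ob S"
      and zu: "z = (z1, Idn S T) \<and> u = (Compl S z1, Idn S T) \<or> z = (Idn S T, z1) \<and> u = (Idn S T, Compl S z1)"
      using e unfolding elementary_def by blast
    have v: "zero_object (Fib H (Dom S (Compl S z1))) (pbo H (Compl S z1) (lowo H z1 A'))" if "A' \<in> Ob (Fib H (Dom S z1))" for A'
      using pull_low_zero[OF z1 _ Compl_disjoint[OF z1] that] z1 by simp
    show "zero_object (Fib H (fst (Dom SS u))) (fst (pO u ?B)) \<or> zero_object (Fib H (snd (Dom SS u))) (snd (pO u ?B))"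
      using zu A v[of "fst A"] v[of "snd A"] by (auto simp: SS_simps pF_simps p_defs)
  qed (use B zA in simp_all)
  moreover have "\<alpha>u ?B \<in> Iso (bF (Dom SS u))" "Dom (bF (Dom SS u)) (\<alpha>u ?B) = Fo (Dom SS u) (pO u ?B)"
    "Cod (bF (Dom SS u)) (\<alpha>u ?B) = pbo H (px u) (Fo (Cod SS u) ?B)"
    using fam_isoD(2)[OF \<alpha>u B refl] pairs.familyD[OF fam_isoD(1)[OF \<alpha>u] zA(2) B refl] by simp_all
  ultimately have zero: "zero_object (bF (Dom SS u)) (pbo H (px u) (Fo (Cod SS u) ?B))"
    using additive_category.zero_object_Iso[of "bF (Dom SS u)" "\<alpha>u ?B"] fibre_additive[of "Dom S (px u)"] P by simp
  have FA: "Fo (Dom SS z) A \<in> Ob (bF (Dom SS z))" using A zA by simp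
  show ?thesis
  proof (rule Iso_of_vanishing[OF px_Cl[OF E(1)] P(4) k, unfolded P])
    show "pba H (px z) (\<beta> A) \<in> Iso (bF (Dom SS z))" by (rule mate_pull_Iso[OF E(1) \<alpha> A M \<beta>])
    show "zero_object (bF (Dom SS u)) (pbo H (px u) (Dom (bF (Cod SS z)) (\<beta> A)))"
      using zero low_famD[OF \<beta> A refl] E(3) by simp
  qed (use low_famD[OF \<beta> A refl] FA in simp_all)
qed

lemma sharp_box_arrow:
  assumes p: "p \<in> Sm2" "px p \<in> Sm S" and m: "fam_iso p (at m p)" and A: "A \<in> Ob (pF (Dom SS p))"
  shows "Dom (bF (Cod SS p)) (sharp_box S H B m (fst p) (snd p) (fst A) (snd A)) = sho H (px p) (Fo (Dom SS p) A)"
    "Cod (bF (Cod SS p)) (sharp_box S H B m (fst p) (snd p) (fst A) (snd A)) = Fo (Cod SS p) (sho H (fst p) (fst A), sho H (snd p) (snd A))"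
proof -
  have pA: "p \<in> Ar SS" using p Sm2_Ar by auto
  note P = px[OF pA]
  interpret X: category SS by (rule category_SS)
  have c: "fst p \<in> Sm S" "snd p \<in> Sm S" using p(1) by (auto simp: Sm2_def)
  interpret P1: adj "Fib H (Dom S (fst p))" "Fib H (Cod S (fst p))" "sho H (fst p)" "sha H (fst p)" "pbo H (fst p)" "pba H (fst p)" "sh_unit H (fst p)" "sh_counit H (fst p)"
    by (rule sharp[OF c(1) refl refl])
  interpret P2: adj "Fib H (Dom S (snd p))" "Fib H (Cod S (snd p))" "sho H (snd p)" "sha H (snd p)" "pbo H (snd p)" "pba H (snd p)" "sh_unit H (snd p)" "sh_counit H (snd p)"
    by (rule sharp[OF c(2) refl refl])
  interpret Q: adj "bF (Dom SS p)" "bF (Cod SS p)" "sho H (px p)" "sha H (px p)" "pbo H (px p)" "pba H (px p)" "sh_unit H (px p)" "sh_counit H (px p)"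
    using sharp[OF p(2) refl refl] unfolding P .
  let ?X = "(sho H (fst p) (fst A), sho H (snd p) (snd A))"
  let ?u = "(sh_unit H (fst p) (fst A), sh_unit H (snd p) (snd A))"
  have A12: "fst A \<in> Ob (Fib H (Dom S (fst p)))" "snd A \<in> Ob (Fib H (Dom S (snd p)))" using A by (simp_all add: pF_simps SS_simps)
  have X: "?X \<in> Ob (pF (Cod SS p))" using A12 by (simp add: pF_simps SS_simps)
  have u: "?u \<in> Ar (pF (Dom SS p))" "Dom (pF (Dom SS p)) ?u = A" "Cod (pF (Dom SS p)) ?u = pO p ?X"
    using A12 by (simp_all add: pF_simps SS_simps p_defs)
  note mX = pairs.familyD[OF fam_isoD(1)[OF m] pA X refl]
  have eq: "sharp_box S H B m (fst p) (snd p) (fst A) (snd A) = sh_counit H (px p) (Fo (Cod SS p) ?X) \<cdot>\<^bsub>bF (Cod SS p)\<^esub> sha H (px p) (at m p ?X)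
      \<cdot>\<^bsub>bF (Cod SS p)\<^esub> sha H (px p) (Fa (Dom SS p) ?u)"
    by (simp add: sharp_box_def Let_def at_def SS_simps px_def Fo_def Fa_def bF_def)
  have Fu: "Fa (Dom SS p) ?u \<in> Ar (bF (Dom SS p))" "Dom (bF (Dom SS p)) (Fa (Dom SS p) ?u) = Fo (Dom SS p) A"
      "Cod (bF (Dom SS p)) (Fa (Dom SS p) ?u) = Fo (Dom SS p) (pO p ?X)"
    using u pA by simp_all
  have FX: "Fo (Cod SS p) ?X \<in> Ob (bF (Cod SS p))" using X pA by simp
  show "Dom (bF (Cod SS p)) (sharp_box S H B m (fst p) (snd p) (fst A) (snd A)) = sho H (px p) (Fo (Dom SS p) A)"
    "Cod (bF (Cod SS p)) (sharp_box S H B m (fst p) (snd p) (fst A) (snd A)) = Fo (Cod SS p) ?X"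
    unfolding eq using Fu FX mX by simp_all
qed

text \<open>Apart from the invertible \<open>\<beta>\<close> and counit, \<open>minvP z \<beta>\<close> is \<open>z\<^sup>*\<close> of \<open>\<eta> \<boxtimes> id\<close> or \<open>id \<boxtimes> \<eta>\<close> for a unit \<open>\<eta>\<close>. The
  functor \<open>- \<boxtimes> A2\<close> carries \<open>u\<^sub># D\<close> to \<open>(u \<times> T)\<^sub># (D \<boxtimes> A2)\<close> by smooth adjointability, and similarly in
  the other variable, so \<open>pull_triangulated_unit_Iso\<close> applies.\<close>

lemma elementary_minvP_Iso:
  assumes e: "elementary z u" and \<beta>: "low_fam z \<beta>" and iso: "\<And>A. A \<in> Ob (pF (Dom SS z)) \<Longrightarrow> \<beta> A \<in> Iso (bF (Cod SS z))"
    and m: "fam_iso u (at m u)" and sa: "smooth_adjointable S H B m" and A: "A \<in> Ob (pF (Cod SS z))"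
  shows "minvP z \<beta> A \<in> Iso (bF (Dom SS z))"
proof (rule minvP_factor_Iso)
  note E = elementary[OF e]
  show "z \<in> Cl2" by (rule E(1))
  have zA: "z \<in> Ar SS" "u \<in> Ar SS" using E(1,2) Cl2_Ar Sm2_Ar by auto
  note P = px[OF zA(1)] px[OF zA(2)]
  have sb: "\<exists>D'\<in>Ob (bF (Dom SS u)). \<exists>i\<in>Iso (bF (Cod SS z)). Dom (bF (Cod SS z)) i = sho H (px u) D' \<and>
      Cod (bF (Cod SS z)) i = Fo (Cod SS z) (sho H (fst u) (fst D), sho H (snd u) (snd D))" if D: "D \<in> Ob (pF (Dom SS u))" for D
  proof (intro bexI conjI)
    interpret X: category SS by (rule category_SS)
    let ?i = "sharp_box S H B m (fst u) (snd u) (fst D) (snd D)"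
    have "?i \<in> Iso (Fib H (Pr S (Cod S (fst u)) (Cod S (snd u))))"
      using sa E(2) D by (auto simp: smooth_adjointable_def Sm2_def pF_simps SS_simps)
    then show "?i \<in> Iso (bF (Cod SS z))" unfolding E(3)[symmetric] by (simp add: bF_def SS_simps)
    show "Dom (bF (Cod SS z)) ?i = sho H (px u) (Fo (Dom SS u) D)"
      "Cod (bF (Cod SS z)) ?i = Fo (Cod SS z) (sho H (fst u) (fst D), sho H (snd u) (snd D))"
      using sharp_box_arrow[OF E(2,4) m D] unfolding E(3) by blast+
    show "Fo (Dom SS u) D \<in> Ob (bF (Dom SS u))" using D zA by simp
  qed
  obtain z1 T where z1: "z1 \<in> Cl S" and T: "T \<in> Ob S"
    and zu: "z = (z1, Idn S T) \<and> u = (Compl S z1, Idn S T) \<or> z = (Idn S T, z1) \<and> u = (Idn S T, Compl S z1)"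
    using e unfolding elementary_def by blast
  have Y: "Fib H (Cod S (px z)) = bF (Cod SS z)" "Fib H (Dom S (px z)) = bF (Dom SS z)" "Fib H (Dom S (px u)) = bF (Dom SS u)"
    using P by simp_all
  have z1d: "Cod S z1 \<in> Ob S" using z1 by simp
  from zu show "pba H (px z) (Fa (Cod SS z) (pEt z A)) \<in> Iso (bF (Dom SS z))"
  proof
    assume zu: "z = (z1, Idn S T) \<and> u = (Compl S z1, Idn S T)"
    have A12: "fst A \<in> Ob (Fib H (Cod S z1))" "snd A \<in> Ob (Fib H T)" using A zu T by (simp_all add: pF_simps SS_simps)
    have bz: "bF (Cod SS z) = Fib H (Pr S (Cod S z1) T)" using zu T by (simp add: bF_def SS_simps)
    have "pba H (px z) (bxa B (Cod S z1) T (low_unit H z1 (fst A)) (Idn (Fib H T) (snd A))) \<in> Iso (Fib H (Dom S (px z)))"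
    proof (rule pull_triangulated_unit_Iso[OF z1 px_Cl[OF E(1)] E(4,5) _ _ A12(1)])
      show "triangulated_functor (Fib H (Cod S z1)) (Fib H (Cod S (px z))) (\<lambda>A1. bxo B (Cod S z1) T A1 (snd A))
          (\<lambda>\<phi>1. bxa B (Cod S z1) T \<phi>1 (Idn (Fib H T) (snd A))) (\<lambda>A1. bxl B (Cod S z1) T A1 (snd A))"
        unfolding Y bz by (rule box_triangulated_functors(1)[OF z1d T A12(2)])
      show "\<exists>D'\<in>Ob (Fib H (Dom S (px u))). \<exists>i\<in>Iso (Fib H (Cod S (px z))). Dom (Fib H (Cod S (px z))) i = sho H (px u) D' \<and>
          Cod (Fib H (Cod S (px z))) i = bxo B (Cod S z1) T (sho H (Compl S z1) D) (snd A)" if "D \<in> Ob (Fib H (Dom S (Compl S z1)))" for D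
        unfolding Y using sb[of "(D, snd A)"] that A12 zu T sharp_Idn[OF T A12(2)] by (simp add: pF_simps SS_simps Fo_def)
    qed
    then show ?thesis using zu T low_Idn[OF T A12(2)] unfolding Y by (simp add: Fa_def p_defs SS_simps)
  next
    assume zu: "z = (Idn S T, z1) \<and> u = (Idn S T, Compl S z1)"
    have A12: "snd A \<in> Ob (Fib H (Cod S z1))" "fst A \<in> Ob (Fib H T)" using A zu T by (simp_all add: pF_simps SS_simps)
    have bz: "bF (Cod SS z) = Fib H (Pr S T (Cod S z1))" using zu T by (simp add: bF_def SS_simps)
    have "pba H (px z) (bxa B T (Cod S z1) (Idn (Fib H T) (fst A)) (low_unit H z1 (snd A))) \<in> Iso (Fib H (Dom S (px z)))"
    proof (rule pull_triangulated_unit_Iso[OF z1 px_Cl[OF E(1)] E(4,5) _ _ A12(1)])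
      show "triangulated_functor (Fib H (Cod S z1)) (Fib H (Cod S (px z))) (\<lambda>A2. bxo B T (Cod S z1) (fst A) A2)
          (\<lambda>\<phi>2. bxa B T (Cod S z1) (Idn (Fib H T) (fst A)) \<phi>2) (\<lambda>A2. bxr B T (Cod S z1) (fst A) A2)"
        unfolding Y bz by (rule box_triangulated_functors(2)[OF T z1d A12(2)])
      show "\<exists>D'\<in>Ob (Fib H (Dom S (px u))). \<exists>i\<in>Iso (Fib H (Cod S (px z))). Dom (Fib H (Cod S (px z))) i = sho H (px u) D' \<and>
          Cod (Fib H (Cod S (px z))) i = bxo B T (Cod S z1) (fst A) (sho H (Compl S z1) D)" if "D \<in> Ob (Fib H (Dom S (Compl S z1)))" for D
        unfolding Y using sb[of "(fst A, D)"] that A12 zu T sharp_Idn[OF T A12(2)] by (simp add: pF_simps SS_simps Fo_def)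
    qed
    then show ?thesis using zu T low_Idn[OF T A12(2)] unfolding Y by (simp add: Fa_def p_defs SS_simps)
  qed
qed (use \<beta> iso A in simp_all)

end

section \<open>From a localic structure to a core\<close>

context box_over
begin

lemma Ar_SS: "Ar SS = Ar S \<times> Ar S"
  by (simp add: SS_def prod_cat_simps)

lemma ext_tensorD:
  assumes "ext_tensor S H (Ar S) B m"
  shows "f \<in> Ar SS \<Longrightarrow> fam_iso f (at m f)"
    and "f \<in> Ar SS \<Longrightarrow> g \<in> Ar SS \<Longrightarrow> Cod SS f = Dom SS g \<Longrightarrow> A \<in> Ob (pF (Cod SS g)) \<Longrightarrow>
      pairs.cocycle_at f g (at m f) (at m g) (at m (g \<cdot>\<^bsub>SS\<^esub> f)) A"
  using assms unfolding ext_tensor_iff Ar_SS by blast+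

lemma at_mbar_of: "at (mbar_of S H B m) z A = mbarP z (at m z) A"
  by (simp add: at_def mbar_of_def mbarP_def Let_def SS_simps p_defs px_def Fo_def Fa_def bF_def)

lemma at_mbar_of': "at (mbar_of S H B m) z = mbarP z (at m z)"
  by (rule ext) (rule at_mbar_of)

lemma Sq2D:
  assumes s: "Sq2 z' p' p z" and p: "p \<in> Sm2" and z: "z \<in> Cl2"
  shows "z' \<in> Cl2" "p' \<in> Sm2" "Dom SS p' = Dom SS z'" "Cod SS z' = Dom SS p" "Cod SS p' = Dom SS z" "p \<cdot>\<^bsub>SS\<^esub> z' = z \<cdot>\<^bsub>SS\<^esub> p'"
proof -
  have c: "cartesian S (fst z') (fst p') (fst p) (fst z)" "cartesian S (snd z') (snd p') (snd p) (snd z)"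
    using s by (auto simp: Sq2_def)
  have pz: "fst p \<in> Sm S" "snd p \<in> Sm S" "fst z \<in> Cl S" "snd z \<in> Cl S" using p z by (auto simp: Sm2_def Cl2_def)
  show "z' \<in> Cl2" using closed_base_change[OF _ _ c(1)] closed_base_change[OF _ _ c(2)] pz by (auto simp: Cl2_def mem_Times_iff)
  show "p' \<in> Sm2" using smooth_base_change[OF _ c(1)] smooth_base_change[OF _ c(2)] pz by (auto simp: Sm2_def mem_Times_iff)
  show "Dom SS p' = Dom SS z'" "Cod SS z' = Dom SS p" "Cod SS p' = Dom SS z" "p \<cdot>\<^bsub>SS\<^esub> z' = z \<cdot>\<^bsub>SS\<^esub> p'"
    using cartesianD[OF c(1)] cartesianD[OF c(2)] by (simp_all add: SS_simps)
qed

lemma low_square_iff: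
  assumes s: "Sq2 z' p' p z" "p \<in> Sm2" "z \<in> Cl2" and \<sigma>: "pairs.family p' \<sigma>'" and \<beta>: "low_fam z' \<beta>'"
    and A: "A \<in> Ob (pF (Dom SS z))"
  shows "low_square' z' p' p z \<sigma> \<sigma>' \<beta> \<beta>' A \<longleftrightarrow> low_square z' p' p z \<sigma> \<sigma>' \<beta> \<beta>' A"
proof -
  note D = Sq2D[OF s]
  have ar: "z' \<in> Ar SS" "p' \<in> Ar SS" "p \<in> Ar SS" "z \<in> Ar SS" using D s Cl2_Ar Sm2_Ar by auto
  note P = px[OF ar(1)] px[OF ar(2)]
  interpret X: category SS by (rule category_SS)
  interpret DD: category "bF (Dom SS p)" by (rule pairs.B.fib) (use ar in simp)
  interpret Z: adj "bF (Cod SS z')" "bF (Dom SS z')" "pbo H (px z')" "pba H (px z')" "lowo H (px z')" "lowa H (px z')" "low_unit H (px z')" "low_counit H (px z')"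
    using low[OF px_Cl[OF D(1)] refl refl] unfolding P .
  have comp: "fst z \<in> Cl S" "snd z \<in> Cl S" "fst z' \<in> Cl S" "snd z' \<in> Cl S" "fst p \<in> Ar S" "snd p \<in> Ar S" "fst p' \<in> Ar S" "snd p' \<in> Ar S"
    "Dom S (fst p') = Dom S (fst z')" "Dom S (snd p') = Dom S (snd z')" "Cod S (fst z') = Dom S (fst p)" "Cod S (snd z') = Dom S (snd p)"
    "Cod S (fst p') = Dom S (fst z)" "Cod S (snd p') = Dom S (snd z)"
    "fst p \<cdot>\<^bsub>S\<^esub> fst z' = fst z \<cdot>\<^bsub>S\<^esub> fst p'" "snd p \<cdot>\<^bsub>S\<^esub> snd z' = snd z \<cdot>\<^bsub>S\<^esub> snd p'"
    using D s ar by (auto simp: Cl2_def SS_simps)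
  have cb: "cbP z' p' p z A \<in> Ar (pF (Dom SS p))" "Cod (pF (Dom SS p)) (cbP z' p' p z A) = rO z' (pO p' A)"
    using A comp closed_bc[of "fst z" "fst z'" "fst p" "fst p'" "fst A"] closed_bc[of "snd z" "snd z'" "snd p" "snd p'" "snd A"]
    by (simp_all add: pF_simps SS_simps p_defs cbP_def prod_eq_iff)
  have pA: "pO p' A \<in> Ob (pF (Dom SS z'))" using A ar D by simp
  have s: "\<sigma>' A \<in> Ar (bF (Dom SS z'))" "Dom (bF (Dom SS z')) (\<sigma>' A) = Fo (Dom SS z') (pO p' A)"
    using pairs.familyD[OF \<sigma> ar(2), of A "Dom SS z'"] A D by simp_all
  note b = low_famD[OF \<beta> pA D(4)[symmetric]]
  have l: "lowa H (px z') (\<sigma>' A) \<in> Ar (bF (Dom SS p))" "Dom (bF (Dom SS p)) (lowa H (px z') (\<sigma>' A)) = lowo H (px z') (Fo (Dom SS z') (pO p' A))"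
    using s D(4) Z.R.arr[OF s(1)] Z.R.dom[OF s(1)] by simp_all
  have F: "Fa (Dom SS p) (cbP z' p' p z A) \<in> Ar (bF (Dom SS p))" "Cod (bF (Dom SS p)) (Fa (Dom SS p) (cbP z' p' p z A)) = Fo (Dom SS p) (rO z' (pO p' A))"
    using cb ar by simp_all
  show ?thesis unfolding low_square_def low_square'_def using l F b by simp
qed

lemma cocycle_star_eq:
  assumes "pairs.family f \<alpha>" "pairs.family g \<beta>" "pairs.family (g \<cdot>\<^bsub>SS\<^esub> f) \<gamma>" "f \<in> Ar SS" "g \<in> Ar SS" "Cod SS f = Dom SS g"
    "A \<in> Ob (pF (Cod SS g))" "pairs.cocycle_at f g \<alpha> \<beta> \<gamma> A"
  shows "pairs.star f g \<alpha> \<beta> A = \<gamma> A"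
  using pairs.cocycle_imp_star[OF assms(1,2,4-7,3,8)] by simp

text \<open>Each condition on \<open>mbar_of\<close> is the translation to mates of the corresponding property of \<open>m\<close>. For base change the
  property is that \<open>m\<close> at \<open>p z' = z p'\<close> may be computed along either factorization, for
  the triangles it is the composition law itself.\<close>

lemma localic_imp_core:
  assumes ext: "ext_tensor S H (Ar S) B m" and sh: "tensor_shift_compatible S H (Ar S) B m"
  shows "ext_tensor_cl_op S H B (mbar_of S H B m)" "tensor_cl_op_shift_compatible S H B (mbar_of S H B m)"
    "core_base_change S H B m (mbar_of S H B m)" "core_triangles S H B m (mbar_of S H B m)"
proof -
  interpret X: category SS by (rule category_SS)
  note fi = ext_tensorD(1)[OF ext] and coc = ext_tensorD(2)[OF ext]
  have shc: "shc l f (at m f) A" if "f \<in> Ar SS" "A \<in> Ob (pF (Cod SS f))" for f A l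
    using sh that unfolding tensor_shift_compatible_iff Ar_SS by blast
  let ?b = "\<lambda>z. at (mbar_of S H B m) z"
  have lf: "low_fam z (?b z)" if "z \<in> Cl2" for z
    using mbarP_low_fam[OF that fi[OF Cl2_Ar[OF that]]] unfolding at_mbar_of' .
  have M: "mate z (at m z) (?b z) A" if "z \<in> Cl2" "A \<in> Ob (pF (Dom SS z))" for z A
    using mbarP_mate[OF that(1) fi[OF Cl2_Ar[OF that(1)]] that(2)] unfolding at_mbar_of' .
  have comp: "w \<cdot>\<^bsub>SS\<^esub> z \<in> Cl2" if "z \<in> Cl2" "w \<in> Cl2" "Cod SS z = Dom SS w" for z w
    using that by (auto simp: Cl2_def SS_simps)
  have lc: "low_cocycle z w (?b z) (?b w) (?b (w \<cdot>\<^bsub>SS\<^esub> z)) A"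
    if z: "z \<in> Cl2" "w \<in> Cl2" "Cod SS z = Dom SS w" "A \<in> Ob (pF (Dom SS z))" for z w A
  proof -
    have ar: "z \<in> Ar SS" "w \<in> Ar SS" using z Cl2_Ar by auto
    have v: "w \<cdot>\<^bsub>SS\<^esub> z \<in> Cl2" by (rule comp[OF z(1-3)])
    have vd: "Dom SS (w \<cdot>\<^bsub>SS\<^esub> z) = Dom SS z" "Cod SS (w \<cdot>\<^bsub>SS\<^esub> z) = Cod SS w" using ar z by simp_all
    have A: "A \<in> Ob (pF (Dom SS (w \<cdot>\<^bsub>SS\<^esub> z)))" using z(4) vd by simp
    note b = low_famD[OF lf[OF v] A vd(2)[symmetric], unfolded vd]
    have r: "rO z A \<in> Ob (pF (Dom SS w))" using rO_Ob[OF z(1,4)] z(3) by simp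
    have rv: "rO (w \<cdot>\<^bsub>SS\<^esub> z) A \<in> Ob (pF (Cod SS w))" using rO_Ob[OF v A] vd by simp
    have "mate (w \<cdot>\<^bsub>SS\<^esub> z) (at m (w \<cdot>\<^bsub>SS\<^esub> z)) (?b (w \<cdot>\<^bsub>SS\<^esub> z)) A" by (rule M[OF v A])
    then show ?thesis
      unfolding low_cocycle_def
      using mate_composition_iff[where \<beta>v = "?b (w \<cdot>\<^bsub>SS\<^esub> z)" and \<beta>w = "?b w" and \<beta>z = "?b z" and A = A, OF z fi[OF ar(2)] fi[OF ar(1)] fi[OF Cl2_Ar[OF v]] lf[OF z(2)] lf[OF z(1)] b M[OF z(2) r] M[OF z(1,4)] coc[OF ar z(3) rv]]
      by blast
  qed
  have iso: "?b z A \<in> Iso (bF (Cod SS z))" if z: "z \<in> Cl2" and A: "A \<in> Ob (pF (Dom SS z))" for z A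
  proof -
    obtain w z' uw uz where e: "elementary w uw" "elementary z' uz" and d: "Cod SS z' = Dom SS w" "z = w \<cdot>\<^bsub>SS\<^esub> z'" "Cod SS w = Cod SS z" "Dom SS z' = Dom SS z"
      by (rule elementary_factorization[OF z])
    note w = elementary[OF e(1)] and z' = elementary[OF e(2)]
    have A': "A \<in> Ob (pF (Dom SS z'))" using A d(4) by simp
    have r: "rO z' A \<in> Ob (pF (Dom SS w))" using rO_Ob[OF z'(1) A'] d(1) by simp
    have ei: "?b y A \<in> Iso (bF (Cod SS y))" if "elementary y u" "A \<in> Ob (pF (Dom SS y))" for y u A
      using elementary_low_Iso[OF that(1) fi[OF Cl2_Ar[OF elementary(1)[OF that(1)]]] fi[OF Sm2_Ar[OF elementary(2)[OF that(1)]]]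
          lf[OF elementary(1)[OF that(1)]] that(2) M[OF elementary(1)[OF that(1)] that(2)]] .
    note i1 = ei[OF e(2) A'] and i2 = ei[OF e(1) r]
    note L = low_conn_isos[OF z'(1) w(1) d(1) A']
    interpret D: category "bF (Cod SS w)" by (rule pairs.B.fib) (use w Cl2_Ar in simp)
    have ar: "w \<in> Ar SS" "z' \<in> Ar SS" using w z' Cl2_Ar by auto
    interpret W: adj "bF (Cod SS w)" "bF (Dom SS w)" "pbo H (px w)" "pba H (px w)" "lowo H (px w)" "lowa H (px w)" "low_unit H (px w)" "low_counit H (px w)"
      using low[OF px_Cl[OF w(1)] refl refl] unfolding px[OF ar(1)] .
    note b1 = low_famD[OF lf[OF z'(1)] A' refl] and b2 = low_famD[OF lf[OF w(1)] r refl]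
    have i1': "lowa H (px w) (?b z' A) \<in> Iso (bF (Cod SS w))" "Dom (bF (Cod SS w)) (lowa H (px w) (?b z' A)) = lowo H (px w) (Fo (Cod SS z') (rO z' A))"
      using W.R.iso i1 W.R.dom b1 d(1) by simp_all
    have i3: "Fa (Cod SS w) (lcP w z' A) \<in> Iso (bF (Cod SS w))" "Cod (bF (Cod SS w)) (Fa (Cod SS w) (lcP w z' A)) = Fo (Cod SS w) (rO w (rO z' A))"
      using L ar functor_on.iso[OF pairs.ff[of "Cod SS w"] L(2)] functor_on.cod[OF pairs.ff[of "Cod SS w"]] category.Iso_Ar[OF pairs.A.fib[of "Cod SS w"] L(2)] by simp_all
    have "lowa H (px w) (?b z' A) \<cdot>\<^bsub>bF (Cod SS w)\<^esub> ?b w (rO z' A) \<cdot>\<^bsub>bF (Cod SS w)\<^esub> Fa (Cod SS w) (lcP w z' A) \<in> Iso (bF (Cod SS w))"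
      using i1' i2 i3 b2 d(1) D.Iso_Ar by simp
    then have c: "low_conn S H (px w) (px z') (Fo (Dom SS z') A) \<cdot>\<^bsub>bF (Cod SS w)\<^esub> ?b z A \<in> Iso (bF (Cod SS w))"
      using lc[OF z'(1) w(1) d(1) A'] unfolding low_cocycle_def d(2)[symmetric] by simp
    have "?b z A \<in> Iso (bF (Cod SS w))"
      by (rule D.Iso_right_factor[OF L(1) _ _ c]) (use low_famD[OF lf[OF z] A d(3)] L(3)[folded d(2), unfolded d(4)] d(4) in simp_all)
    then show ?thesis unfolding d(3) .
  qed
  show "ext_tensor_cl_op S H B (mbar_of S H B m)"
    unfolding ext_tensor_cl_op_iff using lf iso lc by blast
  show "tensor_cl_op_shift_compatible S H B (mbar_of S H B m)"
    unfolding tensor_cl_op_shift_compatible_iff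
  proof (intro ballI allI)
    fix z A l assume z: "z \<in> Cl2" and A: "A \<in> Ob (pF (Dom SS z))"
    show "low_shc l z (?b z) A"
      using low_shc_iff(1)[OF z fi[OF Cl2_Ar[OF z]] lf[OF z] M[OF z] A] shc[OF Cl2_Ar[OF z] rO_Ob[OF z A]] by blast
  qed
  show "core_base_change S H B m (mbar_of S H B m)"
    unfolding core_base_change_iff
  proof (intro allI impI ballI)
    fix z' p' p z A assume s: "Sq2 z' p' p z" "p \<in> Sm2" "z \<in> Cl2" and A: "A \<in> Ob (pF (Dom SS z))"
    note D = Sq2D[OF s]
    have ar: "z \<in> Ar SS" "z' \<in> Ar SS" "p \<in> Ar SS" "p' \<in> Ar SS" using D s Cl2_Ar Sm2_Ar by auto
    have cc: "Cod SS p = Cod SS z" using arg_cong[OF D(6), of "Cod SS"] ar D(1-5) by simp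
    have r: "rO z A \<in> Ob (pF (Cod SS z))" by (rule rO_Ob[OF s(3) A])
    have r': "rO z A \<in> Ob (pF (Cod SS p))" using r cc by simp
    note F = fam_isoD(1)[OF fi]
    have "pairs.star z' p (at m z') (at m p) (rO z A) = at m (p \<cdot>\<^bsub>SS\<^esub> z') (rO z A)"
      by (rule cocycle_star_eq[OF F F F _ _ _ _ coc]) (use ar D r r' in simp_all)
    also have "\<dots> = at m (z \<cdot>\<^bsub>SS\<^esub> p') (rO z A)" by (simp only: D(6))
    also have "\<dots> = pairs.star p' z (at m p') (at m z) (rO z A)"
      by (rule cocycle_star_eq[OF F F F _ _ _ _ coc, symmetric]) (use ar D r in simp_all)
    finally have "low_square z' p' p z (at m p) (at m p') (?b z) (?b z') A"
      using base_change_iff(1)[OF s(3) D(1) ar(3,4) D(3-6) fi[OF ar(1)] fi[OF ar(2)] F[OF ar(3)] F[OF ar(4)] lf[OF s(3)] lf[OF D(1)] M[OF s(3)] M[OF D(1)] A]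
      by blast
    then show "low_square' z' p' p z (at m p) (at m p') (?b z) (?b z') A"
      using low_square_iff[OF s F[OF ar(4)] lf[OF D(1)] A] by blast
  qed
  show "core_triangles S H B m (mbar_of S H B m)"
    unfolding core_triangles_iff
  proof (intro ballI impI)
    fix h p A assume h: "h \<in> Cl2" "p \<in> Sm2" "Cod SS h = Dom SS p" and A: "A \<in> Ob (pF (Cod SS p))"
    have ar: "h \<in> Ar SS" "p \<in> Ar SS" using h Cl2_Ar Sm2_Ar by auto
    have pA: "pO p A \<in> Ob (pF (Cod SS h))" using A ar h by simp
    have "inv_ar (bF (Dom SS h)) (minvP h (?b h) (pO p A)) = at m h (pO p A)"
      by (rule minvP_Iso(2)[OF h(1) fi[OF ar(1)] M[OF h(1)] lf[OF h(1)] pA])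
    then show "pairs.cocycle_at h p (\<lambda>A. inv_ar (bF (Dom SS h)) (minvP h (?b h) A)) (at m p) (at m (p \<cdot>\<^bsub>SS\<^esub> h)) A"
      using coc[OF ar h(3) A] by (simp add: pairs.cocycle_at_def)
  qed
qed

text \<open>A localic structure expressed through its core: the composition law for \<open>p t\<close>, with the closed part
  recovered from its mate by \<open>minvP_Iso\<close>.\<close>

lemma glued_formula:
  assumes ext: "ext_tensor S H (Ar S) B m" and t: "t \<in> Cl2" and p: "p \<in> Sm2" and d: "Cod SS t = Dom SS p"
    and A: "A \<in> Ob (pF (Cod SS p))"
  shows "at m (p \<cdot>\<^bsub>SS\<^esub> t) A = inv_ar (bF (Dom SS t)) (conn H (px t) (px p) (Fo (Cod SS p) A)) \<cdot>\<^bsub>bF (Dom SS t)\<^esub>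
     pba H (px t) (at m p A) \<cdot>\<^bsub>bF (Dom SS t)\<^esub> inv_ar (bF (Dom SS t)) (minvP t (at (mbar_of S H B m) t) (pO p A)) \<cdot>\<^bsub>bF (Dom SS t)\<^esub>
     Fa (Dom SS t) (pC t p A)"
proof -
  interpret X: category SS by (rule category_SS)
  note fi = ext_tensorD(1)[OF ext] and coc = ext_tensorD(2)[OF ext]
  have ar: "t \<in> Ar SS" "p \<in> Ar SS" using t p Cl2_Ar Sm2_Ar by auto
  have pA: "pO p A \<in> Ob (pF (Cod SS t))" using A ar d by simp
  have "inv_ar (bF (Dom SS t)) (minvP t (at (mbar_of S H B m) t) (pO p A)) = at m t (pO p A)"
    by (rule minvP_Iso(2)[OF t fi[OF ar(1)] _ _ pA])
      (use mbarP_mate[OF t fi[OF ar(1)]] mbarP_low_fam[OF t fi[OF ar(1)]] in \<open>simp_all add: at_mbar_of'\<close>)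
  moreover have "at m (p \<cdot>\<^bsub>SS\<^esub> t) A = pairs.star t p (at m t) (at m p) A"
    by (rule cocycle_star_eq[symmetric, OF _ _ _ ar d A coc[OF ar d A]]) (use fam_isoD(1)[OF fi] ar d in simp_all)
  ultimately show ?thesis using A by (simp add: pairs.star_def)
qed

section \<open>From a core to a localic structure\<close>

lemma cartesian_SS:
  assumes "Sq2 a b f g" shows "cartesian SS a b f g"
proof -
  interpret X: category SS by (rule category_SS)
  have c: "cartesian S (fst a) (fst b) (fst f) (fst g)" "cartesian S (snd a) (snd b) (snd f) (snd g)"
    using assms by (auto simp: Sq2_def)
  note D = cartesianD[OF c(1)] cartesianD[OF c(2)]
  show ?thesis
  proof (rule category.cartesianI[OF category_SS])
    fix x y assume xy: "x \<in> Ar SS" "y \<in> Ar SS" "Dom SS x = Dom SS y" "Cod SS x = Dom SS f" "Cod SS y = Dom SS g" "f \<cdot>\<^bsub>SS\<^esub> x = g \<cdot>\<^bsub>SS\<^esub> y"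
    obtain h1 where h1: "h1 \<in> Ar S" "Dom S h1 = Dom S (fst x)" "Cod S h1 = Dom S (fst a)" "fst a \<cdot>\<^bsub>S\<^esub> h1 = fst x" "fst b \<cdot>\<^bsub>S\<^esub> h1 = fst y"
      using cartesian_factor[OF c(1), of "fst x" "fst y", OF _ _ _ _ _ _ refl refl] xy by (auto simp: SS_simps)
    obtain h2 where h2: "h2 \<in> Ar S" "Dom S h2 = Dom S (snd x)" "Cod S h2 = Dom S (snd a)" "snd a \<cdot>\<^bsub>S\<^esub> h2 = snd x" "snd b \<cdot>\<^bsub>S\<^esub> h2 = snd y"
      using cartesian_factor[OF c(2), of "snd x" "snd y", OF _ _ _ _ _ _ refl refl] xy by (auto simp: SS_simps)
    show "\<exists>h. h \<in> Ar SS \<and> Dom SS h = Dom SS x \<and> Cod SS h = Dom SS a \<and> a \<cdot>\<^bsub>SS\<^esub> h = x \<and> b \<cdot>\<^bsub>SS\<^esub> h = y"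
      by (intro exI[of _ "(h1, h2)"]) (simp add: SS_simps h1 h2)
  next
    fix h h' assume h: "h \<in> Ar SS" "h' \<in> Ar SS" "Dom SS h = Dom SS h'" "Cod SS h = Dom SS a" "Cod SS h' = Dom SS a" "a \<cdot>\<^bsub>SS\<^esub> h = a \<cdot>\<^bsub>SS\<^esub> h'" "b \<cdot>\<^bsub>SS\<^esub> h = b \<cdot>\<^bsub>SS\<^esub> h'"
    have "fst h = fst h'" by (rule cartesian_eq[OF c(1)]) (use h in \<open>simp_all add: SS_simps\<close>)
    moreover have "snd h = snd h'" by (rule cartesian_eq[OF c(2)]) (use h in \<open>simp_all add: SS_simps\<close>)
    ultimately show "h = h'" by (simp add: prod_eq_iff)
  qed (use D in \<open>simp_all add: SS_simps\<close>)
qed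

text \<open>Inverting \<open>minvP\<close> turns \<open>mb\<close> into families over the pairs of closed immersions, first for the elementary
  ones and then, by the composition law, for all of them. Together with \<open>ms\<close> they form the two sections
  to which the extension theorem applies.\<close>

lemma core_imp_localic:
  assumes ext: "ext_tensor S H (Sm S) B ms" and sh: "tensor_shift_compatible S H (Sm S) B ms" and sa: "smooth_adjointable S H B ms"
    and cl: "ext_tensor_cl_op S H B mb" and clsh: "tensor_cl_op_shift_compatible S H B mb"
    and bc: "core_base_change S H B ms mb" and tri: "core_triangles S H B ms mb"
  shows "\<exists>m. ext_tensor S H (Ar S) B m \<and> tensor_shift_compatible S H (Ar S) B m \<and> smooth_adjointable S H B m \<and>
    (\<forall>p\<in>Sm2. \<forall>A\<in>Ob (pF (Cod SS p)). at m p A = at ms p A) \<and>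
    (\<forall>z\<in>Cl2. \<forall>A\<in>Ob (pF (Dom SS z)). at (mbar_of S H B m) z A = at mb z A)"
proof -
  interpret X: category SS by (rule category_SS)
  have sfi: "fam_iso p (at ms p)" if "p \<in> Sm2" for p
    using ext that unfolding ext_tensor_iff Sm2_def by blast
  have scoc: "pairs.cocycle_at f g (at ms f) (at ms g) (at ms (g \<cdot>\<^bsub>SS\<^esub> f)) A"
    if "f \<in> Sm2" "g \<in> Sm2" "Cod SS f = Dom SS g" "A \<in> Ob (pF (Cod SS g))" for f g A
    using ext that unfolding ext_tensor_iff Sm2_def by blast
  have sshc: "shc l f (at ms f) A" if "f \<in> Sm2" "A \<in> Ob (pF (Cod SS f))" for f A l
    using sh that unfolding tensor_shift_compatible_iff Sm2_def by blast
  have lf: "low_fam z (at mb z)" if "z \<in> Cl2" for z using cl that unfolding ext_tensor_cl_op_iff by blast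
  have biso: "at mb z A \<in> Iso (bF (Cod SS z))" if "z \<in> Cl2" "A \<in> Ob (pF (Dom SS z))" for z A using cl that unfolding ext_tensor_cl_op_iff by blast
  have lc: "low_cocycle z w (at mb z) (at mb w) (at mb (w \<cdot>\<^bsub>SS\<^esub> z)) A"
    if "z \<in> Cl2" "w \<in> Cl2" "Cod SS z = Dom SS w" "A \<in> Ob (pF (Dom SS z))" for z w A using cl that unfolding ext_tensor_cl_op_iff by blast
  have lsh: "low_shc l z (at mb z) A" if "z \<in> Cl2" "A \<in> Ob (pF (Dom SS z))" for z A l
    using clsh that unfolding tensor_cl_op_shift_compatible_iff by blast
  let ?g = "\<lambda>z A. inv_ar (bF (Dom SS z)) (minvP z (at mb z) A)"
  have comp: "w \<cdot>\<^bsub>SS\<^esub> z \<in> Cl2" if "z \<in> Cl2" "w \<in> Cl2" "Cod SS z = Dom SS w" for z w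
    using that by (auto simp: Cl2_def SS_simps)
  have star_mate: "fam_iso (w \<cdot>\<^bsub>SS\<^esub> z) (pairs.star z w \<alpha>z \<alpha>w)"
    "A \<in> Ob (pF (Dom SS z)) \<Longrightarrow> mate (w \<cdot>\<^bsub>SS\<^esub> z) (pairs.star z w \<alpha>z \<alpha>w) (at mb (w \<cdot>\<^bsub>SS\<^esub> z)) A"
    if z: "z \<in> Cl2" "w \<in> Cl2" "Cod SS z = Dom SS w" and fi: "fam_iso z \<alpha>z" "fam_iso w \<alpha>w"
      and M: "\<And>A. A \<in> Ob (pF (Dom SS z)) \<Longrightarrow> mate z \<alpha>z (at mb z) A" "\<And>A. A \<in> Ob (pF (Dom SS w)) \<Longrightarrow> mate w \<alpha>w (at mb w) A"
    for z w \<alpha>z \<alpha>w A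
  proof -
    have ar: "z \<in> Ar SS" "w \<in> Ar SS" using z Cl2_Ar by auto
    have v: "w \<cdot>\<^bsub>SS\<^esub> z \<in> Cl2" by (rule comp[OF z])
    have vd: "Dom SS (w \<cdot>\<^bsub>SS\<^esub> z) = Dom SS z" "Cod SS (w \<cdot>\<^bsub>SS\<^esub> z) = Cod SS w" using ar z by simp_all
    note F = fam_isoD(1)[OF fi(1)] fam_isoD(1)[OF fi(2)]
    show fiv: "fam_iso (w \<cdot>\<^bsub>SS\<^esub> z) (pairs.star z w \<alpha>z \<alpha>w)"
      unfolding fam_iso_def vd
    proof (intro conjI ballI)
      show "pairs.family (w \<cdot>\<^bsub>SS\<^esub> z) (pairs.star z w \<alpha>z \<alpha>w)" by (rule pairs.star_family[OF F ar z(3)])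
      fix A assume A: "A \<in> Ob (pF (Cod SS w))"
      show "pairs.star z w \<alpha>z \<alpha>w A \<in> Iso (bF (Dom SS z))"
        by (rule pairs.star_Iso[OF F ar z(3) A]) (use fam_isoD(2)[OF fi(1), of "pO w A"] fam_isoD(2)[OF fi(2) A] A ar z in simp_all)
    qed
    assume A: "A \<in> Ob (pF (Dom SS z))"
    have A': "A \<in> Ob (pF (Dom SS (w \<cdot>\<^bsub>SS\<^esub> z)))" using A vd by simp
    note b = low_famD[OF lf[OF v] A' vd(2)[symmetric], unfolded vd]
    have r: "rO z A \<in> Ob (pF (Dom SS w))" using rO_Ob[OF z(1) A] z(3) by simp
    have rv: "rO (w \<cdot>\<^bsub>SS\<^esub> z) A \<in> Ob (pF (Cod SS w))" using rO_Ob[OF v A'] vd by simp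
    show "mate (w \<cdot>\<^bsub>SS\<^esub> z) (pairs.star z w \<alpha>z \<alpha>w) (at mb (w \<cdot>\<^bsub>SS\<^esub> z)) A"
      using mate_composition_iff[where \<beta>v = "at mb (w \<cdot>\<^bsub>SS\<^esub> z)" and \<beta>w = "at mb w" and \<beta>z = "at mb z" and A = A, OF z A fi(2,1) fiv lf[OF z(2)] lf[OF z(1)] b M(2)[OF r] M(1)[OF A] pairs.star_cocycle[OF F ar z(3) rv]]
        lc[OF z A] unfolding low_cocycle_def by blast
  qed
  have mi: "minvP z (at mb z) A \<in> Iso (bF (Dom SS z))" if z: "z \<in> Cl2" and A: "A \<in> Ob (pF (Cod SS z))" for z A
  proof -
    obtain w z' uw uz where e: "elementary w uw" "elementary z' uz" and d: "Cod SS z' = Dom SS w" "z = w \<cdot>\<^bsub>SS\<^esub> z'" "Cod SS w = Cod SS z" "Dom SS z' = Dom SS z"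
      by (rule elementary_factorization[OF z])
    note w = elementary[OF e(1)] and z' = elementary[OF e(2)]
    have ei: "minvP y (at mb y) A \<in> Iso (bF (Dom SS y))" if "elementary y u" "A \<in> Ob (pF (Cod SS y))" for y u A
      by (rule elementary_minvP_Iso[OF that(1) lf[OF elementary(1)[OF that(1)]] biso[OF elementary(1)[OF that(1)]]
          sfi[OF elementary(2)[OF that(1)]] sa that(2)])
    note g1 = minvP_mate[OF z'(1) lf[OF z'(1)] ei[OF e(2)]] and g2 = minvP_mate[OF w(1) lf[OF w(1)] ei[OF e(1)]]
    note sm = star_mate[OF z'(1) w(1) d(1) g1(1) g2(1) g1(2) g2(2)]
    show ?thesis
      by (rule minvP_Iso(1)[OF z sm(1)[folded d(2)] sm(2)[folded d(2)] lf[OF z] A]) (use d(4) in simp_all)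
  qed
  have cfi: "fam_iso z (?g z)" if "z \<in> Cl2" for z by (rule minvP_mate(1)[OF that lf[OF that] mi[OF that]])
  have cM: "mate z (?g z) (at mb z) A" if "z \<in> Cl2" "A \<in> Ob (pF (Dom SS z))" for z A
    by (rule minvP_mate(2)[OF that(1) lf[OF that(1)] mi[OF that(1)] that(2)])
  have ccoc: "pairs.star z w (?g z) (?g w) A = ?g (w \<cdot>\<^bsub>SS\<^esub> z) A"
    if z: "z \<in> Cl2" "w \<in> Cl2" "Cod SS z = Dom SS w" and A: "A \<in> Ob (pF (Cod SS w))" for z w A
  proof -
    have ar: "z \<in> Ar SS" "w \<in> Ar SS" using z Cl2_Ar by auto
    have v: "w \<cdot>\<^bsub>SS\<^esub> z \<in> Cl2" by (rule comp[OF z])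
    note sm = star_mate[OF z cfi[OF z(1)] cfi[OF z(2)] cM[OF z(1)] cM[OF z(2)]]
    show ?thesis
      by (rule minvP_Iso(2)[OF v sm lf[OF v], symmetric]) (use A ar z in simp_all)
  qed
  have cshc: "shc l z (?g z) A" if "z \<in> Cl2" "A \<in> Ob (pF (Cod SS z))" for z A l
    by (rule low_shc_iff(2)[OF that(1) cfi[OF that(1)] lf[OF that(1)] cM[OF that(1)] that(2) lsh[OF that(1) pO_Ob[OF that]]])
  let ?s = "\<lambda>p. restrict (at ms p) (Ob (pF (Cod SS p)))" and ?c = "\<lambda>z. restrict (?g z) (Ob (pF (Cod SS z)))"
  have Smw: "wide_subcategory SS Sm2" and Clw: "wide_subcategory SS Cl2"
    using Sm_subcategory Cl_subcategory by (auto simp: wide_subcategory_def Sm2_def Cl2_def SS_simps)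
  interpret E: two_sections SS Sm2 Cl2 Sq2 pairs.families pairs.star ?s ?c
  proof (intro two_sections.intro two_sections_axioms.intro category_SS Smw Clw)
    fix p f assume p: "p \<in> Sm2" and f: "f \<in> Ar SS" and d: "Cod SS f = Cod SS p"
    then have c: "fst p \<in> Sm S" "snd p \<in> Sm S" "fst f \<in> Ar S" "snd f \<in> Ar S" "Cod S (fst f) = Cod S (fst p)" "Cod S (snd f) = Cod S (snd p)"
      by (auto simp: Sm2_def SS_simps)
    obtain f1 p1 f2 p2 where "cartesian S f1 p1 (fst p) (fst f)" "cartesian S f2 p2 (snd p) (snd f)"
      using smooth_fibre_product[OF c(1,3,5)] smooth_fibre_product[OF c(2,4,6)] by blast
    then have "Sq2 (f1, f2) (p1, p2) p f" by (simp add: Sq2_def)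
    then show "\<exists>f' p'. Sq2 f' p' p f" by blast
  next
    show "cartesian SS a b f g" if "Sq2 a b f g" for a b f g by (rule cartesian_SS[OF that])
    show "p' \<in> Sm2" if "Sq2 f' p' p f" "p \<in> Sm2" for f' p' p f
      using that smooth_base_change unfolding Sq2_def Sm2_def mem_Times_iff by blast
    show "f' \<in> Sm2" if "Sq2 f' p' p f" "f \<in> Sm2" for f' p' p f
      using that smooth_base_change cartesian_flip unfolding Sq2_def Sm2_def mem_Times_iff by blast
    show "z' \<in> Cl2" if "Sq2 z' p' p z" "p \<in> Sm2" "z \<in> Cl2" for z' p' p z using Sq2D(1)[OF that] .
    show "z \<in> Cl2" if "z \<in> Ar SS" "g \<in> Ar SS" "Cod SS z = Dom SS g" "g \<cdot>\<^bsub>SS\<^esub> z \<in> Cl2" for z g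
      using that closed_cancel[of "fst z" "fst g"] closed_cancel[of "snd z" "snd g"] by (auto simp: SS_simps Cl2_def mem_Times_iff)
    show "\<exists>t\<in>Cl2. \<exists>p\<in>Sm2. Cod SS t = Dom SS p \<and> f = p \<cdot>\<^bsub>SS\<^esub> t" if f: "f \<in> Ar SS" for f
    proof -
      have c: "fst f \<in> Ar S" "snd f \<in> Ar S" using f by (auto simp: SS_simps)
      obtain t1 p1 where 1: "t1 \<in> Cl S" "p1 \<in> Sm S" "Cod S t1 = Dom S p1" "fst f = p1 \<cdot>\<^bsub>S\<^esub> t1" using factorization[OF c(1)] by blast
      obtain t2 p2 where 2: "t2 \<in> Cl S" "p2 \<in> Sm S" "Cod S t2 = Dom S p2" "snd f = p2 \<cdot>\<^bsub>S\<^esub> t2" using factorization[OF c(2)] by blast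
      show ?thesis
        by (intro bexI[of _ "(t1, t2)"] bexI[of _ "(p1, p2)"]) (use 1 2 in \<open>simp_all add: SS_simps Cl2_def Sm2_def prod_eq_iff\<close>)
    qed
    show "pairs.star f g \<alpha> \<beta> \<in> pairs.families (g \<cdot>\<^bsub>SS\<^esub> f)"
      if "f \<in> Ar SS" "g \<in> Ar SS" "Cod SS f = Dom SS g" "\<alpha> \<in> pairs.families f" "\<beta> \<in> pairs.families g" for f g \<alpha> \<beta>
      by (rule pairs.star_families) (fact that)+
    show "pairs.star (g \<cdot>\<^bsub>SS\<^esub> f) h (pairs.star f g \<alpha> \<beta>) \<gamma> = pairs.star f (h \<cdot>\<^bsub>SS\<^esub> g) \<alpha> (pairs.star g h \<beta> \<gamma>)"
      if "f \<in> Ar SS" "g \<in> Ar SS" "h \<in> Ar SS" "Cod SS f = Dom SS g" "Cod SS g = Dom SS h"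
        "\<alpha> \<in> pairs.families f" "\<beta> \<in> pairs.families g" "\<gamma> \<in> pairs.families h" for f g h \<alpha> \<beta> \<gamma>
      using pairs.star_assoc[OF that(1-5)] that(6-8) by (simp add: pairs.families_def)
    show "?s p \<in> pairs.families p" if "p \<in> Sm2" for p by (rule pairs.restrict_families[OF fam_isoD(1)[OF sfi[OF that]] Sm2_Ar[OF that]])
    show "?c z \<in> pairs.families z" if "z \<in> Cl2" for z by (rule pairs.restrict_families[OF fam_isoD(1)[OF cfi[OF that]] Cl2_Ar[OF that]])
    show "?s (q \<cdot>\<^bsub>SS\<^esub> p) = pairs.star p q (?s p) (?s q)" if "p \<in> Sm2" "q \<in> Sm2" "Cod SS p = Dom SS q" for p q
    proof (rule pairs.restrict_eq_star)
      show "pairs.family (q \<cdot>\<^bsub>SS\<^esub> p) (at ms (q \<cdot>\<^bsub>SS\<^esub> p))"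
        using Smw that by (intro fam_isoD(1)[OF sfi]) (simp add: wide_subcategory_def)
    qed (use that fam_isoD(1)[OF sfi] Sm2_Ar scoc in auto)
    show "?c (w \<cdot>\<^bsub>SS\<^esub> z) = pairs.star z w (?c z) (?c w)" if z: "z \<in> Cl2" "w \<in> Cl2" "Cod SS z = Dom SS w" for z w
    proof (rule pairs.restrict_eq_star[OF fam_isoD(1)[OF cfi[OF z(1)]] fam_isoD(1)[OF cfi[OF z(2)]] fam_isoD(1)[OF cfi[OF comp[OF z]]] Cl2_Ar[OF z(1)] Cl2_Ar[OF z(2)] z(3)])
      fix A assume A: "A \<in> Ob (pF (Cod SS w))"
      show "pairs.cocycle_at z w (?g z) (?g w) (?g (w \<cdot>\<^bsub>SS\<^esub> z)) A"
        using pairs.star_cocycle[OF fam_isoD(1)[OF cfi[OF z(1)]] fam_isoD(1)[OF cfi[OF z(2)]] Cl2_Ar[OF z(1)] Cl2_Ar[OF z(2)] z(3) A]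
        unfolding pairs.cocycle_at_def ccoc[OF z A] .
    qed
    show "?s (Idn SS x) = ?c (Idn SS x)" if x: "x \<in> Ob SS" for x
    proof -
      let ?i = "Idn SS x"
      have i: "?i \<in> Sm2" "?i \<in> Cl2" using Smw Clw x by (auto simp: wide_subcategory_def)
      have id: "?i \<in> Ar SS" "Cod SS ?i = x" "Dom SS ?i = x" "?i \<cdot>\<^bsub>SS\<^esub> ?i = ?i" using x by simp_all
      note F = fam_isoD(1)[OF sfi[OF i(1)]] fam_isoD(1)[OF cfi[OF i(2)]]
      \<comment> \<open>The connection isomorphisms at an identity are not assumed to be trivial, so neither side is known to be
        an identity. But \<open>star\<close> of the smooth value with itself, and of the closed value with the smooth one by
        the triangle condition, are both the smooth value.\<close>
      have "at ms ?i A = ?g ?i A" if A: "A \<in> Ob (pF x)" for A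
      proof -
        have A': "A \<in> Ob (pF (Cod SS ?i))" using A id by simp
        have "Cod SS ?i = Dom SS ?i" using id by simp
        note cd = this
        have ii: "?i \<cdot>\<^bsub>SS\<^esub> ?i \<in> Sm2" unfolding id(4) by (rule i(1))
        have e1: "pairs.star ?i ?i (at ms ?i) (at ms ?i) A = at ms ?i A"
          using pairs.cocycle_imp_star[OF F(1,1) id(1,1) cd A' _ scoc[OF i(1,1) cd A'], unfolded id(4)] F(1) by simp
        have "pairs.cocycle_at ?i ?i (?g ?i) (at ms ?i) (at ms (?i \<cdot>\<^bsub>SS\<^esub> ?i)) A"
          using tri[unfolded core_triangles_iff] i cd A' ii by blast
        then have e2: "pairs.star ?i ?i (?g ?i) (at ms ?i) A = at ms ?i A"
          using pairs.cocycle_imp_star[OF F(2,1) id(1,1) cd A', of "at ms ?i"] F(1) unfolding id(4) by simp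
        have "at ms ?i (pO ?i A) = ?g ?i (pO ?i A)"
          by (rule pairs.star_cancel[OF F(1) F(2) F(1) id(1,1) cd A']) (use fam_isoD(2)[OF sfi[OF i(1)] A' refl] id e1 e2 in simp_all)
        moreover have "pO ?i A = A"
          using x A by (simp add: SS_simps pF_simps p_defs pbo_Idn prod_eq_iff)
        ultimately show ?thesis by simp
      qed
      then show ?thesis using id by (auto simp: restrict_def fun_eq_iff)
    qed
    show "pairs.star z' p (?c z') (?s p) = pairs.star p' z (?s p') (?c z)" if s: "Sq2 z' p' p z" "p \<in> Sm2" "z \<in> Cl2" for z' p' p z
    proof -
      note D = Sq2D[OF s]
      have ar: "z \<in> Ar SS" "z' \<in> Ar SS" "p \<in> Ar SS" "p' \<in> Ar SS" using D s Cl2_Ar Sm2_Ar by auto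
      have cc: "Cod SS p = Cod SS z" using arg_cong[OF D(6), of "Cod SS"] ar D(1-5) by simp
      note F = fam_isoD(1)[OF sfi[OF s(2)]] fam_isoD(1)[OF sfi[OF D(2)]]
      have "pairs.star z' p (?g z') (at ms p) A = pairs.star p' z (at ms p') (?g z) A" for A
      proof (cases "A \<in> Ob (pF (Cod SS z))")
        case A: True
        have "low_square' z' p' p z (at ms p) (at ms p') (at mb z) (at mb z') (pO z A)"
          using bc s pO_Ob[OF s(3) A] unfolding core_base_change_iff by blast
        then have "low_square z' p' p z (at ms p) (at ms p') (at mb z) (at mb z') (pO z A)"
          using low_square_iff[OF s F(2) lf[OF D(1)] pO_Ob[OF s(3) A]] by blast
        then show ?thesis
          using base_change_iff(2)[OF s(3) D(1) ar(3,4) D(3-6) cfi[OF s(3)] cfi[OF D(1)] F lf[OF s(3)] lf[OF D(1)] cM[OF s(3)] cM[OF D(1)] A]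
          by blast
      qed (use cc in \<open>simp add: pairs.star_def\<close>)
      then have "pairs.star z' p (?g z') (at ms p) = pairs.star p' z (at ms p') (?g z)" by (rule HOL.ext)
      moreover have "pairs.star z' p (?c z') (?s p) = pairs.star z' p (?g z') (at ms p)"
        by (rule pairs.star_cong) (use ar D in simp_all)
      moreover have "pairs.star p' z (?s p') (?c z) = pairs.star p' z (at ms p') (?g z)"
        by (rule pairs.star_cong) (use ar D in simp_all)
      ultimately show ?thesis by simp
    qed
    show "?s (p \<cdot>\<^bsub>SS\<^esub> h) = pairs.star h p (?c h) (?s p)" if h: "h \<in> Cl2" "p \<in> Sm2" "Cod SS h = Dom SS p" "p \<cdot>\<^bsub>SS\<^esub> h \<in> Sm2" for h p
      by (rule pairs.restrict_eq_star[OF fam_isoD(1)[OF cfi[OF h(1)]] fam_isoD(1)[OF sfi[OF h(2)]] fam_isoD(1)[OF sfi[OF h(4)]] Cl2_Ar[OF h(1)] Sm2_Ar[OF h(2)] h(3)])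
        (use tri h in \<open>unfold core_triangles_iff, blast\<close>)
  qed
  define m where "m = (\<lambda>f1 f2 A1 A2. E.ext (f1, f2) (A1, A2))"
  have at: "at m f = E.ext f" for f by (rule HOL.ext) (simp add: at_def m_def)
  have fs: "\<exists>t p. t \<in> Cl2 \<and> p \<in> Sm2 \<and> Cod SS t = Dom SS p \<and> f = p \<cdot>\<^bsub>SS\<^esub> t \<and> E.ext f = pairs.star t p (?g t) (at ms p)" if f: "f \<in> Ar SS" for f
  proof -
    obtain t p where tp: "t \<in> Cl2" "p \<in> Sm2" "Cod SS t = Dom SS p" "f = p \<cdot>\<^bsub>SS\<^esub> t" using E.factorization[OF f] by blast
    have "pairs.star t p (?c t) (?s p) = pairs.star t p (?g t) (at ms p)"
      by (rule pairs.star_cong) (use tp Cl2_Ar Sm2_Ar in simp_all)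
    then show ?thesis using E.ext_factorization[OF tp(1-3)] tp by metis
  qed
  have efi: "fam_iso f (at m f)" if f: "f \<in> Ar SS" for f
  proof -
    obtain t p where tp: "t \<in> Cl2" "p \<in> Sm2" "Cod SS t = Dom SS p" "f = p \<cdot>\<^bsub>SS\<^esub> t" "E.ext f = pairs.star t p (?g t) (at ms p)" using fs[OF f] by blast
    have ar: "t \<in> Ar SS" "p \<in> Ar SS" using tp Cl2_Ar Sm2_Ar by auto
    note F = fam_isoD(1)[OF cfi[OF tp(1)]] fam_isoD(1)[OF sfi[OF tp(2)]]
    have fd: "Dom SS f = Dom SS t" "Cod SS f = Cod SS p" using tp(3,4) ar by simp_all
    show ?thesis unfolding at fam_iso_def fd
    proof (intro conjI ballI)
      show "pairs.family f (E.ext f)" unfolding tp(4,5)[unfolded tp(4)] using pairs.star_family[OF F ar tp(3)] tp(5) tp(4) by simp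
      fix A assume A: "A \<in> Ob (pF (Cod SS p))"
      have pA: "pO p A \<in> Ob (pF (Cod SS t))" using A ar tp(3) by simp
      show "E.ext f A \<in> Iso (bF (Dom SS t))" unfolding tp(5)
        by (rule pairs.star_Iso[OF F ar tp(3) A]) (use fam_isoD(2)[OF cfi[OF tp(1)] pA refl] fam_isoD(2)[OF sfi[OF tp(2)] A refl] tp(3) in simp_all)
    qed
  qed
  have em: "ext_tensor S H (Ar S) B m"
    unfolding ext_tensor_iff
  proof (intro conjI ballI impI)
    show "fam_iso f (at m f)" if "f \<in> Ar S \<times> Ar S" for f using efi that by (simp add: SS_simps mem_Times_iff)
    fix f g A assume "f \<in> Ar S \<times> Ar S" "g \<in> Ar S \<times> Ar S" and c: "Cod SS f = Dom SS g" and A: "A \<in> Ob (pF (Cod SS g))"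
    then have fg: "f \<in> Ar SS" "g \<in> Ar SS" by (auto simp: SS_simps)
    show "pairs.cocycle_at f g (at m f) (at m g) (at m (g \<cdot>\<^bsub>SS\<^esub> f)) A"
      unfolding at E.ext_cmp[OF fg c]
      by (rule pairs.star_cocycle[OF _ _ fg c A]) (use fam_isoD(1)[OF efi] fg in \<open>simp_all add: at\<close>)
  qed
  have shm: "tensor_shift_compatible S H (Ar S) B m"
    unfolding tensor_shift_compatible_iff
  proof (intro ballI allI)
    fix f A l assume "f \<in> Ar S \<times> Ar S" and A: "A \<in> Ob (pF (Cod SS f))"
    then have f: "f \<in> Ar SS" by (auto simp: SS_simps)
    obtain t p where tp: "t \<in> Cl2" "p \<in> Sm2" "Cod SS t = Dom SS p" "f = p \<cdot>\<^bsub>SS\<^esub> t" "E.ext f = pairs.star t p (?g t) (at ms p)" using fs[OF f] by blast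
    show "shc l f (at m f) A" unfolding at tp(5) unfolding tp(4)
      by (rule star_shc[OF fam_isoD(1)[OF cfi[OF tp(1)]] fam_isoD(1)[OF sfi[OF tp(2)]] Cl2_Ar[OF tp(1)] Sm2_Ar[OF tp(2)] tp(3)])
        (use cshc[OF tp(1)] sshc[OF tp(2)] A tp(4) in simp_all)
  qed
  have msm: "at m p A = at ms p A" if "p \<in> Sm2" "A \<in> Ob (pF (Cod SS p))" for p A
    unfolding at E.ext_Sm[OF that(1)] using that(2) by simp
  have mcl: "at m z A = ?g z A" if "z \<in> Cl2" "A \<in> Ob (pF (Cod SS z))" for z A
    unfolding at E.ext_Cl[OF that(1)] using that(2) by simp
  have sam: "smooth_adjointable S H B m"
    unfolding smooth_adjointable_def
  proof (intro ballI)
    fix p1 p2 A1 A2 assume p: "p1 \<in> Sm S" "p2 \<in> Sm S" and A: "A1 \<in> Ob (Fib H (Dom S p1))" "A2 \<in> Ob (Fib H (Dom S p2))"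
    interpret P1: adj "Fib H (Dom S p1)" "Fib H (Cod S p1)" "sho H p1" "sha H p1" "pbo H p1" "pba H p1" "sh_unit H p1" "sh_counit H p1"
      by (rule sharp[OF p(1) refl refl])
    interpret P2: adj "Fib H (Dom S p2)" "Fib H (Cod S p2)" "sho H p2" "sha H p2" "pbo H p2" "pba H p2" "sh_unit H p2" "sh_counit H p2"
      by (rule sharp[OF p(2) refl refl])
    have "m p1 p2 (sho H p1 A1) (sho H p2 A2) = ms p1 p2 (sho H p1 A1) (sho H p2 A2)"
      using msm[of "(p1, p2)" "(sho H p1 A1, sho H p2 A2)"] p A by (simp add: Sm2_def pF_simps SS_simps at_def)
    then have "sharp_box S H B m p1 p2 A1 A2 = sharp_box S H B ms p1 p2 A1 A2" by (simp add: sharp_box_def)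
    then show "sharp_box S H B m p1 p2 A1 A2 \<in> Iso (Fib H (Pr S (Cod S p1) (Cod S p2)))"
      using sa p A by (simp add: smooth_adjointable_def)
  qed
  have mbm: "at (mbar_of S H B m) z A = at mb z A" if z: "z \<in> Cl2" and A: "A \<in> Ob (pF (Dom SS z))" for z A
  proof -
    note fz = efi[OF Cl2_Ar[OF z]]
    have "mate z (at m z) (at mb z) A"
      using cM[OF z A] mcl[OF z rO_Ob[OF z A]] by (simp add: mate_def)
    then show ?thesis
      unfolding at_mbar_of
      by (intro mate_unique[OF z fz A mbarP_mate[OF z fz A] _ mbarP_low_fam[OF z fz] lf[OF z]])
  qed
  show ?thesis using em shm sam msm mbm by blast
qed

end

section \<open>The correspondence\<close>

text \<open>All the conditions depend only on the components of the \<open>box\<close> record, not on the record type extending it.\<close>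

lemma box_predicates_cong:
  assumes "bxo B = bxo B'" "bxa B = bxa B'" "bxl B = bxl B'" "bxr B = bxr B'"
  shows "ext_tensor S H M B m \<longleftrightarrow> ext_tensor S H M B' m"
    and "box_functors S H B \<longleftrightarrow> box_functors S H B'" and "box_triangulated S H B \<longleftrightarrow> box_triangulated S H B'"
    and "tensor_shift_compatible S H M B m \<longleftrightarrow> tensor_shift_compatible S H M B' m"
    and "smooth_adjointable S H' B m \<longleftrightarrow> smooth_adjointable S H' B' m"
    and "ext_tensor_cl_op S H' B mb \<longleftrightarrow> ext_tensor_cl_op S H' B' mb"
    and "tensor_cl_op_shift_compatible S H' B mb \<longleftrightarrow> tensor_cl_op_shift_compatible S H' B' mb"
    and "core_base_change S H' B m mb \<longleftrightarrow> core_base_change S H' B' m mb"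
    and "core_triangles S H' B m mb \<longleftrightarrow> core_triangles S H' B' m mb"
    and "mbar_of S H' B m = mbar_of S H' B' m"
  using assms
  by (simp_all add: ext_tensor_def box_functors_def box_triangulated_def tensor_shift_compatible_def
      smooth_adjointable_def sharp_box_def ext_tensor_cl_op_def tensor_cl_op_shift_compatible_def
      core_base_change_def core_triangles_def mcl_of_def mbar_of_def fun_eq_iff)

context localic_over_base
begin

lemma box_overI:
  assumes "ext_tensor S H M B m" "box_triangulated S H B"
  shows "box_over S H B"
  using assms localic_over_base_axioms by (simp add: box_over_def box_over_axioms_def ext_tensor_def)

lemma localic_ext_tensor_core:
  assumes "localic_ext_tensor S H T"
  shows "ext_tensor_core S H (core_of S H T)"
proof -
  have T: "ext_tensor S H (Ar S) T (mten T)" "box_triangulated S H T" "tensor_shift_compatible S H (Ar S) T (mten T)"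
    "smooth_adjointable S H T (mten T)"
    using assms by (simp_all add: localic_ext_tensor_def tri_ext_tensor_def)
  interpret box_over S H T by (rule box_overI[OF T(1,2)])
  have sub: "Sm S \<times> Sm S \<subseteq> Ar S \<times> Ar S" using Sm_subcategory unfolding wide_subcategory_def by blast
  have "ext_tensor S H (Sm S) T (mten T)"
    using T(1) sub unfolding ext_tensor_iff by (meson subsetD)
  moreover have "tensor_shift_compatible S H (Sm S) T (mten T)"
    using T(3) sub unfolding tensor_shift_compatible_iff by (meson subsetD)
  moreover note T(2,4) localic_imp_core[OF T(1,3)]
  moreover have K: "bxo (core_of S H T) = bxo T" "bxa (core_of S H T) = bxa T" "bxl (core_of S H T) = bxl T" "bxr (core_of S H T) = bxr T"
    and m: "msm (core_of S H T) = mten T" "mbcl (core_of S H T) = mbar_of S H T (mten T)"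
    by (simp_all add: core_of_def)
  ultimately show ?thesis
    unfolding ext_tensor_core_def tri_ext_tensor_def tri_ext_tensor_cl_op_def box_predicates_cong[OF K] m by blast
qed

text \<open>The formula \<open>glued_formula\<close> evaluates \<open>\<boxtimes>\<close>, the smooth part and the mates only at arguments at which
  \<open>same_core\<close> compares them.\<close>

lemma localic_determined_by_core:
  assumes T: "localic_ext_tensor S H T" and T': "localic_ext_tensor S H T'"
    and same: "same_core S H (core_of S H T) (core_of S H T')"
  shows "same_tensor S H T T'"
  unfolding same_tensor_def
proof (intro conjI ballI)
  have eq_bx: "bxo T S1 S2 A1 A2 = bxo T' S1 S2 A1 A2" "bxl T S1 S2 A1 A2 = bxl T' S1 S2 A1 A2" "bxr T S1 S2 A1 A2 = bxr T' S1 S2 A1 A2"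
    if "S1 \<in> Ob S" "S2 \<in> Ob S" "A1 \<in> Ob (Fib H S1)" "A2 \<in> Ob (Fib H S2)" for S1 S2 A1 A2
    using same that by (simp_all add: same_core_def same_box_def core_of_def)
  have eq_bxa: "bxa T S1 S2 \<phi>1 \<phi>2 = bxa T' S1 S2 \<phi>1 \<phi>2"
    if "S1 \<in> Ob S" "S2 \<in> Ob S" "\<phi>1 \<in> Ar (Fib H S1)" "\<phi>2 \<in> Ar (Fib H S2)" for S1 S2 \<phi>1 \<phi>2
    using same that by (simp add: same_core_def same_box_def core_of_def)
  have eq_m: "mten T p1 p2 A1 A2 = mten T' p1 p2 A1 A2"
    if "p1 \<in> Sm S" "p2 \<in> Sm S" "A1 \<in> Ob (Fib H (Cod S p1))" "A2 \<in> Ob (Fib H (Cod S p2))" for p1 p2 A1 A2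
    using same that by (simp add: same_core_def core_of_def)
  have eq_mb: "mbar_of S H T (mten T) z1 z2 A1 A2 = mbar_of S H T' (mten T') z1 z2 A1 A2"
    if "z1 \<in> Cl S" "z2 \<in> Cl S" "A1 \<in> Ob (Fib H (Dom S z1))" "A2 \<in> Ob (Fib H (Dom S z2))" for z1 z2 A1 A2
    using same that by (simp add: same_core_def core_of_def)
  show "same_box S H T T'" using same by (simp add: same_core_def same_box_def core_of_def)
  fix f1 f2 A1 A2 assume f: "f1 \<in> Ar S" "f2 \<in> Ar S" and A: "A1 \<in> Ob (Fib H (Cod S f1))" "A2 \<in> Ob (Fib H (Cod S f2))"
  obtain t1 p1 where 1: "t1 \<in> Cl S" "p1 \<in> Sm S" "Cod S t1 = Dom S p1" "f1 = p1 \<cdot>\<^bsub>S\<^esub> t1" using factorization[OF f(1)] by blast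
  obtain t2 p2 where 2: "t2 \<in> Cl S" "p2 \<in> Sm S" "Cod S t2 = Dom S p2" "f2 = p2 \<cdot>\<^bsub>S\<^esub> t2" using factorization[OF f(2)] by blast
  have A': "A1 \<in> Ob (Fib H (Cod S p1))" "A2 \<in> Ob (Fib H (Cod S p2))" using A 1 2 by simp_all
  have glued: "mten U f1 f2 A1 A2 = inv_ar (Fib H (Pr S (Dom S t1) (Dom S t2)))
        (conn H (prod_ar S t1 t2) (prod_ar S p1 p2) (bxo U (Cod S p1) (Cod S p2) A1 A2)) \<cdot>\<^bsub>Fib H (Pr S (Dom S t1) (Dom S t2))\<^esub>
      pba H (prod_ar S t1 t2) (mten U p1 p2 A1 A2) \<cdot>\<^bsub>Fib H (Pr S (Dom S t1) (Dom S t2))\<^esub>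
      mcl_of S H U (mbar_of S H U (mten U)) t1 t2 (pbo H p1 A1) (pbo H p2 A2) \<cdot>\<^bsub>Fib H (Pr S (Dom S t1) (Dom S t2))\<^esub>
      bxa U (Dom S t1) (Dom S t2) (conn H t1 p1 A1) (conn H t2 p2 A2)" if "localic_ext_tensor S H U" for U :: "('s, 'm, 'a, 'b) tensor"
  proof -
    have U: "ext_tensor S H (Ar S) U (mten U)" "box_triangulated S H U"
      using that by (simp_all add: localic_ext_tensor_def tri_ext_tensor_def)
    interpret U: box_over S H U by (rule box_overI[OF U])
    show ?thesis
      using U.glued_formula[OF U(1), of "(t1, t2)" "(p1, p2)" "(A1, A2)"] 1 2 A'
      by (simp add: U.Cl2_def U.Sm2_def U.SS_simps U.pF_simps U.at_def U.p_defs U.px_def U.Fo_def U.Fa_def U.bF_def U.minvP_def mcl_of_def Let_def)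
  qed
  interpret L1: adj "Fib H (Cod S t1)" "Fib H (Dom S t1)" "pbo H t1" "pba H t1" "lowo H t1" "lowa H t1" "low_unit H t1" "low_counit H t1"
    by (rule low[OF 1(1) refl refl])
  interpret L2: adj "Fib H (Cod S t2)" "Fib H (Dom S t2)" "pbo H t2" "pba H t2" "lowo H t2" "lowa H t2" "low_unit H t2" "low_counit H t2"
    by (rule low[OF 2(1) refl refl])
  have ar: "t1 \<in> Ar S" "t2 \<in> Ar S" "p1 \<in> Ar S" "p2 \<in> Ar S" using 1 2 by simp_all
  have ob: "Cod S p1 \<in> Ob S" "Cod S p2 \<in> Ob S" "Dom S t1 \<in> Ob S" "Dom S t2 \<in> Ob S" "Cod S t1 \<in> Ob S" "Cod S t2 \<in> Ob S"
    using ar by simp_all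
  have pA: "pbo H p1 A1 \<in> Ob (Fib H (Cod S t1))" "pbo H p2 A2 \<in> Ob (Fib H (Cod S t2))"
    using A' ar 1(3) 2(3) by simp_all
  have tA: "pbo H t1 (pbo H p1 A1) \<in> Ob (Fib H (Dom S t1))" "pbo H t2 (pbo H p2 A2) \<in> Ob (Fib H (Dom S t2))"
    using pA ar by simp_all
  have un: "low_unit H t1 (pbo H p1 A1) \<in> Ar (Fib H (Cod S t1))" "low_unit H t2 (pbo H p2 A2) \<in> Ar (Fib H (Cod S t2))"
    using pA by simp_all
  have cn: "conn H t1 p1 A1 \<in> Ar (Fib H (Dom S t1))" "conn H t2 p2 A2 \<in> Ar (Fib H (Dom S t2))"
    using A' ar 1(3) 2(3) by simp_all
  have "mcl_of S H T (mbar_of S H T (mten T)) t1 t2 (pbo H p1 A1) (pbo H p2 A2) =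
      mcl_of S H T' (mbar_of S H T' (mten T')) t1 t2 (pbo H p1 A1) (pbo H p2 A2)"
    using eq_bx(1)[OF ob(3,4) tA] eq_mb[OF 1(1) 2(1) tA] eq_bxa[OF ob(5,6) un] by (simp add: mcl_of_def)
  then show "mten T f1 f2 A1 A2 = mten T' f1 f2 A1 A2"
    unfolding glued[OF T] glued[OF T'] eq_bx(1)[OF ob(1,2) A'] eq_m[OF 1(2) 2(2) A'] eq_bxa[OF ob(3,4) cn] by simp
qed

lemma core_extends:
  assumes "ext_tensor_core S H K"
  shows "\<exists>T. localic_ext_tensor S H T \<and> same_core S H (core_of S H T) K"
proof -
  have K: "ext_tensor S H (Sm S) K (msm K)" "box_triangulated S H K" "tensor_shift_compatible S H (Sm S) K (msm K)"
    "smooth_adjointable S H K (msm K)" "ext_tensor_cl_op S H K (mbcl K)" "tensor_cl_op_shift_compatible S H K (mbcl K)"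
    "core_base_change S H K (msm K) (mbcl K)" "core_triangles S H K (msm K) (mbcl K)"
    using assms by (simp_all add: ext_tensor_core_def tri_ext_tensor_def tri_ext_tensor_cl_op_def)
  interpret box_over S H K by (rule box_overI[OF K(1,2)])
  obtain m where m: "ext_tensor S H (Ar S) K m" "tensor_shift_compatible S H (Ar S) K m" "smooth_adjointable S H K m"
    and sm: "\<forall>p\<in>Sm2. \<forall>A\<in>Ob (pF (Cod SS p)). at m p A = at (msm K) p A"
    and cl: "\<forall>z\<in>Cl2. \<forall>A\<in>Ob (pF (Dom SS z)). at (mbar_of S H K m) z A = at (mbcl K) z A"
    using core_imp_localic[OF K(1,3,4,5,6,7,8)] by blast
  let ?T = "\<lparr>bxo = bxo K, bxa = bxa K, bxl = bxl K, bxr = bxr K, mten = m\<rparr>"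
  have T: "bxo ?T = bxo K" "bxa ?T = bxa K" "bxl ?T = bxl K" "bxr ?T = bxr K" by simp_all
  note cong = box_predicates_cong[OF T]
  have "localic_ext_tensor S H ?T"
    using m K(2) by (simp add: localic_ext_tensor_def tri_ext_tensor_def cong)
  moreover have "same_core S H (core_of S H ?T) K"
    using sm cl by (simp add: same_core_def same_box_def core_of_def cong Sm2_def Cl2_def Ball_pF SS_simps at_def)
  ultimately show ?thesis by blast
qed

end

theorem theorem5p3:
  fixes S :: "('s, 'm) base_cat" and H :: "('s, 'm, 'a, 'b) adj_fib_cat"
  assumes "base_category S" and "localic_fibered_category S H"
  shows "(\<forall>T. localic_ext_tensor S H T \<longrightarrow> ext_tensor_core S H (core_of S H T)) \<and>
    (\<forall>K. ext_tensor_core S H K \<longrightarrow>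
      (\<exists>T. localic_ext_tensor S H T \<and> same_core S H (core_of S H T) K \<and>
        (\<forall>T'. localic_ext_tensor S H T' \<and> same_core S H (core_of S H T') K \<longrightarrow> same_tensor S H T' T)))"
proof -
  interpret localic_over_base S H by (intro localic_over_base.intro assms)
  have "same_core S H K1 K2" if "same_core S H K1 K" "same_core S H K2 K" for K1 K2 K :: "('s, 'm, 'a, 'b) tensor_core"
    using that by (simp add: same_core_def same_box_def)
  then show ?thesis
    using localic_ext_tensor_core core_extends localic_determined_by_core by meson
qed

end
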